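(* Fix $\alpha,\beta>0$ and $\xi\in\mathrm{ri}\,\mathcal U$, and let $\kappa^\xi$ be the Doob-transformed transition probability of the i.i.d. Beta$(\alpha,\beta)$ random walk in random environment, as defined in the context. Then for any $n\in\mathbb Z$, the random variables $\{\kappa^\xi_{x,x+e_1}(\omega): x=(x_1,x_2)\in\mathbb Z^2,\ x_1+x_2=n\}$ are i.i.d. under $\mathbb P$. Moreover, the following law of large numbers holds: $$P_0^{\kappa^\xi(\omega)}\{N^{-1}X_N\to\xi\}=1\qquad\text{for }\mathbb P\text{-a.e. }\omega.$$
   Context: Let $e_1=(1,0)$, $e_2=(0,1)$, $|x|_1=|x_1|+|x_2|$. Fix $\alpha,\beta>0$. The environment space is $\Omega=[0,1]^{\mathbb Z^2}$; under $\mathbb P$ the coordinates $\omega_{x,x+e_1}$, $x\in\mathbb Z^2$, are i.i.d. Beta$(\alpha,\beta)$, and $\omega_{x,x+e_2}=1-\omega_{x,x+e_1}$. For nearest-neighbor transition probabilities $p=(p_{y,y+e_i})$ on $\mathbb Z^2$ with $p_{y,y+e_1}+p_{y,y+e_2}=1$, $P^p_x$ denotes the law of the Markov chain $(X_n)_{n\ge0}$ with $X_0=x$ and $P^p_x(X_{n+1}=y+e_i\mid X_n=y)=p_{y,y+e_i}$. Let $\mathrm{ri}\,\mathcal U=\{te_1+(1-t)e_2:0<t<1\}$. For each $\xi\in\mathrm{ri}\,\mathcal U$, the process $B^\xi=\{B^\xi_{x,y}(\omega):x,y\in\mathbb Z^2\}$ is defined $\mathbb P$-a.s. by $$B^\xi_{x,y}(\omega)=\lim_{N\to\infty}\big(\log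 P^\omega_x\{X_{|z_N-x|_1}=z_N\}-\log P^\omega_y\{X_{|z_N-y|_1}=z_N\}\big),$$ where $z_N\in\mathbb Z^2$ is any sequence with $|z_N|_1\to\infty$, $z_N/|z_N|_1\to\xi$ (the paper proves that, $\mathbb P$-a.s., the limit exists for all $x,y$ and all such sequences and does not depend on the sequence). It satisfies $B^\xi_{x,y}+B^\xi_{y,z}=B^\xi_{x,z}$ and $\omega_{x,x+e_1}e^{-B^\xi_{x,x+e_1}}+\omega_{x,x+e_2}e^{-B^\xi_{x,x+e_2}}=1$, so $$\kappa^\xi_{x,x+e_i}(\omega)=\omega_{x,x+e_i}e^{-B^\xi_{x,x+e_i}(\omega)},\quad i\in\{1,2\},$$ defines a transition probability on $\mathbb Z^2$. *)

theory Defs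
  imports "HOL-Probability.Probability"
begin

type_synonym site = "int \<times> int"

abbreviation e1 :: site where "e1 \<equiv> (1, 0)"
abbreviation e2 :: site where "e2 \<equiv> (0, 1)"

definition l1norm :: "site \<Rightarrow> nat" where
  "l1norm z = nat (\<bar>fst z\<bar> + \<bar>snd z\<bar>)"

definition to_plane :: "site \<Rightarrow> real \<times> real" where
  "to_plane z = (real_of_int (fst z), real_of_int (snd z))"

definition ri_U :: "(real \<times> real) set" where
  "ri_U = {t *\<^sub>R to_plane e1 + (1 - t) *\<^sub>R to_plane e2 | t. 0 < t \<and> t < 1}"


definition beta_law :: "real \<Rightarrow> real \<Rightarrow> real measure" where
  "beta_law \<alpha> \<beta> = density (restrict_space lborel {0..1})
     (\<lambda>t. ennreal (t powr (\<alpha> - 1) * (1 - t) powr (\<beta> - 1) / Beta \<alpha> \<beta>))"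

text \<open>An environment is stored through its independent coordinates: \<open>\<omega> x\<close> is the
  probability of the step from \<open>x\<close> to \<open>x + e1\<close>.  The space of the following measure is
  the set of all functions from the lattice to the closed unit interval.\<close>

definition env_law :: "real \<Rightarrow> real \<Rightarrow> (site \<Rightarrow> real) measure" where
  "env_law \<alpha> \<beta> = PiM UNIV (\<lambda>_. beta_law \<alpha> \<beta>)"

definition env :: "(site \<Rightarrow> real) \<Rightarrow> site \<Rightarrow> site \<Rightarrow> real" where
  "env \<omega> x y = (if y = x + e1 then \<omega> x else if y = x + e2 then 1 - \<omega> x else 0)"


lemma prob_space_beta_law:
  assumes "\<alpha> > 0" "\<beta> > 0"
  shows "prob_space (beta_law \<alpha> \<beta>)"
proof
  let ?f = "\<lambda>t. t powr (\<alpha> - 1) * (1 - t) powr (\<beta> - 1)"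
  have B: "Beta \<alpha> \<beta> > 0" using assms by (simp add: Beta_def Gamma_real_pos)
  have "((\<lambda>t. ?f t / Beta \<alpha> \<beta>) has_integral (Beta \<alpha> \<beta> / Beta \<alpha> \<beta>)) {0..1}"
    by (intro has_integral_divide has_integral_Beta_real assms)
  then have "(\<integral>\<^sup>+t. ennreal (?f t / Beta \<alpha> \<beta>) * indicator {0..1} t \<partial>lborel) = ennreal 1"
    using B by (intro nn_integral_has_integral_lebesgue') auto
  moreover have "emeasure (beta_law \<alpha> \<beta>) (space (beta_law \<alpha> \<beta>)) =
      (\<integral>\<^sup>+t. ennreal (?f t / Beta \<alpha> \<beta>) * indicator {0..1} t \<partial>lborel)"
    using sets.top[of "restrict_space lborel {0..1::real}"] unfolding beta_law_def
    by (subst emeasure_density)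
       (auto simp: space_restrict_space nn_integral_restrict_space
         intro!: nn_integral_cong measurable_restrict_space1 split: split_indicator)
  ultimately show "emeasure (beta_law \<alpha> \<beta>) (space (beta_law \<alpha> \<beta>)) = 1" by simp
qed

lemma prob_space_env_law: "\<alpha> > 0 \<Longrightarrow> \<beta> > 0 \<Longrightarrow> prob_space (env_law \<alpha> \<beta>)"
  unfolding env_law_def by (intro prob_space_PiM prob_space_beta_law)

lemma space_env_law: "space (env_law \<alpha> \<beta>) = {\<omega>. \<forall>x. \<omega> x \<in> {0..1}}"
  by (auto simp: env_law_def beta_law_def space_PiM space_restrict_space PiE_iff)


text \<open>The law of the Markov chain started at \<open>x\<close> with transition probabilities \<open>p\<close>, as a
  measure on trajectories (Ionescu-Tulcea construction).  It is meaningful only if each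
  \<open>p y\<close> is a probability mass function: otherwise \<open>embed_pmf (p y)\<close> is unspecified.\<close>

definition walk_kernel ::
    "(site \<Rightarrow> site \<Rightarrow> real) \<Rightarrow> site \<Rightarrow> nat \<Rightarrow> (nat \<Rightarrow> site) \<Rightarrow> site measure" where
  "walk_kernel p x n X =
     measure_pmf (case n of 0 \<Rightarrow> return_pmf x | Suc m \<Rightarrow> embed_pmf (p (X m)))"

definition walk_law :: "(site \<Rightarrow> site \<Rightarrow> real) \<Rightarrow> site \<Rightarrow> (nat \<Rightarrow> site) measure" where
  "walk_law p x = projective_family.lim UNIV
     (Ionescu_Tulcea.CI (walk_kernel p x) (\<lambda>_. count_space UNIV)) (\<lambda>_. count_space UNIV)"

lemma Ionescu_Tulcea_walk_kernel:
  "Ionescu_Tulcea (walk_kernel p x) (\<lambda>_. count_space UNIV)"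
proof (rule Ionescu_Tulcea.intro)
  fix i
  show "walk_kernel p x i \<in> measurable (PiM {0..<i} (\<lambda>_. count_space UNIV))
          (subprob_algebra (count_space UNIV))"
  proof (cases i)
    case 0
    then show ?thesis
      by (auto simp: walk_kernel_def[abs_def] space_subprob_algebra
          intro: prob_space_imp_subprob_space measure_pmf.prob_space_axioms)
  next
    case (Suc m)
    have 1: "(\<lambda>X. X m) \<in> measurable (PiM {0..<i} (\<lambda>_. count_space UNIV)) (count_space (UNIV :: site set))"
      by (rule measurable_component_singleton) (simp add: Suc)
    have 2: "(\<lambda>y. measure_pmf (embed_pmf (p y))) \<in> measurable (count_space UNIV)
          (subprob_algebra (count_space UNIV))"
      by (auto simp: space_subprob_algebra
          intro: prob_space_imp_subprob_space measure_pmf.prob_space_axioms)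
    show ?thesis
      using measurable_compose[OF 1 2] by (simp add: walk_kernel_def[abs_def] Suc)
  qed
qed (simp add: walk_kernel_def measure_pmf.prob_space_axioms)

lemma prob_space_walk_law: "prob_space (walk_law p x)"
  and sets_walk_law: "sets (walk_law p x) = sets (PiM UNIV (\<lambda>_. count_space UNIV))"
proof -
  interpret Ionescu_Tulcea "walk_kernel p x" "\<lambda>_. count_space UNIV"
    by (rule Ionescu_Tulcea_walk_kernel)
  have *: "walk_law p x = PF.lim" by (simp add: walk_law_def)
  show sets: "sets (walk_law p x) = sets (PiM UNIV (\<lambda>_. count_space UNIV))"
    unfolding * by (rule PF.sets_lim)
  have "prob_space (CI {})" by (rule PF.prob_space_P) auto
  moreover have "CI {} = distr (walk_law p x) (PiM {} (\<lambda>_. count_space UNIV)) (\<lambda>X. restrict X {})"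
    unfolding * by (rule distr_lim[symmetric]) simp
  moreover have "(\<lambda>X. restrict X {}) \<in> measurable (walk_law p x) (PiM {} (\<lambda>_. count_space UNIV))"
    by (rule measurable_restrict) simp
  ultimately show "prob_space (walk_law p x)"
    by (metis prob_space_distrD)
qed

lemma space_walk_law: "space (walk_law p x) = UNIV"
  using sets_eq_imp_space_eq[OF sets_walk_law[of p x]] by (simp add: space_PiM)

theorem emeasure_walk_law_path:
  "emeasure (walk_law p x) {X. \<forall>k\<le>n. X k = s k} =
     (if s 0 = x then \<Prod>k<n. ennreal (pmf (embed_pmf (p (s k))) (s (Suc k))) else 0)"
  (is "_ = ?R n")
proof -
  interpret Ionescu_Tulcea "walk_kernel p x" "\<lambda>_. count_space UNIV"
    by (rule Ionescu_Tulcea_walk_kernel)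
  let ?M = "\<lambda>_::nat. count_space (UNIV :: site set)"
  let ?s = "\<lambda>n. restrict s {0..<n}"
  have sing: "{?s n} \<in> sets (PiM {0..<n} ?M)" for n
  proof -
    have "{?s n} = PiE {0..<n} (\<lambda>k. {s k})" by (auto simp: PiE_def Pi_def extensional_def fun_eq_iff)
    then show ?thesis by (auto intro!: sets_PiM_I_finite)
  qed
  have upd: "Y(n := y) = ?s (Suc n) \<longleftrightarrow> Y = ?s n \<and> y = s n" if "Y \<in> space (PiM {0..<n} ?M)" for Y n y
    using that by (auto simp: space_PiM PiE_def extensional_def fun_eq_iff restrict_def)
  have eP': "emeasure (eP n Y) {?s (Suc n)} =
      emeasure (walk_kernel p x n (?s n)) {s n} * indicator {?s n} Y"
    if "Y \<in> space (PiM {0..<n} ?M)" for Y n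
  proof -
    have "(\<lambda>y. Y(n := y)) -` {?s (Suc n)} \<inter> space (count_space UNIV) = (if Y = ?s n then {s n} else {})"
      using upd[OF that] by auto
    then show ?thesis
      by (subst emeasure_eP[OF that sing]) (simp split: split_indicator)
  qed
  have step: "emeasure (C 0 (Suc n) (\<lambda>_. undefined)) {?s (Suc n)} =
      emeasure (walk_kernel p x n (?s n)) {s n} * emeasure (C 0 n (\<lambda>_. undefined)) {?s n}" for n
  proof -
    have u: "(\<lambda>_. undefined) \<in> space (PiM {0..<0} ?M)" by (simp add: space_PiM)
    have sp: "space (C 0 n (\<lambda>_. undefined)) = space (PiM {0..<n} ?M)"
      and se: "sets (C 0 n (\<lambda>_. undefined)) = sets (PiM {0..<n} ?M)"
      using space_C[OF u, of n] sets_C[OF u, of n] by simp_all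
    have "emeasure (C 0 (Suc n) (\<lambda>_. undefined)) {?s (Suc n)} =
        (\<integral>\<^sup>+Y. emeasure (eP n Y) {?s (Suc n)} \<partial>C 0 n (\<lambda>_. undefined))"
      unfolding C.simps add_0
    proof (rule emeasure_bind[where N="PiM {0..<Suc n} ?M"])
      show "space (C 0 n (\<lambda>_. undefined)) \<noteq> {}" by (simp add: sp space_PiM_empty_iff)
      show "eP n \<in> measurable (C 0 n (\<lambda>_. undefined)) (subprob_algebra (PiM {0..<Suc n} ?M))"
        using measurable_eP[of n] by (simp add: measurable_cong_sets[OF se refl])
    qed (rule sing)
    also have "\<dots> = (\<integral>\<^sup>+Y. emeasure (walk_kernel p x n (?s n)) {s n} * indicator {?s n} Y \<partial>C 0 n (\<lambda>_. undefined))"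
      by (intro nn_integral_cong eP') (simp add: sp)
    also have "\<dots> = emeasure (walk_kernel p x n (?s n)) {s n} * emeasure (C 0 n (\<lambda>_. undefined)) {?s n}"
      by (rule nn_integral_cmult_indicator) (simp add: se sing)
    finally show ?thesis .
  qed
  have kernel_0: "emeasure (walk_kernel p x 0 (?s 0)) {s 0} = (if s 0 = x then 1 else 0)"
    by (simp add: walk_kernel_def)
  have kernel_Suc: "emeasure (walk_kernel p x (Suc n) (?s (Suc n))) {s (Suc n)} =
      ennreal (pmf (embed_pmf (p (s n))) (s (Suc n)))" for n
    by (simp add: walk_kernel_def emeasure_pmf_single)
  have "emeasure (C 0 (Suc n) (\<lambda>_. undefined)) {?s (Suc n)} = ?R n"
  proof (induction n)
    case 0
    have "emeasure (C 0 0 (\<lambda>_. undefined)) {?s 0} = 1"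
      using sing[of 0] by (simp add: restrict_def)
    then show ?case
      unfolding step[of 0] kernel_0 by simp
  next
    case (Suc n)
    then show ?case
      unfolding step[of "Suc n"] kernel_Suc Suc.IH by (simp add: mult.commute)
  qed
  moreover have "emeasure (walk_law p x) (PF.emb UNIV {0..<Suc n} {?s (Suc n)}) =
      emeasure (C 0 (Suc n) (\<lambda>_. undefined)) {?s (Suc n)}"
  proof -
    have "emeasure (walk_law p x) (PF.emb UNIV {0..<Suc n} {?s (Suc n)}) = emeasure (CI {0..<Suc n}) {?s (Suc n)}"
      unfolding walk_law_def by (rule lim) (auto intro: sing)
    also have "\<dots> = emeasure (C 0 (Suc n) (\<lambda>_. undefined)) (PF.emb {0..<Suc n} {0..<Suc n} {?s (Suc n)})"
      by (rule emeasure_CI) (auto intro: sing)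
    also have "PF.emb {0..<Suc n} {0..<Suc n} {?s (Suc n)} = {?s (Suc n)}"
      by (rule prod_emb_id) (auto simp: space_PiM)
    finally show ?thesis .
  qed
  moreover have "PF.emb UNIV {0..<Suc n} {?s (Suc n)} = {X. \<forall>k\<le>n. X k = s k}"
    by (auto simp: prod_emb_def space_PiM fun_eq_iff less_Suc_eq_le restrict_def) metis
  ultimately show ?thesis by simp
qed


lemma pmf_nearest_neighbour:
  assumes "\<And>z. 0 \<le> p y z" "\<And>z. z \<noteq> y + e1 \<Longrightarrow> z \<noteq> y + e2 \<Longrightarrow> p y z = 0"
    and "p y (y + e1) + p y (y + e2) = 1"
  shows "pmf (embed_pmf (p y)) z = p y z"
proof (rule pmf_embed_pmf)
  have "(\<integral>\<^sup>+z. ennreal (p y z) \<partial>count_space UNIV) = (\<Sum>z\<in>{y + e1, y + e2}. ennreal (p y z))"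
    using assms(2) by (intro nn_integral_count_space') auto
  also have "\<dots> = ennreal (p y (y + e1) + p y (y + e2))"
    using assms(1) by simp
  finally show "(\<integral>\<^sup>+z. ennreal (p y z) \<partial>count_space UNIV) = 1" by (simp add: assms(3))
qed (rule assms(1))


text \<open>The quenched probability to be at \<open>z\<close> after \<open>l1norm (z - x)\<close> steps.\<close>

definition hit_prob :: "(site \<Rightarrow> real) \<Rightarrow> site \<Rightarrow> site \<Rightarrow> real" where
  "hit_prob \<omega> x z = measure (walk_law (env \<omega>) x)
     {X \<in> space (walk_law (env \<omega>) x). X (l1norm (z - x)) = z}"

definition goes_in_direction :: "(nat \<Rightarrow> site) \<Rightarrow> real \<times> real \<Rightarrow> bool" where
  "goes_in_direction z \<xi> \<longleftrightarrow>
     filterlim (\<lambda>N. l1norm (z N)) at_top sequentially \<and>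
     (\<lambda>N. to_plane (z N) /\<^sub>R real (l1norm (z N))) \<longlonglongrightarrow> \<xi>"

text \<open>The common value of the limit over all sequences going in direction \<open>\<xi>\<close>.  For
  environments where there is no such common limit (a null set) the value is an
  unspecified constant.  Here \<open>ln 0 = 0\<close>; for directions in \<open>ri_U\<close> and environments
  with values strictly between 0 and 1 both probabilities are positive for large \<open>N\<close>.\<close>

definition busemann :: "real \<times> real \<Rightarrow> (site \<Rightarrow> real) \<Rightarrow> site \<Rightarrow> site \<Rightarrow> real" where
  "busemann \<xi> \<omega> x y = (THE b. \<forall>z. goes_in_direction z \<xi> \<longrightarrow>
     (\<lambda>N. ln (hit_prob \<omega> x (z N)) - ln (hit_prob \<omega> y (z N))) \<longlonglongrightarrow> b)"

definition doob_kernel :: "real \<times> real \<Rightarrow> (site \<Rightarrow> real) \<Rightarrow> site \<Rightarrow> site \<Rightarrow> real" where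
  "doob_kernel \<xi> \<omega> x y = env \<omega> x y * exp (- busemann \<xi> \<omega> x y)"

end

theory Submission
  imports Defs
begin

text \<open>A pair of laws for the variables on horizontal and vertical edges, inverse beta and beta
  with parameter \<open>\<lambda> > 0\<close> (or the mirror image), generates a field on a quadrant that is stationary
  under the corner update: the dual weights form an i.i.d. beta environment, and the products of the
  reciprocal edge variables along paths are a positive harmonic function for it.  The edge variables on
  an antidiagonal are independent, and so are the weights of the corresponding Doob transform.

  Fractional moments, whose exponents have digamma values as derivatives, show that the transformed
  walk eventually avoids every cone of directions not containing the characteristic direction of
  \<open>\<lambda>\<close>.  By the planar comparison of harmonic functions, a walk conditioned to hit a far point
  in direction \<open>\<xi>\<close> then takes its first step along \<open>e1\<close> with a probability that is
  asymptotically at most the Doob weight for parameters on one side of \<open>\<xi>\<close>, and at least the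
  Doob weight for parameters on the other side.  As the parameters tend to that of \<open>\<xi>\<close>, both
  bounds converge to the same law (in the direction of the averaged drift, where no stationary pair
  exists, to that of the environment itself).  A limit superior and a limit inferior with equal laws
  coincide almost surely, so the limit exists and is independent along antidiagonals.

  For the law of large numbers, the limiting harmonic function on \<open>site_at 0 a b\<close> is a product along
  a row and a column, dominated by stationary products from the right and from the left
  respectively; the moment bounds and Borel--Cantelli finish the proof.\<close>

section \<open>Walks in a fixed environment\<close>

text \<open>Stationary fields with different parameters are never coupled. They share only the law
  of the environment, so one parameter informs another in just two ways: through moments of passage
  probabilities, and through distribution functions along antidiagonals.

  The moments rest on one inequality. A transformed walk visits a site with probability at most 1,
  hence the passage probability to that site is at most the product of the edge variables along a
  path, whatever the parameter. If u and w are the mean logarithms of the two kinds of edges, this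
  bound has rate \<open>\<zeta> * u + (1 - \<zeta>) * w\<close> in direction \<zeta>, and the
  characteristic parameter of \<zeta> is its minimiser. The visit probability of another transformed
  walk then decays at the difference of two such rates. Moments of small order t detect this
  difference: only derivatives at t = 0 count, and splitting factors of unknown joint law by
  Cauchy-Schwarz costs nothing to first order.

  In the inverse beta family the minimiser tends to infinity as \<zeta> approaches the averaged
  drift; the edge variables then concentrate at 1 and the harmonic function becomes
  constant.\<close>

fun step_prob :: "(site \<Rightarrow> real) \<Rightarrow> nat \<Rightarrow> site \<Rightarrow> site \<Rightarrow> real" where
  "step_prob w 0 x z = (if x = z then 1 else 0)"
| "step_prob w (Suc n) x z = w x * step_prob w n (x + e1) z + (1 - w x) * step_prob w n (x + e2) z"

definition is_env :: "(site \<Rightarrow> real) \<Rightarrow> bool" where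
  "is_env w \<longleftrightarrow> (\<forall>x. 0 \<le> w x \<and> w x \<le> 1)"

lemma is_envD: "is_env w \<Longrightarrow> 0 \<le> w x" "is_env w \<Longrightarrow> w x \<le> 1"
  unfolding is_env_def by blast+

lemma step_prob_nonneg: "is_env w \<Longrightarrow> 0 \<le> step_prob w n x z"
  by (induction n arbitrary: x) (simp_all add: is_envD)

lemma pmf_env: "is_env w \<Longrightarrow> pmf (embed_pmf (env w y)) z = env w y z"
  by (rule pmf_nearest_neighbour) (simp_all add: env_def is_envD)

lemma nn_integral_env:
  assumes "is_env w"
  shows "(\<integral>\<^sup>+z. ennreal (env w y z) * f z \<partial>count_space UNIV) =
         ennreal (w y) * f (y + e1) + ennreal (1 - w y) * f (y + e2)"
proof -
  have "(\<integral>\<^sup>+z. ennreal (env w y z) * f z \<partial>count_space UNIV) =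
        (\<Sum>z\<in>{y + e1, y + e2}. ennreal (env w y z) * f z)"
    by (intro nn_integral_count_space') (auto simp: env_def)
  then show ?thesis by (simp add: env_def)
qed

lemma measurable_walk_component [measurable]:
  "(\<lambda>X. X n) \<in> measurable (walk_law p x) (count_space UNIV)"
  unfolding measurable_cong_sets[OF sets_walk_law refl]
  by (rule measurable_component_singleton) simp

text \<open>The fixed prefix is what lets the induction on the number of free steps run: summing
  over the next site turns one more free step into a prefix longer by one, so path probabilities
  suffice and no Markov property has to be formulated.\<close>

lemma emeasure_walk_law_path_then:
  assumes w: "is_env w"
  shows "emeasure (walk_law (env w) x) {X. (\<forall>k\<le>m. X k = s k) \<and> X (m + n) = z} =
    (if s 0 = x then (\<Prod>k<m. ennreal (env w (s k) (s (Suc k)))) else 0) * ennreal (step_prob w n (s m) z)"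
proof (induction n arbitrary: m s)
  case 0
  show ?case
  proof (cases "s m = z")
    case True
    then have "{X. (\<forall>k\<le>m. X k = s k) \<and> X (m + 0) = z} = {X. \<forall>k\<le>m. X k = s k}" by auto
    with True show ?thesis by (simp only: emeasure_walk_law_path) (simp add: pmf_env[OF w])
  next
    case False
    then have *: "{X. (\<forall>k\<le>m. X k = s k) \<and> X (m + 0) = z} = {}" by auto
    show ?thesis unfolding * using False by simp
  qed
next
  case (Suc n)
  let ?W = "walk_law (env w) x"
  let ?A = "\<lambda>y. {X. (\<forall>k\<le>Suc m. X k = (s(Suc m := y)) k) \<and> X (Suc m + n) = z}"
  have sp: "space ?W = UNIV" by (rule space_walk_law)
  have meas: "?A y \<in> sets ?W" for y
  proof -
    have "{X \<in> space ?W. (\<forall>k\<le>Suc m. X k = (s(Suc m := y)) k) \<and> X (Suc m + n) = z} \<in> sets ?W"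
      by measurable
    then show ?thesis by (simp add: sp)
  qed
  have eq: "{X. (\<forall>k\<le>m. X k = s k) \<and> X (m + Suc n) = z} = (\<Union>y. ?A y)"
    by (auto simp: le_Suc_eq)
  have "emeasure ?W (\<Union>y. ?A y) = (\<integral>\<^sup>+y. emeasure ?W (?A y) \<partial>count_space UNIV)"
    by (rule emeasure_UN_countable) (use meas in \<open>auto simp: disjoint_family_on_def\<close>)
  also have "\<dots> = (\<integral>\<^sup>+y. ennreal (env w (s m) y) *
      ((if s 0 = x then (\<Prod>k<m. ennreal (env w (s k) (s (Suc k)))) else 0) * ennreal (step_prob w n y z)) \<partial>count_space UNIV)"
    by (intro nn_integral_cong) (subst Suc.IH, auto simp: mult_ac intro!: prod.cong)
  also have "\<dots> = (if s 0 = x then (\<Prod>k<m. ennreal (env w (s k) (s (Suc k)))) else 0) * ennreal (step_prob w (Suc n) (s m) z)"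
  proof -
    have "ennreal (step_prob w (Suc n) (s m) z) =
        ennreal (w (s m)) * ennreal (step_prob w n (s m + e1) z) +
        ennreal (1 - w (s m)) * ennreal (step_prob w n (s m + e2) z)"
      by (simp add: is_envD[OF w] step_prob_nonneg[OF w] ennreal_mult')
    then show ?thesis unfolding nn_integral_env[OF w] by (simp add: distrib_left mult_ac)
  qed
  finally show ?case unfolding eq .
qed

lemma emeasure_walk_law_at:
  assumes "is_env w"
  shows "emeasure (walk_law (env w) x) {X. X n = z} = ennreal (step_prob w n x z)"
proof -
  let ?W = "walk_law (env w) x"
  have sp: "space ?W = UNIV" by (rule space_walk_law)
  interpret prob_space ?W by (rule prob_space_walk_law)
  have A: "{X. X n = z} \<in> sets ?W" for n z
    using measurable_sets[OF measurable_walk_component[of n "env w" x], of "{z}"] by (simp add: sp vimage_def)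
  have "emeasure ?W {X. X 0 = x} = 1"
    using emeasure_walk_law_path[of "env w" x 0 "\<lambda>_. x"] by simp
  then have "AE X in ?W. X 0 = x"
    by (auto dest!: AE_prob_1[of "{X. X 0 = x}", OF measure_eq_emeasure_eq_ennreal[where x=1, simplified]])
  then have "emeasure ?W {X. X n = z} = emeasure ?W {X. (\<forall>k\<le>0. X k = x) \<and> X (0 + n) = z}"
    by (intro emeasure_eq_AE) (use A[of n z] A[of 0 x] in \<open>auto simp: Collect_conj_eq\<close>)
  also have "\<dots> = ennreal (step_prob w n x z)"
    by (subst emeasure_walk_law_path_then[OF assms, where s="\<lambda>_. x"]) simp
  finally show ?thesis .
qed

lemma measure_walk_law_at:
  "is_env w \<Longrightarrow> measure (walk_law (env w) x) {X. X n = z} = step_prob w n x z"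
  by (simp add: measure_def emeasure_walk_law_at step_prob_nonneg)

lemma step_prob_le_1: "is_env w \<Longrightarrow> step_prob w n x z \<le> 1"
  by (metis measure_walk_law_at prob_space.prob_le_1 prob_space_walk_law)

lemma step_prob_support:
  "step_prob w n x z \<noteq> 0 \<Longrightarrow> fst x \<le> fst z \<and> snd x \<le> snd z \<and> fst z - fst x + (snd z - snd x) = int n"
proof (induction n arbitrary: x)
  case (Suc n)
  then have "step_prob w n (x + e1) z \<noteq> 0 \<or> step_prob w n (x + e2) z \<noteq> 0" by auto
  then show ?case using Suc.IH by fastforce
qed (auto split: if_splits)

definition below :: "site \<Rightarrow> site \<Rightarrow> bool" (infix "\<sqsubseteq>" 50) where
  "x \<sqsubseteq> z \<longleftrightarrow> fst x \<le> fst z \<and> snd x \<le> snd z"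

text \<open>The number of steps is determined by the end points, so this is the probability of ever
  visiting \<open>z\<close>. The truncation in \<open>nat\<close> is harmless: when \<open>z\<close>
  is not reachable from \<open>x\<close> the value is 0, as \<open>pass_eq_0\<close>
  confirms.\<close>

definition pass :: "(site \<Rightarrow> real) \<Rightarrow> site \<Rightarrow> site \<Rightarrow> real" where
  "pass w x z = step_prob w (nat (fst z - fst x + (snd z - snd x))) x z"

lemma hit_prob_eq_pass:
  assumes "is_env w"
  shows "hit_prob w x z = pass w x z"
proof -
  have "hit_prob w x z = step_prob w (l1norm (z - x)) x z"
    by (simp add: hit_prob_def measure_walk_law_at[OF assms] space_walk_law)
  also have "\<dots> = pass w x z"
  proof (cases "x \<sqsubseteq> z")
    case True
    then show ?thesis by (simp add: pass_def l1norm_def below_def)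
  next
    case False
    then show ?thesis
      using step_prob_support[of w _ x z] unfolding pass_def below_def by metis
  qed
  finally show ?thesis .
qed

lemma pass_self [simp]: "pass w x x = 1"
  by (simp add: pass_def)

lemma pass_eq_0: "\<not> x \<sqsubseteq> z \<Longrightarrow> pass w x z = 0"
  using step_prob_support[of w _ x z] unfolding pass_def below_def by metis

lemma pass_nonneg: "is_env w \<Longrightarrow> 0 \<le> pass w x z"
  and pass_le_1: "is_env w \<Longrightarrow> pass w x z \<le> 1"
  by (simp_all add: pass_def step_prob_nonneg step_prob_le_1)

text \<open>Where \<open>z\<close> is unreachable all three terms vanish. The equation is therefore
  available just outside the rectangle below \<open>z\<close>, where boundary sums of such functions
  are formed later.\<close>

lemma pass_harmonic:
  assumes "x \<noteq> z"
  shows "pass w x z = w x * pass w (x + e1) z + (1 - w x) * pass w (x + e2) z"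
proof (cases "fst z - fst x + (snd z - snd x) \<ge> 1")
  case True
  then have n: "nat (fst z - fst x + (snd z - snd x)) = Suc (nat (fst z - fst x + (snd z - snd x) - 1))"
    by simp
  have "fst z - fst (x + e1) + (snd z - snd (x + e1)) = fst z - fst x + (snd z - snd x) - 1"
    "fst z - fst (x + e2) + (snd z - snd (x + e2)) = fst z - fst x + (snd z - snd x) - 1" by simp_all
  then show ?thesis unfolding pass_def n by (simp only: step_prob.simps)
next
  case False
  then have "\<not> x \<sqsubseteq> z" "\<not> (x + e1) \<sqsubseteq> z" "\<not> (x + e2) \<sqsubseteq> z"
    using assms by (auto simp: below_def prod_eq_iff)
  then show ?thesis by (simp add: pass_eq_0)
qed

lemma site_rect_induct [consumes 1, case_names step]:
  assumes "x \<sqsubseteq> z"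
    and "\<And>x. x \<sqsubseteq> z \<Longrightarrow> (\<And>y. y = x + e1 \<or> y = x + e2 \<Longrightarrow> y \<sqsubseteq> z \<Longrightarrow> P y) \<Longrightarrow> P x"
  shows "P x"
  using assms(1)
proof (induction "nat (fst z - fst x + (snd z - snd x))" arbitrary: x rule: less_induct)
  case less
  show ?case
  proof (rule assms(2)[OF less.prems])
    fix y assume y: "y = x + e1 \<or> y = x + e2" "y \<sqsubseteq> z"
    show "P y"
      by (rule less.hyps) (use y less.prems in \<open>auto simp: below_def\<close>)
  qed
qed

lemma pass_pos:
  assumes "x \<sqsubseteq> z" and w: "is_env w" "\<And>y. x \<sqsubseteq> y \<Longrightarrow> 0 < w y \<and> w y < 1"
  shows "0 < pass w x z"
  using assms(1) w(2)
proof (induction x rule: site_rect_induct)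
  case (step x)
  show ?case
  proof (cases "x = z")
    case False
    have IH: "0 < pass w y z" if "y = x + e1 \<or> y = x + e2" "y \<sqsubseteq> z" for y
      by (rule step.IH[OF that]) (rule step.prems, use that in \<open>auto simp: below_def\<close>)
    have wx: "0 < w x" "w x < 1" using step.prems[of x] by (auto simp: below_def)
    from False step(1) have "(x + e1) \<sqsubseteq> z \<or> (x + e2) \<sqsubseteq> z"
      by (auto simp: below_def prod_eq_iff)
    then show ?thesis
    proof
      assume "(x + e1) \<sqsubseteq> z"
      then have "0 < w x * pass w (x + e1) z" using IH wx by simp
      moreover have "0 \<le> (1 - w x) * pass w (x + e2) z" using wx pass_nonneg[OF w(1)] by simp
      ultimately show ?thesis using pass_harmonic[OF False, of w] by linarith
    next
      assume "(x + e2) \<sqsubseteq> z"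
      then have "0 < (1 - w x) * pass w (x + e2) z" using IH wx by simp
      moreover have "0 \<le> w x * pass w (x + e1) z" using wx pass_nonneg[OF w(1)] by simp
      ultimately show ?thesis using pass_harmonic[OF False, of w] by linarith
    qed
  qed simp
qed

lemma step_prob_mult_le:
  assumes "is_env w"
  shows "step_prob w m x y * step_prob w n y z \<le> step_prob w (m + n) x z"
proof (induction m arbitrary: x)
  case (Suc m)
  have "step_prob w (Suc m) x y * step_prob w n y z =
      w x * (step_prob w m (x + e1) y * step_prob w n y z) + (1 - w x) * (step_prob w m (x + e2) y * step_prob w n y z)"
    by (simp add: algebra_simps)
  also have "\<dots> \<le> w x * step_prob w (m + n) (x + e1) z + (1 - w x) * step_prob w (m + n) (x + e2) z"
    by (intro add_mono mult_left_mono Suc.IH) (auto simp: is_envD[OF assms])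
  finally show ?case by simp
qed (use assms in \<open>auto simp: step_prob_nonneg\<close>)

lemma pass_mult_le:
  assumes w: "is_env w"
  shows "pass w x y * pass w y z \<le> pass w x z"
proof (cases "x \<sqsubseteq> y \<and> y \<sqsubseteq> z")
  case True
  then have "nat (fst z - fst x + (snd z - snd x)) =
      nat (fst y - fst x + (snd y - snd x)) + nat (fst z - fst y + (snd z - snd y))"
    by (auto simp: below_def)
  then show ?thesis using step_prob_mult_le[OF w] by (simp add: pass_def)
next
  case False
  then have "pass w x y * pass w y z = 0" by (auto simp: pass_eq_0)
  then show ?thesis using pass_nonneg[OF w, of x z] by linarith
qed

text \<open>Along every path from \<open>x\<close> to \<open>z\<close> the quotients of consecutive
  values of \<open>h\<close> telescope to \<open>h z / h x\<close>, independently of the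
  path.\<close>

lemma step_prob_doob:
  assumes "x0 \<sqsubseteq> x" and "\<And>y. x0 \<sqsubseteq> y \<Longrightarrow> h y > 0"
    and "\<And>y. x0 \<sqsubseteq> y \<Longrightarrow> k y = w y * h (y + e1) / h y \<and> 1 - k y = (1 - w y) * h (y + e2) / h y"
  shows "step_prob k n x z * h x = step_prob w n x z * h z"
  using assms(1)
proof (induction n arbitrary: x)
  case (Suc n)
  have hx: "h x > 0" using assms(2)[OF Suc.prems] .
  have k: "k x * h x = w x * h (x + e1)" "(1 - k x) * h x = (1 - w x) * h (x + e2)"
    using assms(3)[OF Suc.prems] hx by (auto simp del: diff_eq_eq eq_diff_eq)
  have "step_prob k (Suc n) x z * h x =
     (k x * h x) * step_prob k n (x + e1) z + ((1 - k x) * h x) * step_prob k n (x + e2) z"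
    by (simp add: algebra_simps)
  also have "\<dots> = w x * (step_prob k n (x + e1) z * h (x + e1)) + (1 - w x) * (step_prob k n (x + e2) z * h (x + e2))"
    unfolding k by (simp add: mult_ac)
  also have "\<dots> = step_prob w (Suc n) x z * h z"
  proof -
    have "x0 \<sqsubseteq> x + e1" "x0 \<sqsubseteq> x + e2" using Suc.prems by (auto simp: below_def)
    then show ?thesis unfolding Suc.IH[OF \<open>x0 \<sqsubseteq> x + e1\<close>] Suc.IH[OF \<open>x0 \<sqsubseteq> x + e2\<close>]
      by (simp add: algebra_simps)
  qed
  finally show ?case .
qed auto

text \<open>The quotient \<open>g / f\<close> increases along \<open>e1\<close> and decreases along \<open>e2\<close>.  This is stated
  without division because \<open>f\<close> vanishes just outside the rectangle, where the quotient counts as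
  \<open>- \<infinity>\<close> (north) or \<open>\<infinity>\<close> (east).\<close>

lemma ratio_monotone:
  fixes f g a b :: "site \<Rightarrow> real"
  assumes "x \<sqsubseteq> z"
    and ab: "\<And>y. x \<sqsubseteq> y \<Longrightarrow> a y > 0 \<and> b y > 0"
    and f0: "\<And>y. x \<sqsubseteq> y \<Longrightarrow> y \<sqsubseteq> z \<Longrightarrow> f y > 0"
    and f: "\<And>y. x \<sqsubseteq> y \<Longrightarrow> y \<sqsubseteq> z \<Longrightarrow> y \<noteq> z \<Longrightarrow> f y = a y * f (y + e1) + b y * f (y + e2)"
    and g: "\<And>y. x \<sqsubseteq> y \<Longrightarrow> y \<sqsubseteq> z \<Longrightarrow> y \<noteq> z \<Longrightarrow> g y = a y * g (y + e1) + b y * g (y + e2)"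
    and north: "\<And>y. snd y = snd z + 1 \<Longrightarrow> fst y \<le> fst z \<Longrightarrow> x \<sqsubseteq> y \<Longrightarrow> f y = 0 \<and> g y \<le> 0"
    and east: "\<And>y. fst y = fst z + 1 \<Longrightarrow> snd y \<le> snd z \<Longrightarrow> x \<sqsubseteq> y \<Longrightarrow> f y = 0 \<and> g y \<ge> 0"
  shows "(fst x < fst z \<longrightarrow> g x * f (x + e1) \<le> g (x + e1) * f x) \<and>
         (snd x < snd z \<longrightarrow> g (x + e2) * f x \<le> g x * f (x + e2))"
  using assms
proof (induction x rule: site_rect_induct)
  case (step x)
  have xx: "x \<sqsubseteq> x" by (simp add: below_def)
  have mono: "x \<sqsubseteq> y" if "x' \<sqsubseteq> y" "x' = x + e1 \<or> x' = x + e2" for x' y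
    using that by (auto simp: below_def)
  have IH: "(fst y < fst z \<longrightarrow> g y * f (y + e1) \<le> g (y + e1) * f y) \<and>
         (snd y < snd z \<longrightarrow> g (y + e2) * f y \<le> g y * f (y + e2))"
    if y: "y = x + e1 \<or> y = x + e2" "y \<sqsubseteq> z" for y
    by (rule step.IH[OF y]) (use mono[OF _ y(1)] step.prems in blast)+
  have A: "a x > 0" "b x > 0" using step.prems(1)[OF xx] by auto
  have F0: "f x > 0" using step.prems(2)[OF xx step(1)] .
  show ?case
  proof (cases "x = z")
    case False
    note F = step.prems(3)[OF xx step(1) False] and G = step.prems(4)[OF xx step(1) False]
    show ?thesis
    proof (cases "fst x < fst z")
      case 1: True
      then have z1: "x + e1 \<sqsubseteq> z" "x \<sqsubseteq> x + e1" using step(1) by (auto simp: below_def)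
      have f1: "f (x + e1) > 0" by (rule step.prems(2)) (use z1 in auto)
      show ?thesis
      proof (cases "snd x < snd z")
        case 2: True
        then have z2: "x + e2 \<sqsubseteq> z" "x \<sqsubseteq> x + e2" using step(1) by (auto simp: below_def)
        have z12: "x + e1 + e2 \<sqsubseteq> z" "x \<sqsubseteq> x + e1 + e2" using 1 2 by (auto simp: below_def)
        have f2: "f (x + e2) > 0" by (rule step.prems(2)) (use z2 in auto)
        have f12: "f (x + e1 + e2) > 0" by (rule step.prems(2)) (use z12 in auto)
        have i1: "g (x + e1 + e2) * f (x + e1) \<le> g (x + e1) * f (x + e1 + e2)"
          using IH[of "x + e1"] z1 2 by auto
        have i2: "g (x + e2) * f (x + e1 + e2) \<le> g (x + e1 + e2) * f (x + e2)"
          using IH[of "x + e2"] z2 1 by (auto simp: add_ac)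
        \<comment> \<open>The quotients at the two neighbours are compared through the far corner of
          the unit square. The quotient at \<open>x\<close> is a weighted mean of those two, so it
          lies between them, and both claims follow.\<close>
        have "g (x + e2) / f (x + e2) \<le> g (x + e1 + e2) / f (x + e1 + e2)"
          using i2 f2 f12 by (simp add: divide_simps mult_ac)
        also have "\<dots> \<le> g (x + e1) / f (x + e1)"
          using i1 f1 f12 by (simp add: divide_simps mult_ac)
        finally have r: "g (x + e2) * f (x + e1) \<le> g (x + e1) * f (x + e2)"
          using f1 f2 by (simp add: divide_simps mult_ac)
        have "g x * f (x + e1) \<le> g (x + e1) * f x"
          using mult_left_mono[OF r, of "b x"] A unfolding F G by (simp add: algebra_simps)
        moreover have "g (x + e2) * f x \<le> g x * f (x + e2)"
          using mult_left_mono[OF r, of "a x"] A unfolding F G by (simp add: algebra_simps)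
        ultimately show ?thesis by simp
      next
        case 2: False
        then have s: "snd x = snd z" using step(1) by (auto simp: below_def)
        have "f (x + e2) = 0 \<and> g (x + e2) \<le> 0"
          by (rule step.prems(5)) (use s step(1) in \<open>auto simp: below_def\<close>)
        then have "g (x + e2) * (b x * f (x + e1)) \<le> 0" "f (x + e2) = 0"
          using A f1 by (auto intro: mult_nonpos_nonneg)
        then have "g x * f (x + e1) \<le> g (x + e1) * f x"
          unfolding F G by (simp add: algebra_simps)
        then show ?thesis using s by simp
      qed
    next
      case 1: False
      then have s: "fst x = fst z" "snd x < snd z" using step(1) False by (auto simp: below_def prod_eq_iff)
      then have z2: "x + e2 \<sqsubseteq> z" "x \<sqsubseteq> x + e2" by (auto simp: below_def)
      have f2: "f (x + e2) > 0" by (rule step.prems(2)) (use z2 in auto)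
      have "f (x + e1) = 0 \<and> g (x + e1) \<ge> 0"
        by (rule step.prems(6)) (use s in \<open>auto simp: below_def\<close>)
      then have "g (x + e1) * (a x * f (x + e2)) \<ge> 0" "f (x + e1) = 0"
        using A f2 by auto
      then have "g (x + e2) * f x \<le> g x * f (x + e2)"
        unfolding F G by (simp add: algebra_simps)
      then show ?thesis using s by simp
    qed
  qed simp
qed

section \<open>Beta laws\<close>

text \<open>Extended by 0 outside the open unit interval, so that affine substitutions can be made
  over the whole line without tracking domains.\<close>

definition beta_kern :: "real \<Rightarrow> real \<Rightarrow> real \<Rightarrow> real" where
  "beta_kern a b t = (if 0 < t \<and> t < 1 then t powr (a - 1) * (1 - t) powr (b - 1) else 0)"

lemma beta_kern_nonneg: "0 \<le> beta_kern a b t"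
  by (simp add: beta_kern_def)

lemma measurable_beta_kern [measurable]: "beta_kern a b \<in> borel_measurable borel"
  unfolding beta_kern_def[abs_def] by measurable

text \<open>A copy of \<open>beta_law\<close> on the Borel line: edge variables and weights then
  live on one common measurable space, and the passage to \<open>beta_law\<close> is made once, by
  \<open>clip\<close>.\<close>

definition beta_borel :: "real \<Rightarrow> real \<Rightarrow> real measure" where
  "beta_borel a b = density lborel (\<lambda>t. ennreal (beta_kern a b t / Beta a b))"

lemma sets_beta_borel [simp, measurable_cong]: "sets (beta_borel a b) = sets borel"
  and space_beta_borel [simp]: "space (beta_borel a b) = UNIV"
  by (simp_all add: beta_borel_def)

lemma Beta_real_pos: "a > 0 \<Longrightarrow> b > 0 \<Longrightarrow> Beta a b > (0 :: real)"
  by (simp add: Beta_def Gamma_real_pos)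

lemma nn_integral_beta_borel:
  "g \<in> borel_measurable borel \<Longrightarrow>
   (\<integral>\<^sup>+x. g x \<partial>beta_borel a b) = (\<integral>\<^sup>+x. ennreal (beta_kern a b x / Beta a b) * g x \<partial>lborel)"
  unfolding beta_borel_def by (intro nn_integral_density) auto

lemma nn_integral_beta_kern:
  assumes "a > 0" "b > 0"
  shows "(\<integral>\<^sup>+x. ennreal (beta_kern a b x) \<partial>lborel) = ennreal (Beta a b)"
proof -
  have "((\<lambda>t. t powr (a - 1) * (1 - t) powr (b - 1)) has_integral Beta a b) {0..1}"
    by (intro has_integral_Beta_real assms)
  then have "(\<integral>\<^sup>+t. ennreal (t powr (a - 1) * (1 - t) powr (b - 1)) * indicator {0..1} t \<partial>lborel) = ennreal (Beta a b)"
    by (intro nn_integral_has_integral_lebesgue') auto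
  also have "(\<integral>\<^sup>+t. ennreal (t powr (a - 1) * (1 - t) powr (b - 1)) * indicator {0..1} t \<partial>lborel) =
      (\<integral>\<^sup>+t. ennreal (beta_kern a b t) \<partial>lborel)"
    by (intro nn_integral_cong) (auto simp: beta_kern_def split: split_indicator)
  finally show ?thesis .
qed

lemma prob_space_beta_borel:
  assumes "a > 0" "b > 0"
  shows "prob_space (beta_borel a b)"
proof
  have B: "Beta a b > 0" using assms by (rule Beta_real_pos)
  have "emeasure (beta_borel a b) (space (beta_borel a b)) = (\<integral>\<^sup>+x. 1 \<partial>beta_borel a b)" by simp
  also have "\<dots> = (\<integral>\<^sup>+x. ennreal (1 / Beta a b) * ennreal (beta_kern a b x) \<partial>lborel)"
    using B by (subst nn_integral_beta_borel) (auto simp: ennreal_mult'[symmetric])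
  also have "\<dots> = ennreal (1 / Beta a b) * ennreal (Beta a b)"
    by (subst nn_integral_cmult) (auto simp: nn_integral_beta_kern[OF assms])
  also have "\<dots> = 1" using B by (simp flip: ennreal_mult')
  finally show "emeasure (beta_borel a b) (space (beta_borel a b)) = 1" .
qed

lemma AE_beta_borel: "AE x in beta_borel a b. 0 < x \<and> x < 1"
  unfolding beta_borel_def by (subst AE_density) (auto simp: beta_kern_def)

lemma distr_beta_law: "distr (beta_law a b) borel (\<lambda>x. x) = beta_borel a b"
proof (rule measure_eqI)
  fix A assume "A \<in> sets (distr (beta_law a b) borel (\<lambda>x. x))"
  then have A[measurable]: "A \<in> sets borel" by simp
  have m: "(\<lambda>x. x) \<in> measurable (beta_law a b) borel"
    unfolding beta_law_def by (simp add: measurable_restrict_space1)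
  have "emeasure (distr (beta_law a b) borel (\<lambda>x. x)) A = (\<integral>\<^sup>+x. indicator A x \<partial>distr (beta_law a b) borel (\<lambda>x. x))"
    by simp
  also have "\<dots> = (\<integral>\<^sup>+x. indicator A x \<partial>beta_law a b)"
    by (subst nn_integral_distr[OF m]) auto
  also have "\<dots> = (\<integral>\<^sup>+x. ennreal (x powr (a - 1) * (1 - x) powr (b - 1) / Beta a b) * indicator A x
       \<partial>restrict_space lborel {0..1})"
    unfolding beta_law_def by (subst nn_integral_density) (auto intro!: measurable_restrict_space1)
  also have "\<dots> = (\<integral>\<^sup>+x. ennreal (beta_kern a b x / Beta a b) * indicator A x \<partial>lborel)"
    by (subst nn_integral_restrict_space)
       (auto intro!: nn_integral_cong simp: beta_kern_def split: split_indicator)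
  also have "\<dots> = emeasure (beta_borel a b) A"
    by (subst nn_integral_beta_borel[symmetric]) auto
  finally show "emeasure (distr (beta_law a b) borel (\<lambda>x. x)) A = emeasure (beta_borel a b) A" .
qed simp

lemma space_beta_law: "space (beta_law a b) = {0..1}"
  by (simp add: beta_law_def space_restrict_space)

lemma measurable_beta_law_iff:
  "f \<in> measurable M (beta_law a b) \<longleftrightarrow> f \<in> borel_measurable M \<and> f \<in> space M \<rightarrow> {0..1}"
proof -
  have "measurable M (beta_law a b) = measurable M (restrict_space borel {0..1})"
    by (intro measurable_cong_sets) (auto simp: beta_law_def sets_restrict_space)
  then show ?thesis by (auto simp: measurable_restrict_space2_iff)
qed

text \<open>A measurable retraction of the line onto the unit interval. It leaves values in that
  interval alone, and makes maps into environments total, so that null sets need no separate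
  treatment in measurability proofs.\<close>

definition clip :: "real \<Rightarrow> real" where "clip x = max 0 (min 1 x)"

lemma clip_range: "0 \<le> clip x" "clip x \<le> 1"
  by (auto simp: clip_def)

lemma clip_id: "0 \<le> x \<Longrightarrow> x \<le> 1 \<Longrightarrow> clip x = x"
  by (auto simp: clip_def)

lemma measurable_clip_borel [measurable]: "clip \<in> borel_measurable borel"
  unfolding clip_def[abs_def] by measurable

lemma measurable_clip: "clip \<in> measurable borel (beta_law a b)"
  by (auto simp: measurable_beta_law_iff clip_range)

lemma beta_law_eq_distr: "beta_law a b = distr (beta_borel a b) (beta_law a b) clip"
proof -
  have m: "(\<lambda>x. x) \<in> measurable (beta_law a b) borel"
    unfolding beta_law_def by (simp add: measurable_restrict_space1)
  have "distr (beta_borel a b) (beta_law a b) clip = distr (beta_law a b) (beta_law a b) (clip \<circ> (\<lambda>x. x))"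
    unfolding distr_beta_law[symmetric] by (rule distr_distr[OF measurable_clip m])
  also have "\<dots> = distr (beta_law a b) (beta_law a b) (\<lambda>x. x)"
    by (intro distr_cong) (auto simp: space_beta_law clip_id)
  finally show ?thesis by simp
qed

lemma nn_integral_beta_borel_reflect:
  assumes [measurable]: "g \<in> borel_measurable borel"
  shows "(\<integral>\<^sup>+x. g (1 - x) \<partial>beta_borel a b) = (\<integral>\<^sup>+x. g x \<partial>beta_borel b a)"
proof -
  have "(\<integral>\<^sup>+x. g x \<partial>beta_borel b a) = (\<integral>\<^sup>+x. ennreal (beta_kern b a x / Beta b a) * g x \<partial>lborel)"
    by (rule nn_integral_beta_borel) simp
  also have "\<dots> = (\<integral>\<^sup>+x. ennreal (beta_kern b a (1 + (-1) * x) / Beta b a) * g (1 + (-1) * x) \<partial>lborel)"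
    by (subst nn_integral_real_affine[where t=1 and c="-1"]) auto
  also have "\<dots> = (\<integral>\<^sup>+x. ennreal (beta_kern a b x / Beta a b) * g (1 - x) \<partial>lborel)"
    by (intro nn_integral_cong) (auto simp: beta_kern_def Beta_commute[of b a] mult_ac)
  also have "\<dots> = (\<integral>\<^sup>+x. g (1 - x) \<partial>beta_borel a b)"
    by (rule nn_integral_beta_borel[symmetric]) simp
  finally show ?thesis by simp
qed

text \<open>Both sides are parametrizations of one Dirichlet\<open>(a, b, c)\<close> vector.\<close>

lemma beta_kern_product:
  fixes g :: "real \<Rightarrow> real \<Rightarrow> ennreal"
  assumes [measurable]: "(\<lambda>(x, y). g x y) \<in> borel_measurable (borel \<Otimes>\<^sub>M borel)"
  shows "(\<integral>\<^sup>+p. \<integral>\<^sup>+q. ennreal (beta_kern (a + b) c p * beta_kern a b q) * g (p * q) ((1 - p) / (1 - p * q)) \<partial>lborel \<partial>lborel) =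
         (\<integral>\<^sup>+s. \<integral>\<^sup>+w. ennreal (beta_kern a (b + c) s * beta_kern c b w) * g s w \<partial>lborel \<partial>lborel)"
proof -
  \<comment> \<open>The unnormalised Dirichlet density of the vector
    \<open>(s, p - s, 1 - p)\<close> in the coordinates p and s. The left side arises from it by
    \<open>s = p * q\<close> at fixed p, the right side by \<open>w = (1 - p) / (1 - s)\<close> at
    fixed s.\<close>
  define K where "K p s = (if 0 < s \<and> s < p \<and> p < 1 then s powr (a - 1) * (1 - p) powr (c - 1) * (p - s) powr (b - 1) else 0)"
    for p s :: real
  have [measurable]: "(\<lambda>(p, s). K p s) \<in> borel_measurable (borel \<Otimes>\<^sub>M borel)"
    unfolding K_def by measurable
  have K0: "0 \<le> K p s" for p s by (simp add: K_def)
  have 1: "(\<integral>\<^sup>+q. ennreal (beta_kern (a + b) c p * beta_kern a b q) * g (p * q) ((1 - p) / (1 - p * q)) \<partial>lborel) =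
     (\<integral>\<^sup>+s. ennreal (K p s) * g s ((1 - p) / (1 - s)) \<partial>lborel)" for p
  proof (cases "0 < p \<and> p < 1")
    case True
    have "(\<integral>\<^sup>+q. ennreal (beta_kern (a + b) c p * beta_kern a b q) * g (p * q) ((1 - p) / (1 - p * q)) \<partial>lborel) =
      ennreal (1 / p) * (\<integral>\<^sup>+s. ennreal (beta_kern (a + b) c p * beta_kern a b (s / p)) * g s ((1 - p) / (1 - s)) \<partial>lborel)"
      using True by (subst nn_integral_real_affine[where t=0 and c="1/p"]) auto
    also have "\<dots> = (\<integral>\<^sup>+s. ennreal (1 / p) * (ennreal (beta_kern (a + b) c p * beta_kern a b (s / p)) * g s ((1 - p) / (1 - s))) \<partial>lborel)"
      by (rule nn_integral_cmult[symmetric]) measurable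
    also have "\<dots> = (\<integral>\<^sup>+s. ennreal (K p s) * g s ((1 - p) / (1 - s)) \<partial>lborel)"
    proof (intro nn_integral_cong)
      fix s
      have "1 / p * (beta_kern (a + b) c p * beta_kern a b (s / p)) = K p s"
      proof (cases "0 < s \<and> s < p")
        case s: True
        have "(1 - s / p) = (p - s) / p" using True by (simp add: field_simps)
        then have "beta_kern a b (s / p) = s powr (a - 1) / p powr (a - 1) * ((p - s) powr (b - 1) / p powr (b - 1))"
          using True s by (simp add: beta_kern_def powr_divide)
        moreover have "p powr (a + b - 1) = p powr (a - 1) * p powr (b - 1) * p"
        proof -
          have "p powr (a + b - 1) = p powr (1 + ((a - 1) + (b - 1)))" by (simp add: algebra_simps)
          also have "\<dots> = p * (p powr (a - 1) * p powr (b - 1))"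
            using True unfolding powr_add by simp
          finally show ?thesis by simp
        qed
        ultimately show ?thesis using True s by (simp add: beta_kern_def K_def field_simps)
      next
        case False
        then show ?thesis using True by (auto simp: beta_kern_def K_def field_simps)
      qed
      then show "ennreal (1 / p) * (ennreal (beta_kern (a + b) c p * beta_kern a b (s / p)) * g s ((1 - p) / (1 - s))) =
         ennreal (K p s) * g s ((1 - p) / (1 - s))"
        using True by (simp add: mult.assoc[symmetric] ennreal_mult'[symmetric] beta_kern_nonneg)
    qed
    finally show ?thesis .
  next
    case False
    then have "beta_kern (a + b) c p = 0" "K p s = 0" for s by (auto simp: beta_kern_def K_def)
    then show ?thesis by simp
  qed
  \<comment> \<open>Here the substitution is \<open>p = 1 - (1 - s) * w\<close>, with Jacobian
    \<open>1 - s\<close>.\<close>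
  have 2: "(\<integral>\<^sup>+p. ennreal (K p s) * g s ((1 - p) / (1 - s)) \<partial>lborel) =
     (\<integral>\<^sup>+w. ennreal (beta_kern a (b + c) s * beta_kern c b w) * g s w \<partial>lborel)" for s
  proof (cases "0 < s \<and> s < 1")
    case True
    have eq: "(1 - s) * K (1 + - (1 - s) * w) s = beta_kern a (b + c) s * beta_kern c b w" for w
    proof (cases "0 < w \<and> w < 1")
      case w: True
      have p: "1 - (1 + - (1 - s) * w) = (1 - s) * w" "1 + - (1 - s) * w - s = (1 - s) * (1 - w)"
        by (auto simp: algebra_simps)
      have "0 < (1 - s) * w" "0 < (1 - s) * (1 - w)" using True w by auto
      then have "K (1 + - (1 - s) * w) s = s powr (a - 1) * ((1 - s) * w) powr (c - 1) * ((1 - s) * (1 - w)) powr (b - 1)"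
        using True p unfolding K_def by (simp del: mult_minus_left add: algebra_simps)
      moreover have "(1 - s) powr (b + c - 1) = (1 - s) * (1 - s) powr (c - 1) * (1 - s) powr (b - 1)"
      proof -
        have "(1 - s) powr (b + c - 1) = (1 - s) powr (1 + ((c - 1) + (b - 1)))" by (simp add: algebra_simps)
        also have "\<dots> = (1 - s) * ((1 - s) powr (c - 1) * (1 - s) powr (b - 1))"
          using True unfolding powr_add by simp
        finally show ?thesis by simp
      qed
      ultimately show ?thesis using True w by (simp add: beta_kern_def powr_mult)
    next
      case False
      then have "\<not> (0 < s \<and> s < 1 + - (1 - s) * w \<and> 1 + - (1 - s) * w < 1)"
      proof (cases "0 < w")
        case True
        with False have "1 \<le> w" by auto
        then have "1 - s \<le> (1 - s) * w" using \<open>0 < s \<and> s < 1\<close> by simp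
        then show ?thesis by (simp add: algebra_simps)
      next
        case False
        then have "(1 - s) * w \<le> 0" using \<open>0 < s \<and> s < 1\<close> by (intro mult_nonneg_nonpos) auto
        then show ?thesis by (simp add: algebra_simps)
      qed
      then have "K (1 + - (1 - s) * w) s = 0" unfolding K_def by (rule if_not_P)
      then show ?thesis using False by (auto simp: beta_kern_def)
    qed
    have "(\<integral>\<^sup>+p. ennreal (K p s) * g s ((1 - p) / (1 - s)) \<partial>lborel) =
      ennreal (1 - s) * (\<integral>\<^sup>+w. ennreal (K (1 + - (1 - s) * w) s) * g s ((1 - (1 + - (1 - s) * w)) / (1 - s)) \<partial>lborel)"
      using True by (subst nn_integral_real_affine[where t=1 and c="-(1-s)"]) auto
    also have "\<dots> = ennreal (1 - s) * (\<integral>\<^sup>+w. ennreal (K (1 + - (1 - s) * w) s) * g s w \<partial>lborel)"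
    proof -
      have "(1 - (1 + - (1 - s) * w)) / (1 - s) = w" for w using True by (simp add: field_simps)
      then show ?thesis by (simp only:)
    qed
    also have "\<dots> = (\<integral>\<^sup>+w. ennreal (1 - s) * (ennreal (K (1 + - (1 - s) * w) s) * g s w) \<partial>lborel)"
      by (rule nn_integral_cmult[symmetric]) measurable
    also have "\<dots> = (\<integral>\<^sup>+w. ennreal (beta_kern a (b + c) s * beta_kern c b w) * g s w \<partial>lborel)"
      unfolding eq[symmetric] using True by (simp add: mult.assoc[symmetric] ennreal_mult'[symmetric] K0 del: mult_minus_left)
    finally show ?thesis .
  next
    case False
    then have "beta_kern a (b + c) s = 0" "K p s = 0" for p by (auto simp: beta_kern_def K_def)
    then show ?thesis by simp
  qed
  have "(\<integral>\<^sup>+p. \<integral>\<^sup>+s. ennreal (K p s) * g s ((1 - p) / (1 - s)) \<partial>lborel \<partial>lborel) =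
        (\<integral>\<^sup>+s. \<integral>\<^sup>+p. ennreal (K p s) * g s ((1 - p) / (1 - s)) \<partial>lborel \<partial>lborel)"
    by (rule lborel_pair.Fubini') measurable
  then show ?thesis unfolding 1 2 .
qed

text \<open>The normalising constants on both sides are
  \<Gamma>(a)\<Gamma>(b)\<Gamma>(c)/\<Gamma>(a+b+c). This piece of beta algebra is the source of the
  stationarity of the edge laws.\<close>

lemma beta_borel_product:
  fixes g :: "real \<Rightarrow> real \<Rightarrow> ennreal"
  assumes abc: "a > 0" "b > 0" "c > 0"
    and [measurable]: "(\<lambda>(x, y). g x y) \<in> borel_measurable (borel \<Otimes>\<^sub>M borel)"
  shows "(\<integral>\<^sup>+p. \<integral>\<^sup>+q. g (p * q) ((1 - p) / (1 - p * q)) \<partial>beta_borel a b \<partial>beta_borel (a + b) c) =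
         (\<integral>\<^sup>+s. \<integral>\<^sup>+w. g s w \<partial>beta_borel c b \<partial>beta_borel a (b + c))"
proof -
  have dens: "(\<integral>\<^sup>+x. \<integral>\<^sup>+y. f x y \<partial>beta_borel a2 b2 \<partial>beta_borel a1 b1) =
      ennreal (1 / (Beta a1 b1 * Beta a2 b2)) * (\<integral>\<^sup>+x. \<integral>\<^sup>+y. ennreal (beta_kern a1 b1 x * beta_kern a2 b2 y) * f x y \<partial>lborel \<partial>lborel)"
    if ab: "a1 > 0" "b1 > 0" "a2 > 0" "b2 > 0"
      and f[measurable]: "(\<lambda>(x, y). f x y) \<in> borel_measurable (borel \<Otimes>\<^sub>M borel)"
    for f :: "real \<Rightarrow> real \<Rightarrow> ennreal" and a1 b1 a2 b2
  proof -
    have B: "Beta a1 b1 > 0" "Beta a2 b2 > 0" using ab by (auto intro: Beta_real_pos)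
    let ?c = "ennreal (1 / (Beta a1 b1 * Beta a2 b2))"
    have eq: "ennreal (beta_kern a1 b1 x / Beta a1 b1) * (ennreal (beta_kern a2 b2 y / Beta a2 b2) * f x y) =
        ?c * (ennreal (beta_kern a1 b1 x * beta_kern a2 b2 y) * f x y)" for x y
    proof -
      have "(beta_kern a1 b1 x / Beta a1 b1) * (beta_kern a2 b2 y / Beta a2 b2) =
          1 / (Beta a1 b1 * Beta a2 b2) * (beta_kern a1 b1 x * beta_kern a2 b2 y)" by simp
      then show ?thesis
        using B unfolding mult.assoc[symmetric] by (simp add: ennreal_mult'[symmetric] beta_kern_nonneg)
    qed
    have "(\<integral>\<^sup>+x. \<integral>\<^sup>+y. f x y \<partial>beta_borel a2 b2 \<partial>beta_borel a1 b1) =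
      (\<integral>\<^sup>+x. ennreal (beta_kern a1 b1 x / Beta a1 b1) * (\<integral>\<^sup>+y. ennreal (beta_kern a2 b2 y / Beta a2 b2) * f x y \<partial>lborel) \<partial>lborel)"
      by (simp add: nn_integral_beta_borel)
    also have "\<dots> = (\<integral>\<^sup>+x. \<integral>\<^sup>+y. ?c * (ennreal (beta_kern a1 b1 x * beta_kern a2 b2 y) * f x y) \<partial>lborel \<partial>lborel)"
      unfolding eq[symmetric] by (intro nn_integral_cong nn_integral_cmult[symmetric]) measurable
    also have "\<dots> = (\<integral>\<^sup>+x. ?c * (\<integral>\<^sup>+y. ennreal (beta_kern a1 b1 x * beta_kern a2 b2 y) * f x y \<partial>lborel) \<partial>lborel)"
      by (intro nn_integral_cong nn_integral_cmult) measurable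
    also have "\<dots> = ?c * (\<integral>\<^sup>+x. \<integral>\<^sup>+y. ennreal (beta_kern a1 b1 x * beta_kern a2 b2 y) * f x y \<partial>lborel \<partial>lborel)"
      by (intro nn_integral_cmult) measurable
    finally show ?thesis .
  qed
  have "Gamma (a + b) \<noteq> 0" "Gamma (b + c) \<noteq> 0"
    using abc by (auto simp: Gamma_eq_zero_iff)
  then have "Beta (a + b) c * Beta a b = Beta a (b + c) * Beta c b"
    by (simp add: Beta_def add_ac)
  then show ?thesis
    using abc by (subst (1 2) dens) (auto simp: beta_kern_product)
qed

lemma nn_integral_beta_borel_powr:
  assumes "a > 0" "b > 0" "a + t > 0"
  shows "(\<integral>\<^sup>+x. ennreal (x powr t) \<partial>beta_borel a b) = ennreal (Beta (a + t) b / Beta a b)"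
proof -
  have B: "Beta a b > 0" using assms by (simp add: Beta_real_pos)
  have "(\<integral>\<^sup>+x. ennreal (x powr t) \<partial>beta_borel a b) = (\<integral>\<^sup>+x. ennreal (beta_kern a b x / Beta a b) * ennreal (x powr t) \<partial>lborel)"
    by (rule nn_integral_beta_borel) simp
  also have "\<dots> = (\<integral>\<^sup>+x. ennreal (1 / Beta a b) * ennreal (beta_kern (a + t) b x) \<partial>lborel)"
    using B by (intro nn_integral_cong)
      (auto simp: beta_kern_def ennreal_mult'[symmetric] algebra_simps powr_add[symmetric] divide_simps)
  also have "\<dots> = ennreal (1 / Beta a b) * ennreal (Beta (a + t) b)"
    using assms by (subst nn_integral_cmult) (auto simp: nn_integral_beta_kern)
  finally show ?thesis using B by (simp add: ennreal_mult'[symmetric])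
qed

text \<open>On the unit interval a larger first parameter lowers the unnormalised density, so only
  the ratio of the normalising constants remains. This later gives continuity in the parameter for
  all Borel sets at once.\<close>

lemma nn_integral_beta_borel_le:
  assumes "0 < a" "a \<le> a'" "b > 0" and [measurable]: "f \<in> borel_measurable borel"
  shows "(\<integral>\<^sup>+x. f x \<partial>beta_borel a' b) \<le> ennreal (Beta a b / Beta a' b) * (\<integral>\<^sup>+x. f x \<partial>beta_borel a b)"
proof -
  have B: "Beta a b > 0" "Beta a' b > 0" using assms by (auto intro!: Beta_real_pos)
  have "(\<integral>\<^sup>+x. f x \<partial>beta_borel a' b) = (\<integral>\<^sup>+x. ennreal (beta_kern a' b x / Beta a' b) * f x \<partial>lborel)"
    by (rule nn_integral_beta_borel) simp
  also have "\<dots> \<le> (\<integral>\<^sup>+x. ennreal (beta_kern a b x / Beta a' b) * f x \<partial>lborel)"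
    using B assms by (intro nn_integral_mono mult_right_mono ennreal_leI divide_right_mono)
       (auto simp: beta_kern_def intro!: mult_right_mono powr_mono')
  also have "\<dots> = (\<integral>\<^sup>+x. ennreal (Beta a b / Beta a' b) * (ennreal (beta_kern a b x / Beta a b) * f x) \<partial>lborel)"
    using B by (intro nn_integral_cong) (simp add: mult.assoc[symmetric] ennreal_mult'[symmetric] beta_kern_nonneg)
  also have "\<dots> = ennreal (Beta a b / Beta a' b) * (\<integral>\<^sup>+x. f x \<partial>beta_borel a b)"
    by (subst nn_integral_cmult) (auto simp: nn_integral_beta_borel)
  finally show ?thesis .
qed

section \<open>Stationary pairs of edge laws\<close>

text \<open>In a positive harmonic function \<open>h\<close> for the weights \<open>w\<close>, let \<open>u = h y / h (y + e1)\<close> and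
  \<open>v = h y / h (y + e2)\<close> sit on the edges leaving \<open>y\<close>.  Harmonicity at \<open>y\<close> forces
  \<open>w y = u (1 - v) / (u - v)\<close>.  The update propagates \<open>u\<close> and \<open>v\<close> to the opposite edges
  of the unit square and replaces the random input \<open>w\<close> by this dual weight.\<close>

definition upd_h :: "real \<Rightarrow> real \<Rightarrow> real \<Rightarrow> real" where "upd_h u v w = w + (1 - w) * u / v"
definition upd_v :: "real \<Rightarrow> real \<Rightarrow> real \<Rightarrow> real" where "upd_v u v w = 1 - w + w * v / u"
definition dual_weight :: "real \<Rightarrow> real \<Rightarrow> real" where "dual_weight u v = clip (u * (1 - v) / (u - v))"

lemma
  fixes f g h :: "'a \<Rightarrow> real"
  assumes [measurable]: "f \<in> borel_measurable M" "g \<in> borel_measurable M" "h \<in> borel_measurable M"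
  shows measurable_upd_h [measurable (raw)]: "(\<lambda>x. upd_h (f x) (g x) (h x)) \<in> borel_measurable M"
    and measurable_upd_v [measurable (raw)]: "(\<lambda>x. upd_v (f x) (g x) (h x)) \<in> borel_measurable M"
  unfolding upd_h_def upd_v_def by measurable

lemma measurable_dual_weight [measurable (raw)]:
  fixes f g :: "'a \<Rightarrow> real"
  assumes [measurable]: "f \<in> borel_measurable M" "g \<in> borel_measurable M"
  shows "(\<lambda>x. dual_weight (f x) (g x)) \<in> borel_measurable M"
  unfolding dual_weight_def by measurable

text \<open>Harmonicity makes 1 a convex combination of 1/u and 1/v, so one of u and v exceeds 1 and
  the other does not; \<open>support\<close> admits both orders to make the notion closed under
  reflection in the diagonal. \<open>invariant\<close> says, with test functions, that the corner
  update maps the product law of u, v and w to itself.\<close>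

locale stat_pair =
  fixes \<alpha> \<beta> :: real and LU LV :: "real measure"
  assumes ab: "\<alpha> > 0" "\<beta> > 0"
    and prob_LU: "prob_space LU" and prob_LV: "prob_space LV"
    and sets_LU [simp, measurable_cong]: "sets LU = sets borel"
    and sets_LV [simp, measurable_cong]: "sets LV = sets borel"
    and support: "(AE u in LU. 1 < u) \<and> (AE v in LV. 0 < v \<and> v < 1) \<or>
                  (AE u in LU. 0 < u \<and> u < 1) \<and> (AE v in LV. 1 < v)"
    and invariant: "\<And>g :: real \<Rightarrow> real \<Rightarrow> real \<Rightarrow> ennreal.
      (\<lambda>(u, v, w). g u v w) \<in> borel_measurable (borel \<Otimes>\<^sub>M borel \<Otimes>\<^sub>M borel) \<Longrightarrow>
      (\<integral>\<^sup>+u. \<integral>\<^sup>+v. \<integral>\<^sup>+w. g (upd_h u v w) (upd_v u v w) (dual_weight u v) \<partial>beta_borel \<alpha> \<beta> \<partial>LV \<partial>LU) =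
      (\<integral>\<^sup>+u. \<integral>\<^sup>+v. \<integral>\<^sup>+w. g u v w \<partial>beta_borel \<alpha> \<beta> \<partial>LV \<partial>LU)"
begin

lemma space_LU [simp]: "space LU = UNIV" and space_LV [simp]: "space LV = UNIV"
  using sets_eq_imp_space_eq[OF sets_LU] sets_eq_imp_space_eq[OF sets_LV] by simp_all

end

text \<open>Reflection in the diagonal exchanges the two steps: u and v trade places and every
  weight w becomes \<open>1 - w\<close>, which turns Beta(\<alpha>,\<beta>) into
  Beta(\<beta>,\<alpha>).\<close>

lemma stat_pair_swap:
  assumes "stat_pair \<alpha> \<beta> LU LV"
  shows "stat_pair \<beta> \<alpha> LV LU"
proof -
  interpret stat_pair \<alpha> \<beta> LU LV by fact
  interpret U: prob_space LU by (rule prob_LU)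
  interpret V: prob_space LV by (rule prob_LV)
  interpret W: prob_space "beta_borel \<alpha> \<beta>" using ab by (intro prob_space_beta_borel)
  interpret W': prob_space "beta_borel \<beta> \<alpha>" using ab by (intro prob_space_beta_borel)
  interpret UV: pair_sigma_finite LU LV ..
  show ?thesis
  proof (rule stat_pair.intro)
    fix g :: "real \<Rightarrow> real \<Rightarrow> real \<Rightarrow> ennreal"
    assume [measurable]: "(\<lambda>(u, v, w). g u v w) \<in> borel_measurable (borel \<Otimes>\<^sub>M borel \<Otimes>\<^sub>M borel)"
    have [measurable (raw)]: "(\<lambda>x. g (a x) (b x) (c x)) \<in> borel_measurable M"
      if "a \<in> borel_measurable M" "b \<in> borel_measurable M" "c \<in> borel_measurable M" for a b c and M :: "'z measure"
      using measurable_compose[OF measurable_Pair[OF that(1) measurable_Pair[OF that(2,3)]]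
        \<open>(\<lambda>(u, v, w). g u v w) \<in> borel_measurable (borel \<Otimes>\<^sub>M borel \<Otimes>\<^sub>M borel)\<close>] by simp
    \<comment> \<open>The identity \<open>dual_weight v u = 1 - dual_weight u v\<close> used below
      needs \<open>clip\<close> to act as the identity, so the unclipped value has to lie in the
      unit interval.\<close>
    have AEuv: "AE u in LU. AE v in LV. u \<noteq> v \<and> u > 0 \<and> v > 0 \<and> 0 \<le> u * (1 - v) / (u - v) \<and> u * (1 - v) / (u - v) \<le> 1"
      using support
    proof
      assume A: "(AE u in LU. 1 < u) \<and> (AE v in LV. 0 < v \<and> v < 1)"
      show ?thesis
      proof (rule AE_mp[OF conjunct1[OF A]], rule AE_I2, rule impI)
        fix u :: real assume u: "1 < u"
        show "AE v in LV. u \<noteq> v \<and> u > 0 \<and> v > 0 \<and> 0 \<le> u * (1 - v) / (u - v) \<and> u * (1 - v) / (u - v) \<le> 1"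
          using conjunct2[OF A] by eventually_elim (use u in \<open>auto simp: divide_simps algebra_simps\<close>)
      qed
    next
      assume A: "(AE u in LU. 0 < u \<and> u < 1) \<and> (AE v in LV. 1 < v)"
      show ?thesis
      proof (rule AE_mp[OF conjunct1[OF A]], rule AE_I2, rule impI)
        fix u :: real assume u: "0 < u \<and> u < 1"
        show "AE v in LV. u \<noteq> v \<and> u > 0 \<and> v > 0 \<and> 0 \<le> u * (1 - v) / (u - v) \<and> u * (1 - v) / (u - v) \<le> 1"
          using conjunct2[OF A] by eventually_elim (use u in \<open>auto simp: divide_simps algebra_simps\<close>)
      qed
    qed
    have "(\<integral>\<^sup>+v. \<integral>\<^sup>+u. \<integral>\<^sup>+w. g (upd_h v u w) (upd_v v u w) (dual_weight v u) \<partial>beta_borel \<beta> \<alpha> \<partial>LU \<partial>LV) =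
       (\<integral>\<^sup>+u. \<integral>\<^sup>+v. \<integral>\<^sup>+w. g (upd_h v u w) (upd_v v u w) (dual_weight v u) \<partial>beta_borel \<beta> \<alpha> \<partial>LV \<partial>LU)"
      by (rule UV.Fubini') measurable
    also have "\<dots> = (\<integral>\<^sup>+u. \<integral>\<^sup>+v. \<integral>\<^sup>+w. g (upd_h v u (1 - w)) (upd_v v u (1 - w)) (dual_weight v u) \<partial>beta_borel \<alpha> \<beta> \<partial>LV \<partial>LU)"
      by (subst nn_integral_beta_borel_reflect) auto
    also have "\<dots> = (\<integral>\<^sup>+u. \<integral>\<^sup>+v. \<integral>\<^sup>+w. g (upd_v u v w) (upd_h u v w) (1 - dual_weight u v) \<partial>beta_borel \<alpha> \<beta> \<partial>LV \<partial>LU)"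
    proof (rule nn_integral_cong_AE, rule AE_mp[OF AEuv], rule AE_I2, rule impI, rule nn_integral_cong_AE)
      fix u assume "AE v in LV. u \<noteq> v \<and> u > 0 \<and> v > 0 \<and> 0 \<le> u * (1 - v) / (u - v) \<and> u * (1 - v) / (u - v) \<le> 1"
      then show "AE v in LV. (\<integral>\<^sup>+w. g (upd_h v u (1 - w)) (upd_v v u (1 - w)) (dual_weight v u) \<partial>beta_borel \<alpha> \<beta>) =
          (\<integral>\<^sup>+w. g (upd_v u v w) (upd_h u v w) (1 - dual_weight u v) \<partial>beta_borel \<alpha> \<beta>)"
      proof eventually_elim
        case (elim v)
        have "v * (1 - u) / (v - u) = 1 - u * (1 - v) / (u - v)"
          using elim by (simp add: field_simps)
        then have "dual_weight v u = 1 - dual_weight u v"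
          using elim unfolding dual_weight_def by (simp add: clip_id)
        then show ?case by (simp add: upd_h_def upd_v_def)
      qed
    qed
    also have "\<dots> = (\<integral>\<^sup>+u. \<integral>\<^sup>+v. \<integral>\<^sup>+w. g v u (1 - w) \<partial>beta_borel \<alpha> \<beta> \<partial>LV \<partial>LU)"
      by (rule invariant[of "\<lambda>u v w. g v u (1 - w)"]) measurable
    also have "\<dots> = (\<integral>\<^sup>+u. \<integral>\<^sup>+v. \<integral>\<^sup>+w. g v u w \<partial>beta_borel \<beta> \<alpha> \<partial>LV \<partial>LU)"
      by (subst nn_integral_beta_borel_reflect) auto
    also have "\<dots> = (\<integral>\<^sup>+v. \<integral>\<^sup>+u. \<integral>\<^sup>+w. g v u w \<partial>beta_borel \<beta> \<alpha> \<partial>LU \<partial>LV)"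
      by (rule UV.Fubini'[symmetric]) measurable
    finally show "(\<integral>\<^sup>+v. \<integral>\<^sup>+u. \<integral>\<^sup>+w. g (upd_h v u w) (upd_v v u w) (dual_weight v u) \<partial>beta_borel \<beta> \<alpha> \<partial>LU \<partial>LV) =
       (\<integral>\<^sup>+v. \<integral>\<^sup>+u. \<integral>\<^sup>+w. g v u w \<partial>beta_borel \<beta> \<alpha> \<partial>LU \<partial>LV)" .
  qed (use ab support in \<open>blast | simp add: prob_LU prob_LV\<close>)+
qed

definition inv_beta :: "real \<Rightarrow> real \<Rightarrow> real measure" where
  "inv_beta a b = distr (beta_borel a b) borel inverse"

lemma sets_inv_beta [simp, measurable_cong]: "sets (inv_beta a b) = sets borel"
  by (simp add: inv_beta_def)

text \<open>Write u = 1/q and v = p. The dual weight is \<open>(1 - p) / (1 - p * q)\<close>, while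
  the updated edges depend only on w and on \<open>s = p * q\<close>. By
  \<open>beta_borel_product\<close> the dual weight is independent of s and has the law of w.
  Exchanging the two weights and reading the product identity backwards restores the original
  triple.\<close>

lemma stat_pair_beta:
  assumes "l > 0" "\<alpha> > 0" "\<beta> > 0"
  shows "stat_pair \<alpha> \<beta> (inv_beta l \<beta>) (beta_borel (l + \<beta>) \<alpha>)"
proof -
  let ?P = "beta_borel (l + \<beta>) \<alpha>" and ?Q = "beta_borel l \<beta>" and ?W = "beta_borel \<alpha> \<beta>" and ?S = "beta_borel l (\<beta> + \<alpha>)"
  interpret P: prob_space ?P using assms by (intro prob_space_beta_borel) auto
  interpret Q: prob_space ?Q using assms by (intro prob_space_beta_borel) auto
  interpret W: prob_space ?W using assms by (intro prob_space_beta_borel) auto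
  interpret S: prob_space ?S using assms by (intro prob_space_beta_borel) auto
  interpret QP: pair_sigma_finite ?Q ?P ..
  interpret WW: pair_sigma_finite ?W ?W ..
  show ?thesis
  proof (rule stat_pair.intro)
    show "prob_space (inv_beta l \<beta>)" unfolding inv_beta_def by (rule Q.prob_space_distr) simp
    have "AE u in inv_beta l \<beta>. 1 < u"
      unfolding inv_beta_def by (subst AE_distr_iff) (auto intro!: AE_mp[OF AE_beta_borel AE_I2] simp: one_less_inverse)
    then show "(AE u in inv_beta l \<beta>. 1 < u) \<and> (AE v in ?P. 0 < v \<and> v < 1) \<or>
         (AE u in inv_beta l \<beta>. 0 < u \<and> u < 1) \<and> (AE v in ?P. 1 < v)"
      using AE_beta_borel by blast
    fix g :: "real \<Rightarrow> real \<Rightarrow> real \<Rightarrow> ennreal"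
    assume [measurable]: "(\<lambda>(u, v, w). g u v w) \<in> borel_measurable (borel \<Otimes>\<^sub>M borel \<Otimes>\<^sub>M borel)"
    have [measurable (raw)]: "(\<lambda>x. g (a x) (b x) (c x)) \<in> borel_measurable M"
      if "a \<in> borel_measurable M" "b \<in> borel_measurable M" "c \<in> borel_measurable M" for a b c and M :: "'z measure"
      using measurable_compose[OF measurable_Pair[OF that(1) measurable_Pair[OF that(2,3)]]
        \<open>(\<lambda>(u, v, w). g u v w) \<in> borel_measurable (borel \<Otimes>\<^sub>M borel \<Otimes>\<^sub>M borel)\<close>] by simp
    have cong: "(\<integral>\<^sup>+p. \<integral>\<^sup>+q. f p q \<partial>?Q \<partial>?P) = (\<integral>\<^sup>+p. \<integral>\<^sup>+q. f' p q \<partial>?Q \<partial>?P)"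
      if "\<And>p q. 0 < p \<Longrightarrow> p < 1 \<Longrightarrow> 0 < q \<Longrightarrow> q < 1 \<Longrightarrow> f p q = f' p q" for f f' :: "real \<Rightarrow> real \<Rightarrow> ennreal"
    proof (rule nn_integral_cong_AE, rule AE_mp[OF AE_beta_borel], rule AE_I2, rule impI)
      fix p :: real assume p: "0 < p \<and> p < 1"
      show "(\<integral>\<^sup>+q. f p q \<partial>?Q) = (\<integral>\<^sup>+q. f' p q \<partial>?Q)"
        by (rule nn_integral_cong_AE, rule AE_mp[OF AE_beta_borel], rule AE_I2) (use p that in blast)
    qed
    have pq: "p * q < 1" if "0 < p" "p < 1" "0 < q" "q < 1" for p q :: real
      using mult_strict_mono[of p 1 q 1] that by simp
    have "(\<integral>\<^sup>+u. \<integral>\<^sup>+v. \<integral>\<^sup>+w. g (upd_h u v w) (upd_v u v w) (dual_weight u v) \<partial>?W \<partial>?P \<partial>inv_beta l \<beta>) =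
      (\<integral>\<^sup>+q. \<integral>\<^sup>+p. \<integral>\<^sup>+w. g (upd_h (inverse q) p w) (upd_v (inverse q) p w) (dual_weight (inverse q) p) \<partial>?W \<partial>?P \<partial>?Q)"
      unfolding inv_beta_def by (subst nn_integral_distr) auto
    also have "\<dots> = (\<integral>\<^sup>+p. \<integral>\<^sup>+q. \<integral>\<^sup>+w. g (upd_h (inverse q) p w) (upd_v (inverse q) p w) (dual_weight (inverse q) p) \<partial>?W \<partial>?Q \<partial>?P)"
      by (rule QP.Fubini'[symmetric]) measurable
    also have "\<dots> = (\<integral>\<^sup>+p. \<integral>\<^sup>+q. \<integral>\<^sup>+w. g (w + (1 - w) / (p * q)) (1 - w + w * (p * q)) ((1 - p) / (1 - p * q)) \<partial>?W \<partial>?Q \<partial>?P)"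
    proof (rule cong, goal_cases)
      case (1 p q)
      have "inverse q * (1 - p) / (inverse q - p) = (1 - p) / (1 - p * q)"
        using 1 pq[of p q] by (simp add: field_simps)
      moreover have "0 \<le> (1 - p) / (1 - p * q)" "(1 - p) / (1 - p * q) \<le> 1"
        using 1 pq[of p q] by (auto simp: divide_simps mult_left_le)
      ultimately have "dual_weight (inverse q) p = (1 - p) / (1 - p * q)"
        by (simp add: dual_weight_def clip_id)
      then show ?case
        by (simp add: upd_h_def upd_v_def field_simps)
    qed
    also have "\<dots> = (\<integral>\<^sup>+s. \<integral>\<^sup>+y. \<integral>\<^sup>+w. g (w + (1 - w) / s) (1 - w + w * s) y \<partial>?W \<partial>?W \<partial>?S)"
      by (rule beta_borel_product[of l \<beta> \<alpha> "\<lambda>s y. \<integral>\<^sup>+w. g (w + (1 - w) / s) (1 - w + w * s) y \<partial>?W"]) (use assms in auto)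
    \<comment> \<open>The heart of the argument: y and w are independent of s and of each other,
      with the same law, so their roles may be exchanged.\<close>
    also have "\<dots> = (\<integral>\<^sup>+s. \<integral>\<^sup>+w. \<integral>\<^sup>+y. g (w + (1 - w) / s) (1 - w + w * s) y \<partial>?W \<partial>?W \<partial>?S)"
      by (intro nn_integral_cong WW.Fubini') measurable
    also have "\<dots> = (\<integral>\<^sup>+p. \<integral>\<^sup>+q. \<integral>\<^sup>+y. g ((1 - p) / (1 - p * q) + (1 - (1 - p) / (1 - p * q)) / (p * q))
         (1 - (1 - p) / (1 - p * q) + (1 - p) / (1 - p * q) * (p * q)) y \<partial>?W \<partial>?Q \<partial>?P)"
      by (rule beta_borel_product[of l \<beta> \<alpha> "\<lambda>s w. \<integral>\<^sup>+y. g (w + (1 - w) / s) (1 - w + w * s) y \<partial>?W", symmetric]) (use assms in auto)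
    also have "\<dots> = (\<integral>\<^sup>+p. \<integral>\<^sup>+q. \<integral>\<^sup>+y. g (inverse q) p y \<partial>?W \<partial>?Q \<partial>?P)"
    proof (rule cong, goal_cases)
      case (1 p q)
      define x where "x = (1 - p) / (1 - p * q)"
      have x: "x * (1 - p * q) = 1 - p" using 1 pq[of p q] by (simp add: x_def)
      then have p: "1 - x + x * (p * q) = p" by (simp add: algebra_simps)
      have "x + (1 - x) / (p * q) = (1 - x + x * (p * q)) / (p * q)"
        using 1 by (simp add: add_divide_distrib)
      also have "\<dots> = inverse q" unfolding p using 1 by (simp add: field_simps)
      finally have "x + (1 - x) / (p * q) = inverse q" .
      moreover note p
      ultimately show ?case by (simp add: x_def)
    qed
    also have "\<dots> = (\<integral>\<^sup>+q. \<integral>\<^sup>+p. \<integral>\<^sup>+y. g (inverse q) p y \<partial>?W \<partial>?P \<partial>?Q)"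
      by (rule QP.Fubini') measurable
    also have "\<dots> = (\<integral>\<^sup>+u. \<integral>\<^sup>+v. \<integral>\<^sup>+w. g u v w \<partial>?W \<partial>?P \<partial>inv_beta l \<beta>)"
      unfolding inv_beta_def by (subst nn_integral_distr) auto
    finally show "(\<integral>\<^sup>+u. \<integral>\<^sup>+v. \<integral>\<^sup>+w. g (upd_h u v w) (upd_v u v w) (dual_weight u v) \<partial>?W \<partial>?P \<partial>inv_beta l \<beta>) =
       (\<integral>\<^sup>+u. \<integral>\<^sup>+v. \<integral>\<^sup>+w. g u v w \<partial>?W \<partial>?P \<partial>inv_beta l \<beta>)" .
  qed (use assms P.prob_space_axioms in auto)
qed

section \<open>Stationary fields on a quadrant\<close>

text \<open>The inputs of a field with a given corner: the horizontal edges of its bottom row, the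
  vertical edges of its left column, and a weight at every site. Weights outside the quadrant are
  included because the environment has to be defined on the whole lattice.\<close>

datatype coord = HBd nat | VBd nat | Wt site

definition site_at :: "site \<Rightarrow> nat \<Rightarrow> nat \<Rightarrow> site" where
  "site_at c a b = c + (int a, int b)"

lemma site_at_inj [simp]: "site_at c a b = site_at c a' b' \<longleftrightarrow> a = a' \<and> b = b'"
  by (auto simp: site_at_def)

lemma site_at_Suc: "site_at c (Suc a) b = site_at c a b + e1" "site_at c a (Suc b) = site_at c a b + e2"
  by (auto simp: site_at_def prod_eq_iff)

lemma site_at_0 [simp]: "site_at c 0 0 = c"
  by (simp add: site_at_def prod_eq_iff)

lemma below_site_at: "c \<sqsubseteq> x \<longleftrightarrow> (\<exists>a b. x = site_at c a b)"
proof
  assume "c \<sqsubseteq> x"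
  then have "x = site_at c (nat (fst x - fst c)) (nat (snd x - snd c))"
    by (simp add: site_at_def below_def prod_eq_iff)
  then show "\<exists>a b. x = site_at c a b" by blast
qed (auto simp: site_at_def below_def)

fun field_h and field_v :: "site \<Rightarrow> (coord \<Rightarrow> real) \<Rightarrow> nat \<Rightarrow> nat \<Rightarrow> real" where
  "field_h c \<eta> a 0 = \<eta> (HBd a)"
| "field_h c \<eta> a (Suc b) = upd_h (field_h c \<eta> a b) (field_v c \<eta> a b) (\<eta> (Wt (site_at c a b)))"
| "field_v c \<eta> 0 b = \<eta> (VBd b)"
| "field_v c \<eta> (Suc a) b = upd_v (field_h c \<eta> a b) (field_v c \<eta> a b) (\<eta> (Wt (site_at c a b)))"

text \<open>Inside the quadrant the input weights only drive the recursion; the environment for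
  which the field is harmonic consists of the dual weights. Outside, the input weights are kept, so
  that the law on the whole lattice is that of an i.i.d. environment.\<close>

definition true_env :: "site \<Rightarrow> (coord \<Rightarrow> real) \<Rightarrow> site \<Rightarrow> real" where
  "true_env c \<eta> x = (if c \<sqsubseteq> x then dual_weight (field_h c \<eta> (nat (fst x - fst c)) (nat (snd x - snd c)))
     (field_v c \<eta> (nat (fst x - fst c)) (nat (snd x - snd c))) else clip (\<eta> (Wt x)))"

lemma true_env_at: "true_env c \<eta> (site_at c a b) = dual_weight (field_h c \<eta> a b) (field_v c \<eta> a b)"
  by (simp add: true_env_def site_at_def below_def)

lemma is_env_true_env: "is_env (true_env c \<eta>)"
  by (auto simp: is_env_def true_env_def dual_weight_def clip_range)

definition lower_set :: "(nat \<times> nat) set \<Rightarrow> bool" where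
  "lower_set D \<longleftrightarrow> (\<forall>a b a' b'. (a, b) \<in> D \<longrightarrow> a' \<le> a \<longrightarrow> b' \<le> b \<longrightarrow> (a', b') \<in> D)"

text \<open>The variables on the boundary path of a lower set \<open>D\<close>: each column carries one horizontal
  and each row one vertical edge of the path.  Inside \<open>D\<close> the dual weights are replaced by the
  weights of the environment.\<close>

definition boundary_state :: "site \<Rightarrow> (nat \<times> nat) set \<Rightarrow> (coord \<Rightarrow> real) \<Rightarrow> coord \<Rightarrow> real" where
  "boundary_state c D \<eta> k = (case k of
     HBd a \<Rightarrow> field_h c \<eta> a (card {b. (a, b) \<in> D})
   | VBd b \<Rightarrow> field_v c \<eta> (card {a. (a, b) \<in> D}) b
   | Wt x \<Rightarrow> if \<exists>(a, b)\<in>D. x = site_at c a b then true_env c \<eta> x else \<eta> (Wt x))"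

definition flip_at :: "site \<Rightarrow> nat \<Rightarrow> nat \<Rightarrow> (coord \<Rightarrow> real) \<Rightarrow> coord \<Rightarrow> real" where
  "flip_at c a b \<eta> = (let u = \<eta> (HBd a); v = \<eta> (VBd b); w = \<eta> (Wt (site_at c a b)) in
     \<eta>(HBd a := upd_h u v w, VBd b := upd_v u v w, Wt (site_at c a b) := dual_weight u v))"

text \<open>A cell that maximises \<open>a + b\<close> over a lower set is an outer corner: it is
  the topmost cell of its column and the rightmost cell of its row.\<close>

lemma lower_set_fibres:
  assumes D: "lower_set D" "finite D" "(a, b) \<in> D" and max: "\<And>a' b'. (a', b') \<in> D \<Longrightarrow> a' + b' \<le> a + b"
  shows "{b'. (a, b') \<in> D - {(a, b)}} = {..<b}" "{a'. (a', b) \<in> D - {(a, b)}} = {..<a}"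
    "{b'. (a, b') \<in> D} = {..b}" "{a'. (a', b) \<in> D} = {..a}"
proof -
  have *: "b' \<le> b" if "(a, b') \<in> D" for b' using max[OF that] by simp
  have **: "a' \<le> a" if "(a', b) \<in> D" for a' using max[OF that] by simp
  have L: "(a, b') \<in> D" if "b' \<le> b" for b' using D that unfolding lower_set_def by blast
  have R: "(a', b) \<in> D" if "a' \<le> a" for a' using D that unfolding lower_set_def by blast
  show "{b'. (a, b') \<in> D - {(a, b)}} = {..<b}" "{a'. (a', b) \<in> D - {(a, b)}} = {..<a}"
    "{b'. (a, b') \<in> D} = {..b}" "{a'. (a', b) \<in> D} = {..a}"
    using * ** L R by (auto simp: less_le)
qed

text \<open>Adding an outer corner changes the height of one column, the width of one row and the
  status of one site. Hence three coordinates of the state change, and they change by the corner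
  update.\<close>

lemma boundary_state_insert:
  assumes D: "lower_set D" "finite D" "(a, b) \<in> D" and max: "\<And>a' b'. (a', b') \<in> D \<Longrightarrow> a' + b' \<le> a + b"
  shows "boundary_state c D \<eta> = flip_at c a b (boundary_state c (D - {(a, b)}) \<eta>)"
proof
  fix k
  note fib = lower_set_fibres[OF assms]
  let ?S = "boundary_state c (D - {(a, b)}) \<eta>"
  have S: "?S (HBd a) = field_h c \<eta> a b" "?S (VBd b) = field_v c \<eta> a b"
    by (simp_all only: boundary_state_def coord.case fib card_lessThan)
  have W: "?S (Wt (site_at c a b)) = \<eta> (Wt (site_at c a b))"
    by (auto simp: boundary_state_def)
  show "boundary_state c D \<eta> k = flip_at c a b ?S k"
  proof (cases k)
    case (HBd i)
    show ?thesis
    proof (cases "i = a")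
      case True
      then show ?thesis
        using HBd unfolding flip_at_def Let_def S W by (simp add: boundary_state_def fib)
    next
      case False
      then show ?thesis using HBd by (simp add: flip_at_def Let_def boundary_state_def)
    qed
  next
    case (VBd i)
    show ?thesis
    proof (cases "i = b")
      case True
      then show ?thesis
        using VBd unfolding flip_at_def Let_def S W by (simp add: boundary_state_def fib)
    next
      case False
      then show ?thesis using VBd by (simp add: flip_at_def Let_def boundary_state_def)
    qed
  next
    case (Wt x)
    show ?thesis
    proof (cases "x = site_at c a b")
      case True
      have "\<exists>(a', b')\<in>D. x = site_at c a' b'" using D(3) True by auto
      then show ?thesis
        using Wt True unfolding flip_at_def Let_def S W by (simp add: boundary_state_def true_env_at)
    next
      case False
      then have "(\<exists>(a', b')\<in>D. x = site_at c a' b') \<longleftrightarrow> (\<exists>(a', b')\<in>D - {(a, b)}. x = site_at c a' b')"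
        by auto
      then show ?thesis using Wt False by (simp add: flip_at_def Let_def boundary_state_def)
    qed
  qed
qed

section \<open>Invariance of the field law under the corner updates\<close>

context stat_pair
begin

definition coord_law :: "coord \<Rightarrow> real measure" where
  "coord_law k = (case k of HBd _ \<Rightarrow> LU | VBd _ \<Rightarrow> LV | Wt _ \<Rightarrow> beta_borel \<alpha> \<beta>)"

lemma sets_coord_law [simp, measurable_cong]: "sets (coord_law k) = sets borel"
  by (simp add: coord_law_def split: coord.split)

lemma space_coord_law [simp]: "space (coord_law k) = UNIV"
  using sets_eq_imp_space_eq[OF sets_coord_law] by simp

lemma prob_space_coord_law: "prob_space (coord_law k)"
  using ab by (auto simp: coord_law_def prob_LU prob_LV prob_space_beta_borel split: coord.split)

definition field_law :: "(coord \<Rightarrow> real) measure" where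
  "field_law = PiM UNIV coord_law"

lemma sets_field_law [measurable_cong]: "sets field_law = sets (PiM UNIV (\<lambda>_. borel))"
  unfolding field_law_def by (intro sets_PiM_cong) auto

lemma space_field_law [simp]: "space field_law = UNIV"
  by (simp add: field_law_def space_PiM)

lemma prob_space_field_law: "prob_space field_law"
  unfolding field_law_def by (intro prob_space_PiM prob_space_coord_law)

lemma measurable_coord [measurable]: "(\<lambda>\<eta>. \<eta> k) \<in> borel_measurable field_law"
  unfolding measurable_cong_sets[OF sets_field_law refl] by simp

lemma measurable_field_law_iff:
  "f \<in> measurable M field_law \<longleftrightarrow> (\<forall>k. (\<lambda>x. f x k) \<in> borel_measurable M)"
proof
  assume "f \<in> measurable M field_law"
  then show "\<forall>k. (\<lambda>x. f x k) \<in> borel_measurable M"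
    using measurable_compose[OF _ measurable_coord] by blast
next
  assume "\<forall>k. (\<lambda>x. f x k) \<in> borel_measurable M"
  then show "f \<in> measurable M field_law"
    unfolding measurable_cong_sets[OF refl sets_field_law]
    by (intro measurable_PiM_single') auto
qed

lemma measurable_field [measurable]:
  "(\<lambda>\<eta>. field_h c \<eta> a b) \<in> borel_measurable field_law"
  "(\<lambda>\<eta>. field_v c \<eta> a b) \<in> borel_measurable field_law"
proof -
  have "(\<lambda>\<eta>. field_h c \<eta> a b) \<in> borel_measurable field_law \<and>
      (\<lambda>\<eta>. field_v c \<eta> a b) \<in> borel_measurable field_law"
  proof (induction "a + b" arbitrary: a b rule: less_induct)
    case less
    have "(\<lambda>\<eta>. field_h c \<eta> a b) \<in> borel_measurable field_law"
    proof (cases b)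
      case (Suc b')
      with less[of a b'] have [measurable]: "(\<lambda>\<eta>. field_h c \<eta> a b') \<in> borel_measurable field_law"
        "(\<lambda>\<eta>. field_v c \<eta> a b') \<in> borel_measurable field_law" by auto
      show ?thesis using Suc by simp
    qed simp
    moreover have "(\<lambda>\<eta>. field_v c \<eta> a b) \<in> borel_measurable field_law"
    proof (cases a)
      case (Suc a')
      with less[of a' b] have [measurable]: "(\<lambda>\<eta>. field_h c \<eta> a' b) \<in> borel_measurable field_law"
        "(\<lambda>\<eta>. field_v c \<eta> a' b) \<in> borel_measurable field_law" by auto
      show ?thesis using Suc by simp
    qed simp
    ultimately show ?case by simp
  qed
  then show "(\<lambda>\<eta>. field_h c \<eta> a b) \<in> borel_measurable field_law"
    "(\<lambda>\<eta>. field_v c \<eta> a b) \<in> borel_measurable field_law" by blast+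
qed

lemma measurable_true_env_coord [measurable]: "(\<lambda>\<eta>. true_env c \<eta> x) \<in> borel_measurable field_law"
  by (cases "c \<sqsubseteq> x") (simp_all add: true_env_def)

lemma measurable_true_env [measurable]: "true_env c \<in> measurable field_law (env_law \<alpha> \<beta>)"
proof -
  have "(\<lambda>\<eta> x. true_env c \<eta> x) \<in> measurable field_law (PiM UNIV (\<lambda>_. beta_law \<alpha> \<beta>))"
  proof (rule measurable_PiM_single')
    show "(\<lambda>\<eta>. true_env c \<eta> x) \<in> measurable field_law (beta_law \<alpha> \<beta>)" for x
      by (simp add: measurable_beta_law_iff Pi_iff is_envD[OF is_env_true_env])
    show "(\<lambda>\<eta> x. true_env c \<eta> x) \<in> space field_law \<rightarrow> (\<Pi>\<^sub>E x\<in>UNIV. space (beta_law \<alpha> \<beta>))"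
      by (simp add: space_beta_law Pi_iff PiE_iff is_envD[OF is_env_true_env])
  qed
  then show ?thesis by (simp add: env_law_def)
qed

lemma measurable_flip_at: "flip_at c a b \<in> measurable field_law field_law"
proof -
  have "(\<lambda>\<eta>. flip_at c a b \<eta> k) \<in> borel_measurable field_law" for k
  proof -
    have "k = HBd a \<or> k = VBd b \<or> k = Wt (site_at c a b) \<or> (\<forall>\<eta>. flip_at c a b \<eta> k = \<eta> k)"
      by (auto simp: flip_at_def Let_def)
    then show ?thesis by (elim disjE) (simp_all add: flip_at_def Let_def)
  qed
  then show ?thesis by (simp add: measurable_field_law_iff)
qed

text \<open>Redrawing one coordinate leaves a product law unchanged. This turns a single coordinate
  into an inner integral without splitting the index set.\<close>

lemma nn_integral_resample:
  assumes [measurable]: "f \<in> borel_measurable field_law"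
  shows "(\<integral>\<^sup>+\<eta>. f \<eta> \<partial>field_law) = (\<integral>\<^sup>+\<eta>. \<integral>\<^sup>+x. f (\<eta>(k := x)) \<partial>coord_law k \<partial>field_law)"
proof -
  interpret K: prob_space "coord_law k" by (rule prob_space_coord_law)
  interpret F: prob_space field_law by (rule prob_space_field_law)
  interpret KF: pair_sigma_finite "coord_law k" field_law ..
  have eq: "distr (coord_law k \<Otimes>\<^sub>M field_law) field_law (\<lambda>(x, X). X(k := x)) = field_law"
    using distr_pair_PiM_eq_PiM[of UNIV coord_law k] prob_space_coord_law by (simp add: field_law_def)
  have [measurable]: "(\<lambda>(x, X). X(k := x)) \<in> measurable (coord_law k \<Otimes>\<^sub>M field_law) field_law"
  proof -
    have "(\<lambda>p. ((snd p)(k := fst p)) i) \<in> borel_measurable (coord_law k \<Otimes>\<^sub>M field_law)" for i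
      by (cases "i = k") simp_all
    then show ?thesis by (simp add: measurable_field_law_iff split_beta')
  qed
  have "(\<integral>\<^sup>+\<eta>. f \<eta> \<partial>field_law) = (\<integral>\<^sup>+\<eta>. f \<eta> \<partial>distr (coord_law k \<Otimes>\<^sub>M field_law) field_law (\<lambda>(x, X). X(k := x)))"
    unfolding eq ..
  also have "\<dots> = (\<integral>\<^sup>+p. f ((snd p)(k := fst p)) \<partial>(coord_law k \<Otimes>\<^sub>M field_law))"
    by (subst nn_integral_distr) (auto simp: split_beta')
  also have "\<dots> = (\<integral>\<^sup>+\<eta>. \<integral>\<^sup>+x. f (\<eta>(k := x)) \<partial>coord_law k \<partial>field_law)"
    by (subst KF.nn_integral_snd[symmetric]) (auto simp: split_beta')
  finally show ?thesis .
qed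

lemma measurable_resample [measurable (raw)]:
  assumes "X \<in> measurable M field_law" "Y \<in> borel_measurable M"
  shows "(\<lambda>x. (X x)(k := Y x)) \<in> measurable M field_law"
proof -
  have "(\<lambda>x. ((X x)(k := Y x)) i) \<in> borel_measurable M" for i
    using assms by (cases "i = k") (simp_all add: measurable_field_law_iff)
  then show ?thesis by (simp add: measurable_field_law_iff)
qed

lemma nn_integral_resample3:
  assumes [measurable]: "f \<in> borel_measurable field_law"
  shows "(\<integral>\<^sup>+\<eta>. f \<eta> \<partial>field_law) = (\<integral>\<^sup>+\<eta>. \<integral>\<^sup>+u. \<integral>\<^sup>+v. \<integral>\<^sup>+w.
    f (\<eta>(HBd a := u, VBd b := v, Wt y := w)) \<partial>beta_borel \<alpha> \<beta> \<partial>LV \<partial>LU \<partial>field_law)"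
proof -
  interpret V: prob_space LV by (rule prob_LV)
  interpret W: prob_space "beta_borel \<alpha> \<beta>" using ab by (intro prob_space_beta_borel)
  have "(\<integral>\<^sup>+\<eta>. f \<eta> \<partial>field_law) = (\<integral>\<^sup>+\<eta>. \<integral>\<^sup>+w. f (\<eta>(Wt y := w)) \<partial>beta_borel \<alpha> \<beta> \<partial>field_law)"
    using nn_integral_resample[of f "Wt y"] by (simp add: coord_law_def)
  also have "\<dots> = (\<integral>\<^sup>+\<eta>. \<integral>\<^sup>+v. \<integral>\<^sup>+w. f (\<eta>(VBd b := v, Wt y := w)) \<partial>beta_borel \<alpha> \<beta> \<partial>LV \<partial>field_law)"
    by (subst nn_integral_resample[of _ "VBd b"]) (simp_all add: coord_law_def)
  also have "\<dots> = (\<integral>\<^sup>+\<eta>. \<integral>\<^sup>+u. \<integral>\<^sup>+v. \<integral>\<^sup>+w.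
    f (\<eta>(HBd a := u, VBd b := v, Wt y := w)) \<partial>beta_borel \<alpha> \<beta> \<partial>LV \<partial>LU \<partial>field_law)"
    by (subst nn_integral_resample[of _ "HBd a"]) (simp_all add: coord_law_def)
  finally show ?thesis .
qed

text \<open>Once the three coordinates involved have been redrawn, the claim is
  \<open>invariant\<close> under the outer integral, with all other coordinates frozen.\<close>

lemma distr_flip_at: "distr field_law field_law (flip_at c a b) = field_law"
proof (rule measure_eqI)
  fix A assume "A \<in> sets (distr field_law field_law (flip_at c a b))"
  then have A[measurable]: "A \<in> sets field_law" by simp
  define f where "f = (indicator A :: _ \<Rightarrow> ennreal)"
  have f[measurable]: "f \<in> borel_measurable field_law" by (simp add: f_def)
  note measurable_flip_at[measurable]
  let ?y = "site_at c a b"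
  have "emeasure (distr field_law field_law (flip_at c a b)) A = (\<integral>\<^sup>+\<eta>. f (flip_at c a b \<eta>) \<partial>field_law)"
    by (subst nn_integral_indicator[symmetric, unfolded f_def[symmetric]], simp)
       (simp add: f_def[symmetric] nn_integral_distr)
  also have "\<dots> = (\<integral>\<^sup>+\<eta>. \<integral>\<^sup>+u. \<integral>\<^sup>+v. \<integral>\<^sup>+w.
      f (\<eta>(HBd a := upd_h u v w, VBd b := upd_v u v w, Wt ?y := dual_weight u v)) \<partial>beta_borel \<alpha> \<beta> \<partial>LV \<partial>LU \<partial>field_law)"
    by (subst nn_integral_resample3[where a=a and b=b and y="?y"])
       (simp_all add: flip_at_def Let_def fun_upd_twist)
  also have "\<dots> = (\<integral>\<^sup>+\<eta>. \<integral>\<^sup>+u. \<integral>\<^sup>+v. \<integral>\<^sup>+w.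
      f (\<eta>(HBd a := u, VBd b := v, Wt ?y := w)) \<partial>beta_borel \<alpha> \<beta> \<partial>LV \<partial>LU \<partial>field_law)"
  proof (rule nn_integral_cong, rule invariant)
    fix \<eta>
    have [measurable]: "(\<lambda>_. \<eta>) \<in> measurable M field_law" for M :: "'z measure"
      by simp
    show "(\<lambda>(u, v, w). f (\<eta>(HBd a := u, VBd b := v, Wt ?y := w))) \<in> borel_measurable (borel \<Otimes>\<^sub>M borel \<Otimes>\<^sub>M borel)"
      by measurable
  qed
  also have "\<dots> = (\<integral>\<^sup>+\<eta>. f \<eta> \<partial>field_law)"
    by (rule nn_integral_resample3[symmetric]) simp
  also have "\<dots> = emeasure field_law A" by (simp add: f_def)
  finally show "emeasure (distr field_law field_law (flip_at c a b)) A = emeasure field_law A" .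
qed simp

text \<open>Induction on the number of cells. Removing a cell with maximal \<open>a + b\<close>
  leaves a lower set, and restoring it is one law-preserving corner update.\<close>

lemma
  assumes "lower_set D" "finite D"
  shows measurable_boundary_state: "boundary_state c D \<in> measurable field_law field_law"
    and distr_boundary_state: "distr field_law field_law (boundary_state c D) = field_law"
proof -
  have "boundary_state c D \<in> measurable field_law field_law \<and> distr field_law field_law (boundary_state c D) = field_law"
    using assms
  proof (induction "card D" arbitrary: D)
    case 0
    then have "boundary_state c D = (\<lambda>\<eta>. \<eta>)"
      by (auto simp: boundary_state_def fun_eq_iff split: coord.split)
    then show ?case by (simp add: distr_id)
  next
    case (Suc n)
    then have "D \<noteq> {}" by auto
    define m where "m = Max ((\<lambda>(a, b). a + b) ` D)"
    have "m \<in> (\<lambda>(a, b). a + b) ` D" unfolding m_def using Suc.prems \<open>D \<noteq> {}\<close> by (intro Max_in) auto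
    then obtain a b where d: "(a, b) \<in> D" "a + b = m" by auto
    have max: "a' + b' \<le> a + b" if "(a', b') \<in> D" for a' b'
      unfolding d(2) m_def using that Suc.prems by (intro Max_ge) force+
    have "lower_set (D - {(a, b)})"
      unfolding lower_set_def
    proof (intro allI impI)
      fix i j i' j' assume 1: "(i, j) \<in> D - {(a, b)}" "i' \<le> i" "j' \<le> j"
      then have "(i', j') \<in> D" using Suc.prems unfolding lower_set_def by blast
      moreover have "(i', j') \<noteq> (a, b)"
      proof
        assume "(i', j') = (a, b)"
        with max[of i j] 1 show False by auto
      qed
      ultimately show "(i', j') \<in> D - {(a, b)}" by simp
    qed
    moreover have "card (D - {(a, b)}) = n" "finite (D - {(a, b)})" using Suc d by auto
    ultimately have IH: "boundary_state c (D - {(a, b)}) \<in> measurable field_law field_law"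
      "distr field_law field_law (boundary_state c (D - {(a, b)})) = field_law"
      using Suc.hyps(1)[of "D - {(a, b)}"] by auto
    have eq: "boundary_state c D = flip_at c a b \<circ> boundary_state c (D - {(a, b)})"
      using boundary_state_insert[OF Suc.prems d(1) max] by (auto simp: fun_eq_iff)
    have "distr field_law field_law (boundary_state c D) =
        distr (distr field_law field_law (boundary_state c (D - {(a, b)}))) field_law (flip_at c a b)"
      unfolding eq by (rule distr_distr[symmetric, OF measurable_flip_at IH(1)])
    then show ?case unfolding IH(2) distr_flip_at using eq measurable_comp[OF IH(1) measurable_flip_at] by metis
  qed
  then show "boundary_state c D \<in> measurable field_law field_law"
    "distr field_law field_law (boundary_state c D) = field_law" by blast+
qed

text \<open>For finitely many sites choose a square containing those of them that lie in the
  quadrant. On them the environment then coincides with weight coordinates of a boundary state,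
  whose law is the product law.\<close>

lemma distr_true_env: "distr field_law (env_law \<alpha> \<beta>) (true_env c) = env_law \<alpha> \<beta>"
proof -
  interpret B: prob_space "beta_law \<alpha> \<beta>" by (rule prob_space_beta_law) (use ab in auto)
  interpret P: product_prob_space "\<lambda>_ :: site. beta_law \<alpha> \<beta>" UNIV ..
  interpret L: product_prob_space coord_law UNIV
    by (intro product_prob_spaceI prob_space_coord_law)
  show ?thesis
    unfolding env_law_def
  proof (rule P.PiM_eq)
    show "sets (distr field_law (PiM UNIV (\<lambda>_. beta_law \<alpha> \<beta>)) (true_env c)) = sets (PiM UNIV (\<lambda>_ :: site. beta_law \<alpha> \<beta>))"
      by simp
    fix J :: "site set" and F assume J: "finite J" and F: "\<And>j. j \<in> J \<Longrightarrow> F j \<in> sets (beta_law \<alpha> \<beta>)"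
    \<comment> \<open>The sum dominates each single offset from the corner, and \<open>Suc\<close>
      makes the inequality strict; a crude bound is enough here.\<close>
    define m where "m = Suc (\<Sum>x\<in>J. nat (fst x - fst c) + nat (snd x - snd c))"
    define D where "D = {..<m} \<times> {..<m}"
    have D: "lower_set D" "finite D" by (auto simp: lower_set_def D_def)
    let ?S = "boundary_state c D"
    have in_D: "\<exists>(a, b)\<in>D. x = site_at c a b" if "x \<in> J" "c \<sqsubseteq> x" for x
    proof -
      have "nat (fst x - fst c) + nat (snd x - snd c) \<le> (\<Sum>x\<in>J. nat (fst x - fst c) + nat (snd x - snd c))"
        using that J by (intro member_le_sum) auto
      then have "(nat (fst x - fst c), nat (snd x - snd c)) \<in> D" by (auto simp: D_def m_def)
      moreover have "x = site_at c (nat (fst x - fst c)) (nat (snd x - snd c))"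
        using that by (simp add: site_at_def below_def prod_eq_iff)
      ultimately show ?thesis by blast
    qed
    have env: "true_env c \<eta> x = clip (?S \<eta> (Wt x))" if "x \<in> J" for x \<eta>
    proof (cases "c \<sqsubseteq> x")
      case True
      then have "?S \<eta> (Wt x) = true_env c \<eta> x" using in_D[OF that] by (simp add: boundary_state_def)
      then show ?thesis by (simp add: clip_id is_envD[OF is_env_true_env])
    next
      case False
      then have "\<not> (\<exists>(a, b)\<in>D. x = site_at c a b)" using below_site_at by blast
      then show ?thesis using False by (simp add: boundary_state_def true_env_def)
    qed
    have C: "clip -` F x \<in> sets borel" if "x \<in> J" for x
      using measurable_sets[OF measurable_clip F[OF that]] by simp
    have cyl: "{\<eta>. \<forall>k\<in>Wt ` J. \<eta> k \<in> clip -` F (case k of Wt x \<Rightarrow> x)} \<in> sets field_law"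
    proof -
      have "{\<eta> \<in> space field_law. \<forall>k\<in>Wt ` J. \<eta> k \<in> clip -` F (case k of Wt x \<Rightarrow> x)} \<in> sets field_law"
      proof (rule sets.sets_Collect_finite_All)
        fix k assume "k \<in> Wt ` J"
        then show "{\<eta> \<in> space field_law. \<eta> k \<in> clip -` F (case k of Wt x \<Rightarrow> x)} \<in> sets field_law"
          using measurable_sets[OF measurable_coord[of k] C] by (auto simp: vimage_def)
      qed (use J in simp)
      then show ?thesis by simp
    qed
    have "emeasure (distr field_law (PiM UNIV (\<lambda>_. beta_law \<alpha> \<beta>)) (true_env c)) (P.emb UNIV J (Pi\<^sub>E J F)) =
       emeasure field_law {\<eta>. \<forall>x\<in>J. true_env c \<eta> x \<in> F x}"
    proof (subst emeasure_distr)
      show "true_env c \<in> measurable field_law (PiM UNIV (\<lambda>_. beta_law \<alpha> \<beta>))"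
        using measurable_true_env by (simp add: env_law_def)
      show "emeasure field_law (true_env c -` P.emb UNIV J (Pi\<^sub>E J F) \<inter> space field_law) =
        emeasure field_law {\<eta>. \<forall>x\<in>J. true_env c \<eta> x \<in> F x}"
        by (intro arg_cong[where f="emeasure field_law"])
           (auto simp: prod_emb_def space_beta_law PiE_iff is_envD[OF is_env_true_env])
    qed (use J F in auto)
    also have "{\<eta>. \<forall>x\<in>J. true_env c \<eta> x \<in> F x} =
        ?S -` {\<eta>. \<forall>k\<in>Wt ` J. \<eta> k \<in> clip -` F (case k of Wt x \<Rightarrow> x)} \<inter> space field_law"
      using env by auto
    also have "emeasure field_law \<dots> = emeasure (distr field_law field_law ?S) {\<eta>. \<forall>k\<in>Wt ` J. \<eta> k \<in> clip -` F (case k of Wt x \<Rightarrow> x)}"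
      by (rule emeasure_distr[symmetric, OF measurable_boundary_state[OF D] cyl])
    also have "\<dots> = emeasure field_law {\<eta>. \<forall>k\<in>Wt ` J. \<eta> k \<in> clip -` F (case k of Wt x \<Rightarrow> x)}"
      unfolding distr_boundary_state[OF D] ..
    also have "\<dots> = (\<Prod>k\<in>Wt ` J. emeasure (coord_law k) (clip -` F (case k of Wt x \<Rightarrow> x)))"
    proof -
      have "clip -` F (case k of Wt x \<Rightarrow> x) \<in> sets (coord_law k)" if "k \<in> Wt ` J" for k
        using that C by (auto simp del: vimage_eq)
      then show ?thesis
        using L.emeasure_PiM_Collect[of "Wt ` J" "\<lambda>k. clip -` F (case k of Wt x \<Rightarrow> x)"] J
        by (simp add: field_law_def space_PiM)
    qed
    also have "\<dots> = (\<Prod>x\<in>J. emeasure (beta_borel \<alpha> \<beta>) (clip -` F x))"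
      by (subst prod.reindex) (auto simp: coord_law_def inj_on_def)
    also have "\<dots> = (\<Prod>x\<in>J. emeasure (beta_law \<alpha> \<beta>) (F x))"
    proof (intro prod.cong refl)
      fix x assume "x \<in> J"
      have "clip \<in> measurable (beta_borel \<alpha> \<beta>) (beta_law \<alpha> \<beta>)"
        using measurable_clip by (simp add: measurable_cong_sets[OF sets_beta_borel refl])
      then have "emeasure (distr (beta_borel \<alpha> \<beta>) (beta_law \<alpha> \<beta>) clip) (F x) = emeasure (beta_borel \<alpha> \<beta>) (clip -` F x)"
        using F[OF \<open>x \<in> J\<close>] by (simp add: emeasure_distr)
      then show "emeasure (beta_borel \<alpha> \<beta>) (clip -` F x) = emeasure (beta_law \<alpha> \<beta>) (F x)"
        by (simp add: beta_law_eq_distr[symmetric])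
    qed
    finally show "emeasure (distr field_law (PiM UNIV (\<lambda>_. beta_law \<alpha> \<beta>)) (true_env c)) (P.emb UNIV J (Pi\<^sub>E J F)) =
      (\<Prod>j\<in>J. emeasure (beta_law \<alpha> \<beta>) (F j))" .
  qed
qed

end

lemma measurable_env_law_coord: "(\<lambda>w. w x) \<in> borel_measurable (env_law \<alpha> \<beta>)"
proof -
  have "(\<lambda>w. w x) \<in> measurable (env_law \<alpha> \<beta>) (beta_law \<alpha> \<beta>)"
    unfolding env_law_def by (rule measurable_component_singleton) simp
  then show ?thesis by (simp add: measurable_beta_law_iff)
qed

lemma measurable_step_prob [measurable]: "(\<lambda>w. step_prob w n x z) \<in> borel_measurable (env_law \<alpha> \<beta>)"
proof (induction n arbitrary: x)
  case (Suc n)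
  note [measurable] = measurable_env_law_coord Suc.IH
  show ?case by simp
qed simp

lemma measurable_pass [measurable]: "(\<lambda>w. pass w x z) \<in> borel_measurable (env_law \<alpha> \<beta>)"
  by (simp add: pass_def)

section \<open>The harmonic function of a stationary field\<close>

definition regular_pair :: "real \<Rightarrow> real \<Rightarrow> bool" where
  "regular_pair u v \<longleftrightarrow> 1 < u \<and> 0 < v \<and> v < 1 \<or> 0 < u \<and> u < 1 \<and> 1 < v"

definition regular_field :: "site \<Rightarrow> (coord \<Rightarrow> real) \<Rightarrow> bool" where
  "regular_field c \<eta> \<longleftrightarrow> (\<forall>a b. regular_pair (field_h c \<eta> a b) (field_v c \<eta> a b))"

text \<open>By the cocycle identity any monotone path would give the same product. The path along
  the bottom row and then up a column is chosen because each of its two pieces separately consists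
  of i.i.d. edges, which is all that the moment bounds ask for.\<close>

definition harm :: "site \<Rightarrow> (coord \<Rightarrow> real) \<Rightarrow> nat \<Rightarrow> nat \<Rightarrow> real" where
  "harm c \<eta> a b = (\<Prod>i<a. 1 / field_h c \<eta> i 0) * (\<Prod>j<b. 1 / field_v c \<eta> a j)"

definition harm_at :: "site \<Rightarrow> (coord \<Rightarrow> real) \<Rightarrow> site \<Rightarrow> real" where
  "harm_at c \<eta> x = harm c \<eta> (nat (fst x - fst c)) (nat (snd x - snd c))"

text \<open>This is \<open>dual_weight u v / u\<close>, the probability of an \<open>e1\<close> step
  after the transform by the harmonic function, in simplified form.\<close>

definition doob_weight :: "real \<Rightarrow> real \<Rightarrow> real" where
  "doob_weight u v = (1 - v) / (u - v)"

definition doob_at :: "site \<Rightarrow> (coord \<Rightarrow> real) \<Rightarrow> site \<Rightarrow> real" where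
  "doob_at c \<eta> x = (if c \<sqsubseteq> x then
     doob_weight (field_h c \<eta> (nat (fst x - fst c)) (nat (snd x - snd c)))
       (field_v c \<eta> (nat (fst x - fst c)) (nat (snd x - snd c))) else 0)"

lemma harm_at_site [simp]: "harm_at c \<eta> (site_at c a b) = harm c \<eta> a b"
  by (simp add: harm_at_def site_at_def)

lemma doob_at_site: "doob_at c \<eta> (site_at c a b) = doob_weight (field_h c \<eta> a b) (field_v c \<eta> a b)"
  by (simp add: doob_at_def site_at_def below_def)

lemma measurable_doob_weight [measurable (raw)]:
  fixes f g :: "'a \<Rightarrow> real"
  assumes [measurable]: "f \<in> borel_measurable M" "g \<in> borel_measurable M"
  shows "(\<lambda>x. doob_weight (f x) (g x)) \<in> borel_measurable M"
  unfolding doob_weight_def by measurable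

lemma regular_pair_weights:
  assumes "regular_pair u v"
  shows "0 < u" "0 < v" "0 < dual_weight u v" "dual_weight u v < 1"
    "doob_weight u v = dual_weight u v / u" "1 - doob_weight u v = (1 - dual_weight u v) / v"
    "0 < doob_weight u v" "doob_weight u v < 1"
proof -
  show uv: "0 < u" "0 < v" using assms by (auto simp: regular_pair_def)
  have ne: "u - v \<noteq> 0" using assms by (auto simp: regular_pair_def)
  have r: "0 < u * (1 - v) / (u - v)" "u * (1 - v) / (u - v) < 1"
    using assms by (auto simp: regular_pair_def divide_simps algebra_simps zero_less_mult_iff)
  then have d: "dual_weight u v = u * (1 - v) / (u - v)"
    by (simp add: dual_weight_def clip_id)
  show "0 < dual_weight u v" "dual_weight u v < 1" using r d by auto
  show e: "doob_weight u v = dual_weight u v / u"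
    using uv by (simp add: d doob_weight_def)
  have "1 - u * (1 - v) / (u - v) = v * (u - 1) / (u - v)" using ne by (simp add: field_simps)
  then have "(1 - dual_weight u v) / v = (u - 1) / (u - v)" using uv d by simp
  moreover have "1 - doob_weight u v = (u - 1) / (u - v)" using ne by (simp add: doob_weight_def field_simps)
  ultimately show f: "1 - doob_weight u v = (1 - dual_weight u v) / v" by simp
  show "0 < doob_weight u v" unfolding e by (rule divide_pos_pos) (use uv r d in auto)
  have "0 < (1 - dual_weight u v) / v" using uv r d by simp
  then show "doob_weight u v < 1" using f by linarith
qed

context
  fixes c :: site and \<eta> :: "coord \<Rightarrow> real"
  assumes reg: "regular_field c \<eta>"
begin

lemma reg_pair: "regular_pair (field_h c \<eta> a b) (field_v c \<eta> a b)"
  using reg by (simp add: regular_field_def)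

lemmas field_pos = regular_pair_weights(1,2)[OF reg_pair]

text \<open>Both sides equal \<open>(1 - w) * u + w * v\<close> for the input weight w of the
  square, whatever its value.\<close>

lemma field_cocycle:
  "field_h c \<eta> a b * field_v c \<eta> (Suc a) b = field_v c \<eta> a b * field_h c \<eta> a (Suc b)"
  using field_pos[of a b] by (simp add: upd_h_def upd_v_def field_simps)

lemma harm_pos: "harm c \<eta> a b > 0"
  unfolding harm_def by (intro mult_pos_pos prod_pos) (auto simp: field_pos field_pos(1)[of _ 0, simplified])

lemma harm_Suc_right: "harm c \<eta> a (Suc b) = harm c \<eta> a b / field_v c \<eta> a b"
  by (simp add: harm_def)

lemma harm_Suc_left: "harm c \<eta> (Suc a) b = harm c \<eta> a b / field_h c \<eta> a b"
proof (induction b)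
  case (Suc b)
  have "harm c \<eta> (Suc a) (Suc b) = harm c \<eta> a b / (field_h c \<eta> a b * field_v c \<eta> (Suc a) b)"
    by (simp only: harm_Suc_right Suc) simp
  also have "\<dots> = harm c \<eta> a (Suc b) / field_h c \<eta> a (Suc b)"
    unfolding field_cocycle harm_Suc_right by simp
  finally show ?case .
qed (simp add: harm_def)

lemma true_env_pos: "c \<sqsubseteq> x \<Longrightarrow> 0 < true_env c \<eta> x \<and> true_env c \<eta> x < 1"
  using below_site_at[of c x] regular_pair_weights[OF reg_pair] by (auto simp: true_env_at)

lemma doob_at_pos: "c \<sqsubseteq> x \<Longrightarrow> 0 < doob_at c \<eta> x \<and> doob_at c \<eta> x < 1"
  using below_site_at[of c x] regular_pair_weights[OF reg_pair] by (auto simp: doob_at_site)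

lemma is_env_doob_at: "is_env (doob_at c \<eta>)"
  using doob_at_pos unfolding is_env_def by (metis doob_at_def less_eq_real_def zero_le_one)

lemma harm_at_pos: "harm_at c \<eta> x > 0"
  by (simp add: harm_at_def harm_pos)

lemma doob_at_eq:
  assumes "c \<sqsubseteq> x"
  shows "doob_at c \<eta> x = true_env c \<eta> x * harm_at c \<eta> (x + e1) / harm_at c \<eta> x"
    and "1 - doob_at c \<eta> x = (1 - true_env c \<eta> x) * harm_at c \<eta> (x + e2) / harm_at c \<eta> x"
proof -
  obtain a b where x: "x = site_at c a b" using assms below_site_at by blast
  have e: "x + e1 = site_at c (Suc a) b" "x + e2 = site_at c a (Suc b)"
    unfolding x site_at_Suc by simp_all
  show "doob_at c \<eta> x = true_env c \<eta> x * harm_at c \<eta> (x + e1) / harm_at c \<eta> x"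
    unfolding e unfolding x doob_at_site harm_at_site true_env_at harm_Suc_left
    using regular_pair_weights[OF reg_pair[of a b]] harm_pos[of a b] by simp
  show "1 - doob_at c \<eta> x = (1 - true_env c \<eta> x) * harm_at c \<eta> (x + e2) / harm_at c \<eta> x"
    unfolding e unfolding x doob_at_site harm_at_site true_env_at harm_Suc_right
    using regular_pair_weights[OF reg_pair[of a b]] harm_pos[of a b] by simp
qed

lemma harm_at_harmonic:
  assumes "c \<sqsubseteq> x"
  shows "harm_at c \<eta> x = true_env c \<eta> x * harm_at c \<eta> (x + e1) + (1 - true_env c \<eta> x) * harm_at c \<eta> (x + e2)"
proof -
  have "doob_at c \<eta> x * harm_at c \<eta> x = true_env c \<eta> x * harm_at c \<eta> (x + e1)"
    "(1 - doob_at c \<eta> x) * harm_at c \<eta> x = (1 - true_env c \<eta> x) * harm_at c \<eta> (x + e2)"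
    using doob_at_eq[OF assms]
    unfolding nonzero_eq_divide_eq[OF less_imp_neq[OF harm_at_pos, symmetric]] by blast+
  then show ?thesis by (simp add: algebra_simps)
qed

lemma pass_doob_at:
  assumes "c \<sqsubseteq> x"
  shows "pass (doob_at c \<eta>) x z * harm_at c \<eta> x = pass (true_env c \<eta>) x z * harm_at c \<eta> z"
  unfolding pass_def
  by (rule step_prob_doob[OF assms harm_at_pos]) (blast intro: doob_at_eq)

text \<open>The left side is a passage probability of the transformed walk, since the harmonic
  function is 1 at the corner. All moment bounds originate here.\<close>

lemma pass_harm_le_1: "pass (true_env c \<eta>) c z * harm_at c \<eta> z \<le> 1"
proof -
  have "harm_at c \<eta> c = 1" using harm_at_site[of c \<eta> 0 0] by (simp add: harm_def)
  then show ?thesis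
    using pass_doob_at[of c z] pass_le_1[OF is_env_doob_at, of c z] by (simp add: below_def)
qed

end

section \<open>Independence along rows, columns and antidiagonals\<close>

lemma card_box: "card {b'. (a, b') \<in> {..<m} \<times> {..<n}} = (if a < m then n else 0)"
  "card {a'. (a', b) \<in> {..<m} \<times> {..<n}} = (if b < n then m else 0)"
proof -
  have "{b'. (a, b') \<in> {..<m} \<times> {..<n}} = (if a < m then {..<n} else {})" by auto
  then show "card {b'. (a, b') \<in> {..<m} \<times> {..<n}} = (if a < m then n else 0)" by (simp split: if_splits)
  have "{a'. (a', b) \<in> {..<m} \<times> {..<n}} = (if b < n then {..<m} else {})" by auto
  then show "card {a'. (a', b) \<in> {..<m} \<times> {..<n}} = (if b < n then m else 0)" by (simp split: if_splits)
qed

lemma boundary_state_box: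
  "a < m \<Longrightarrow> boundary_state c ({..<m} \<times> {..<n}) \<eta> (HBd a) = field_h c \<eta> a n"
  "b < n \<Longrightarrow> boundary_state c ({..<m} \<times> {..<n}) \<eta> (VBd b) = field_v c \<eta> m b"
  by (simp_all only: boundary_state_def coord.case card_box if_True)

text \<open>The staircase boundary of the triangle contains both edges leaving each site of the
  antidiagonal \<open>a + b = n\<close>, and distinct sites use disjoint coordinates.\<close>

lemma boundary_state_triangle:
  assumes "a \<le> n"
  shows "boundary_state c {(a, b). a + b < n} \<eta> (HBd a) = field_h c \<eta> a (n - a)"
    "boundary_state c {(a, b). a + b < n} \<eta> (VBd (n - a)) = field_v c \<eta> a (n - a)"
proof -
  have "{b. (a, b) \<in> {(a, b). a + b < n}} = {..<n - a}" by auto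
  then show "boundary_state c {(a, b). a + b < n} \<eta> (HBd a) = field_h c \<eta> a (n - a)"
    by (simp only: boundary_state_def coord.case card_lessThan)
  have "{a'. (a', n - a) \<in> {(a, b). a + b < n}} = {..<a}" using assms by auto
  then show "boundary_state c {(a, b). a + b < n} \<eta> (VBd (n - a)) = field_v c \<eta> a (n - a)"
    by (simp only: boundary_state_def coord.case card_lessThan)
qed

context stat_pair
begin

lemma coord_law_simps [simp]:
  "coord_law (HBd a) = LU" "coord_law (VBd b) = LV" "coord_law (Wt x) = beta_borel \<alpha> \<beta>"
  by (simp_all add: coord_law_def)

lemma AE_boundary_state:
  assumes "lower_set D" "finite D" "AE x in coord_law k. P x"
  shows "AE \<eta> in field_law. P (boundary_state c D \<eta> k)"
proof -
  have "AE \<eta> in field_law. P (\<eta> k)"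
    unfolding field_law_def by (rule AE_PiM_component) (auto simp: prob_space_coord_law assms)
  then have "AE \<eta> in distr field_law field_law (boundary_state c D). P (\<eta> k)"
    by (subst distr_boundary_state[OF assms(1,2)])
  then show ?thesis by (rule AE_distrD[OF measurable_boundary_state[OF assms(1,2)]])
qed

lemma AE_field:
  assumes "AE u in LU. P u" "AE v in LV. Q v"
  shows "AE \<eta> in field_law. \<forall>a b. P (field_h c \<eta> a b) \<and> Q (field_v c \<eta> a b)"
proof -
  have "AE \<eta> in field_law. P (field_h c \<eta> a b)" for a b
  proof -
    have "AE u in coord_law (HBd a). P u" unfolding coord_law_simps by (rule assms(1))
    from AE_boundary_state[OF _ _ this, of "{..<Suc a} \<times> {..<b}" c]
    show ?thesis by (simp only: boundary_state_box lessI) (simp add: lower_set_def)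
  qed
  moreover have "AE \<eta> in field_law. Q (field_v c \<eta> a b)" for a b
  proof -
    have "AE u in coord_law (VBd b). Q u" unfolding coord_law_simps by (rule assms(2))
    from AE_boundary_state[OF _ _ this, of "{..<a} \<times> {..<Suc b}" c]
    show ?thesis by (simp only: boundary_state_box lessI) (simp add: lower_set_def)
  qed
  ultimately show ?thesis by (simp add: AE_all_countable)
qed

lemma AE_regular_field: "AE \<eta> in field_law. regular_field c \<eta>"
  using support
proof
  assume "(AE u in LU. 1 < u) \<and> (AE v in LV. 0 < v \<and> v < 1)"
  then have "AE \<eta> in field_law. \<forall>a b. 1 < field_h c \<eta> a b \<and> (0 < field_v c \<eta> a b \<and> field_v c \<eta> a b < 1)"
    by (intro AE_field) auto
  then show ?thesis by eventually_elim (auto simp: regular_field_def regular_pair_def)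
next
  assume "(AE u in LU. 0 < u \<and> u < 1) \<and> (AE v in LV. 1 < v)"
  then have "AE \<eta> in field_law. \<forall>a b. (0 < field_h c \<eta> a b \<and> field_h c \<eta> a b < 1) \<and> 1 < field_v c \<eta> a b"
    by (intro AE_field) auto
  then show ?thesis by eventually_elim (auto simp: regular_field_def regular_pair_def)
qed

lemma nn_integral_boundary_state:
  assumes "lower_set D" "finite D" and [measurable]: "f \<in> borel_measurable field_law"
  shows "(\<integral>\<^sup>+\<eta>. f (boundary_state c D \<eta>) \<partial>field_law) = (\<integral>\<^sup>+\<eta>. f \<eta> \<partial>field_law)"
proof -
  note measurable_boundary_state[OF assms(1,2), measurable]
  have "(\<integral>\<^sup>+\<eta>. f \<eta> \<partial>field_law) = (\<integral>\<^sup>+\<eta>. f \<eta> \<partial>distr field_law field_law (boundary_state c D))"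
    by (simp add: distr_boundary_state[OF assms(1,2)])
  also have "\<dots> = (\<integral>\<^sup>+\<eta>. f (boundary_state c D \<eta>) \<partial>field_law)"
    by (rule nn_integral_distr) auto
  finally show ?thesis by simp
qed

lemma nn_integral_prod_coords:
  assumes "finite J" and [measurable]: "\<And>k. k \<in> J \<Longrightarrow> f k \<in> borel_measurable borel"
  shows "(\<integral>\<^sup>+\<eta>. (\<Prod>k\<in>J. f k (\<eta> k)) \<partial>field_law) = (\<Prod>k\<in>J. \<integral>\<^sup>+x. f k x \<partial>coord_law k)"
  using assms
proof (induction J)
  case empty
  interpret prob_space field_law by (rule prob_space_field_law)
  show ?case using emeasure_space_1 by simp
next
  case (insert k J)
  note insert.prems[measurable]
  have [measurable]: "(\<lambda>\<eta>. \<Prod>k\<in>J. f k (\<eta> k)) \<in> borel_measurable field_law"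
    by (intro borel_measurable_prod_ennreal measurable_compose[OF measurable_coord]) (use insert.prems in auto)
  have "(\<integral>\<^sup>+\<eta>. (\<Prod>k\<in>insert k J. f k (\<eta> k)) \<partial>field_law) = (\<integral>\<^sup>+\<eta>. f k (\<eta> k) * (\<Prod>k\<in>J. f k (\<eta> k)) \<partial>field_law)"
    using insert.hyps by simp
  also have "\<dots> = (\<integral>\<^sup>+\<eta>. \<integral>\<^sup>+x. f k x * (\<Prod>k\<in>J. f k (\<eta> k)) \<partial>coord_law k \<partial>field_law)"
    by (subst nn_integral_resample[of _ k]) (use insert in \<open>auto intro!: nn_integral_cong prod.cong arg_cong2[where f="(*)"]\<close>)
  also have "\<dots> = (\<integral>\<^sup>+\<eta>. (\<integral>\<^sup>+x. f k x \<partial>coord_law k) * (\<Prod>k\<in>J. f k (\<eta> k)) \<partial>field_law)"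
    by (intro nn_integral_cong nn_integral_multc)
       (use insert.prems in \<open>auto simp: measurable_cong_sets[OF sets_coord_law refl]\<close>)
  also have "\<dots> = (\<integral>\<^sup>+x. f k x \<partial>coord_law k) * (\<Prod>k\<in>J. \<integral>\<^sup>+x. f k x \<partial>coord_law k)"
    by (subst nn_integral_cmult) (use insert in auto)
  finally show ?case using insert.hyps by simp
qed

lemma nn_integral_prod_pairs:
  assumes "A \<subseteq> {..n}" and f: "\<And>a. (\<lambda>(u, v). f a u v) \<in> borel_measurable (borel \<Otimes>\<^sub>M borel)"
  shows "(\<integral>\<^sup>+\<eta>. (\<Prod>a\<in>A. f a (\<eta> (HBd a)) (\<eta> (VBd (n - a)))) \<partial>field_law) =
         (\<Prod>a\<in>A. \<integral>\<^sup>+u. \<integral>\<^sup>+v. f a u v \<partial>LV \<partial>LU)"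
proof -
  have "finite A" using assms(1) finite_subset by blast
  interpret V: prob_space LV by (rule prob_LV)
  have [measurable (raw)]: "(\<lambda>x. f a (g x) (h x)) \<in> borel_measurable M"
    if "g \<in> borel_measurable M" "h \<in> borel_measurable M" for a g h and M :: "'z measure"
    using measurable_compose[OF measurable_Pair[OF that] f[of a]] by simp
  from \<open>finite A\<close> assms(1) show ?thesis
  proof (induction A)
    case empty
    interpret prob_space field_law by (rule prob_space_field_law)
    show ?case using emeasure_space_1 by simp
  next
    case (insert a A)
    let ?g = "\<lambda>\<eta>. \<Prod>a\<in>A. f a (\<eta> (HBd a)) (\<eta> (VBd (n - a)))"
    have inv: "?g (\<eta>(HBd a := u)) = ?g \<eta>" "?g (\<eta>(VBd (n - a) := v)) = ?g \<eta>" for \<eta> u v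
    proof -
      have ne: "a' \<noteq> a" "n - a' \<noteq> n - a" if "a' \<in> A" for a'
      proof -
        have "a \<le> n" "a' \<le> n" using insert.prems that by auto
        moreover show "a' \<noteq> a" using insert.hyps(2) that by auto
        ultimately show "n - a' \<noteq> n - a" by linarith
      qed
      show "?g (\<eta>(HBd a := u)) = ?g \<eta>" "?g (\<eta>(VBd (n - a) := v)) = ?g \<eta>"
        using ne by (auto intro!: prod.cong)
    qed
    have "(\<integral>\<^sup>+\<eta>. (\<Prod>a\<in>insert a A. f a (\<eta> (HBd a)) (\<eta> (VBd (n - a)))) \<partial>field_law) =
      (\<integral>\<^sup>+\<eta>. f a (\<eta> (HBd a)) (\<eta> (VBd (n - a))) * ?g \<eta> \<partial>field_law)"
      using insert.hyps by simp
    also have "\<dots> = (\<integral>\<^sup>+\<eta>. \<integral>\<^sup>+v. f a (\<eta> (HBd a)) v * ?g \<eta> \<partial>LV \<partial>field_law)"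
      by (subst nn_integral_resample[of _ "VBd (n - a)"]) (simp_all add: inv coord_law_def del: fun_upd_apply, simp)
    also have "\<dots> = (\<integral>\<^sup>+\<eta>. \<integral>\<^sup>+u. \<integral>\<^sup>+v. f a u v * ?g \<eta> \<partial>LV \<partial>LU \<partial>field_law)"
      by (subst nn_integral_resample[of _ "HBd a"]) (simp_all add: inv coord_law_def del: fun_upd_apply, simp)
    also have "\<dots> = (\<integral>\<^sup>+\<eta>. (\<integral>\<^sup>+u. \<integral>\<^sup>+v. f a u v \<partial>LV \<partial>LU) * ?g \<eta> \<partial>field_law)"
    proof (rule nn_integral_cong)
      fix \<eta>
      have "(\<integral>\<^sup>+u. \<integral>\<^sup>+v. f a u v * ?g \<eta> \<partial>LV \<partial>LU) = (\<integral>\<^sup>+u. (\<integral>\<^sup>+v. f a u v \<partial>LV) * ?g \<eta> \<partial>LU)"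
      proof (intro nn_integral_cong nn_integral_multc)
        fix u
        have "(\<lambda>v. f a u v) \<in> borel_measurable borel"
          using measurable_compose[OF measurable_Pair[OF measurable_const[of u borel borel] measurable_ident] f[of a]]
          by simp
        then show "f a u \<in> borel_measurable LV" unfolding measurable_cong_sets[OF sets_LV refl] .
      qed
      also have "\<dots> = (\<integral>\<^sup>+u. \<integral>\<^sup>+v. f a u v \<partial>LV \<partial>LU) * ?g \<eta>"
        by (rule nn_integral_multc) measurable
      finally show "(\<integral>\<^sup>+u. \<integral>\<^sup>+v. f a u v * ?g \<eta> \<partial>LV \<partial>LU) = (\<integral>\<^sup>+u. \<integral>\<^sup>+v. f a u v \<partial>LV \<partial>LU) * ?g \<eta>" .
    qed
    also have "\<dots> = (\<integral>\<^sup>+u. \<integral>\<^sup>+v. f a u v \<partial>LV \<partial>LU) * (\<integral>\<^sup>+\<eta>. ?g \<eta> \<partial>field_law)"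
      by (rule nn_integral_cmult) measurable
    finally show ?case using insert by simp
  qed
qed

lemma nn_integral_antidiagonal:
  assumes "A \<subseteq> {..n}" and f: "\<And>a. (\<lambda>(u, v). f a u v) \<in> borel_measurable (borel \<Otimes>\<^sub>M borel)"
  shows "(\<integral>\<^sup>+\<eta>. (\<Prod>a\<in>A. f a (field_h c \<eta> a (n - a)) (field_v c \<eta> a (n - a))) \<partial>field_law) =
         (\<Prod>a\<in>A. \<integral>\<^sup>+u. \<integral>\<^sup>+v. f a u v \<partial>LV \<partial>LU)"
proof -
  have [measurable (raw)]: "(\<lambda>x. f a (g x) (h x)) \<in> borel_measurable M"
    if "g \<in> borel_measurable M" "h \<in> borel_measurable M" for a g h and M :: "'z measure"
    using measurable_compose[OF measurable_Pair[OF that] f[of a]] by simp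
  have D: "lower_set {(a, b). a + b < n}" "finite {(a, b). a + b < n}"
    by (auto simp: lower_set_def intro!: finite_subset[of "{(a, b). a + b < n}" "{..<n} \<times> {..<n}"])
  have "(\<integral>\<^sup>+\<eta>. (\<Prod>a\<in>A. f a (field_h c \<eta> a (n - a)) (field_v c \<eta> a (n - a))) \<partial>field_law) =
    (\<integral>\<^sup>+\<eta>. (\<Prod>a\<in>A. f a (boundary_state c {(a, b). a + b < n} \<eta> (HBd a)) (boundary_state c {(a, b). a + b < n} \<eta> (VBd (n - a)))) \<partial>field_law)"
    using assms(1) by (intro nn_integral_cong prod.cong refl) (subst boundary_state_triangle; auto)+
  also have "\<dots> = (\<integral>\<^sup>+\<eta>. (\<Prod>a\<in>A. f a (\<eta> (HBd a)) (\<eta> (VBd (n - a)))) \<partial>field_law)"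
    by (rule nn_integral_boundary_state[OF D]) measurable
  finally show ?thesis using nn_integral_prod_pairs[OF assms] by simp
qed

lemma nn_integral_row:
  assumes [measurable]: "f \<in> borel_measurable borel"
  shows "(\<integral>\<^sup>+\<eta>. (\<Prod>i<m. f (field_h c \<eta> i 0)) \<partial>field_law) = (\<integral>\<^sup>+u. f u \<partial>LU) ^ m"
proof -
  have "(\<integral>\<^sup>+\<eta>. (\<Prod>i<m. f (field_h c \<eta> i 0)) \<partial>field_law) = (\<integral>\<^sup>+\<eta>. (\<Prod>k\<in>HBd ` {..<m}. f (\<eta> k)) \<partial>field_law)"
    by (subst prod.reindex) (auto simp: inj_on_def)
  also have "\<dots> = (\<integral>\<^sup>+u. f u \<partial>LU) ^ m"
    by (subst nn_integral_prod_coords) (auto simp: prod.reindex inj_on_def coord_law_def)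
  finally show ?thesis .
qed

text \<open>An interior column is the right side of the boundary path of a box, so its edges are
  coordinates of a boundary state and hence i.i.d.\<close>

lemma nn_integral_column:
  assumes [measurable]: "f \<in> borel_measurable borel"
  shows "(\<integral>\<^sup>+\<eta>. (\<Prod>j<n. f (field_v c \<eta> m j)) \<partial>field_law) = (\<integral>\<^sup>+v. f v \<partial>LV) ^ n"
proof -
  let ?D = "{..<m} \<times> {..<n}"
  have "(\<integral>\<^sup>+\<eta>. (\<Prod>j<n. f (field_v c \<eta> m j)) \<partial>field_law) =
     (\<integral>\<^sup>+\<eta>. (\<Prod>j<n. f (boundary_state c ?D \<eta> (VBd j))) \<partial>field_law)"
    by (intro nn_integral_cong prod.cong refl) (subst boundary_state_box; simp)
  also have "\<dots> = (\<integral>\<^sup>+\<eta>. (\<Prod>j<n. f (\<eta> (VBd j))) \<partial>field_law)"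
    by (rule nn_integral_boundary_state) (auto simp: lower_set_def)
  also have "\<dots> = (\<integral>\<^sup>+\<eta>. (\<Prod>k\<in>VBd ` {..<n}. f (\<eta> k)) \<partial>field_law)"
    by (subst prod.reindex) (auto simp: inj_on_def)
  also have "\<dots> = (\<integral>\<^sup>+v. f v \<partial>LV) ^ n"
    by (subst nn_integral_prod_coords) (auto simp: prod.reindex inj_on_def coord_law_def)
  finally show ?thesis .
qed

end

section \<open>Moment bounds\<close>

text \<open>Here \<open>m\<close> is the logarithm of the moment of order t, and \<open>u\<close>
  plays the role of the mean of the logarithm. It is recorded as a derivative at 0, so no
  integrability of the logarithm has to be established.\<close>

definition log_mgf :: "real measure \<Rightarrow> real \<Rightarrow> (real \<Rightarrow> real) \<Rightarrow> real \<Rightarrow> bool" where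
  "log_mgf L r m u \<longleftrightarrow> 0 < r \<and> m 0 = 0 \<and> (m has_real_derivative u) (at 0) \<and>
     (\<forall>t. \<bar>t\<bar> < r \<longrightarrow> (\<integral>\<^sup>+x. ennreal (x powr t) \<partial>L) = ennreal (exp (m t)))"

lemma ennreal_power_le_exp:
  fixes x :: ennreal
  assumes "x ^ n \<le> ennreal (exp e)" "n > 0"
  shows "x \<le> ennreal (exp (e / n))"
proof (rule ccontr)
  assume "\<not> x \<le> ennreal (exp (e / n))"
  then have *: "ennreal (exp (e / n)) < x" by simp
  have "x \<noteq> \<top>" using assms by (auto simp: top_unique)
  then obtain y where y: "x = ennreal y" "0 \<le> y" by (cases x) auto
  have "exp (e / n) ^ n < y ^ n"
    using * y assms(2) by (intro power_strict_mono) (auto simp: ennreal_less_iff)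
  moreover have "exp (e / n) ^ n = exp e"
    using assms(2) by (simp add: exp_of_nat_mult[symmetric])
  moreover have "y ^ n \<le> exp e"
    using assms(1) y by (simp add: ennreal_power)
  ultimately show False by simp
qed

lemma powr_square: "(x powr s) ^ 2 = (x :: real) powr (2 * s)"
  and powr_fourth: "(x powr s) ^ 4 = (x :: real) powr (4 * s)"
  by (simp_all add: power2_eq_square power4_eq_xxxx powr_add[symmetric])

text \<open>Two applications of Cauchy-Schwarz. Nothing is known about the joint law of the three
  factors, so they must be separated before moments can be used.\<close>

lemma nn_integral_triple_le:
  fixes P R C :: "'a \<Rightarrow> ennreal"
  assumes [measurable]: "P \<in> borel_measurable N" "R \<in> borel_measurable N" "C \<in> borel_measurable N"
  shows "(\<integral>\<^sup>+x. P x * R x * C x \<partial>N) ^ 4 \<le> (\<integral>\<^sup>+x. P x ^ 2 \<partial>N) ^ 2 * ((\<integral>\<^sup>+x. R x ^ 4 \<partial>N) * (\<integral>\<^sup>+x. C x ^ 4 \<partial>N))"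
proof -
  have "(\<integral>\<^sup>+x. P x * R x * C x \<partial>N) ^ 4 = ((\<integral>\<^sup>+x. P x * (R x * C x) \<partial>N) ^ 2) ^ 2"
    by (simp add: mult.assoc flip: power_mult)
  also have "\<dots> \<le> ((\<integral>\<^sup>+x. P x ^ 2 \<partial>N) * (\<integral>\<^sup>+x. (R x * C x) ^ 2 \<partial>N)) ^ 2"
    by (intro power_mono Cauchy_Schwarz_nn_integral) auto
  also have "\<dots> = (\<integral>\<^sup>+x. P x ^ 2 \<partial>N) ^ 2 * (\<integral>\<^sup>+x. R x ^ 2 * C x ^ 2 \<partial>N) ^ 2"
    by (simp add: power_mult_distrib)
  also have "\<dots> \<le> (\<integral>\<^sup>+x. P x ^ 2 \<partial>N) ^ 2 * ((\<integral>\<^sup>+x. (R x ^ 2) ^ 2 \<partial>N) * (\<integral>\<^sup>+x. (C x ^ 2) ^ 2 \<partial>N))"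
    by (intro mult_left_mono Cauchy_Schwarz_nn_integral) auto
  finally show ?thesis by (simp flip: power_mult)
qed

text \<open>For values in the unit interval and \<open>s \<le> 1\<close> one has
  \<open>f \<le> f powr s\<close>, so a moment of small order controls the function itself. Level n
  has at most n + 1 sites, which exponential decay absorbs.\<close>

lemma AE_summable_levels:
  fixes f :: "nat \<Rightarrow> nat \<Rightarrow> 'a \<Rightarrow> real"
  assumes [measurable]: "\<And>a b. f a b \<in> borel_measurable N"
    and f: "AE x in N. \<forall>a b. 0 \<le> f a b x \<and> f a b x \<le> 1"
    and s: "0 < s" "s \<le> 1" and "c > 0"
    and le: "\<And>a b. (a, b) \<in> B \<Longrightarrow> (\<integral>\<^sup>+x. ennreal (f a b x powr s) \<partial>N) \<le> ennreal (exp (- c * real (a + b)))"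
  shows "AE x in N. summable (\<lambda>n. \<Sum>a\<in>{a. a \<le> n \<and> (a, n - a) \<in> B}. f a (n - a) x)"
proof -
  define A where "A n = {a. a \<le> n \<and> (a, n - a) \<in> B}" for n
  have A: "finite (A n)" "card (A n) \<le> Suc n" for n
    using card_mono[of "{..n}" "A n"] by (auto simp: A_def)
  define g where "g n x = (\<Sum>a\<in>A n. f a (n - a) x powr s)" for n x
  have g_meas[measurable]: "g n \<in> borel_measurable N" for n unfolding g_def by measurable
  have g_le: "(\<integral>\<^sup>+x. ennreal (g n x) \<partial>N) \<le> ennreal (real (Suc n) * exp (- c) ^ n)" for n
  proof -
    have "(\<integral>\<^sup>+x. ennreal (g n x) \<partial>N) = (\<Sum>a\<in>A n. \<integral>\<^sup>+x. ennreal (f a (n - a) x powr s) \<partial>N)"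
    proof -
      have "ennreal (g n x) = (\<Sum>a\<in>A n. ennreal (f a (n - a) x powr s))" for x
        unfolding g_def by (simp add: sum_ennreal)
      then show ?thesis by (simp only:) (rule nn_integral_sum, measurable)
    qed
    also have "\<dots> \<le> (\<Sum>a\<in>A n. ennreal (exp (- c * real n)))"
      by (intro sum_mono order_trans[OF le]) (auto simp: A_def)
    also have "\<dots> = ennreal (real (card (A n)) * exp (- c * real n))"
      by (simp add: ennreal_mult' ennreal_of_nat_eq_real_of_nat)
    also have "\<dots> \<le> ennreal (real (Suc n) * exp (- c) ^ n)"
      using A(2)[of n] by (intro ennreal_leI mult_mono) (auto simp: exp_of_nat_mult[symmetric] mult.commute simp del: of_nat_Suc)
    finally show ?thesis .
  qed
  have "(\<integral>\<^sup>+x. (\<Sum>n. ennreal (g n x)) \<partial>N) = (\<Sum>n. \<integral>\<^sup>+x. ennreal (g n x) \<partial>N)"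
    by (rule nn_integral_suminf) auto
  also have "\<dots> \<le> (\<Sum>n. ennreal (real (Suc n) * exp (- c) ^ n))"
    by (intro suminf_le g_le) auto
  also have "\<dots> < \<infinity>"
  proof -
    have "summable (\<lambda>n. real (Suc n) * exp (- c) ^ n)"
      using geometric_deriv_sums[of "exp (- c)"] \<open>c > 0\<close> by (auto simp: sums_iff)
    then show ?thesis
      by (subst suminf_ennreal2) (auto simp: less_top[symmetric])
  qed
  finally have "AE x in N. (\<Sum>n. ennreal (g n x)) \<noteq> \<infinity>"
    by (intro nn_integral_PInf_AE) auto
  with f show ?thesis
  proof eventually_elim
    case (elim x)
    have "summable (\<lambda>n. g n x)"
      by (rule summable_suminf_not_top) (use elim(2) in \<open>auto simp: g_def sum_nonneg\<close>)
    then show ?case unfolding A_def[symmetric]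
    proof (rule summable_comparison_test')
      fix n :: nat assume "n \<ge> 0"
      have "norm (\<Sum>a\<in>A n. f a (n - a) x) = (\<Sum>a\<in>A n. f a (n - a) x)"
        using elim(1) by (simp add: sum_nonneg)
      also have "\<dots> \<le> g n x"
        unfolding g_def
      proof (rule sum_mono)
        fix a
        show "f a (n - a) x \<le> f a (n - a) x powr s"
          using elim(1) s powr_mono'[of s 1 "f a (n - a) x"] by auto
      qed
      finally show "norm (\<Sum>a\<in>A n. f a (n - a) x) \<le> g n x" .
    qed
  qed
qed

text \<open>To first order in t the exponents are the derivatives at 0, where the cone condition
  leaves the margin \<open>c\<close>. Half of the margin pays for the error of linearisation. The
  order \<open>4 * t\<close> is what two applications of Cauchy-Schwarz produce.\<close>

lemma exponent_choice:
  fixes m1 m2 m3 m4 :: "real \<Rightarrow> real" and B :: "(nat \<times> nat) set"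
  assumes m0: "m1 0 = 0" "m2 0 = 0" "m3 0 = 0" "m4 0 = 0"
    and d: "(m1 has_real_derivative u') (at 0)" "(m2 has_real_derivative w') (at 0)"
      "(m3 has_real_derivative u) (at 0)" "(m4 has_real_derivative w) (at 0)"
    and "c > 0" "r > 0"
    and B: "\<And>a b. (a, b) \<in> B \<Longrightarrow> real a * (u' - u) + real b * (w' - w) \<le> - c * real (a + b)"
  obtains t c' where "0 < t" "t \<le> 1" "4 * t < r" "c' > 0"
    "\<And>a b. (a, b) \<in> B \<Longrightarrow>
      real a * (m1 (4 * t) + m3 (- (4 * t))) + real b * (m2 (4 * t) + m4 (- (4 * t))) \<le> - c' * real (a + b)"
proof -
  have small: "\<exists>\<delta>>0. \<forall>t. 0 < t \<and> t < \<delta> \<longrightarrow> f t + g (- t) \<le> t * (p - q + c / 2)"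
    if "f 0 = 0" "g 0 = 0" "(f has_real_derivative p) (at 0)" "(g has_real_derivative q) (at 0)"
    for f g :: "real \<Rightarrow> real" and p q
  proof -
    have g: "((\<lambda>t. g (- t)) has_real_derivative - q) (at 0)"
      using DERIV_mirror[of g q 0] that(4) by simp
    have "((\<lambda>t. t * (p - q + c / 2) - (f t + g (- t))) has_real_derivative (p - q + c / 2) - (p + - q)) (at 0)"
      using DERIV_diff[OF DERIV_cmult_right[OF DERIV_ident, where c="p - q + c / 2"] DERIV_add[OF that(3) g]] by simp
    moreover have "0 < (p - q + c / 2) - (p + - q)" using \<open>c > 0\<close> by simp
    ultimately obtain \<delta> where "\<delta> > 0" and
      "\<And>h. 0 < h \<Longrightarrow> h < \<delta> \<Longrightarrow> 0 * (p - q + c / 2) - (f 0 + g (- 0)) < (0 + h) * (p - q + c / 2) - (f (0 + h) + g (- (0 + h)))"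
      using DERIV_pos_inc_right[of "\<lambda>t. t * (p - q + c / 2) - (f t + g (- t))" _ 0] by blast
    then show ?thesis using that(1,2) by (intro exI[of _ \<delta>]) (auto simp: less_imp_le)
  qed
  obtain d1 where d1: "d1 > 0" "\<And>t. 0 < t \<Longrightarrow> t < d1 \<Longrightarrow> m1 t + m3 (- t) \<le> t * (u' - u + c / 2)"
    using small[OF m0(1,3) d(1,3)] by blast
  obtain d2 where d2: "d2 > 0" "\<And>t. 0 < t \<Longrightarrow> t < d2 \<Longrightarrow> m2 t + m4 (- t) \<le> t * (w' - w + c / 2)"
    using small[OF m0(2,4) d(2,4)] by blast
  \<comment> \<open>Dividing by 8 makes \<open>4 * t\<close> at most half of each admissible radius,
    hence strictly smaller.\<close>
  define t where "t = min 1 (min r (min d1 d2)) / 8"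
  have t: "0 < t" "t \<le> 1" "4 * t < r" "4 * t < d1" "4 * t < d2"
    using d1(1) d2(1) \<open>r > 0\<close> by (auto simp: t_def min_def)
  show thesis
  proof (rule that[of t "4 * t * (c / 2)"])
    fix a b assume ab: "(a, b) \<in> B"
    have "real a * (m1 (4 * t) + m3 (- (4 * t))) + real b * (m2 (4 * t) + m4 (- (4 * t))) \<le>
       real a * (4 * t * (u' - u + c / 2)) + real b * (4 * t * (w' - w + c / 2))"
      using t by (intro add_mono mult_left_mono d1 d2) auto
    also have "\<dots> = 4 * t * (real a * (u' - u) + real b * (w' - w)) + 4 * t * (c / 2) * real (a + b)"
      by (simp add: algebra_simps)
    also have "\<dots> \<le> 4 * t * (- c * real (a + b)) + 4 * t * (c / 2) * real (a + b)"
      using t by (intro add_mono mult_left_mono order_refl B ab) auto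
    also have "\<dots> = - (4 * t * (c / 2)) * real (a + b)"
      by (simp add: algebra_simps)
    finally show "real a * (m1 (4 * t) + m3 (- (4 * t))) + real b * (m2 (4 * t) + m4 (- (4 * t))) \<le> - (4 * t * (c / 2)) * real (a + b)" .
  qed (use t \<open>c > 0\<close> in auto)
qed

section \<open>Moments of row and column products\<close>

definition row_prod :: "site \<Rightarrow> (coord \<Rightarrow> real) \<Rightarrow> nat \<Rightarrow> real" where
  "row_prod c \<eta> a = (\<Prod>i<a. field_h c \<eta> i 0)"

definition col_prod :: "site \<Rightarrow> (coord \<Rightarrow> real) \<Rightarrow> nat \<Rightarrow> nat \<Rightarrow> real" where
  "col_prod c \<eta> a b = (\<Prod>j<b. field_v c \<eta> a j)"

lemma harm_eq: "harm c \<eta> a b = inverse (row_prod c \<eta> a) * inverse (col_prod c \<eta> a b)"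
  by (simp add: harm_def row_prod_def col_prod_def prod_dividef divide_inverse prod_inversef[symmetric])

lemma row_prod_pos: "regular_field c \<eta> \<Longrightarrow> row_prod c \<eta> a > 0"
  and col_prod_pos: "regular_field c \<eta> \<Longrightarrow> col_prod c \<eta> a b > 0"
  unfolding row_prod_def col_prod_def by (auto intro!: prod_pos field_pos simp del: field_h.simps field_v.simps)

context stat_pair
begin

lemma measurable_row_col [measurable]:
  "(\<lambda>\<eta>. row_prod c \<eta> a) \<in> borel_measurable field_law"
  "(\<lambda>\<eta>. col_prod c \<eta> a b) \<in> borel_measurable field_law"
  unfolding row_prod_def col_prod_def by measurable

lemma row_moment:
  assumes "log_mgf LU r m u" "\<bar>t\<bar> < r"
  shows "(\<integral>\<^sup>+\<eta>. ennreal (row_prod c \<eta> a powr t) \<partial>field_law) = ennreal (exp (real a * m t))"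
proof -
  have "(\<integral>\<^sup>+\<eta>. ennreal (row_prod c \<eta> a powr t) \<partial>field_law) = (\<integral>\<^sup>+\<eta>. (\<Prod>i<a. ennreal (field_h c \<eta> i 0 powr t)) \<partial>field_law)"
    by (simp add: row_prod_def prod_powr_distrib prod_ennreal)
  also have "\<dots> = (\<integral>\<^sup>+u. ennreal (u powr t) \<partial>LU) ^ a"
    by (rule nn_integral_row) simp
  also have "\<dots> = ennreal (exp (real a * m t))"
    using assms by (simp add: log_mgf_def ennreal_power exp_of_nat_mult)
  finally show ?thesis .
qed

lemma col_moment:
  assumes "log_mgf LV r m u" "\<bar>t\<bar> < r"
  shows "(\<integral>\<^sup>+\<eta>. ennreal (col_prod c \<eta> a b powr t) \<partial>field_law) = ennreal (exp (real b * m t))"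
proof -
  have "(\<integral>\<^sup>+\<eta>. ennreal (col_prod c \<eta> a b powr t) \<partial>field_law) = (\<integral>\<^sup>+\<eta>. (\<Prod>j<b. ennreal (field_v c \<eta> a j powr t)) \<partial>field_law)"
    by (simp add: col_prod_def prod_powr_distrib prod_ennreal)
  also have "\<dots> = (\<integral>\<^sup>+v. ennreal (v powr t) \<partial>LV) ^ b"
    by (rule nn_integral_column) simp
  also have "\<dots> = ennreal (exp (real b * m t))"
    using assms by (simp add: log_mgf_def ennreal_power exp_of_nat_mult)
  finally show ?thesis .
qed

text \<open>The left side does not involve the stationary pair: any pair may be used to bound it,
  because each generates an environment with the same law. The square comes from separating the row
  from the column, whose joint law is not computed.\<close>

lemma env_pass_moment:
  assumes "log_mgf LU r1 m1 u" "log_mgf LV r2 m2 w" "0 < t" "2 * t < r1" "2 * t < r2"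
  shows "(\<integral>\<^sup>+\<omega>. ennreal (pass \<omega> c (site_at c a b) powr t) \<partial>env_law \<alpha> \<beta>) ^ 2
     \<le> ennreal (exp (real a * m1 (2 * t) + real b * m2 (2 * t)))"
proof -
  note measurable_true_env[measurable]
  have "(\<integral>\<^sup>+\<omega>. ennreal (pass \<omega> c (site_at c a b) powr t) \<partial>env_law \<alpha> \<beta>) =
      (\<integral>\<^sup>+\<omega>. ennreal (pass \<omega> c (site_at c a b) powr t) \<partial>distr field_law (env_law \<alpha> \<beta>) (true_env c))"
    by (simp add: distr_true_env)
  also have "\<dots> = (\<integral>\<^sup>+\<eta>. ennreal (pass (true_env c \<eta>) c (site_at c a b) powr t) \<partial>field_law)"
    by (subst nn_integral_distr) auto
  also have "\<dots> \<le> (\<integral>\<^sup>+\<eta>. ennreal (row_prod c \<eta> a powr t) * ennreal (col_prod c \<eta> a b powr t) \<partial>field_law)"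
  proof (rule nn_integral_mono_AE, rule AE_mp[OF AE_regular_field[of c]], rule AE_I2, rule impI)
    fix \<eta> assume reg: "regular_field c \<eta>"
    note pos = row_prod_pos[OF reg, of a] col_prod_pos[OF reg, of a b]
    have "pass (true_env c \<eta>) c (site_at c a b) * harm c \<eta> a b \<le> 1"
      using pass_harm_le_1[OF reg, of "site_at c a b"] by simp
    then have "pass (true_env c \<eta>) c (site_at c a b) \<le> row_prod c \<eta> a * col_prod c \<eta> a b"
      using pos by (simp add: harm_eq divide_simps)
    then have "pass (true_env c \<eta>) c (site_at c a b) powr t \<le> (row_prod c \<eta> a * col_prod c \<eta> a b) powr t"
      using assms(3) pass_nonneg[OF is_env_true_env] by (intro powr_mono2) auto
    also have "\<dots> = row_prod c \<eta> a powr t * col_prod c \<eta> a b powr t"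
      using pos by (simp add: powr_mult)
    finally show "ennreal (pass (true_env c \<eta>) c (site_at c a b) powr t) \<le> ennreal (row_prod c \<eta> a powr t) * ennreal (col_prod c \<eta> a b powr t)"
      by (simp add: ennreal_mult[symmetric] ennreal_leI)
  qed
  finally have "(\<integral>\<^sup>+\<omega>. ennreal (pass \<omega> c (site_at c a b) powr t) \<partial>env_law \<alpha> \<beta>) ^ 2 \<le>
      (\<integral>\<^sup>+\<eta>. ennreal (row_prod c \<eta> a powr t) * ennreal (col_prod c \<eta> a b powr t) \<partial>field_law) ^ 2"
    by (rule power_mono) simp
  also have "\<dots> \<le> (\<integral>\<^sup>+\<eta>. ennreal (row_prod c \<eta> a powr t) ^ 2 \<partial>field_law) * (\<integral>\<^sup>+\<eta>. ennreal (col_prod c \<eta> a b powr t) ^ 2 \<partial>field_law)"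
    by (rule Cauchy_Schwarz_nn_integral) auto
  also have "\<dots> = (\<integral>\<^sup>+\<eta>. ennreal (row_prod c \<eta> a powr (2 * t)) \<partial>field_law) * (\<integral>\<^sup>+\<eta>. ennreal (col_prod c \<eta> a b powr (2 * t)) \<partial>field_law)"
  proof -
    have "ennreal (x powr t) ^ 2 = ennreal (x powr (2 * t))" for x
      by (simp add: ennreal_power powr_square)
    then show ?thesis by simp
  qed
  also have "\<dots> = ennreal (exp (real a * m1 (2 * t) + real b * m2 (2 * t)))"
    using assms by (simp add: row_moment[OF assms(1)] col_moment[OF assms(2)] ennreal_mult[symmetric] exp_add)
  finally show ?thesis .
qed

text \<open>The pair \<open>(LU, LV)\<close> only serves to bound the moments of the passage probabilities;
  the factors \<open>R\<close> and \<open>C\<close> come from another parameter.\<close>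

lemma AE_summable_pass:
  fixes R C :: "nat \<Rightarrow> nat \<Rightarrow> 'a \<Rightarrow> real"
  assumes L: "log_mgf LU r1 m1 u'" "log_mgf LV r2 m2 w'"
    and T: "T \<in> measurable N (env_law \<alpha> \<beta>)" "distr N (env_law \<alpha> \<beta>) T = env_law \<alpha> \<beta>"
    and RC[measurable]: "\<And>a b. R a b \<in> borel_measurable N" "\<And>a b. C a b \<in> borel_measurable N"
    and m34: "m3 0 = 0" "m4 0 = 0" "(m3 has_real_derivative u) (at 0)" "(m4 has_real_derivative w) (at 0)"
    and r: "r > 0"
    and R: "\<And>a b t. 0 < t \<Longrightarrow> t < r \<Longrightarrow> (\<integral>\<^sup>+x. ennreal (R a b x powr t) \<partial>N) \<le> ennreal (exp (real a * m3 (- t)))"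
    and C: "\<And>a b t. 0 < t \<Longrightarrow> t < r \<Longrightarrow> (\<integral>\<^sup>+x. ennreal (C a b x powr t) \<partial>N) \<le> ennreal (exp (real b * m4 (- t)))"
    and le1: "AE x in N. \<forall>a b. 0 \<le> R a b x \<and> 0 \<le> C a b x \<and> pass (T x) c (site_at c a b) * R a b x * C a b x \<le> 1"
    and env: "\<And>x. x \<in> space N \<Longrightarrow> is_env (T x)"
    and "\<epsilon> > 0" and B: "\<And>a b. (a, b) \<in> B \<Longrightarrow> real a * (u' - u) + real b * (w' - w) \<le> - \<epsilon> * real (a + b)"
  shows "AE x in N. summable (\<lambda>n. \<Sum>a\<in>{a. a \<le> n \<and> (a, n - a) \<in> B}.
     pass (T x) c (site_at c a (n - a)) * R a (n - a) x * C a (n - a) x)"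
proof -
  note T(1)[measurable]
  have L': "m1 0 = 0" "m2 0 = 0" "(m1 has_real_derivative u') (at 0)" "(m2 has_real_derivative w') (at 0)"
    "min r (min r1 r2) > 0"
    using L r by (auto simp: log_mgf_def)
  obtain t e where t: "0 < t" "t \<le> 1" "4 * t < min r (min r1 r2)" "e > 0"
    and te: "\<And>a b. (a, b) \<in> B \<Longrightarrow>
      real a * (m1 (4 * t) + m3 (- (4 * t))) + real b * (m2 (4 * t) + m4 (- (4 * t))) \<le> - e * real (a + b)"
    using exponent_choice[OF L'(1,2) m34(1,2) L'(3,4) m34(3,4) \<open>\<epsilon> > 0\<close> L'(5) B] by metis
  have env': "AE x in N. is_env (T x)" using env by simp
  show ?thesis
  \<comment> \<open>The estimates below bound the fourth power of the t-th moment by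
    \<open>exp (- e * real (a + b))\<close>; taking the fourth root leaves a quarter of the
    rate.\<close>
  proof (rule AE_summable_levels[where s=t and c="e / 4"])
    show "AE x in N. \<forall>a b. 0 \<le> pass (T x) c (site_at c a b) * R a b x * C a b x \<and>
       pass (T x) c (site_at c a b) * R a b x * C a b x \<le> 1"
      using le1 env' by eventually_elim (simp add: pass_nonneg)
    fix a b assume ab: "(a, b) \<in> B"
    have pw: "ennreal (x powr s) ^ 2 = ennreal (x powr (2 * s))" "ennreal (x powr s) ^ 4 = ennreal (x powr (4 * s))" for x s
      by (simp_all add: ennreal_power powr_square powr_fourth)
    have "(\<integral>\<^sup>+x. ennreal ((pass (T x) c (site_at c a b) * R a b x * C a b x) powr t) \<partial>N) =
       (\<integral>\<^sup>+x. ennreal (pass (T x) c (site_at c a b) powr t) * ennreal (R a b x powr t) * ennreal (C a b x powr t) \<partial>N)"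
    proof (rule nn_integral_cong_AE, use le1 env' in eventually_elim)
      case (elim x)
      then show ?case by (simp add: powr_mult pass_nonneg ennreal_mult)
    qed
    then have "(\<integral>\<^sup>+x. ennreal ((pass (T x) c (site_at c a b) * R a b x * C a b x) powr t) \<partial>N) ^ 4 \<le>
      (\<integral>\<^sup>+x. ennreal (pass (T x) c (site_at c a b) powr t) ^ 2 \<partial>N) ^ 2 *
        ((\<integral>\<^sup>+x. ennreal (R a b x powr t) ^ 4 \<partial>N) * (\<integral>\<^sup>+x. ennreal (C a b x powr t) ^ 4 \<partial>N))"
      by (simp only:) (rule nn_integral_triple_le; measurable)
    also have "\<dots> = (\<integral>\<^sup>+\<omega>. ennreal (pass \<omega> c (site_at c a b) powr (2 * t)) \<partial>env_law \<alpha> \<beta>) ^ 2 *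
        ((\<integral>\<^sup>+x. ennreal (R a b x powr (4 * t)) \<partial>N) * (\<integral>\<^sup>+x. ennreal (C a b x powr (4 * t)) \<partial>N))"
    proof -
      have "(\<integral>\<^sup>+\<omega>. ennreal (pass \<omega> c (site_at c a b) powr (2 * t)) \<partial>env_law \<alpha> \<beta>) =
          (\<integral>\<^sup>+\<omega>. ennreal (pass \<omega> c (site_at c a b) powr (2 * t)) \<partial>distr N (env_law \<alpha> \<beta>) T)"
        by (simp add: T(2))
      also have "\<dots> = (\<integral>\<^sup>+x. ennreal (pass (T x) c (site_at c a b) powr (2 * t)) \<partial>N)"
        by (rule nn_integral_distr) auto
      finally show ?thesis unfolding pw by simp
    qed
    \<comment> \<open>The splitting leaves a squared integral of the passage probability to the
      power \<open>2 * t\<close>, and \<open>env_pass_moment\<close> doubles the order once more. So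
      all factors meet at order \<open>4 * t\<close>.\<close>
    also have "\<dots> \<le> ennreal (exp (real a * m1 (2 * (2 * t)) + real b * m2 (2 * (2 * t)))) *
        (ennreal (exp (real a * m3 (- (4 * t)))) * ennreal (exp (real b * m4 (- (4 * t)))))"
      using t by (intro mult_mono env_pass_moment[OF L] R C) auto
    also have "\<dots> = ennreal (exp (real a * (m1 (4 * t) + m3 (- (4 * t))) + real b * (m2 (4 * t) + m4 (- (4 * t)))))"
      by (simp add: ennreal_mult[symmetric] exp_add[symmetric] algebra_simps)
    also have "\<dots> \<le> ennreal (exp (- e * real (a + b)))"
      using te[OF ab] by (intro ennreal_leI) simp
    finally show "(\<integral>\<^sup>+x. ennreal ((pass (T x) c (site_at c a b) * R a b x * C a b x) powr t) \<partial>N) \<le> ennreal (exp (- (e / 4) * real (a + b)))"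
      by (auto dest!: ennreal_power_le_exp)
  qed (use t in auto)
qed

text \<open>The summands are the probabilities that the transformed walk started at \<open>c\<close>
  visits the site, so this is the Borel-Cantelli condition for eventually avoiding the cone
  \<open>B\<close>. The pair \<open>(LU', LV')\<close> enters only through the law of the
  environment.\<close>

lemma AE_summable_doob:
  assumes \<mu>: "stat_pair \<alpha> \<beta> LU' LV'" and L': "log_mgf LU' r1 m1 u'" "log_mgf LV' r2 m2 w'"
    and L: "log_mgf LU r3 m3 u" "log_mgf LV r4 m4 w"
    and "\<epsilon> > 0" and B: "\<And>a b. (a, b) \<in> B \<Longrightarrow> real a * (u' - u) + real b * (w' - w) \<le> - \<epsilon> * real (a + b)"
  shows "AE \<eta> in field_law. summable (\<lambda>n. \<Sum>a\<in>{a. a \<le> n \<and> (a, n - a) \<in> B}.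
     pass (true_env c \<eta>) c (site_at c a (n - a)) * harm c \<eta> a (n - a))"
proof -
  interpret \<mu>: stat_pair \<alpha> \<beta> LU' LV' by fact
  have inv: "AE \<eta> in field_law. \<forall>a b t. inverse (row_prod c \<eta> a) powr t = row_prod c \<eta> a powr (- t) \<and>
      inverse (col_prod c \<eta> a b) powr t = col_prod c \<eta> a b powr (- t)"
    using AE_regular_field[of c]
  proof eventually_elim
    case (elim \<eta>)
    then show ?case
      using row_prod_pos[OF elim] col_prod_pos[OF elim]
      by (auto simp: powr_minus powr_def ln_inverse less_imp_neq[symmetric] exp_minus[symmetric])
  qed
  have "AE \<eta> in field_law. summable (\<lambda>n. \<Sum>a\<in>{a. a \<le> n \<and> (a, n - a) \<in> B}.
     pass (true_env c \<eta>) c (site_at c a (n - a)) * inverse (row_prod c \<eta> a) * inverse (col_prod c \<eta> a (n - a)))"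
  proof (rule \<mu>.AE_summable_pass[OF L' measurable_true_env distr_true_env, where r="min r3 r4" and ?m3.0=m3 and ?m4.0=m4])
    show "AE x in field_law. \<forall>a b. 0 \<le> inverse (row_prod c x a) \<and> 0 \<le> inverse (col_prod c x a b) \<and>
       pass (true_env c x) c (site_at c a b) * inverse (row_prod c x a) * inverse (col_prod c x a b) \<le> 1"
      using AE_regular_field[of c]
    proof eventually_elim
      case (elim \<eta>)
      show ?case
        using row_prod_pos[OF elim] col_prod_pos[OF elim] pass_harm_le_1[OF elim]
        by (metis harm_at_site harm_eq inverse_nonnegative_iff_nonnegative less_imp_le mult.assoc)
    qed
    fix a b t assume t: "0 < t" "t < min r3 r4"
    have "(\<integral>\<^sup>+\<eta>. ennreal (inverse (row_prod c \<eta> a) powr t) \<partial>field_law) = (\<integral>\<^sup>+\<eta>. ennreal (row_prod c \<eta> a powr (- t)) \<partial>field_law)"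
      by (rule nn_integral_cong_AE) (use inv in eventually_elim, simp)
    then show "(\<integral>\<^sup>+\<eta>. ennreal (inverse (row_prod c \<eta> a) powr t) \<partial>field_law) \<le> ennreal (exp (real a * m3 (- t)))"
      using t by (simp add: row_moment[OF L(1)])
    have "(\<integral>\<^sup>+\<eta>. ennreal (inverse (col_prod c \<eta> a b) powr t) \<partial>field_law) = (\<integral>\<^sup>+\<eta>. ennreal (col_prod c \<eta> a b powr (- t)) \<partial>field_law)"
      by (rule nn_integral_cong_AE) (use inv in eventually_elim, simp)
    then show "(\<integral>\<^sup>+\<eta>. ennreal (inverse (col_prod c \<eta> a b) powr t) \<partial>field_law) \<le> ennreal (exp (real b * m4 (- t)))"
      using t by (simp add: col_moment[OF L(2)])
  qed (use L \<open>\<epsilon> > 0\<close> B in \<open>auto simp: log_mgf_def is_env_true_env\<close>)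
  then show ?thesis by (simp add: harm_eq mult.assoc)
qed

end

section \<open>Comparison with conditioned walks\<close>

text \<open>For unreachable \<open>z\<close> the division by 0 gives 0, so the value always lies in
  the unit interval.\<close>

definition bridge :: "(site \<Rightarrow> real) \<Rightarrow> site \<Rightarrow> site \<Rightarrow> real" where
  "bridge w x z = w x * pass w (x + e1) z / pass w x z"

lemma bridge_bounds:
  assumes "is_env w"
  shows "0 \<le> bridge w x z" "bridge w x z \<le> 1"
proof -
  note w = is_envD[OF assms, of x] pass_nonneg[OF assms]
  show "0 \<le> bridge w x z" by (simp add: bridge_def w)
  show "bridge w x z \<le> 1"
  proof (cases "x = z")
    case True
    then have "\<not> x + e1 \<sqsubseteq> z" by (simp add: below_def)
    then show ?thesis by (simp add: bridge_def pass_eq_0)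
  next
    case False
    have "w x * pass w (x + e1) z \<le> pass w x z"
      using w by (simp add: pass_harmonic[OF False])
    then show ?thesis using w(3)[of x z] by (auto simp: bridge_def divide_le_eq_1 less_le)
  qed
qed

text \<open>The probability that the transformed walk started at \<open>c\<close> ever visits the
  site.\<close>

definition doob_mass :: "site \<Rightarrow> (coord \<Rightarrow> real) \<Rightarrow> nat \<Rightarrow> nat \<Rightarrow> real" where
  "doob_mass c \<eta> a b = pass (true_env c \<eta>) c (site_at c a b) * harm c \<eta> a b"

text \<open>\<open>ratio_monotone\<close> is applied with f the passage probability to the far point
  and g the harmonic function, corrected so that g has the required signs on the two outer sides of
  the rectangle. One correction removes what enters through the north side, the other what enters
  through the east side. Relative to the value at \<open>x\<close>, the correction costs at most the
  expected number of visited sites on that side divided by \<open>D\<close>, the probability that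
  the transformed walk visits \<open>x\<close>.\<close>

lemma bridge_comparison:
  assumes reg: "regular_field c \<eta>" and x: "c \<sqsubseteq> x" "fst x < fst (site_at c p q)" "snd x < snd (site_at c p q)"
  defines "w \<equiv> true_env c \<eta>" and "D \<equiv> pass (true_env c \<eta>) c x * harm_at c \<eta> x"
  shows "D > 0"
    and "bridge w x (site_at c p q) * (1 - (\<Sum>a\<le>p. doob_mass c \<eta> a (Suc q)) / D) \<le> doob_at c \<eta> x"
    and "(1 - bridge w x (site_at c p q)) * (1 - (\<Sum>b\<le>q. doob_mass c \<eta> (Suc p) b) / D) \<le> 1 - doob_at c \<eta> x"
proof -
  let ?z = "site_at c p q"
  let ?h = "harm_at c \<eta>"
  let ?f = "\<lambda>y. pass w y ?z"
  have w: "is_env w" unfolding w_def by (rule is_env_true_env)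
  have wpos: "0 < w y \<and> w y < 1" if "c \<sqsubseteq> y" for y
    using true_env_pos[OF reg that] by (simp add: w_def)
  have trans: "c \<sqsubseteq> y" if "x \<sqsubseteq> y" for y using x(1) that by (auto simp: below_def)
  have xz: "x \<sqsubseteq> ?z" "x \<noteq> ?z" using x by (auto simp: below_def)
  have hpos: "?h y > 0" for y by (rule harm_at_pos[OF reg])
  have pos: "pass w y y' > 0" if "c \<sqsubseteq> y" "y \<sqsubseteq> y'" for y y'
    using that wpos by (intro pass_pos[OF _ w]) (auto simp: below_def)
  have Dpos: "pass w c x * ?h x > 0" using pos[of c x] x hpos by (auto simp: below_def)
  then show "D > 0" by (simp add: D_def w_def)
  have D: "D = pass w c x * ?h x" by (simp add: D_def w_def)
  \<comment> \<open>\<open>N\<close> dominates the harmonic function on the north row, as does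
    \<open>E\<close> on the east column. A walk running along the side is counted several times,
    which is harmless because only domination is needed.\<close>
  define N where "N y = (\<Sum>a\<le>p. pass w y (site_at c a (Suc q)) * harm c \<eta> a (Suc q))" for y
  define E where "E y = (\<Sum>b\<le>q. pass w y (site_at c (Suc p) b) * harm c \<eta> (Suc p) b)" for y
  have N0: "N y \<ge> 0" and E0: "E y \<ge> 0" for y
    unfolding N_def E_def by (auto intro!: sum_nonneg mult_nonneg_nonneg pass_nonneg w less_imp_le[OF harm_pos[OF reg]])
  have harmN: "N y = w y * N (y + e1) + (1 - w y) * N (y + e2)" if "y \<sqsubseteq> ?z" for y
  proof -
    have "y \<noteq> site_at c a (Suc q)" for a using that by (auto simp: below_def site_at_def)
    then show ?thesis unfolding N_def by (subst pass_harmonic) (simp_all add: sum_distrib_left sum.distrib[symmetric] algebra_simps)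
  qed
  have harmE: "E y = w y * E (y + e1) + (1 - w y) * E (y + e2)" if "y \<sqsubseteq> ?z" for y
  proof -
    have "y \<noteq> site_at c (Suc p) b" for b using that by (auto simp: below_def site_at_def)
    then show ?thesis unfolding E_def by (subst pass_harmonic) (simp_all add: sum_distrib_left sum.distrib[symmetric] algebra_simps)
  qed
  have harmh: "?h y = w y * ?h (y + e1) + (1 - w y) * ?h (y + e2)" if "x \<sqsubseteq> y" for y
    unfolding w_def by (rule harm_at_harmonic[OF reg trans[OF that]])
  have north: "?h y \<le> N y" "E y = 0" if "snd y = snd ?z + 1" "fst y \<le> fst ?z" "x \<sqsubseteq> y" for y
  proof -
    have "c \<sqsubseteq> y" by (rule trans[OF that(3)])
    then obtain a b where y: "y = site_at c a b" using below_site_at by blast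
    have ab: "b = Suc q" "a \<le> p" using that y by (auto simp: site_at_def)
    have "pass w y (site_at c a (Suc q)) * harm c \<eta> a (Suc q) \<le> N y"
      unfolding N_def by (rule member_le_sum)
        (use ab in \<open>auto intro!: mult_nonneg_nonneg pass_nonneg w less_imp_le[OF harm_pos[OF reg]]\<close>)
    then show "?h y \<le> N y" using y ab by simp
    have "\<not> y \<sqsubseteq> site_at c (Suc p) b'" if "b' \<le> q" for b'
      using that y ab by (auto simp: below_def site_at_def)
    then show "E y = 0" by (auto simp: E_def pass_eq_0)
  qed
  have east: "?h y \<le> E y" "N y = 0" if "fst y = fst ?z + 1" "snd y \<le> snd ?z" "x \<sqsubseteq> y" for y
  proof -
    have "c \<sqsubseteq> y" by (rule trans[OF that(3)])
    then obtain a b where y: "y = site_at c a b" using below_site_at by blast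
    have ab: "a = Suc p" "b \<le> q" using that y by (auto simp: site_at_def)
    have "pass w y (site_at c (Suc p) b) * harm c \<eta> (Suc p) b \<le> E y"
      unfolding E_def by (rule member_le_sum)
        (use ab in \<open>auto intro!: mult_nonneg_nonneg pass_nonneg w less_imp_le[OF harm_pos[OF reg]]\<close>)
    then show "?h y \<le> E y" using y ab by simp
    have "\<not> y \<sqsubseteq> site_at c a' (Suc q)" if "a' \<le> p" for a'
      using that y ab by (auto simp: below_def site_at_def)
    then show "N y = 0" by (auto simp: N_def pass_eq_0)
  qed
  have f0: "?f y = 0" if "snd y = snd ?z + 1 \<or> fst y = fst ?z + 1" for y
    using that by (intro pass_eq_0) (auto simp: below_def)
  have fx: "?f x > 0" using pos x xz by blast
  have ind: "(fst x < fst ?z \<longrightarrow> g x * ?f (x + e1) \<le> g (x + e1) * ?f x) \<and>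
         (snd x < snd ?z \<longrightarrow> g (x + e2) * ?f x \<le> g x * ?f (x + e2))"
    if g: "\<And>y. x \<sqsubseteq> y \<Longrightarrow> y \<sqsubseteq> ?z \<Longrightarrow> g y = w y * g (y + e1) + (1 - w y) * g (y + e2)"
      "\<And>y. snd y = snd ?z + 1 \<Longrightarrow> fst y \<le> fst ?z \<Longrightarrow> x \<sqsubseteq> y \<Longrightarrow> g y \<le> 0"
      "\<And>y. fst y = fst ?z + 1 \<Longrightarrow> snd y \<le> snd ?z \<Longrightarrow> x \<sqsubseteq> y \<Longrightarrow> g y \<ge> 0" for g
  proof (rule ratio_monotone[OF xz(1), where a=w and b="\<lambda>y. 1 - w y"])
    show "0 < w y \<and> 0 < 1 - w y" if "x \<sqsubseteq> y" for y using wpos[OF trans[OF that]] by simp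
    show "0 < ?f y" if "x \<sqsubseteq> y" "y \<sqsubseteq> ?z" for y using pos that trans by blast
  qed (use g f0 in \<open>auto intro: pass_harmonic\<close>)
  have cx: "pass w c x > 0" using pos[of c x] x(1) by (simp add: below_def)
  have mass: "(\<Sum>a\<le>p. doob_mass c \<eta> a (Suc q)) / D \<ge> N x / ?h x" "(\<Sum>b\<le>q. doob_mass c \<eta> (Suc p) b) / D \<ge> E x / ?h x"
  proof -
    \<comment> \<open>Going through \<open>x\<close> is one of the ways to reach a boundary site
      from \<open>c\<close>.\<close>
    have "pass w c x * N x \<le> (\<Sum>a\<le>p. doob_mass c \<eta> a (Suc q))"
      unfolding N_def doob_mass_def sum_distrib_left w_def[symmetric]
      by (intro sum_mono) (auto simp: mult.assoc[symmetric] intro!: mult_right_mono pass_mult_le[OF w] less_imp_le[OF harm_pos[OF reg]])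
    then have "pass w c x * N x / D \<le> (\<Sum>a\<le>p. doob_mass c \<eta> a (Suc q)) / D"
      using Dpos by (intro divide_right_mono) (auto simp: D)
    then show "(\<Sum>a\<le>p. doob_mass c \<eta> a (Suc q)) / D \<ge> N x / ?h x" using cx by (simp add: D)
    have "pass w c x * E x \<le> (\<Sum>b\<le>q. doob_mass c \<eta> (Suc p) b)"
      unfolding E_def doob_mass_def sum_distrib_left w_def[symmetric]
      by (intro sum_mono) (auto simp: mult.assoc[symmetric] intro!: mult_right_mono pass_mult_le[OF w] less_imp_le[OF harm_pos[OF reg]])
    then have "pass w c x * E x / D \<le> (\<Sum>b\<le>q. doob_mass c \<eta> (Suc p) b) / D"
      using Dpos by (intro divide_right_mono) (auto simp: D)
    then show "(\<Sum>b\<le>q. doob_mass c \<eta> (Suc p) b) / D \<ge> E x / ?h x" using cx by (simp add: D)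
  qed
  have K: "0 \<le> bridge w x ?z" "bridge w x ?z \<le> 1" using bridge_bounds[OF w] by auto
  show "bridge w x ?z * (1 - (\<Sum>a\<le>p. doob_mass c \<eta> a (Suc q)) / D) \<le> doob_at c \<eta> x"
  proof -
    have "(?h x - N x) * ?f (x + e1) \<le> (?h (x + e1) - N (x + e1)) * ?f x"
    proof (rule mp[OF conjunct1[OF ind[of "\<lambda>y. ?h y - N y"]]])
      show "?h y - N y = w y * (?h (y + e1) - N (y + e1)) + (1 - w y) * (?h (y + e2) - N (y + e2))"
        if "x \<sqsubseteq> y" "y \<sqsubseteq> ?z" for y
        unfolding right_diff_distrib using harmN[OF that(2)] harmh[OF that(1)] by linarith
      show "?h y - N y \<le> 0" if "snd y = snd ?z + 1" "fst y \<le> fst ?z" "x \<sqsubseteq> y" for y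
        using north(1)[OF that] by simp
      show "?h y - N y \<ge> 0" if "fst y = fst ?z + 1" "snd y \<le> snd ?z" "x \<sqsubseteq> y" for y
        using east(2)[OF that] hpos[of y] by simp
    qed (rule x(2))
    also have "\<dots> \<le> ?h (x + e1) * ?f x" using N0[of "x + e1"] fx by (intro mult_right_mono) auto
    finally have "(?h x - N x) * ?f (x + e1) / (?h x * ?f x) \<le> ?h (x + e1) * ?f x / (?h x * ?f x)"
      using hpos[of x] fx by (intro divide_right_mono) auto
    then have "w x * ((1 - N x / ?h x) * (?f (x + e1) / ?f x)) \<le> w x * (?h (x + e1) / ?h x)"
      using hpos[of x] fx wpos[OF x(1)] by (intro mult_left_mono) (auto simp: field_simps)
    then have "bridge w x ?z * (1 - N x / ?h x) \<le> doob_at c \<eta> x"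
      unfolding doob_at_eq(1)[OF reg x(1)] by (simp add: bridge_def w_def mult_ac)
    moreover have "bridge w x ?z * (1 - (\<Sum>a\<le>p. doob_mass c \<eta> a (Suc q)) / D) \<le> bridge w x ?z * (1 - N x / ?h x)"
      using mass K by (intro mult_left_mono) auto
    ultimately show ?thesis by linarith
  qed
  show "(1 - bridge w x ?z) * (1 - (\<Sum>b\<le>q. doob_mass c \<eta> (Suc p) b) / D) \<le> 1 - doob_at c \<eta> x"
  proof -
    \<comment> \<open>The east correction makes the function nonpositive on the east column, the
      wrong sign for \<open>ratio_monotone\<close>; its negative has the right sign on both
      sides.\<close>
    have "(- (?h (x + e2) - E (x + e2))) * ?f x \<le> (- (?h x - E x)) * ?f (x + e2)"
    proof (rule mp[OF conjunct2[OF ind[of "\<lambda>y. - (?h y - E y)"]]])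
      show "- (?h y - E y) = w y * (- (?h (y + e1) - E (y + e1))) + (1 - w y) * (- (?h (y + e2) - E (y + e2)))"
        if "x \<sqsubseteq> y" "y \<sqsubseteq> ?z" for y
        unfolding minus_diff_eq right_diff_distrib using harmE[OF that(2)] harmh[OF that(1)] by linarith
      show "- (?h y - E y) \<le> 0" if "snd y = snd ?z + 1" "fst y \<le> fst ?z" "x \<sqsubseteq> y" for y
        using north(2)[OF that] hpos[of y] by simp
      show "- (?h y - E y) \<ge> 0" if "fst y = fst ?z + 1" "snd y \<le> snd ?z" "x \<sqsubseteq> y" for y
        using east(1)[OF that] by simp
    qed (rule x(3))
    then have "(?h x - E x) * ?f (x + e2) \<le> (?h (x + e2) - E (x + e2)) * ?f x"
      unfolding mult_minus_left neg_le_iff_le .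
    also have "\<dots> \<le> ?h (x + e2) * ?f x" using E0[of "x + e2"] fx by (intro mult_right_mono) auto
    finally have "(?h x - E x) * ?f (x + e2) / (?h x * ?f x) \<le> ?h (x + e2) * ?f x / (?h x * ?f x)"
      using hpos[of x] fx by (intro divide_right_mono) auto
    then have "(1 - w x) * ((1 - E x / ?h x) * (?f (x + e2) / ?f x)) \<le> (1 - w x) * (?h (x + e2) / ?h x)"
      using hpos[of x] fx wpos[OF x(1)] by (intro mult_left_mono) (auto simp: field_simps)
    moreover have "1 - bridge w x ?z = (1 - w x) * ?f (x + e2) / ?f x"
      using fx pass_harmonic[OF xz(2), of w] by (simp add: bridge_def field_simps)
    ultimately have "(1 - bridge w x ?z) * (1 - E x / ?h x) \<le> 1 - doob_at c \<eta> x"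
      unfolding doob_at_eq(2)[OF reg x(1)] by (simp add: w_def mult_ac)
    moreover have "(1 - bridge w x ?z) * (1 - (\<Sum>b\<le>q. doob_mass c \<eta> (Suc p) b) / D) \<le> (1 - bridge w x ?z) * (1 - E x / ?h x)"
      using mass K by (intro mult_left_mono) auto
    ultimately show ?thesis by linarith
  qed
qed

text \<open>A countable decreasing base of neighbourhoods of the direction at infinity. It replaces
  the quantifier over all sequences of sites by countable suprema and infima, which is what makes
  the limits measurable.\<close>

definition zone :: "real \<Rightarrow> nat \<Rightarrow> site set" where
  "zone \<zeta> M = {z. M \<le> l1norm z \<and> dist (to_plane z /\<^sub>R real (l1norm z)) (\<zeta>, 1 - \<zeta>) < 1 / real (Suc M)}"

lemma goes_in_direction_zone:
  "goes_in_direction z (\<zeta>, 1 - \<zeta>) \<longleftrightarrow> (\<forall>M. eventually (\<lambda>N. z N \<in> zone \<zeta> M) sequentially)"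
proof
  assume *: "goes_in_direction z (\<zeta>, 1 - \<zeta>)"
  show "\<forall>M. eventually (\<lambda>N. z N \<in> zone \<zeta> M) sequentially"
  proof
    fix M
    have "eventually (\<lambda>N. M \<le> l1norm (z N)) sequentially"
      using * by (auto simp: goes_in_direction_def filterlim_at_top)
    moreover have "eventually (\<lambda>N. dist (to_plane (z N) /\<^sub>R real (l1norm (z N))) (\<zeta>, 1 - \<zeta>) < 1 / real (Suc M)) sequentially"
      using * by (auto simp: goes_in_direction_def dest!: tendstoD[where e="1 / real (Suc M)"])
    ultimately show "eventually (\<lambda>N. z N \<in> zone \<zeta> M) sequentially"
      by eventually_elim (simp add: zone_def)
  qed
next
  assume *: "\<forall>M. eventually (\<lambda>N. z N \<in> zone \<zeta> M) sequentially"
  show "goes_in_direction z (\<zeta>, 1 - \<zeta>)"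
    unfolding goes_in_direction_def
  proof
    show "filterlim (\<lambda>N. l1norm (z N)) at_top sequentially"
      unfolding filterlim_at_top
    proof
      fix M show "eventually (\<lambda>N. M \<le> l1norm (z N)) sequentially"
        using *[rule_format, of M] by eventually_elim (simp add: zone_def)
    qed
    show "(\<lambda>N. to_plane (z N) /\<^sub>R real (l1norm (z N))) \<longlonglongrightarrow> (\<zeta>, 1 - \<zeta>)"
    proof (rule tendstoI)
      fix e :: real assume "e > 0"
      then obtain M where M: "1 / real (Suc M) < e" using nat_approx_posE by blast
      show "eventually (\<lambda>N. dist (to_plane (z N) /\<^sub>R real (l1norm (z N))) (\<zeta>, 1 - \<zeta>) < e) sequentially"
        using *[rule_format, of M] by eventually_elim (use M in \<open>simp add: zone_def\<close>)
    qed
  qed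
qed

lemma zone_mono: "M \<le> M' \<Longrightarrow> zone \<zeta> M' \<subseteq> zone \<zeta> M"
proof
  fix z assume M: "M \<le> M'" and z: "z \<in> zone \<zeta> M'"
  have "1 / real (Suc M') \<le> 1 / real (Suc M)" using M by (simp add: frac_le)
  then show "z \<in> zone \<zeta> M" using M z by (auto simp: zone_def)
qed

lemma abs_scale:
  fixes x y n :: real
  assumes "n > 0"
  shows "\<bar>x / n - y\<bar> * n = \<bar>x - y * n\<bar>"
proof -
  have "(x / n - y) * n = x - y * n" using assms by (simp add: left_diff_distrib)
  then show ?thesis using assms by (metis abs_mult abs_of_pos)
qed

lemma zone_components:
  assumes "z \<in> zone \<zeta> M" "M > 0"
  shows "\<bar>real_of_int (fst z) - \<zeta> * real (l1norm z)\<bar> \<le> real (l1norm z) / real (Suc M)"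
    "\<bar>real_of_int (snd z) - (1 - \<zeta>) * real (l1norm z)\<bar> \<le> real (l1norm z) / real (Suc M)"
proof -
  let ?n = "real (l1norm z)"
  have n: "?n > 0" using assms by (auto simp: zone_def)
  have d: "dist (to_plane z /\<^sub>R ?n) (\<zeta>, 1 - \<zeta>) < 1 / real (Suc M)" using assms by (auto simp: zone_def)
  have "dist (fst (to_plane z /\<^sub>R ?n)) \<zeta> < 1 / real (Suc M)"
    using dist_fst_le[of "to_plane z /\<^sub>R ?n" "(\<zeta>, 1 - \<zeta>)"] d by simp
  then have "\<bar>real_of_int (fst z) / ?n - \<zeta>\<bar> * ?n \<le> 1 / real (Suc M) * ?n"
    unfolding to_plane_def dist_real_def fst_scaleR snd_scaleR fst_conv snd_conv real_scaleR_def
    using n by (intro mult_right_mono) (simp_all only: divide_inverse mult.commute less_imp_le)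
  moreover have "\<bar>real_of_int (fst z) / ?n - \<zeta>\<bar> * ?n = \<bar>real_of_int (fst z) - \<zeta> * ?n\<bar>"
    using n by (rule abs_scale)
  ultimately show "\<bar>real_of_int (fst z) - \<zeta> * ?n\<bar> \<le> ?n / real (Suc M)" by simp
  have "dist (snd (to_plane z /\<^sub>R ?n)) (1 - \<zeta>) < 1 / real (Suc M)"
    using dist_snd_le[of "to_plane z /\<^sub>R ?n" "(\<zeta>, 1 - \<zeta>)"] d by simp
  then have "\<bar>real_of_int (snd z) / ?n - (1 - \<zeta>)\<bar> * ?n \<le> 1 / real (Suc M) * ?n"
    unfolding to_plane_def dist_real_def fst_scaleR snd_scaleR fst_conv snd_conv real_scaleR_def
    using n by (intro mult_right_mono) (simp_all only: divide_inverse mult.commute less_imp_le)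
  moreover have "\<bar>real_of_int (snd z) / ?n - (1 - \<zeta>)\<bar> * ?n = \<bar>real_of_int (snd z) - (1 - \<zeta>) * ?n\<bar>"
    using n by (rule abs_scale)
  ultimately show "\<bar>real_of_int (snd z) - (1 - \<zeta>) * ?n\<bar> \<le> ?n / real (Suc M)" by simp
qed

text \<open>Zones are centred at the origin, whereas the field has corner \<open>c\<close>. Moving
  the origin changes the coordinates by a bounded amount, which is negligible against
  \<open>\<delta>\<close> times the norm.\<close>

lemma zone_quadrant:
  assumes \<zeta>: "0 < \<zeta>" "\<zeta> < 1" and "\<epsilon> > 0"
  obtains M where "\<And>z. z \<in> zone \<zeta> M \<Longrightarrow> \<exists>p q. z = site_at c p q \<and> m \<le> p \<and> m \<le> q \<and>
    real p \<le> (\<zeta> + \<epsilon>) * real (p + q) \<and> (\<zeta> - \<epsilon>) * real (p + q) \<le> real p"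
proof -
  \<comment> \<open>One \<open>\<delta>\<close> is spent on the width of the zone and one on the
    shift of the corner, so twice \<open>\<delta>\<close> must fit into \<open>\<epsilon>\<close>.
    Staying below \<zeta> and 1 - \<zeta> forces both coordinates to be positive.\<close>
  define \<delta> where "\<delta> = min \<epsilon> (min \<zeta> (1 - \<zeta>)) / 2"
  have \<delta>: "\<delta> > 0" "2 * \<delta> \<le> \<epsilon>" "2 * \<delta> \<le> \<zeta>" "2 * \<delta> \<le> 1 - \<zeta>" using assms by (auto simp: \<delta>_def)
  \<comment> \<open>A common bound for the required distance \<open>m\<close> and for every term in
    which the corner \<open>c\<close> appears below.\<close>
  define K where "K = (1 + \<bar>\<zeta>\<bar> + \<epsilon>) * (\<bar>real_of_int (fst c)\<bar> + \<bar>real_of_int (snd c)\<bar>) + real m"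
  have K0: "K \<ge> 0" using assms by (simp add: K_def)
  obtain M1 where M1: "1 / real (Suc M1) < \<delta>" using nat_approx_posE[OF \<delta>(1)] by blast
  obtain M2 where M2: "K / \<delta> < real M2" using reals_Archimedean2 by blast
  define M where "M = Suc (max M1 M2)"
  show thesis
  proof (rule that)
    fix z assume z: "z \<in> zone \<zeta> M"
    let ?n = "real (l1norm z)"
    have "M > 0" by (simp add: M_def)
    have n: "real M \<le> ?n" using z by (simp add: zone_def)
    have "1 / real (Suc M) \<le> 1 / real (Suc M1)" by (intro frac_le) (auto simp: M_def)
    then have "1 / real (Suc M) \<le> \<delta>" using M1 by linarith
    then have "?n / real (Suc M) \<le> ?n * \<delta>"
      using mult_left_mono[of "1 / real (Suc M)" \<delta> ?n] by simp
    then have z1: "\<bar>real_of_int (fst z) - \<zeta> * ?n\<bar> \<le> ?n * \<delta>" and z2: "\<bar>real_of_int (snd z) - (1 - \<zeta>) * ?n\<bar> \<le> ?n * \<delta>"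
      using zone_components[OF z \<open>M > 0\<close>] by linarith+
    have nK: "K < ?n * \<delta>"
    proof -
      have "K < real M2 * \<delta>" using M2 \<delta> by (simp add: field_simps)
      also have "\<dots> \<le> ?n * \<delta>" using n \<delta> by (intro mult_right_mono) (auto simp: M_def)
      finally show ?thesis .
    qed
    have "?n * (2 * \<delta>) \<le> ?n * \<zeta>" "?n * (2 * \<delta>) \<le> ?n * (1 - \<zeta>)" using \<delta> by (intro mult_left_mono; simp)+
    then have lo: "real_of_int (fst z) \<ge> ?n * \<delta>" "real_of_int (snd z) \<ge> ?n * \<delta>"
      using z1 z2 by (auto simp: abs_le_iff algebra_simps)
    let ?c1 = "real_of_int (fst c)" and ?c2 = "real_of_int (snd c)"
    have cK: "\<bar>?c1\<bar> + \<bar>?c2\<bar> + real m \<le> K"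
    proof -
      have "1 * (\<bar>?c1\<bar> + \<bar>?c2\<bar>) \<le> (1 + \<bar>\<zeta>\<bar> + \<epsilon>) * (\<bar>?c1\<bar> + \<bar>?c2\<bar>)"
        using assms by (intro mult_right_mono) auto
      then show ?thesis by (simp add: K_def)
    qed
    have pq: "real_of_int (fst z - fst c) \<ge> real m" "real_of_int (snd z - snd c) \<ge> real m"
      using lo nK cK by (auto simp: abs_le_iff)
    then have pq': "fst z - fst c \<ge> int m" "snd z - snd c \<ge> int m" by linarith+
    define p q where "p = nat (fst z - fst c)" and "q = nat (snd z - snd c)"
    have mpq: "m \<le> p" "m \<le> q" using pq' by (simp_all add: p_def q_def)
    have zpq: "z = site_at c p q" using pq' by (auto simp: site_at_def p_def q_def prod_eq_iff)
    have p: "real p = real_of_int (fst z) - ?c1" and q: "real q = real_of_int (snd z) - ?c2"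
      using pq' by (auto simp: p_def q_def)
    have "0 \<le> ?n * \<delta>" using \<delta> by simp
    then have "fst z \<ge> 0" "snd z \<ge> 0" using lo by linarith+
    then have nz: "?n = real_of_int (fst z) + real_of_int (snd z)" by (simp add: l1norm_def)
    have e: "(\<zeta> + \<epsilon>) * (?c1 + ?c2) - ?c1 \<le> K" "?c1 - (\<zeta> - \<epsilon>) * (?c1 + ?c2) \<le> K"
    proof -
      have K_eq: "K = (\<bar>\<zeta>\<bar> + \<epsilon>) * (\<bar>?c1\<bar> + \<bar>?c2\<bar>) + (\<bar>?c1\<bar> + \<bar>?c2\<bar>) + real m"
        by (simp add: K_def algebra_simps)
      have "(\<zeta> + \<epsilon>) * (?c1 + ?c2) \<le> \<bar>(\<zeta> + \<epsilon>) * (?c1 + ?c2)\<bar>" by simp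
      also have "\<dots> \<le> (\<bar>\<zeta>\<bar> + \<epsilon>) * (\<bar>?c1\<bar> + \<bar>?c2\<bar>)"
        unfolding abs_mult using assms by (intro mult_mono) auto
      finally show "(\<zeta> + \<epsilon>) * (?c1 + ?c2) - ?c1 \<le> K" using K_eq by linarith
      have "- ((\<zeta> - \<epsilon>) * (?c1 + ?c2)) \<le> \<bar>(\<zeta> - \<epsilon>) * (?c1 + ?c2)\<bar>" by simp
      also have "\<dots> \<le> (\<bar>\<zeta>\<bar> + \<epsilon>) * (\<bar>?c1\<bar> + \<bar>?c2\<bar>)"
        unfolding abs_mult using assms by (intro mult_mono) auto
      finally show "?c1 - (\<zeta> - \<epsilon>) * (?c1 + ?c2) \<le> K" using K_eq by linarith
    qed
    have n2: "?n * (2 * \<delta>) \<le> ?n * \<epsilon>" using \<delta> by (intro mult_left_mono) auto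
    have "real p \<le> (\<zeta> + \<epsilon>) * real (p + q)"
    proof -
      have "real p - (\<zeta> + \<epsilon>) * real (p + q) = real_of_int (fst z) - \<zeta> * ?n - \<epsilon> * ?n + ((\<zeta> + \<epsilon>) * (?c1 + ?c2) - ?c1)"
        unfolding of_nat_add p q nz by (simp add: algebra_simps)
      also have "\<dots> \<le> ?n * \<delta> - \<epsilon> * ?n + K" using z1 e by linarith
      also have "\<dots> \<le> 0" using nK n2 by (simp add: algebra_simps)
      finally show ?thesis by simp
    qed
    moreover have "(\<zeta> - \<epsilon>) * real (p + q) \<le> real p"
    proof -
      have "(\<zeta> - \<epsilon>) * real (p + q) - real p = \<zeta> * ?n - real_of_int (fst z) - \<epsilon> * ?n + (?c1 - (\<zeta> - \<epsilon>) * (?c1 + ?c2))"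
        unfolding of_nat_add p q nz by (simp add: algebra_simps)
      also have "\<dots> \<le> ?n * \<delta> - \<epsilon> * ?n + K" using z1 e by linarith
      also have "\<dots> \<le> 0" using nK n2 by (simp add: algebra_simps)
      finally show ?thesis by simp
    qed
    ultimately show "\<exists>p q. z = site_at c p q \<and> m \<le> p \<and> m \<le> q \<and>
      real p \<le> (\<zeta> + \<epsilon>) * real (p + q) \<and> (\<zeta> - \<epsilon>) * real (p + q) \<le> real p"
      using zpq mpq by blast
  qed
qed

text \<open>Summability is known level by level, while it is used on rows and columns. Sorting a
  finite set of far sites by level bounds its sum by a tail of the series.\<close>

lemma summable_level_tail:
  fixes f :: "nat \<Rightarrow> nat \<Rightarrow> real"
  assumes "\<And>a b. 0 \<le> f a b"
    and "summable (\<lambda>n. \<Sum>a\<in>{a. a \<le> n \<and> (a, n - a) \<in> B}. f a (n - a))" "\<delta> > 0"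
  obtains m where "\<And>A. finite A \<Longrightarrow> A \<subseteq> B \<Longrightarrow> (\<forall>(a, b)\<in>A. m \<le> a + b) \<Longrightarrow> (\<Sum>(a, b)\<in>A. f a b) < \<delta>"
proof -
  define s where "s n = (\<Sum>a\<in>{a. a \<le> n \<and> (a, n - a) \<in> B}. f a (n - a))" for n
  have s0: "0 \<le> s n" for n unfolding s_def by (intro sum_nonneg assms)
  have sm: "summable s" using assms(2) unfolding s_def[abs_def] .
  obtain m where m: "norm (\<Sum>i. s (i + n)) < \<delta>" if "n \<ge> m" for n
    using suminf_exist_split[OF \<open>\<delta> > 0\<close> sm] by blast
  show thesis
  proof (rule that[of m])
    fix A assume A: "finite A" "A \<subseteq> B" "\<forall>(a, b)\<in>A. m \<le> a + b"
    define L where "L = Suc (\<Sum>(a, b)\<in>A. a + b)"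
    have L: "a + b < L" if "(a, b) \<in> A" for a b
      using member_le_sum[OF that, of "\<lambda>(a, b). a + b"] A by (auto simp: L_def)
    have "(\<Sum>(a, b)\<in>A. f a b) = (\<Sum>n\<in>{m..<L}. \<Sum>(a, b)\<in>{p\<in>A. (\<lambda>(a, b). a + b) p = n}. f a b)"
      by (rule sum.group[symmetric]) (use A L in auto)
    also have "\<dots> \<le> (\<Sum>n\<in>{m..<L}. s n)"
    proof (rule sum_mono)
      fix n
      have "(\<Sum>(a, b)\<in>{p\<in>A. (\<lambda>(a, b). a + b) p = n}. f a b) = (\<Sum>a\<in>fst ` {p\<in>A. (\<lambda>(a, b). a + b) p = n}. f a (n - a))"
        by (subst sum.reindex) (auto simp: inj_on_def intro!: sum.cong)
      also have "\<dots> \<le> s n"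
        unfolding s_def using A(2) by (intro sum_mono2) (auto intro: assms)
      finally show "(\<Sum>(a, b)\<in>{p\<in>A. (\<lambda>(a, b). a + b) p = n}. f a b) \<le> s n" .
    qed
    also have "\<dots> = (\<Sum>i<L - m. s (i + m))"
      by (rule sum.reindex_bij_witness[where i="\<lambda>i. i + m" and j="\<lambda>i. i - m"]) auto
    also have "\<dots> \<le> (\<Sum>i. s (i + m))"
      by (rule sum_le_suminf) (use sm s0 in \<open>auto simp: summable_iff_shift\<close>)
    also have "\<dots> < \<delta>" using m[of m] by auto
    finally show "(\<Sum>(a, b)\<in>A. f a b) < \<delta>" .
  qed
qed

text \<open>For a far point in the zone, the north row of its rectangle lies in the cone that the
  transformed walk avoids, so the correction in \<open>bridge_comparison\<close> tends to 0.\<close>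

lemma bridge_upper:
  assumes reg: "regular_field c \<eta>" and \<zeta>: "0 < \<zeta>" "\<zeta> < 1" and "\<epsilon> > 0"
    and sm: "summable (\<lambda>n. \<Sum>a\<in>{a. a \<le> n \<and> (a, n - a) \<in> {(a, b). real a \<le> (\<zeta> + \<epsilon>) * real (a + b)}}. doob_mass c \<eta> a (n - a))"
    and x: "c \<sqsubseteq> x" and "\<delta> > 0"
  shows "\<exists>M. \<forall>z\<in>zone \<zeta> M. bridge (true_env c \<eta>) x z \<le> doob_at c \<eta> x + \<delta>"
proof -
  let ?w = "true_env c \<eta>"
  let ?B = "{(a, b). real a \<le> (\<zeta> + \<epsilon>) * real (a + b)}"
  define D where "D = pass ?w c x * harm_at c \<eta> x"
  obtain i j where xij: "x = site_at c i j" using x below_site_at by blast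
  have nn: "0 \<le> doob_mass c \<eta> a b" for a b
    unfolding doob_mass_def using pass_nonneg[OF is_env_true_env] harm_pos[OF reg] by (simp add: less_imp_le)
  have D: "D > 0"
    using bridge_comparison(1)[OF reg x, of "Suc i" "Suc j"] by (simp add: D_def xij site_at_def)
  obtain m where m: "\<And>A. finite A \<Longrightarrow> A \<subseteq> ?B \<Longrightarrow> (\<forall>(a, b)\<in>A. m \<le> a + b) \<Longrightarrow> (\<Sum>(a, b)\<in>A. doob_mass c \<eta> a b) < \<delta> * D"
    using summable_level_tail[of "doob_mass c \<eta>" ?B "\<delta> * D"] nn sm mult_pos_pos[OF \<open>\<delta> > 0\<close> D] by blast
  obtain M where M: "\<And>z. z \<in> zone \<zeta> M \<Longrightarrow> \<exists>p q. z = site_at c p q \<and> m + Suc i + Suc j \<le> p \<and> m + Suc i + Suc j \<le> q \<and>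
    real p \<le> (\<zeta> + \<epsilon>) * real (p + q) \<and> (\<zeta> - \<epsilon>) * real (p + q) \<le> real p"
    using zone_quadrant[OF \<zeta> \<open>\<epsilon> > 0\<close>] by metis
  show ?thesis
  proof (rule exI[of _ M], rule ballI)
    fix z assume "z \<in> zone \<zeta> M"
    then obtain p q where z: "z = site_at c p q" and pq: "m + Suc i + Suc j \<le> p" "m + Suc i + Suc j \<le> q"
      "real p \<le> (\<zeta> + \<epsilon>) * real (p + q)" using M by blast
    \<comment> \<open>Seen from the corner, sites of the row above \<open>(p, q)\<close> with first
      offset at most p are no more eastern in direction than \<open>(p, q)\<close> itself.\<close>
    have inB: "(a, Suc q) \<in> ?B" if "a \<le> p" for a
    proof (cases "\<zeta> + \<epsilon> \<ge> 1")
      case True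
      then show ?thesis using mult_right_mono[OF True, of "real (a + Suc q)"] by (simp add: algebra_simps)
    next
      case False
      have "real a * (1 - (\<zeta> + \<epsilon>)) \<le> real p * (1 - (\<zeta> + \<epsilon>))"
        using False that by (intro mult_right_mono) auto
      also have "\<dots> \<le> (\<zeta> + \<epsilon>) * real q" using pq(3) by (simp add: algebra_simps)
      also have "\<dots> \<le> (\<zeta> + \<epsilon>) * real (Suc q)" using \<zeta> \<open>\<epsilon> > 0\<close> by (intro mult_left_mono) auto
      finally show ?thesis by (simp add: algebra_simps)
    qed
    have "(\<Sum>a\<le>p. doob_mass c \<eta> a (Suc q)) = (\<Sum>(a, b)\<in>(\<lambda>a. (a, Suc q)) ` {..p}. doob_mass c \<eta> a b)"
      by (subst sum.reindex) (auto simp: inj_on_def)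
    also have "\<dots> < \<delta> * D"
      by (rule m) (use inB pq in auto)
    finally have "(\<Sum>a\<le>p. doob_mass c \<eta> a (Suc q)) / D < \<delta>" using D by (simp add: field_simps)
    moreover have "bridge ?w x z * (1 - (\<Sum>a\<le>p. doob_mass c \<eta> a (Suc q)) / D) \<le> doob_at c \<eta> x"
      using bridge_comparison(2)[OF reg x, of p q] pq by (simp add: D_def z xij site_at_def)
    moreover have "bridge ?w x z * ((\<Sum>a\<le>p. doob_mass c \<eta> a (Suc q)) / D) \<le> 1 * ((\<Sum>a\<le>p. doob_mass c \<eta> a (Suc q)) / D)"
      using bridge_bounds[OF is_env_true_env] nn D by (intro mult_right_mono) (auto intro!: divide_nonneg_pos sum_nonneg)
    ultimately show "bridge ?w x z \<le> doob_at c \<eta> x + \<delta>" by (simp add: algebra_simps)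
  qed
qed

text \<open>The mirror image of \<open>bridge_upper\<close>: now the east column of the rectangle
  lies in the avoided cone.\<close>

lemma bridge_lower:
  assumes reg: "regular_field c \<eta>" and \<zeta>: "0 < \<zeta>" "\<zeta> < 1" and "\<epsilon> > 0"
    and sm: "summable (\<lambda>n. \<Sum>a\<in>{a. a \<le> n \<and> (a, n - a) \<in> {(a, b). (\<zeta> - \<epsilon>) * real (a + b) \<le> real a}}. doob_mass c \<eta> a (n - a))"
    and x: "c \<sqsubseteq> x" and "\<delta> > 0"
  shows "\<exists>M. \<forall>z\<in>zone \<zeta> M. doob_at c \<eta> x - \<delta> \<le> bridge (true_env c \<eta>) x z"
proof -
  let ?w = "true_env c \<eta>"
  let ?B = "{(a, b). (\<zeta> - \<epsilon>) * real (a + b) \<le> real a}"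
  define D where "D = pass ?w c x * harm_at c \<eta> x"
  obtain i j where xij: "x = site_at c i j" using x below_site_at by blast
  have nn: "0 \<le> doob_mass c \<eta> a b" for a b
    unfolding doob_mass_def using pass_nonneg[OF is_env_true_env] harm_pos[OF reg] by (simp add: less_imp_le)
  have D: "D > 0"
    using bridge_comparison(1)[OF reg x, of "Suc i" "Suc j"] by (simp add: D_def xij site_at_def)
  obtain m where m: "\<And>A. finite A \<Longrightarrow> A \<subseteq> ?B \<Longrightarrow> (\<forall>(a, b)\<in>A. m \<le> a + b) \<Longrightarrow> (\<Sum>(a, b)\<in>A. doob_mass c \<eta> a b) < \<delta> * D"
    using summable_level_tail[of "doob_mass c \<eta>" ?B "\<delta> * D"] nn sm mult_pos_pos[OF \<open>\<delta> > 0\<close> D] by blast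
  obtain M where M: "\<And>z. z \<in> zone \<zeta> M \<Longrightarrow> \<exists>p q. z = site_at c p q \<and> m + Suc i + Suc j \<le> p \<and> m + Suc i + Suc j \<le> q \<and>
    real p \<le> (\<zeta> + \<epsilon>) * real (p + q) \<and> (\<zeta> - \<epsilon>) * real (p + q) \<le> real p"
    using zone_quadrant[OF \<zeta> \<open>\<epsilon> > 0\<close>] by metis
  show ?thesis
  proof (rule exI[of _ M], rule ballI)
    fix z assume "z \<in> zone \<zeta> M"
    then obtain p q where z: "z = site_at c p q" and pq: "m + Suc i + Suc j \<le> p" "m + Suc i + Suc j \<le> q"
      "(\<zeta> - \<epsilon>) * real (p + q) \<le> real p" using M by blast
    have inB: "(Suc p, b) \<in> ?B" if "b \<le> q" for b
    proof (cases "\<zeta> - \<epsilon> \<le> 0")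
      case True
      then have "(\<zeta> - \<epsilon>) * real (Suc p + b) \<le> 0" by (rule mult_nonpos_nonneg) simp
      also have "0 \<le> real (Suc p)" by simp
      finally show ?thesis by (simp add: add.assoc)
    next
      case False
      have "(\<zeta> - \<epsilon>) * real b \<le> (\<zeta> - \<epsilon>) * real q"
        using False that by (intro mult_left_mono) auto
      also have "\<dots> \<le> (1 - (\<zeta> - \<epsilon>)) * real p" using pq(3) by (simp add: algebra_simps)
      also have "\<dots> \<le> (1 - (\<zeta> - \<epsilon>)) * real (Suc p)" using \<zeta> \<open>\<epsilon> > 0\<close> by (intro mult_left_mono) auto
      finally show ?thesis by (simp add: algebra_simps)
    qed
    have "(\<Sum>b\<le>q. doob_mass c \<eta> (Suc p) b) = (\<Sum>(a, b)\<in>(\<lambda>b. (Suc p, b)) ` {..q}. doob_mass c \<eta> a b)"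
      by (subst sum.reindex) (auto simp: inj_on_def)
    also have "\<dots> < \<delta> * D"
      by (rule m) (use inB pq in auto)
    finally have "(\<Sum>b\<le>q. doob_mass c \<eta> (Suc p) b) / D < \<delta>" using D by (simp add: field_simps)
    moreover have "(1 - bridge ?w x z) * (1 - (\<Sum>b\<le>q. doob_mass c \<eta> (Suc p) b) / D) \<le> 1 - doob_at c \<eta> x"
      using bridge_comparison(3)[OF reg x, of p q] pq by (simp add: D_def z xij site_at_def)
    moreover have "(1 - bridge ?w x z) * ((\<Sum>b\<le>q. doob_mass c \<eta> (Suc p) b) / D) \<le> 1 * ((\<Sum>b\<le>q. doob_mass c \<eta> (Suc p) b) / D)"
      using bridge_bounds[OF is_env_true_env] nn D by (intro mult_right_mono) (auto intro!: divide_nonneg_pos sum_nonneg)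
    ultimately show "doob_at c \<eta> x - \<delta> \<le> bridge ?w x z" by (simp add: algebra_simps)
  qed
qed

section \<open>Polygamma functions and the characteristic direction\<close>

lemma Polygamma_deriv:
  "x > (0 :: real) \<Longrightarrow> (Polygamma n has_real_derivative Polygamma (Suc n) x) (at x)"
  by (rule has_field_derivative_Polygamma) (auto elim!: nonpos_Ints_cases)

lemma Polygamma_deriv_shift:
  "x + c > (0 :: real) \<Longrightarrow> ((\<lambda>x. Polygamma n (x + c)) has_real_derivative Polygamma (Suc n) (x + c)) (at x)"
  using DERIV_shift[of "Polygamma n" "Polygamma (Suc n) (x + c)" x c] Polygamma_deriv[of "x + c" n] by (simp add: add.commute)

lemma Polygamma_odd_pos: "x > (0 :: real) \<Longrightarrow> odd n \<Longrightarrow> Polygamma n x > 0"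
  by (rule Polygamma_real_odd_pos) (auto elim!: nonpos_Ints_cases)

lemma Polygamma_series:
  "n > 0 \<Longrightarrow> Polygamma n (z :: real) = (-1) ^ Suc n * fact n * (\<Sum>k. inverse ((z + real k) ^ Suc n))"
  by (simp add: Polygamma_def)

text \<open>The Cauchy--Schwarz inequality for the series representation.\<close>

lemma Polygamma_log_convex:
  fixes x :: real
  assumes "x > 0"
  shows "(Polygamma 3 x)\<^sup>2 < Polygamma 2 x * Polygamma 4 x"
proof -
  define S where "S n = (\<Sum>k. inverse ((x + real k) ^ n))" for n :: nat
  have sm: "summable (\<lambda>k. inverse ((x + real k) ^ n))" if "n \<ge> 2" for n
    using Polygamma_converges'[of x n] assms that by simp
  have pos: "x + real k > 0" for k using assms by simp
  have S3: "S 3 > 0" "S 5 > 0"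
    unfolding S_def by (auto intro!: suminf_pos sm simp: pos)
  \<comment> \<open>The value of r that minimises the quadratic
    \<open>r\<^sup>2 * S 3 - 2 * r * S 4 + S 5\<close>, which is a sum of nonnegative terms.\<close>
  define r where "r = S 4 / S 3"
  have "(\<lambda>k. r\<^sup>2 * inverse ((x + real k) ^ 3) - 2 * r * inverse ((x + real k) ^ 4) + inverse ((x + real k) ^ 5))
      sums (r\<^sup>2 * S 3 - 2 * r * S 4 + S 5)"
    unfolding S_def by (intro sums_add sums_diff sums_mult summable_sums sm) auto
  moreover have "r\<^sup>2 * inverse ((x + real k) ^ 3) - 2 * r * inverse ((x + real k) ^ 4) + inverse ((x + real k) ^ 5) \<ge> 0" for k
  proof -
    define y where "y = inverse (x + real k)"
    have "y \<ge> 0" using pos[of k] by (simp add: y_def)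
    then have "0 \<le> y ^ 3 * (r - y)\<^sup>2" by simp
    also have "\<dots> = r\<^sup>2 * y ^ 3 - 2 * r * y ^ 4 + y ^ 5"
      by (simp add: power2_eq_square algebra_simps power_numeral_reduce)
    finally show ?thesis by (simp add: y_def power_inverse)
  qed
  ultimately have "0 \<le> r\<^sup>2 * S 3 - 2 * r * S 4 + S 5"
    by (rule sums_le[OF _ sums_zero, rotated])
  moreover have rS: "r * S 3 = S 4" using S3 by (simp add: r_def)
  ultimately have "0 \<le> S 5 - r * S 4" by (simp add: power2_eq_square mult.assoc)
  then have "0 \<le> S 3 * (S 5 - r * S 4)" using S3 by simp
  also have "\<dots> = S 3 * S 5 - (r * S 3) * S 4" by (simp add: algebra_simps)
  \<comment> \<open>Cauchy-Schwarz is not strict as used here. The strict inequality comes from the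
    factorials, which contribute 36 on the left and 48 on the right.\<close>
  finally have "(S 4)\<^sup>2 \<le> S 3 * S 5" unfolding rS by (simp add: power2_eq_square)
  moreover have "S 3 * S 5 > 0" using S3 by simp
  moreover have "Polygamma 2 x = - 2 * S 3" "Polygamma 3 x = 6 * S 4" "Polygamma 4 x = - 24 * S 5"
    by (simp_all add: Polygamma_series S_def fact_numeral)
  ultimately show ?thesis by (simp add: power2_eq_square)
qed

text \<open>A termwise comparison of the two series. It shows that shifting the argument by a
  constant changes the value by a factor tending to 1 at infinity, as \<open>pg_ratio_large\<close>
  needs.\<close>

lemma Polygamma_2_ratio:
  fixes x c :: real
  assumes "x > 0" "c > 0"
  shows "(x / (x + c)) ^ 3 * (- Polygamma 2 x) \<le> - Polygamma 2 (x + c)"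
proof -
  have sm: "summable (\<lambda>k. inverse ((y + real k) ^ 3))" if "y > 0" for y :: real
    using Polygamma_converges'[of y 3] that by simp
  have "(x / (x + c)) ^ 3 * (\<Sum>k. inverse ((x + real k) ^ 3)) = (\<Sum>k. (x / (x + c)) ^ 3 * inverse ((x + real k) ^ 3))"
    by (rule suminf_mult[symmetric]) (rule sm[OF assms(1)])
  also have "\<dots> \<le> (\<Sum>k. inverse ((x + c + real k) ^ 3))"
  proof (rule suminf_le)
    fix k
    have "x / (x + c) * inverse (x + real k) \<le> inverse (x + c + real k)"
    proof -
      have "0 \<le> c * real k" using assms by simp
      then have "x * (x + c + real k) \<le> (x + c) * (x + real k)" by (simp add: algebra_simps)
      moreover have "0 < x + c + real k" "0 < (x + c) * (x + real k)" using assms by (auto intro!: mult_pos_pos add_pos_nonneg)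
      ultimately show ?thesis
        by (simp add: divide_inverse[symmetric] pos_divide_le_eq pos_le_divide_eq inverse_eq_divide)
    qed
    then have "(x / (x + c) * inverse (x + real k)) ^ 3 \<le> inverse (x + c + real k) ^ 3"
      using assms by (intro power_mono) auto
    then show "(x / (x + c)) ^ 3 * inverse ((x + real k) ^ 3) \<le> inverse ((x + c + real k) ^ 3)"
      by (simp only: power_mult_distrib power_inverse)
  qed (use assms in \<open>auto intro!: sm summable_mult\<close>)
  finally have "(x / (x + c)) ^ 3 * (2 * (\<Sum>k. inverse ((x + real k) ^ 3))) \<le> 2 * (\<Sum>k. inverse ((x + c + real k) ^ 3))"
    by simp
  moreover have "- Polygamma 2 y = 2 * (\<Sum>k. inverse ((y + real k) ^ 3))" for y :: real
    by (simp add: Polygamma_series fact_numeral)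
  ultimately show ?thesis by metis
qed

context
  fixes \<alpha> \<beta> :: real
  assumes ab: "\<alpha> > 0" "\<beta> > 0"
begin

text \<open>These are the rates attached by \<open>log_mgf\<close> to the horizontal and vertical
  edge laws with parameter \<open>l\<close>, that is, the means of their logarithms.\<close>

definition log_u :: "real \<Rightarrow> real" where "log_u l = Digamma (l + \<beta>) - Digamma l"
definition log_w :: "real \<Rightarrow> real" where "log_w l = Digamma (l + \<beta>) - Digamma (l + (\<alpha> + \<beta>))"

definition pg_num :: "real \<Rightarrow> real" where "pg_num l = Polygamma 1 (l + \<beta>) - Polygamma 1 (l + (\<alpha> + \<beta>))"
definition pg_den :: "real \<Rightarrow> real" where "pg_den l = Polygamma 1 l - Polygamma 1 (l + \<beta>)"

lemma pg_pos: "l > 0 \<Longrightarrow> pg_num l > 0" "l > 0 \<Longrightarrow> pg_den l > 0"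
  using ab Polygamma_real_strict_antimono[of "l + \<beta>" "l + (\<alpha> + \<beta>)" 1] Polygamma_real_strict_antimono[of l "l + \<beta>" 1]
  by (auto simp: pg_num_def pg_den_def)

lemma log_u_deriv: "l > 0 \<Longrightarrow> (log_u has_real_derivative - pg_den l) (at l)"
  unfolding log_u_def[abs_def] pg_den_def
  using DERIV_diff[OF Polygamma_deriv_shift[of l \<beta> 0] Polygamma_deriv[of l 0]] ab by simp

lemma log_w_deriv: "l > 0 \<Longrightarrow> (log_w has_real_derivative pg_num l) (at l)"
  unfolding log_w_def[abs_def] pg_num_def
  using DERIV_diff[OF Polygamma_deriv_shift[of l \<beta> 0] Polygamma_deriv_shift[of l "\<alpha> + \<beta>" 0]] ab by simp

lemma log_u_strict_antimono:
  assumes "0 < l" "l < l'"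
  shows "log_u l' < log_u l"
proof (rule DERIV_neg_imp_decreasing[OF assms(2), of log_u])
  fix x assume "l \<le> x"
  then have "x > 0" using assms by simp
  then show "\<exists>y. (log_u has_real_derivative y) (at x) \<and> y < 0"
    using log_u_deriv[of x] pg_pos(2)[of x] by (intro exI[of _ "- pg_den x"]) auto
qed

lemma log_w_strict_mono:
  assumes "0 < l" "l < l'"
  shows "log_w l < log_w l'"
proof (rule DERIV_pos_imp_increasing[OF assms(2), of log_w])
  fix x assume "l \<le> x"
  then have "x > 0" using assms by simp
  then show "\<exists>y. (log_w has_real_derivative y) (at x) \<and> y > 0"
    using log_w_deriv[of x] pg_pos(1)[of x] by (intro exI[of _ "pg_num x"]) auto
qed

lemma log_u_cont: "l > 0 \<Longrightarrow> isCont log_u l" and log_w_cont: "l > 0 \<Longrightarrow> isCont log_w l"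
  using log_u_deriv log_w_deriv DERIV_isCont by blast+

lemma pg_num_deriv:
  "l > 0 \<Longrightarrow> (pg_num has_real_derivative Polygamma 2 (l + \<beta>) - Polygamma 2 (l + (\<alpha> + \<beta>))) (at l)"
  unfolding pg_num_def[abs_def]
  using DERIV_diff[OF Polygamma_deriv_shift[of l \<beta> 1] Polygamma_deriv_shift[of l "\<alpha> + \<beta>" 1]] ab
  by (simp add: numeral_2_eq_2)

lemma pg_den_deriv:
  "l > 0 \<Longrightarrow> (pg_den has_real_derivative Polygamma 2 l - Polygamma 2 (l + \<beta>)) (at l)"
  unfolding pg_den_def[abs_def]
  using DERIV_diff[OF Polygamma_deriv[of l 1] Polygamma_deriv_shift[of l \<beta> 1]] ab
  by (simp add: numeral_2_eq_2)

text \<open>Minus the quotient of the derivatives of \<open>log_w\<close> and \<open>log_u\<close>.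
  The derivative of \<open>log_mix \<zeta>\<close> vanishes exactly where this equals
  \<open>\<zeta> / (1 - \<zeta>)\<close>, so it encodes the characteristic direction of the
  parameter.\<close>

definition pg_ratio :: "real \<Rightarrow> real" where "pg_ratio l = pg_num l / pg_den l"

text \<open>By Cauchy's mean value theorem the logarithmic derivatives of numerator and denominator
  are values of the quotient of the third and second polygamma functions, at points on opposite
  sides of \<open>x + \<beta>\<close>. That quotient is increasing by
  \<open>Polygamma_log_convex\<close>.\<close>

lemma pg_ratio_strict_mono:
  assumes "0 < l" "l < l'"
  shows "pg_ratio l < pg_ratio l'"
proof (rule DERIV_pos_imp_increasing[OF assms(2)])
  fix x assume "l \<le> x" "x \<le> l'"
  then have x: "x > 0" using assms by simp
  define R where "R y = Polygamma 3 y / Polygamma 2 y" for y :: real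
  have neg: "Polygamma 2 y < 0" if "y > 0" for y :: real using that by (intro Polygamma_real_even_neg) auto
  have R_mono: "R y < R y'" if y: "0 < y" "y < y'" for y y'
  proof (rule DERIV_pos_imp_increasing[OF y(2)])
    fix t assume "y \<le> t" "t \<le> y'"
    then have t: "t > 0" using y by simp
    have "(R has_real_derivative (Polygamma 4 t * Polygamma 2 t - Polygamma 3 t * Polygamma 3 t) / (Polygamma 2 t * Polygamma 2 t)) (at t)"
      unfolding R_def[abs_def]
      using DERIV_divide[OF Polygamma_deriv[OF t, of 3] Polygamma_deriv[OF t, of 2]] neg[OF t] by (simp add: eval_nat_numeral)
    moreover have "(Polygamma 4 t * Polygamma 2 t - Polygamma 3 t * Polygamma 3 t) / (Polygamma 2 t * Polygamma 2 t) > 0"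
      using Polygamma_log_convex[OF t] neg[OF t] by (intro divide_pos_pos) (auto simp: power2_eq_square mult.commute mult_neg_neg)
    ultimately show "\<exists>d. (R has_real_derivative d) (at t) \<and> d > 0" by blast
  qed
  have cauchy: "\<exists>\<theta>. y < \<theta> \<and> \<theta> < y' \<and> Polygamma 2 y - Polygamma 2 y' = (Polygamma 1 y - Polygamma 1 y') * R \<theta>"
    if y: "0 < y" "y < y'" for y y'
  proof -
    have "\<exists>\<theta>. y < \<theta> \<and> \<theta> < y' \<and> (Polygamma 2 y' - Polygamma 2 y) * Polygamma 2 \<theta> = (Polygamma 1 y' - Polygamma 1 y) * Polygamma 3 \<theta>"
    proof (rule GMVT'[OF y(2)])
      show "(Polygamma 1 has_real_derivative Polygamma 2 z) (at z)" if "y < z" "z < y'" for z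
        using Polygamma_deriv[of z 1] y that by (simp add: numeral_2_eq_2)
      show "(Polygamma 2 has_real_derivative Polygamma 3 z) (at z)" if "y < z" "z < y'" for z
        using Polygamma_deriv[of z 2] y that by (simp add: eval_nat_numeral)
      have "isCont (Polygamma n) z" if "y \<le> z" for n z
        by (rule DERIV_isCont[OF Polygamma_deriv]) (use that y in linarith)
      then show "isCont (Polygamma 2) z" "isCont (Polygamma 1) z" if "y \<le> z" for z
        using that by blast+
    qed
    then obtain \<theta> where \<theta>: "y < \<theta>" "\<theta> < y'"
      "(Polygamma 2 y' - Polygamma 2 y) * Polygamma 2 \<theta> = (Polygamma 1 y' - Polygamma 1 y) * Polygamma 3 \<theta>" by blast
    have "Polygamma 2 \<theta> \<noteq> 0" using neg[of \<theta>] y \<theta> by simp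
    then have "Polygamma 2 y - Polygamma 2 y' = (Polygamma 1 y - Polygamma 1 y') * R \<theta>"
      using \<theta>(3) by (simp add: R_def field_simps)
    then show ?thesis using \<theta> by blast
  qed
  obtain \<theta>1 where \<theta>1: "x + \<beta> < \<theta>1" "Polygamma 2 (x + \<beta>) - Polygamma 2 (x + (\<alpha> + \<beta>)) = pg_num x * R \<theta>1"
    using cauchy[of "x + \<beta>" "x + (\<alpha> + \<beta>)"] x ab by (auto simp: pg_num_def)
  obtain \<theta>2 where \<theta>2: "x < \<theta>2" "\<theta>2 < x + \<beta>" "Polygamma 2 x - Polygamma 2 (x + \<beta>) = pg_den x * R \<theta>2"
    using cauchy[of x "x + \<beta>"] x ab by (auto simp: pg_den_def)
  have "(pg_ratio has_real_derivative (pg_num x * R \<theta>1 * pg_den x - pg_num x * (pg_den x * R \<theta>2)) / (pg_den x * pg_den x)) (at x)"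
    unfolding pg_ratio_def[abs_def]
    using DERIV_divide[OF pg_num_deriv[OF x] pg_den_deriv[OF x]] pg_pos[OF x] by (simp add: \<theta>1(2) \<theta>2(3))
  moreover have "(pg_num x * R \<theta>1 * pg_den x - pg_num x * (pg_den x * R \<theta>2)) / (pg_den x * pg_den x) > 0"
  proof -
    have "R \<theta>2 < R \<theta>1" using R_mono[of \<theta>2 \<theta>1] \<theta>1 \<theta>2 x by simp
    then have "0 < pg_num x * pg_den x * (R \<theta>1 - R \<theta>2)" using pg_pos[OF x] by simp
    then show ?thesis using pg_pos[OF x] by (intro divide_pos_pos) (auto simp: algebra_simps)
  qed
  ultimately show "\<exists>d. (pg_ratio has_real_derivative d) (at x) \<and> d > 0" by blast
qed

lemma pg_ratio_cont: "l > 0 \<Longrightarrow> isCont pg_ratio l"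
  unfolding pg_ratio_def[abs_def]
  by (intro continuous_divide DERIV_isCont[OF pg_num_deriv] DERIV_isCont[OF pg_den_deriv]) (use pg_pos(2)[of l] in auto)

lemma pg_mvt:
  assumes "l > 0"
  obtains \<theta>1 \<theta>2 where "l + \<beta> < \<theta>1" "\<theta>1 < l + (\<alpha> + \<beta>)" "l < \<theta>2" "\<theta>2 < l + \<beta>"
    "pg_num l = \<alpha> * - Polygamma 2 \<theta>1" "pg_den l = \<beta> * - Polygamma 2 \<theta>2"
proof -
  have m: "\<exists>z. y < z \<and> z < y' \<and> Polygamma 1 y' - Polygamma 1 y = (y' - y) * Polygamma 2 z" if "0 < y" "y < y'" for y y' :: real
  proof (rule MVT2[OF that(2)])
    fix z assume "y \<le> z" "z \<le> y'"
    then show "(Polygamma 1 has_real_derivative Polygamma 2 z) (at z)"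
      using Polygamma_deriv[of z 1] that by (simp add: numeral_2_eq_2)
  qed
  obtain \<theta>1 where "l + \<beta> < \<theta>1" "\<theta>1 < l + (\<alpha> + \<beta>)" "Polygamma 1 (l + (\<alpha> + \<beta>)) - Polygamma 1 (l + \<beta>) = \<alpha> * Polygamma 2 \<theta>1"
    using m[of "l + \<beta>" "l + (\<alpha> + \<beta>)"] assms ab by auto
  moreover obtain \<theta>2 where "l < \<theta>2" "\<theta>2 < l + \<beta>" "Polygamma 1 (l + \<beta>) - Polygamma 1 l = \<beta> * Polygamma 2 \<theta>2"
    using m[of l "l + \<beta>"] assms ab by auto
  ultimately show thesis using that[of \<theta>1 \<theta>2] by (simp add: pg_num_def pg_den_def)
qed

lemma pg2_antimono:
  assumes "0 < x" "x < (y :: real)"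
  shows "- Polygamma 2 y < - Polygamma 2 x"
  using Polygamma_real_strict_mono[of x y 2] assms by simp

lemma pg_ratio_less:
  assumes "l > 0"
  shows "pg_ratio l < \<alpha> / \<beta>"
proof -
  obtain \<theta>1 \<theta>2 where t: "l + \<beta> < \<theta>1" "l < \<theta>2" "\<theta>2 < l + \<beta>"
    "pg_num l = \<alpha> * - Polygamma 2 \<theta>1" "pg_den l = \<beta> * - Polygamma 2 \<theta>2" using pg_mvt[OF assms] by metis
  have "- Polygamma 2 \<theta>1 < - Polygamma 2 \<theta>2" using t assms by (intro pg2_antimono) auto
  then have "pg_num l * \<beta> < \<alpha> * pg_den l" using ab unfolding t by simp
  then show ?thesis using pg_pos[OF assms] ab by (simp add: pg_ratio_def field_simps)
qed

lemma filterlim_at_top_add_const: "filterlim (\<lambda>x :: real. x + c) at_top at_top"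
  using filterlim_tendsto_add_at_top[OF tendsto_const filterlim_ident, of c] by (simp add: add.commute)

text \<open>For large \<open>l\<close> both differences are close to \<alpha> and \<beta> times the
  same value of the second polygamma function, so the quotient approaches \<alpha>/\<beta>.\<close>

lemma pg_ratio_large:
  assumes "\<tau> < \<alpha> / \<beta>"
  shows "\<exists>l>0. \<tau> < pg_ratio l"
proof -
  have "((\<lambda>l. \<alpha> / \<beta> * (l / (l + (\<alpha> + \<beta>))) ^ 3) \<longlongrightarrow> \<alpha> / \<beta> * 1 ^ 3) at_top"
  proof (intro tendsto_intros)
    have "((\<lambda>l. 1 - (\<alpha> + \<beta>) / (l + (\<alpha> + \<beta>))) \<longlongrightarrow> 1 - 0) at_top"
      by (intro tendsto_diff tendsto_const tendsto_divide_0[OF tendsto_const] filterlim_at_top_imp_at_infinity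
          filterlim_at_top_add_const)
    then have "((\<lambda>l. 1 - (\<alpha> + \<beta>) / (l + (\<alpha> + \<beta>))) \<longlongrightarrow> 1) at_top" by simp
    moreover have "eventually (\<lambda>l. 1 - (\<alpha> + \<beta>) / (l + (\<alpha> + \<beta>)) = l / (l + (\<alpha> + \<beta>))) at_top"
      using eventually_gt_at_top[of 0] by eventually_elim (use ab in \<open>simp add: field_simps\<close>)
    ultimately show "((\<lambda>l. l / (l + (\<alpha> + \<beta>))) \<longlongrightarrow> 1) at_top"
      by (simp cong: tendsto_cong)
  qed
  then have "eventually (\<lambda>l. \<tau> < \<alpha> / \<beta> * (l / (l + (\<alpha> + \<beta>))) ^ 3) at_top"
    using assms by (intro order_tendstoD) auto
  then obtain l where l: "l > 0" "\<tau> < \<alpha> / \<beta> * (l / (l + (\<alpha> + \<beta>))) ^ 3"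
    using eventually_conj[OF _ eventually_gt_at_top[of 0]] by (metis (mono_tags, lifting) eventually_happens trivial_limit_at_top_linorder)
  obtain \<theta>1 \<theta>2 where t: "l + \<beta> < \<theta>1" "\<theta>1 < l + (\<alpha> + \<beta>)" "l < \<theta>2" "\<theta>2 < l + \<beta>"
    "pg_num l = \<alpha> * - Polygamma 2 \<theta>1" "pg_den l = \<beta> * - Polygamma 2 \<theta>2" using pg_mvt[OF l(1)] by metis
  have "\<alpha> / \<beta> * (l / (l + (\<alpha> + \<beta>))) ^ 3 * pg_den l \<le> \<alpha> * ((l / (l + (\<alpha> + \<beta>))) ^ 3 * - Polygamma 2 l)"
  proof -
    have "- Polygamma 2 \<theta>2 \<le> - Polygamma 2 l" using pg2_antimono[of l \<theta>2] t l by simp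
    then have "\<alpha> * (l / (l + (\<alpha> + \<beta>))) ^ 3 * - Polygamma 2 \<theta>2 \<le> \<alpha> * (l / (l + (\<alpha> + \<beta>))) ^ 3 * - Polygamma 2 l"
      using ab l by (intro mult_left_mono) auto
    then show ?thesis using ab unfolding t by simp
  qed
  also have "\<dots> \<le> \<alpha> * - Polygamma 2 (l + (\<alpha> + \<beta>))"
    using ab l by (intro mult_left_mono Polygamma_2_ratio) auto
  also have "\<dots> \<le> pg_num l"
    unfolding t(5) using ab t l pg2_antimono[of \<theta>1 "l + (\<alpha> + \<beta>)"] by (intro mult_left_mono) auto
  finally have "\<alpha> / \<beta> * (l / (l + (\<alpha> + \<beta>))) ^ 3 \<le> pg_ratio l"
    using pg_pos[OF l(1)] by (simp add: pg_ratio_def field_simps)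
  then show ?thesis using l by (intro exI[of _ l]) linarith
qed

text \<open>As \<open>l\<close> tends to 0 the denominator explodes like the inverse square of
  \<open>l\<close>, while the numerator stays below \<open>Polygamma 1 \<beta>\<close>.\<close>

lemma pg_ratio_small:
  assumes "\<tau> > 0"
  shows "\<exists>l>0. pg_ratio l < \<tau>"
proof -
  define C where "C = Polygamma 1 \<beta>"
  have C: "C > 0" unfolding C_def using ab by (intro Polygamma_odd_pos) auto
  \<comment> \<open>Chosen so that the inverse square of \<open>l\<close> is
    \<open>C * (1 + 1 / \<tau>) + 1\<close>. Subtracting the at most \<open>C\<close> lost to the
    second term of the denominator leaves more than \<open>C / \<tau>\<close>.\<close>
  define l where "l = 1 / sqrt (C * (1 + 1 / \<tau>) + 1)"
  have pos: "C * (1 + 1 / \<tau>) + 1 > 0" using C assms by (simp add: add_pos_pos)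
  then have l: "l > 0" by (simp add: l_def)
  have l2: "1 / l\<^sup>2 = C * (1 + 1 / \<tau>) + 1" using pos by (simp add: l_def power_divide)
  have "Polygamma 1 (l + 1) > 0" using l by (intro Polygamma_odd_pos) auto
  moreover have "Polygamma 1 (l + 1) = Polygamma 1 l - 1 / l\<^sup>2"
    using Polygamma_plus1[of l 1] l by (simp add: power2_eq_square)
  moreover have "Polygamma 1 (l + \<beta>) < C"
    unfolding C_def using Polygamma_real_strict_antimono[of \<beta> "l + \<beta>" 1] l ab by simp
  ultimately have den: "pg_den l > C / \<tau>" unfolding pg_den_def using l2 C by (simp add: algebra_simps)
  have "pg_num l < C"
    using \<open>Polygamma 1 (l + \<beta>) < C\<close> Polygamma_odd_pos[of "l + (\<alpha> + \<beta>)" 1] l ab by (simp add: pg_num_def)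
  also have "C < \<tau> * pg_den l" using den assms by (simp add: field_simps)
  finally have "pg_ratio l < \<tau>" using pg_pos[OF l] by (simp add: pg_ratio_def field_simps)
  then show ?thesis using l by blast
qed

lemma pg_ratio_surj:
  assumes "0 < \<tau>" "\<tau> < \<alpha> / \<beta>"
  shows "\<exists>l>0. pg_ratio l = \<tau>"
proof -
  obtain l1 l2 where l: "l1 > 0" "pg_ratio l1 < \<tau>" "l2 > 0" "\<tau> < pg_ratio l2"
    using pg_ratio_small[OF assms(1)] pg_ratio_large[OF assms(2)] by blast
  have "l1 < l2"
  proof (rule ccontr)
    assume "\<not> l1 < l2"
    then show False using pg_ratio_strict_mono[of l2 l1] l by (cases "l1 = l2") auto
  qed
  then have "\<exists>x\<ge>l1. x \<le> l2 \<and> pg_ratio x = \<tau>"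
    using l by (intro IVT) (auto intro!: pg_ratio_cont)
  then show ?thesis using l(1) less_le_trans by blast
qed

text \<open>The exponential rate, per step in direction \<zeta>, of the product of edge variables
  that bounds the passage probability.\<close>

definition log_mix :: "real \<Rightarrow> real \<Rightarrow> real" where
  "log_mix \<zeta> l = \<zeta> * log_u l + (1 - \<zeta>) * log_w l"

lemma log_mix_deriv:
  assumes "l > 0"
  shows "(log_mix \<zeta> has_real_derivative pg_den l * ((1 - \<zeta>) * pg_ratio l - \<zeta>)) (at l)"
proof -
  have "(log_mix \<zeta> has_real_derivative \<zeta> * - pg_den l + (1 - \<zeta>) * pg_num l) (at l)"
    unfolding log_mix_def[abs_def]
    by (intro DERIV_add DERIV_cmult log_u_deriv log_w_deriv assms)
  moreover have "\<zeta> * - pg_den l + (1 - \<zeta>) * pg_num l = pg_den l * ((1 - \<zeta>) * pg_ratio l - \<zeta>)"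
    using pg_pos(2)[OF assms] by (simp add: pg_ratio_def field_simps)
  ultimately show ?thesis by simp
qed

text \<open>The derivative has the sign of \<open>(1 - \<zeta>) * pg_ratio l - \<zeta>\<close>,
  which increases through 0 at \<open>l0\<close>. Strictness of the minimum is what later creates
  the exponential decay.\<close>

lemma log_mix_min:
  assumes "0 < \<zeta>" "\<zeta> < 1" "l0 > 0" "pg_ratio l0 = \<zeta> / (1 - \<zeta>)" "l > 0" "l \<noteq> l0"
  shows "log_mix \<zeta> l0 < log_mix \<zeta> l"
proof -
  have cont: "continuous_on {x..y} (log_mix \<zeta>)" if "x > 0" for x y
    by (intro continuous_at_imp_continuous_on ballI DERIV_isCont[OF log_mix_deriv]) (use that in auto)
  have z: "(1 - \<zeta>) * pg_ratio l0 = \<zeta>" using assms by simp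
  show ?thesis
  proof (cases "l0 < l")
    case True
    show ?thesis
    proof (rule DERIV_pos_imp_increasing_open[OF True _ cont])
      fix x assume x: "l0 < x" "x < l"
      then have "(1 - \<zeta>) * pg_ratio l0 < (1 - \<zeta>) * pg_ratio x"
        using assms by (intro mult_strict_left_mono pg_ratio_strict_mono) auto
      then have "pg_den x * ((1 - \<zeta>) * pg_ratio x - \<zeta>) > 0"
        using z pg_pos[of x] x assms by (intro mult_pos_pos) auto
      then show "\<exists>y. (log_mix \<zeta> has_real_derivative y) (at x) \<and> y > 0"
        using log_mix_deriv[of x] x assms by fastforce
    qed (use assms in auto)
  next
    case False
    then have "l < l0" using assms by simp
    then show ?thesis
    proof (rule DERIV_neg_imp_decreasing_open[OF _ _ cont])
      fix x assume x: "l < x" "x < l0"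
      then have "(1 - \<zeta>) * pg_ratio x < (1 - \<zeta>) * pg_ratio l0"
        using assms by (intro mult_strict_left_mono pg_ratio_strict_mono) auto
      then have "pg_den x * ((1 - \<zeta>) * pg_ratio x - \<zeta>) < 0"
        using z pg_pos[of x] x assms by (intro mult_pos_neg) auto
      then show "\<exists>y. (log_mix \<zeta> has_real_derivative y) (at x) \<and> y < 0"
        using log_mix_deriv[of x] x assms by fastforce
    qed (use assms in auto)
  qed
qed

text \<open>In the drift direction the critical value is \<open>\<alpha> / \<beta>\<close>, which
  \<open>pg_ratio\<close> stays below. There is no minimiser, and every parameter is improved by a
  larger one.\<close>

lemma log_mix_drift_decreasing:
  assumes "0 < l" "l < l'"
  shows "log_mix (\<alpha> / (\<alpha> + \<beta>)) l' < log_mix (\<alpha> / (\<alpha> + \<beta>)) l"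
proof (rule DERIV_neg_imp_decreasing[OF assms(2)])
  fix x assume "l \<le> x" "x \<le> l'"
  then have x: "x > 0" using assms by simp
  have e: "1 - \<alpha> / (\<alpha> + \<beta>) = \<beta> / (\<alpha> + \<beta>)" using ab by (simp add: field_simps)
  have "\<beta> / (\<alpha> + \<beta>) * pg_ratio x < \<beta> / (\<alpha> + \<beta>) * (\<alpha> / \<beta>)"
    using ab by (intro mult_strict_left_mono pg_ratio_less x) auto
  also have "\<dots> = \<alpha> / (\<alpha> + \<beta>)" using ab by simp
  finally have "pg_den x * ((1 - \<alpha> / (\<alpha> + \<beta>)) * pg_ratio x - \<alpha> / (\<alpha> + \<beta>)) < 0"
    unfolding e using pg_pos[OF x] by (intro mult_pos_neg) auto
  then show "\<exists>y. (log_mix (\<alpha> / (\<alpha> + \<beta>)) has_real_derivative y) (at x) \<and> y < 0"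
    using log_mix_deriv[OF x] by blast
qed

lemma Digamma_diff_tendsto_0:
  assumes "c > 0"
  shows "((\<lambda>l :: real. Digamma (l + c) - Digamma l) \<longlongrightarrow> 0) at_top"
proof (rule tendsto_sandwich[of "\<lambda>_. 0" _ _ "\<lambda>l. real (nat \<lceil>c\<rceil>) / l"])
  let ?m = "nat \<lceil>c\<rceil>"
  show "eventually (\<lambda>l :: real. 0 \<le> Digamma (l + c) - Digamma l) at_top"
    using eventually_gt_at_top[of 0] by eventually_elim (use assms Digamma_real_mono in force)
  show "eventually (\<lambda>l :: real. Digamma (l + c) - Digamma l \<le> real ?m / l) at_top"
    using eventually_gt_at_top[of 0]
  proof eventually_elim
    case (elim l)
    have step: "Digamma (l + real n) - Digamma l \<le> real n / l" for n
    proof (induction n)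
      case (Suc n)
      have "Digamma (l + real n + 1) = Digamma (l + real n) + 1 / (l + real n)"
        using elim by (intro Digamma_plus1) (auto simp: add_eq_0_iff)
      moreover have "1 / (l + real n) \<le> 1 / l" using elim by (intro frac_le) auto
      ultimately show ?case using Suc by (simp add: add_divide_distrib add_ac)
    qed simp
    have "Digamma (l + c) \<le> Digamma (l + real ?m)"
      using elim assms by (intro Digamma_real_mono) (auto simp: le_of_int_ceiling)
    then show ?case using step[of ?m] by linarith
  qed
  show "((\<lambda>l. real ?m / l) \<longlongrightarrow> 0) at_top"
    by (rule tendsto_divide_0[OF tendsto_const]) (simp add: filterlim_at_top_imp_at_infinity filterlim_ident)
qed simp

lemma log_uw_tendsto_0: "(log_u \<longlongrightarrow> 0) at_top" "(log_w \<longlongrightarrow> 0) at_top"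
proof -
  show "(log_u \<longlongrightarrow> 0) at_top"
    unfolding log_u_def[abs_def] by (rule Digamma_diff_tendsto_0) (use ab in auto)
  have "((\<lambda>l. (Digamma (l + \<beta>) - Digamma l) - (Digamma (l + (\<alpha> + \<beta>)) - Digamma l)) \<longlongrightarrow> 0 - 0) at_top"
    by (intro tendsto_diff Digamma_diff_tendsto_0) (use ab in auto)
  then show "(log_w \<longlongrightarrow> 0) at_top" by (simp add: log_w_def[abs_def])
qed

end

section \<open>Approximation of a direction by stationary pairs\<close>

definition stat_param :: "real \<Rightarrow> real \<Rightarrow> real measure \<Rightarrow> real measure \<Rightarrow> real \<Rightarrow> real \<Rightarrow> bool" where
  "stat_param \<alpha> \<beta> LU LV u w \<longleftrightarrow> stat_pair \<alpha> \<beta> LU LV \<and>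
     (\<exists>r1 m1 r2 m2. log_mgf LU r1 m1 u \<and> log_mgf LV r2 m2 w)"

lemma stat_param_swap: "stat_param \<alpha> \<beta> LU LV u w \<Longrightarrow> stat_param \<beta> \<alpha> LV LU w u"
  unfolding stat_param_def using stat_pair_swap by blast

lemma Beta_real_exp: "a > 0 \<Longrightarrow> b > 0 \<Longrightarrow> Beta a b = exp (ln_Gamma a + ln_Gamma b - ln_Gamma (a + b) :: real)"
  by (simp add: Beta_def Gamma_real_pos_exp exp_add exp_diff)

lemma ln_Gamma_deriv_shift:
  assumes "c > (0 :: real)"
  shows "((\<lambda>t. ln_Gamma (c + t)) has_real_derivative Digamma c) (at 0)"
    and "((\<lambda>t. ln_Gamma (c - t)) has_real_derivative - Digamma c) (at 0)"
proof -
  show *: "((\<lambda>t. ln_Gamma (c + t)) has_real_derivative Digamma c) (at 0)"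
    using DERIV_shift[of ln_Gamma "Digamma c" 0 c] has_field_derivative_ln_Gamma_real[OF assms] by (simp add: add.commute)
  show "((\<lambda>t. ln_Gamma (c - t)) has_real_derivative - Digamma c) (at 0)"
    using DERIV_mirror[of "\<lambda>t. ln_Gamma (c + t)" "Digamma c" 0] * by simp
qed

lemma log_mgf_beta_borel:
  assumes "a > 0" "b > 0"
  shows "log_mgf (beta_borel a b) a (\<lambda>t. ln_Gamma (a + t) - ln_Gamma (a + b + t) - (ln_Gamma a - ln_Gamma (a + b)))
    (Digamma a - Digamma (a + b))"
  unfolding log_mgf_def
proof (intro conjI allI impI)
  show "((\<lambda>t. ln_Gamma (a + t) - ln_Gamma (a + b + t) - (ln_Gamma a - ln_Gamma (a + b)))
     has_real_derivative Digamma a - Digamma (a + b)) (at 0)"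
    using DERIV_diff[OF DERIV_diff[OF ln_Gamma_deriv_shift(1)[of a] ln_Gamma_deriv_shift(1)[of "a + b"]] DERIV_const] assms
    by simp
  fix t :: real assume t: "\<bar>t\<bar> < a"
  then have "a + t > 0" by simp
  then have "Beta (a + t) b / Beta a b = exp (ln_Gamma (a + t) - ln_Gamma (a + b + t) - (ln_Gamma a - ln_Gamma (a + b)))"
    using assms by (simp add: Beta_real_exp exp_diff[symmetric] algebra_simps)
  then show "(\<integral>\<^sup>+x. ennreal (x powr t) \<partial>beta_borel a b) =
     ennreal (exp (ln_Gamma (a + t) - ln_Gamma (a + b + t) - (ln_Gamma a - ln_Gamma (a + b))))"
    using assms t by (simp add: nn_integral_beta_borel_powr)
qed (use assms in auto)

lemma log_mgf_inv_beta:
  assumes "a > 0" "b > 0"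
  shows "log_mgf (inv_beta a b) a (\<lambda>t. ln_Gamma (a - t) - ln_Gamma (a + b - t) - (ln_Gamma a - ln_Gamma (a + b)))
    (Digamma (a + b) - Digamma a)"
  unfolding log_mgf_def
proof (intro conjI allI impI)
  show "((\<lambda>t. ln_Gamma (a - t) - ln_Gamma (a + b - t) - (ln_Gamma a - ln_Gamma (a + b)))
     has_real_derivative Digamma (a + b) - Digamma a) (at 0)"
    using DERIV_diff[OF DERIV_diff[OF ln_Gamma_deriv_shift(2)[of a] ln_Gamma_deriv_shift(2)[of "a + b"]] DERIV_const] assms
    by simp
  fix t :: real assume t: "\<bar>t\<bar> < a"
  have "(\<integral>\<^sup>+x. ennreal (x powr t) \<partial>inv_beta a b) = (\<integral>\<^sup>+x. ennreal (inverse x powr t) \<partial>beta_borel a b)"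
    unfolding inv_beta_def by (subst nn_integral_distr) auto
  also have "\<dots> = (\<integral>\<^sup>+x. ennreal (x powr (- t)) \<partial>beta_borel a b)"
    by (intro nn_integral_cong_AE, rule AE_mp[OF AE_beta_borel AE_I2]) (auto simp: powr_def ln_inverse)
  also have "\<dots> = ennreal (exp (ln_Gamma (a - t) - ln_Gamma (a + b - t) - (ln_Gamma a - ln_Gamma (a + b))))"
    using log_mgf_beta_borel[OF assms] t unfolding log_mgf_def by simp
  finally show "(\<integral>\<^sup>+x. ennreal (x powr t) \<partial>inv_beta a b) =
     ennreal (exp (ln_Gamma (a - t) - ln_Gamma (a + b - t) - (ln_Gamma a - ln_Gamma (a + b))))" .
qed (use assms in auto)

lemma stat_param_beta:
  assumes "\<alpha> > 0" "\<beta> > 0" "l > 0"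
  shows "stat_param \<alpha> \<beta> (inv_beta l \<beta>) (beta_borel (l + \<beta>) \<alpha>) (log_u \<beta> l) (log_w \<alpha> \<beta> l)"
  unfolding stat_param_def log_u_def[OF assms(1,2)] log_w_def[OF assms(1,2)]
  using stat_pair_beta[OF assms(3,1,2)] log_mgf_inv_beta[OF assms(3,2)] log_mgf_beta_borel[of "l + \<beta>" \<alpha>] assms
  by (auto simp: add_ac)

definition doob_law :: "real measure \<Rightarrow> real measure \<Rightarrow> real measure" where
  "doob_law LU LV = distr (LU \<Otimes>\<^sub>M LV) borel (\<lambda>(u, v). doob_weight u v)"

lemma sets_doob_law [simp, measurable_cong]: "sets (doob_law LU LV) = sets borel"
  and space_doob_law [simp]: "space (doob_law LU LV) = UNIV"
  by (simp_all add: doob_law_def)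

context stat_pair
begin

lemma measurable_doob_weight_pair [measurable]:
  "(\<lambda>(u, v). doob_weight v u) \<in> borel_measurable (LU \<Otimes>\<^sub>M LV)"
  by (simp_all add: split_beta')

lemma prob_space_doob_law: "prob_space (doob_law LU LV)"
proof -
  interpret U: prob_space LU by (rule prob_LU)
  interpret V: prob_space LV by (rule prob_LV)
  interpret UV: pair_prob_space LU LV ..
  show ?thesis unfolding doob_law_def by (rule UV.prob_space_distr) measurable
qed

lemma AE_regular_pair: "AE u in LU. AE v in LV. regular_pair u v"
  using support
proof
  assume A: "(AE u in LU. 1 < u) \<and> (AE v in LV. 0 < v \<and> v < 1)"
  show ?thesis
    by (rule AE_mp[OF conjunct1[OF A]], rule AE_I2, rule impI, rule AE_mp[OF conjunct2[OF A]], rule AE_I2)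
       (auto simp: regular_pair_def)
next
  assume A: "(AE u in LU. 0 < u \<and> u < 1) \<and> (AE v in LV. 1 < v)"
  show ?thesis
    by (rule AE_mp[OF conjunct1[OF A]], rule AE_I2, rule impI, rule AE_mp[OF conjunct2[OF A]], rule AE_I2)
       (auto simp: regular_pair_def)
qed

lemma nn_integral_doob_law:
  assumes [measurable]: "f \<in> borel_measurable borel"
  shows "(\<integral>\<^sup>+x. f x \<partial>doob_law LU LV) = (\<integral>\<^sup>+u. \<integral>\<^sup>+v. f (doob_weight u v) \<partial>LV \<partial>LU)"
proof -
  interpret V: prob_space LV by (rule prob_LV)
  have "(\<integral>\<^sup>+x. f x \<partial>doob_law LU LV) = (\<integral>\<^sup>+p. f (case p of (u, v) \<Rightarrow> doob_weight u v) \<partial>(LU \<Otimes>\<^sub>M LV))"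
    unfolding doob_law_def by (rule nn_integral_distr) auto
  also have "\<dots> = (\<integral>\<^sup>+u. \<integral>\<^sup>+v. f (doob_weight u v) \<partial>LV \<partial>LU)"
    by (subst V.nn_integral_fst[symmetric]) auto
  finally show ?thesis .
qed

text \<open>The third coordinate of \<open>invariant\<close>, with a test function that ignores the
  edges.\<close>

lemma nn_integral_dual_weight:
  assumes [measurable]: "f \<in> borel_measurable borel"
  shows "(\<integral>\<^sup>+u. \<integral>\<^sup>+v. f (dual_weight u v) \<partial>LV \<partial>LU) = (\<integral>\<^sup>+x. f x \<partial>beta_borel \<alpha> \<beta>)"
proof -
  interpret U: prob_space LU by (rule prob_LU)
  interpret V: prob_space LV by (rule prob_LV)
  interpret W: prob_space "beta_borel \<alpha> \<beta>" using ab by (intro prob_space_beta_borel)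
  have "(\<integral>\<^sup>+u. \<integral>\<^sup>+v. f (dual_weight u v) \<partial>LV \<partial>LU) =
      (\<integral>\<^sup>+u. \<integral>\<^sup>+v. \<integral>\<^sup>+w. f (dual_weight u v) \<partial>beta_borel \<alpha> \<beta> \<partial>LV \<partial>LU)"
    using W.emeasure_space_1 by simp
  also have "\<dots> = (\<integral>\<^sup>+u. \<integral>\<^sup>+v. \<integral>\<^sup>+w. f w \<partial>beta_borel \<alpha> \<beta> \<partial>LV \<partial>LU)"
    by (rule invariant[of "\<lambda>u v w. f w"]) measurable
  also have "\<dots> = (\<integral>\<^sup>+x. f x \<partial>beta_borel \<alpha> \<beta>)"
    using U.emeasure_space_1 V.emeasure_space_1 by simp
  finally show ?thesis .
qed

lemma nn_integral_doob_law_swap: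
  assumes [measurable]: "f \<in> borel_measurable borel"
  shows "(\<integral>\<^sup>+x. f x \<partial>doob_law LV LU) = (\<integral>\<^sup>+x. f (1 - x) \<partial>doob_law LU LV)"
proof -
  interpret S: stat_pair \<beta> \<alpha> LV LU by (rule stat_pair_swap) unfold_locales
  interpret U: prob_space LU by (rule prob_LU)
  interpret V: prob_space LV by (rule prob_LV)
  interpret UV: pair_sigma_finite LU LV ..
  have "(\<integral>\<^sup>+x. f x \<partial>doob_law LV LU) = (\<integral>\<^sup>+v. \<integral>\<^sup>+u. f (doob_weight v u) \<partial>LU \<partial>LV)"
    by (rule S.nn_integral_doob_law) simp
  also have "\<dots> = (\<integral>\<^sup>+u. \<integral>\<^sup>+v. f (doob_weight v u) \<partial>LV \<partial>LU)"
    by (rule UV.Fubini') simp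
  also have "\<dots> = (\<integral>\<^sup>+u. \<integral>\<^sup>+v. f (1 - doob_weight u v) \<partial>LV \<partial>LU)"
  proof (rule nn_integral_cong_AE, rule AE_mp[OF AE_regular_pair], rule AE_I2, rule impI, rule nn_integral_cong_AE)
    fix u assume "AE v in LV. regular_pair u v"
    then show "AE v in LV. f (doob_weight v u) = f (1 - doob_weight u v)"
    proof eventually_elim
      case (elim v)
      then have "u \<noteq> v" by (auto simp: regular_pair_def)
      then have "1 - doob_weight u v = (- (1 - u)) / (- (v - u))" by (simp add: doob_weight_def field_simps)
      then have "doob_weight v u = 1 - doob_weight u v" by (simp only: doob_weight_def minus_divide_divide)
      then show ?case by simp
    qed
  qed
  also have "\<dots> = (\<integral>\<^sup>+x. f (1 - x) \<partial>doob_law LU LV)"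
    by (rule nn_integral_doob_law[symmetric]) simp
  finally show ?thesis .
qed

text \<open>Reflection sends x to 1 - x and therefore exchanges closed and open half-lines. This is
  why the approximations below record limits for both kinds, as \<open>G\<close> and
  \<open>G'\<close>.\<close>

lemma measure_doob_law_swap:
  "measure (doob_law LV LU) {..t} = 1 - measure (doob_law LU LV) {..<1 - t}"
  "measure (doob_law LV LU) {..<t} = 1 - measure (doob_law LU LV) {..1 - t}"
proof -
  interpret D: prob_space "doob_law LU LV" by (rule prob_space_doob_law)
  have e: "emeasure (doob_law LV LU) A = emeasure (doob_law LU LV) (UNIV - B)"
    if "A \<in> sets borel" "B \<in> sets borel" "\<And>x. 1 - x \<in> A \<longleftrightarrow> x \<notin> B" for A B
  proof -
    have "emeasure (doob_law LV LU) A = (\<integral>\<^sup>+x. indicator A x \<partial>doob_law LV LU)" using that by simp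
    also have "\<dots> = (\<integral>\<^sup>+x. indicator A (1 - x) \<partial>doob_law LU LV)"
      by (rule nn_integral_doob_law_swap) (use that in simp)
    also have "\<dots> = (\<integral>\<^sup>+x. indicator (UNIV - B) x \<partial>doob_law LU LV)"
      by (intro nn_integral_cong) (use that(3) in \<open>auto split: split_indicator\<close>)
    also have "\<dots> = emeasure (doob_law LU LV) (UNIV - B)"
      using that by (intro nn_integral_indicator) auto
    finally show ?thesis .
  qed
  have m: "measure (doob_law LU LV) (UNIV - B) = 1 - measure (doob_law LU LV) B" if "B \<in> sets borel" for B
    using D.prob_compl[of B] that by simp
  have "measure (doob_law LV LU) {..t} = measure (doob_law LU LV) (UNIV - {..<1 - t})"
    unfolding measure_def by (subst e[of _ "{..<1 - t}"]) auto
  then show "measure (doob_law LV LU) {..t} = 1 - measure (doob_law LU LV) {..<1 - t}" by (simp add: m)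
  have "measure (doob_law LV LU) {..<t} = measure (doob_law LU LV) (UNIV - {..1 - t})"
    unfolding measure_def by (subst e[of _ "{..1 - t}"]) auto
  then show "measure (doob_law LV LU) {..<t} = 1 - measure (doob_law LU LV) {..1 - t}" by (simp add: m)
qed

end

text \<open>\<open>N\<close> and \<open>F\<close> are the cones of directions near and far from the direction under
  consideration: the stationary walks with laws \<open>(LU k, LV k)\<close> avoid the near cone, while the
  limiting walk with mean increments \<open>(us, ws)\<close> avoids the far cone.\<close>

definition side_approx :: "(real \<Rightarrow> nat \<Rightarrow> nat \<Rightarrow> bool) \<Rightarrow> (real \<Rightarrow> nat \<Rightarrow> nat \<Rightarrow> bool) \<Rightarrow> real \<Rightarrow> real \<Rightarrow>
    real \<Rightarrow> real \<Rightarrow> (real \<Rightarrow> real) \<Rightarrow> (real \<Rightarrow> real) \<Rightarrow> bool" where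
  "side_approx N F \<alpha> \<beta> us ws G G' \<longleftrightarrow>
    (\<exists>LU LV u w. (\<forall>k :: nat. stat_param \<alpha> \<beta> (LU k) (LV k) (u k) (w k)) \<and>
      (\<forall>k. \<exists>LU' LV' u' w' \<epsilon> c. stat_param \<alpha> \<beta> LU' LV' u' w' \<and> 0 < \<epsilon> \<and> 0 < c \<and>
        (\<forall>a b. N \<epsilon> a b \<longrightarrow> real a * (u' - u k) + real b * (w' - w k) \<le> - c * real (a + b))) \<and>
      (\<forall>t. (\<lambda>k. measure (doob_law (LU k) (LV k)) {..t}) \<longlonglongrightarrow> G t) \<and>
      (\<forall>t. (\<lambda>k. measure (doob_law (LU k) (LV k)) {..<t}) \<longlonglongrightarrow> G' t) \<and>
      u \<longlonglongrightarrow> us \<and> w \<longlonglongrightarrow> ws) \<and>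
    (\<forall>\<epsilon>>0. \<exists>LU' LV' u' w' c. stat_param \<alpha> \<beta> LU' LV' u' w' \<and> 0 < c \<and>
      (\<forall>a b. F \<epsilon> a b \<longrightarrow> real a * (u' - us) + real b * (w' - ws) \<le> - c * real (a + b)))"

lemma side_approxI:
  assumes "\<And>k :: nat. stat_param \<alpha> \<beta> (LU k) (LV k) (u k) (w k)"
    and "\<And>k. \<exists>LU' LV' u' w' \<epsilon> c. stat_param \<alpha> \<beta> LU' LV' u' w' \<and> 0 < \<epsilon> \<and> 0 < c \<and>
        (\<forall>a b. N \<epsilon> a b \<longrightarrow> real a * (u' - u k) + real b * (w' - w k) \<le> - c * real (a + b))"
    and "\<And>t. (\<lambda>k. measure (doob_law (LU k) (LV k)) {..t}) \<longlonglongrightarrow> G t"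
    and "\<And>t. (\<lambda>k. measure (doob_law (LU k) (LV k)) {..<t}) \<longlonglongrightarrow> G' t"
    and "u \<longlonglongrightarrow> us" "w \<longlonglongrightarrow> ws"
    and "\<And>\<epsilon>. \<epsilon> > 0 \<Longrightarrow> \<exists>LU' LV' u' w' c. stat_param \<alpha> \<beta> LU' LV' u' w' \<and> 0 < c \<and>
      (\<forall>a b. F \<epsilon> a b \<longrightarrow> real a * (u' - us) + real b * (w' - ws) \<le> - c * real (a + b))"
  shows "side_approx N F \<alpha> \<beta> us ws G G'"
  unfolding side_approx_def using assms by blast

text \<open>Left and right name the side on which the approximating walks travel: those of
  \<open>left_approx\<close> stay west of \<zeta> and avoid a cone containing \<zeta> and everything
  east of it. They serve for lower bounds on the conditioned \<open>e1\<close> probability, those of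
  \<open>right_approx\<close> for upper bounds.\<close>

definition "left_approx \<zeta> = side_approx (\<lambda>\<epsilon> a b. (\<zeta> - \<epsilon>) * real (a + b) \<le> real a) (\<lambda>\<epsilon> a b. real a \<le> (\<zeta> - \<epsilon>) * real (a + b))"
definition "right_approx \<zeta> = side_approx (\<lambda>\<epsilon> a b. real a \<le> (\<zeta> + \<epsilon>) * real (a + b)) (\<lambda>\<epsilon> a b. (\<zeta> + \<epsilon>) * real (a + b) \<le> real a)"

lemma side_approx_swap:
  assumes "side_approx N F \<alpha> \<beta> us ws G G'"
  shows "side_approx (\<lambda>\<epsilon> a b. N \<epsilon> b a) (\<lambda>\<epsilon> a b. F \<epsilon> b a) \<beta> \<alpha> ws us (\<lambda>t. 1 - G' (1 - t)) (\<lambda>t. 1 - G (1 - t))"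
proof -
  obtain LU LV u w where 1: "\<And>k :: nat. stat_param \<alpha> \<beta> (LU k) (LV k) (u k) (w k)"
    and 2: "\<And>k. \<exists>LU' LV' u' w' \<epsilon> c. stat_param \<alpha> \<beta> LU' LV' u' w' \<and> 0 < \<epsilon> \<and> 0 < c \<and>
        (\<forall>a b. N \<epsilon> a b \<longrightarrow> real a * (u' - u k) + real b * (w' - w k) \<le> - c * real (a + b))"
    and 3: "\<And>t. (\<lambda>k. measure (doob_law (LU k) (LV k)) {..t}) \<longlonglongrightarrow> G t"
      "\<And>t. (\<lambda>k. measure (doob_law (LU k) (LV k)) {..<t}) \<longlonglongrightarrow> G' t"
    and 4: "u \<longlonglongrightarrow> us" "w \<longlonglongrightarrow> ws"
    and 5: "\<And>\<epsilon>. \<epsilon> > 0 \<Longrightarrow> \<exists>LU' LV' u' w' c. stat_param \<alpha> \<beta> LU' LV' u' w' \<and> 0 < c \<and>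
      (\<forall>a b. F \<epsilon> a b \<longrightarrow> real a * (u' - us) + real b * (w' - ws) \<le> - c * real (a + b))"
    using assms unfolding side_approx_def by blast
  show ?thesis
  proof (rule side_approxI[where LU=LV and LV=LU and u=w and w=u])
    fix k :: nat and t
    show "stat_param \<beta> \<alpha> (LV k) (LU k) (w k) (u k)" by (rule stat_param_swap[OF 1])
    obtain LU' LV' u' w' \<epsilon> c where "stat_param \<alpha> \<beta> LU' LV' u' w' \<and> 0 < \<epsilon> \<and> 0 < c \<and>
        (\<forall>a b. N \<epsilon> a b \<longrightarrow> real a * (u' - u k) + real b * (w' - w k) \<le> - c * real (a + b))" using 2 by blast
    then have "stat_param \<beta> \<alpha> LV' LU' w' u'" "0 < \<epsilon>" "0 < c"
      "\<forall>a b. N \<epsilon> b a \<longrightarrow> real a * (w' - w k) + real b * (u' - u k) \<le> - c * real (a + b)"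
      using stat_param_swap by (blast, blast, blast, metis add.commute)
    then show "\<exists>LU' LV' u' w' \<epsilon> c. stat_param \<beta> \<alpha> LU' LV' u' w' \<and> 0 < \<epsilon> \<and> 0 < c \<and>
        (\<forall>a b. N \<epsilon> b a \<longrightarrow> real a * (u' - w k) + real b * (w' - u k) \<le> - c * real (a + b))"
      by blast
    have sp: "stat_pair \<alpha> \<beta> (LU k) (LV k)" for k using 1 by (simp add: stat_param_def)
    show "(\<lambda>k. measure (doob_law (LV k) (LU k)) {..t}) \<longlonglongrightarrow> 1 - G' (1 - t)"
      unfolding stat_pair.measure_doob_law_swap[OF sp] by (intro tendsto_intros 3)
    show "(\<lambda>k. measure (doob_law (LV k) (LU k)) {..<t}) \<longlonglongrightarrow> 1 - G (1 - t)"
      unfolding stat_pair.measure_doob_law_swap[OF sp] by (intro tendsto_intros 3)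
  next
    fix \<epsilon> :: real assume "\<epsilon> > 0"
    then obtain LU' LV' u' w' c where "stat_param \<alpha> \<beta> LU' LV' u' w' \<and> 0 < c \<and>
      (\<forall>a b. F \<epsilon> a b \<longrightarrow> real a * (u' - us) + real b * (w' - ws) \<le> - c * real (a + b))" using 5 by blast
    then have "stat_param \<beta> \<alpha> LV' LU' w' u'" "0 < c"
      "\<forall>a b. F \<epsilon> b a \<longrightarrow> real a * (w' - ws) + real b * (u' - us) \<le> - c * real (a + b)"
      using stat_param_swap by (blast, blast, metis add.commute)
    then show "\<exists>LU' LV' u' w' c. stat_param \<beta> \<alpha> LU' LV' u' w' \<and> 0 < c \<and>
      (\<forall>a b. F \<epsilon> b a \<longrightarrow> real a * (u' - ws) + real b * (w' - us) \<le> - c * real (a + b))"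
      by blast
  qed (use 4 in auto)
qed

lemma right_approx_swap:
  assumes "left_approx (1 - \<zeta>) \<beta> \<alpha> ws us G G'"
  shows "right_approx \<zeta> \<alpha> \<beta> us ws (\<lambda>t. 1 - G' (1 - t)) (\<lambda>t. 1 - G (1 - t))"
proof -
  have "(\<lambda>\<epsilon> a b. (1 - \<zeta> - \<epsilon>) * real (b + a) \<le> real b) = (\<lambda>\<epsilon> a b. real a \<le> (\<zeta> + \<epsilon>) * real (a + b))"
    "(\<lambda>\<epsilon> a b. real b \<le> (1 - \<zeta> - \<epsilon>) * real (b + a)) = (\<lambda>\<epsilon> a b. (\<zeta> + \<epsilon>) * real (a + b) \<le> real a)"
    by (auto simp: fun_eq_iff algebra_simps)
  then show ?thesis using side_approx_swap[OF assms[unfolded left_approx_def]] by (simp add: right_approx_def)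
qed

lemma left_approx_swap:
  assumes "right_approx (1 - \<zeta>) \<beta> \<alpha> ws us G G'"
  shows "left_approx \<zeta> \<alpha> \<beta> us ws (\<lambda>t. 1 - G' (1 - t)) (\<lambda>t. 1 - G (1 - t))"
proof -
  have "(\<lambda>\<epsilon> a b. real b \<le> (1 - \<zeta> + \<epsilon>) * real (b + a)) = (\<lambda>\<epsilon> a b. (\<zeta> - \<epsilon>) * real (a + b) \<le> real a)"
    "(\<lambda>\<epsilon> a b. (1 - \<zeta> + \<epsilon>) * real (b + a) \<le> real b) = (\<lambda>\<epsilon> a b. real a \<le> (\<zeta> - \<epsilon>) * real (a + b))"
    by (auto simp: fun_eq_iff algebra_simps)
  then show ?thesis using side_approx_swap[OF assms[unfolded right_approx_def]] by (simp add: left_approx_def)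
qed

text \<open>Per step, the left side is an affine function of the proportion of \<open>e1\<close>
  steps. It is negative at \<zeta> and nondecreasing, so it stays uniformly negative to the left of
  \<zeta> and slightly beyond.\<close>

lemma linear_cone_right:
  fixes p q \<zeta> :: real
  assumes "q \<le> p" "\<zeta> * p + (1 - \<zeta>) * q < 0"
  shows "\<exists>\<epsilon>>0. \<exists>c>0. \<forall>a b :: nat. real a \<le> (\<zeta> + \<epsilon>) * real (a + b) \<longrightarrow> real a * p + real b * q \<le> - c * real (a + b)"
proof -
  define s where "s = - (\<zeta> * p + (1 - \<zeta>) * q)"
  have s: "s > 0" using assms by (simp add: s_def)
  \<comment> \<open>The added 1 keeps the divisor positive when p and q coincide.\<close>
  define d where "d = p - q + 1"
  have d: "d > 0" using assms by (simp add: d_def)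
  define \<epsilon> where "\<epsilon> = s / (2 * d)"
  have \<epsilon>: "\<epsilon> > 0" using s d by (simp add: \<epsilon>_def)
  have e: "\<epsilon> * (p - q) \<le> s / 2"
  proof -
    have "\<epsilon> * (p - q) \<le> \<epsilon> * d" using \<epsilon> by (simp add: d_def)
    also have "\<dots> = s / 2" using d by (simp add: \<epsilon>_def)
    finally show ?thesis .
  qed
  have "\<forall>a b :: nat. real a \<le> (\<zeta> + \<epsilon>) * real (a + b) \<longrightarrow> real a * p + real b * q \<le> - (s / 2) * real (a + b)"
  proof (intro allI impI)
    fix a b :: nat assume *: "real a \<le> (\<zeta> + \<epsilon>) * real (a + b)"
    have "real a * p + real b * q = real a * (p - q) + real (a + b) * q" by (simp add: algebra_simps)
    also have "\<dots> \<le> (\<zeta> + \<epsilon>) * real (a + b) * (p - q) + real (a + b) * q"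
      using assms by (intro add_right_mono mult_right_mono *) auto
    also have "\<dots> = real (a + b) * (\<epsilon> * (p - q) - s)" by (simp add: s_def algebra_simps)
    also have "\<dots> \<le> real (a + b) * (- (s / 2))" using e by (intro mult_left_mono) auto
    finally show "real a * p + real b * q \<le> - (s / 2) * real (a + b)" by (simp add: mult.commute)
  qed
  moreover have "s / 2 > 0" using s by simp
  ultimately show ?thesis using \<epsilon> by blast
qed

lemma linear_cone_left:
  fixes p q \<zeta> :: real
  assumes "p \<le> q" "\<zeta> * p + (1 - \<zeta>) * q < 0"
  shows "\<exists>\<epsilon>>0. \<exists>c>0. \<forall>a b :: nat. (\<zeta> - \<epsilon>) * real (a + b) \<le> real a \<longrightarrow> real a * p + real b * q \<le> - c * real (a + b)"
proof -
  obtain \<epsilon> c where "\<epsilon> > 0" "c > 0"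
    and *: "\<And>a b :: nat. real a \<le> ((1 - \<zeta>) + \<epsilon>) * real (a + b) \<Longrightarrow> real a * q + real b * p \<le> - c * real (a + b)"
    using linear_cone_right[of p q "1 - \<zeta>"] assms by (auto simp: add.commute)
  have "\<forall>a b :: nat. (\<zeta> - \<epsilon>) * real (a + b) \<le> real a \<longrightarrow> real a * p + real b * q \<le> - c * real (a + b)"
  proof (intro allI impI)
    fix a b :: nat assume "(\<zeta> - \<epsilon>) * real (a + b) \<le> real a"
    then show "real a * p + real b * q \<le> - c * real (a + b)"
      using *[of b a] by (simp add: algebra_simps)
  qed
  then show ?thesis using \<open>\<epsilon> > 0\<close> \<open>c > 0\<close> by blast
qed

section \<open>Continuity of the Doob law in the parameter\<close>

definition beta_comparison :: "real \<Rightarrow> real \<Rightarrow> real \<Rightarrow> real \<Rightarrow> real" where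
  "beta_comparison \<alpha> \<beta> l l' = Beta l \<beta> / Beta l' \<beta> * (Beta (l + \<beta>) \<alpha> / Beta (l' + \<beta>) \<alpha>)"

context
  fixes \<alpha> \<beta> :: real
  assumes ab: "\<alpha> > 0" "\<beta> > 0"
begin

abbreviation "DL l \<equiv> doob_law (inv_beta l \<beta>) (beta_borel (l + \<beta>) \<alpha>)"

lemma emeasure_DL:
  assumes "l > 0" and [measurable]: "A \<in> sets borel"
  shows "emeasure (DL l) A = (\<integral>\<^sup>+q. \<integral>\<^sup>+p. indicator A (doob_weight (inverse q) p) \<partial>beta_borel (l + \<beta>) \<alpha> \<partial>beta_borel l \<beta>)"
proof -
  interpret stat_pair \<alpha> \<beta> "inv_beta l \<beta>" "beta_borel (l + \<beta>) \<alpha>" using assms ab by (intro stat_pair_beta)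
  interpret V: prob_space "beta_borel (l + \<beta>) \<alpha>" by (rule prob_LV)
  have "emeasure (DL l) A = (\<integral>\<^sup>+x. indicator A x \<partial>DL l)" by simp
  also have "\<dots> = (\<integral>\<^sup>+u. \<integral>\<^sup>+v. indicator A (doob_weight u v) \<partial>beta_borel (l + \<beta>) \<alpha> \<partial>inv_beta l \<beta>)"
    by (rule nn_integral_doob_law) simp
  also have "\<dots> = (\<integral>\<^sup>+q. \<integral>\<^sup>+p. indicator A (doob_weight (inverse q) p) \<partial>beta_borel (l + \<beta>) \<alpha> \<partial>beta_borel l \<beta>)"
  proof -
    have "inverse \<in> borel_measurable (beta_borel l \<beta>)"
      unfolding measurable_cong_sets[OF sets_beta_borel refl] by (intro borel_measurable_inverse) simp
    then show ?thesis unfolding inv_beta_def by (subst nn_integral_distr) auto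
  qed
  finally show ?thesis .
qed

lemma prob_space_DL: "l > 0 \<Longrightarrow> prob_space (DL l)"
  using stat_pair.prob_space_doob_law[OF stat_pair_beta] ab by blast

text \<open>Both edge laws depend on the parameter through a first beta parameter, so
  \<open>nn_integral_beta_borel_le\<close> applies to each and the constants multiply.\<close>

lemma measure_DL_le:
  assumes l: "0 < l" "l \<le> l'" and [measurable]: "A \<in> sets borel"
  shows "measure (DL l') A \<le> beta_comparison \<alpha> \<beta> l l' * measure (DL l) A"
proof -
  interpret D: prob_space "DL l" using l by (intro prob_space_DL)
  interpret D': prob_space "DL l'" using l by (intro prob_space_DL) auto
  interpret P: prob_space "beta_borel (l + \<beta>) \<alpha>" using l ab by (intro prob_space_beta_borel) auto
  interpret P': prob_space "beta_borel (l' + \<beta>) \<alpha>" using l ab by (intro prob_space_beta_borel) auto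
  define c1 c2 where "c1 = Beta l \<beta> / Beta l' \<beta>" and "c2 = Beta (l + \<beta>) \<alpha> / Beta (l' + \<beta>) \<alpha>"
  have c: "c1 > 0" "c2 > 0" unfolding c1_def c2_def using l ab by (auto intro!: divide_pos_pos Beta_real_pos)
  have C: "beta_comparison \<alpha> \<beta> l l' = c1 * c2" by (simp add: beta_comparison_def c1_def c2_def)
  have "emeasure (DL l') A = (\<integral>\<^sup>+q. \<integral>\<^sup>+p. indicator A (doob_weight (inverse q) p) \<partial>beta_borel (l' + \<beta>) \<alpha> \<partial>beta_borel l' \<beta>)"
    using l by (intro emeasure_DL) auto
  also have "\<dots> \<le> ennreal c1 * (\<integral>\<^sup>+q. \<integral>\<^sup>+p. indicator A (doob_weight (inverse q) p) \<partial>beta_borel (l' + \<beta>) \<alpha> \<partial>beta_borel l \<beta>)"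
    unfolding c1_def using l ab by (intro nn_integral_beta_borel_le) auto
  also have "\<dots> \<le> ennreal c1 * (\<integral>\<^sup>+q. ennreal c2 * (\<integral>\<^sup>+p. indicator A (doob_weight (inverse q) p) \<partial>beta_borel (l + \<beta>) \<alpha>) \<partial>beta_borel l \<beta>)"
    unfolding c2_def using l ab by (intro mult_left_mono nn_integral_mono nn_integral_beta_borel_le) auto
  also have "\<dots> = ennreal c1 * (ennreal c2 * emeasure (DL l) A)"
    using l by (subst nn_integral_cmult) (auto simp: emeasure_DL)
  also have "\<dots> = ennreal (beta_comparison \<alpha> \<beta> l l' * measure (DL l) A)"
    using c by (simp add: D.emeasure_eq_measure ennreal_mult[symmetric] C mult.assoc)
  finally show ?thesis
    using c by (simp add: D'.emeasure_eq_measure C)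
qed

text \<open>The one-sided domination, applied to a set and to its complement, becomes a bound on the
  difference because both measures have mass 1.\<close>

lemma measure_DL_diff:
  assumes l: "0 < l" "l \<le> l'" and A[measurable]: "A \<in> sets borel"
  shows "\<bar>measure (DL l') A - measure (DL l) A\<bar> \<le> beta_comparison \<alpha> \<beta> l l' - 1"
proof -
  interpret D: prob_space "DL l" using l by (intro prob_space_DL)
  interpret D': prob_space "DL l'" using l by (intro prob_space_DL) auto
  let ?C = "beta_comparison \<alpha> \<beta> l l'"
  have C1: "1 \<le> ?C"
    using measure_DL_le[OF l, of UNIV] D.prob_space D'.prob_space by simp
  have 1: "measure (DL l') A \<le> ?C * measure (DL l) A" by (rule measure_DL_le[OF l A])
  have "measure (DL l') (UNIV - A) \<le> ?C * measure (DL l) (UNIV - A)" by (rule measure_DL_le[OF l]) simp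
  then have 2: "1 - measure (DL l') A \<le> ?C * (1 - measure (DL l) A)"
    using D.prob_compl[of A] D'.prob_compl[of A] by simp
  have "(?C - 1) * measure (DL l) A \<le> ?C - 1" "0 \<le> (?C - 1) * measure (DL l) A" using C1 by (auto simp: mult_left_le)
  then show ?thesis using 1 2 by (simp add: abs_le_iff algebra_simps)
qed

lemma beta_comparison_tendsto:
  assumes "L > 0" "f \<longlonglongrightarrow> L" "g \<longlonglongrightarrow> L"
  shows "(\<lambda>k :: nat. beta_comparison \<alpha> \<beta> (f k) (g k)) \<longlonglongrightarrow> 1"
proof -
  have B: "(\<lambda>k. Beta (h k) b) \<longlonglongrightarrow> Beta M b" if "h \<longlonglongrightarrow> M" "M > 0" "b > 0" for h :: "nat \<Rightarrow> real" and M b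
    unfolding Beta_def
    by (intro tendsto_intros that) (use that in \<open>auto elim!: nonpos_Ints_cases simp: Gamma_eq_zero_iff\<close>)
  have "(\<lambda>k. beta_comparison \<alpha> \<beta> (f k) (g k)) \<longlonglongrightarrow> Beta L \<beta> / Beta L \<beta> * (Beta (L + \<beta>) \<alpha> / Beta (L + \<beta>) \<alpha>)"
    unfolding beta_comparison_def
    by (intro tendsto_mult tendsto_divide B tendsto_add tendsto_const assms)
       (use assms ab in \<open>auto simp: less_imp_neq[OF Beta_real_pos, symmetric]\<close>)
  moreover have "Beta L \<beta> > 0" "Beta (L + \<beta>) \<alpha> > 0" using assms ab by (auto intro!: Beta_real_pos)
  ultimately show ?thesis by simp
qed

lemma measure_DL_tendsto:
  assumes L: "L > 0" and f: "f \<longlonglongrightarrow> L" "\<And>k. f k > 0" and A: "A \<in> sets borel"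
  shows "(\<lambda>k :: nat. measure (DL (f k)) A) \<longlonglongrightarrow> measure (DL L) A"
proof -
  \<comment> \<open>The comparison needs ordered parameters, and \<open>f k\<close> may lie on
    either side of \<open>L\<close>.\<close>
  have "(\<lambda>k. beta_comparison \<alpha> \<beta> (min (f k) L) (max (f k) L) - 1) \<longlonglongrightarrow> 1 - 1"
    using tendsto_min[OF f(1) tendsto_const[of L]] tendsto_max[OF f(1) tendsto_const[of L]]
    by (intro tendsto_diff beta_comparison_tendsto[OF L] tendsto_const) auto
  then have "(\<lambda>k. beta_comparison \<alpha> \<beta> (min (f k) L) (max (f k) L) - 1) \<longlonglongrightarrow> 0" by simp
  then have "(\<lambda>k. measure (DL (f k)) A - measure (DL L) A) \<longlonglongrightarrow> 0"
  proof (rule Lim_null_comparison[rotated])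
    show "eventually (\<lambda>k. norm (measure (DL (f k)) A - measure (DL L) A) \<le> beta_comparison \<alpha> \<beta> (min (f k) L) (max (f k) L) - 1) sequentially"
    proof (rule always_eventually, rule allI)
      fix k
      show "norm (measure (DL (f k)) A - measure (DL L) A) \<le> beta_comparison \<alpha> \<beta> (min (f k) L) (max (f k) L) - 1"
        using measure_DL_diff[of "f k" L A] measure_DL_diff[of L "f k" A] f(2)[of k] L A
        by (cases "f k \<le> L") (auto simp: min_def max_def abs_minus_commute)
    qed
  qed
  then show ?thesis by (rule LIM_zero_cancel)
qed

text \<open>Let \<open>L\<close> be the characteristic parameter of \<zeta>. Parameters below and
  above \<open>L\<close> approximate it from the left and from the right. Each of them is beaten in
  direction \<zeta> by \<open>L\<close> itself, the strict minimiser, which settles the near cones.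
  The far cones are settled by the characteristic parameter of a direction z beyond \<zeta>, which
  beats \<open>L\<close> there. Both sides share the limit laws by continuity in the
  parameter.\<close>

lemma approx_interior:
  assumes \<zeta>: "0 < \<zeta>" "\<zeta> < \<alpha> / (\<alpha> + \<beta>)"
  shows "\<exists>us ws G G'. left_approx \<zeta> \<alpha> \<beta> us ws G G' \<and> right_approx \<zeta> \<alpha> \<beta> us ws G G'"
proof -
  let ?u = "log_u \<beta>" and ?w = "log_w \<alpha> \<beta>" and ?F = "log_mix \<alpha> \<beta>" and ?\<rho> = "pg_ratio \<alpha> \<beta>"
  have drift1: "\<alpha> / (\<alpha> + \<beta>) < 1" using ab by simp
  have solve: "\<exists>l>0. ?\<rho> l = z / (1 - z)" if "0 < z" "z < \<alpha> / (\<alpha> + \<beta>)" for z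
  proof (rule pg_ratio_surj[OF ab])
    have "z < 1" using that drift1 by simp
    then show "0 < z / (1 - z)" using that by simp
    have "z * (\<alpha> + \<beta>) < \<alpha>" using that(2) ab by (simp add: field_simps)
    then show "z / (1 - z) < \<alpha> / \<beta>" using \<open>z < 1\<close> ab by (simp add: divide_simps algebra_simps)
  qed
  have param: "stat_param \<alpha> \<beta> (inv_beta l \<beta>) (beta_borel (l + \<beta>) \<alpha>) (?u l) (?w l)" if "l > 0" for l
    using stat_param_beta[OF ab that] .
  obtain L where L: "L > 0" "?\<rho> L = \<zeta> / (1 - \<zeta>)" using solve[OF \<zeta>] by blast
  have \<zeta>1: "\<zeta> < 1" using \<zeta> drift1 by simp
  have mix: "\<zeta>' * (?u l - ?u l') + (1 - \<zeta>') * (?w l - ?w l') = ?F \<zeta>' l - ?F \<zeta>' l'" for \<zeta>' l l'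
    by (simp add: log_mix_def[OF ab] algebra_simps)
  have order: "l < l'" if "l > 0" "l' > 0" "?\<rho> l = z / (1 - z)" "?\<rho> l' = z' / (1 - z')" "z < z'" "z' < 1" for l l' z z'
  proof (rule ccontr)
    have "z / (1 - z) < z' / (1 - z')" using that by (simp add: divide_simps algebra_simps)
    then have "?\<rho> l < ?\<rho> l'" using that by simp
    moreover assume "\<not> l < l'"
    ultimately show False using pg_ratio_strict_mono[OF ab, of l' l] that by (cases "l = l'") auto
  qed
  \<comment> \<open>The offset 2 keeps all terms positive, at least half of
    \<open>L\<close>.\<close>
  define lm where "lm k = L - L / real (k + 2)" for k
  define lp where "lp k = L + L / real (k + 2)" for k
  have lim0: "(\<lambda>k. L / real (k + 2)) \<longlonglongrightarrow> 0"
    using LIMSEQ_ignore_initial_segment[OF lim_const_over_n[of L], of 2] by simp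
  have lm: "0 < lm k" "lm k < L" and lp: "L < lp k" "0 < lp k" for k
    using L by (auto simp: lm_def lp_def divide_simps add_pos_pos)
  have "lm \<longlonglongrightarrow> L - 0" "lp \<longlonglongrightarrow> L + 0"
    unfolding lm_def lp_def by (intro tendsto_intros lim0)+
  then have lim: "lm \<longlonglongrightarrow> L" "lp \<longlonglongrightarrow> L" by auto
  have uw: "(\<lambda>k. ?u (f k)) \<longlonglongrightarrow> ?u L" "(\<lambda>k. ?w (f k)) \<longlonglongrightarrow> ?w L" if "f \<longlonglongrightarrow> L" for f :: "nat \<Rightarrow> real"
    using isCont_tendsto_compose[OF log_u_cont[OF ab L(1)] that] isCont_tendsto_compose[OF log_w_cont[OF ab L(1)] that] by auto
  have "left_approx \<zeta> \<alpha> \<beta> (?u L) (?w L) (\<lambda>t. measure (DL L) {..t}) (\<lambda>t. measure (DL L) {..<t})"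
    unfolding left_approx_def
  proof (rule side_approxI[where LU="\<lambda>k. inv_beta (lm k) \<beta>" and LV="\<lambda>k. beta_borel (lm k + \<beta>) \<alpha>"
      and u="\<lambda>k. ?u (lm k)" and w="\<lambda>k. ?w (lm k)"])
    fix k :: nat and t
    show "stat_param \<alpha> \<beta> (inv_beta (lm k) \<beta>) (beta_borel (lm k + \<beta>) \<alpha>) (?u (lm k)) (?w (lm k))" by (rule param[OF lm(1)])
    have "?u L \<le> ?u (lm k)" "?w (lm k) \<le> ?w L"
      using log_u_strict_antimono[OF ab lm] log_w_strict_mono[OF ab lm] by (auto intro: less_imp_le)
    moreover have "?F \<zeta> L < ?F \<zeta> (lm k)" using lm[of k] by (intro log_mix_min[OF ab \<zeta>(1) \<zeta>1 L]) auto
    ultimately obtain \<epsilon> c where ec: "\<epsilon> > 0" "c > 0"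
      "\<forall>a b :: nat. (\<zeta> - \<epsilon>) * real (a + b) \<le> real a \<longrightarrow> real a * (?u L - ?u (lm k)) + real b * (?w L - ?w (lm k)) \<le> - c * real (a + b)"
      using linear_cone_left[of "?u L - ?u (lm k)" "?w L - ?w (lm k)" \<zeta>] by (auto simp: mix)
    then show "\<exists>LU' LV' u' w' \<epsilon> c. stat_param \<alpha> \<beta> LU' LV' u' w' \<and> 0 < \<epsilon> \<and> 0 < c \<and>
        (\<forall>a b. (\<zeta> - \<epsilon>) * real (a + b) \<le> real a \<longrightarrow> real a * (u' - ?u (lm k)) + real b * (w' - ?w (lm k)) \<le> - c * real (a + b))"
      using param[OF L(1)] by blast
    show "(\<lambda>k. measure (DL (lm k)) {..t}) \<longlonglongrightarrow> measure (DL L) {..t}"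
      "(\<lambda>k. measure (DL (lm k)) {..<t}) \<longlonglongrightarrow> measure (DL L) {..<t}"
      by (rule measure_DL_tendsto[OF L(1) lim(1) lm(1)]; simp)+
  next
    fix \<epsilon> :: real assume \<epsilon>: "\<epsilon> > 0"
    \<comment> \<open>Half of \<zeta> is the fallback when \<open>\<zeta> - \<epsilon>\<close> is
      not positive. Any direction strictly between 0 and \<zeta> that is not below
      \<open>\<zeta> - \<epsilon>\<close> would serve.\<close>
    define z where "z = max (\<zeta> - \<epsilon>) (\<zeta> / 2)"
    have z: "0 < z" "z < \<zeta>" "\<zeta> - \<epsilon> \<le> z" using \<epsilon> \<zeta> by (auto simp: z_def)
    obtain l where l: "l > 0" "?\<rho> l = z / (1 - z)" using solve[of z] z \<zeta> by auto
    have lL: "l < L" by (rule order[OF l(1) L(1) l(2) L(2) z(2) \<zeta>1])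
    have "?w l \<le> ?w L" "?u L \<le> ?u l"
      using log_u_strict_antimono[OF ab l(1) lL] log_w_strict_mono[OF ab l(1) lL] by (auto intro: less_imp_le)
    moreover have "?F z l < ?F z L" using z \<zeta>1 lL L by (intro log_mix_min[OF ab _ _ l]) auto
    ultimately obtain \<delta> c where ec: "\<delta> > 0" "c > 0"
      "\<forall>a b :: nat. real a \<le> (z + \<delta>) * real (a + b) \<longrightarrow> real a * (?u l - ?u L) + real b * (?w l - ?w L) \<le> - c * real (a + b)"
      using linear_cone_right[of "?w l - ?w L" "?u l - ?u L" z] by (auto simp: mix)
    have "real a \<le> (z + \<delta>) * real (a + b)" if "real a \<le> (\<zeta> - \<epsilon>) * real (a + b)" for a b :: nat
      using that mult_right_mono[of "\<zeta> - \<epsilon>" "z + \<delta>" "real (a + b)"] z ec(1) by simp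
    then show "\<exists>LU' LV' u' w' c. stat_param \<alpha> \<beta> LU' LV' u' w' \<and> 0 < c \<and>
        (\<forall>a b. real a \<le> (\<zeta> - \<epsilon>) * real (a + b) \<longrightarrow> real a * (u' - ?u L) + real b * (w' - ?w L) \<le> - c * real (a + b))"
      using param[OF l(1)] ec by blast
  qed (rule uw[OF lim(1)])+
  moreover have "right_approx \<zeta> \<alpha> \<beta> (?u L) (?w L) (\<lambda>t. measure (DL L) {..t}) (\<lambda>t. measure (DL L) {..<t})"
    unfolding right_approx_def
  proof (rule side_approxI[where LU="\<lambda>k. inv_beta (lp k) \<beta>" and LV="\<lambda>k. beta_borel (lp k + \<beta>) \<alpha>"
      and u="\<lambda>k. ?u (lp k)" and w="\<lambda>k. ?w (lp k)"])
    fix k :: nat and t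
    show "stat_param \<alpha> \<beta> (inv_beta (lp k) \<beta>) (beta_borel (lp k + \<beta>) \<alpha>) (?u (lp k)) (?w (lp k))" by (rule param[OF lp(2)])
    have "?u (lp k) \<le> ?u L" "?w L \<le> ?w (lp k)"
      using log_u_strict_antimono[OF ab L(1) lp(1)] log_w_strict_mono[OF ab L(1) lp(1)] by (auto intro: less_imp_le)
    moreover have "?F \<zeta> L < ?F \<zeta> (lp k)" using lp[of k] by (intro log_mix_min[OF ab \<zeta>(1) \<zeta>1 L]) auto
    ultimately obtain \<epsilon> c where ec: "\<epsilon> > 0" "c > 0"
      "\<forall>a b :: nat. real a \<le> (\<zeta> + \<epsilon>) * real (a + b) \<longrightarrow> real a * (?u L - ?u (lp k)) + real b * (?w L - ?w (lp k)) \<le> - c * real (a + b)"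
      using linear_cone_right[of "?w L - ?w (lp k)" "?u L - ?u (lp k)" \<zeta>] by (auto simp: mix)
    then show "\<exists>LU' LV' u' w' \<epsilon> c. stat_param \<alpha> \<beta> LU' LV' u' w' \<and> 0 < \<epsilon> \<and> 0 < c \<and>
        (\<forall>a b. real a \<le> (\<zeta> + \<epsilon>) * real (a + b) \<longrightarrow> real a * (u' - ?u (lp k)) + real b * (w' - ?w (lp k)) \<le> - c * real (a + b))"
      using param[OF L(1)] by blast
    show "(\<lambda>k. measure (DL (lp k)) {..t}) \<longlonglongrightarrow> measure (DL L) {..t}"
      "(\<lambda>k. measure (DL (lp k)) {..<t}) \<longlonglongrightarrow> measure (DL L) {..<t}"
      by (rule measure_DL_tendsto[OF L(1) lim(2) lp(2)]; simp)+
  next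
    fix \<epsilon> :: real assume \<epsilon>: "\<epsilon> > 0"
    define z where "z = min (\<zeta> + \<epsilon>) ((\<zeta> + \<alpha> / (\<alpha> + \<beta>)) / 2)"
    have "(x + y) / 2 < y" "x < (x + y) / 2" if "x < y" for x y :: real using that by auto
    from this[OF \<zeta>(2)]
    have z: "z < \<alpha> / (\<alpha> + \<beta>)" "\<zeta> < z" "z \<le> \<zeta> + \<epsilon>" using \<epsilon> by (auto simp: z_def min_less_iff_disj)
    have z1: "0 < z" "z < 1" using z \<zeta> drift1 by auto
    obtain l where l: "l > 0" "?\<rho> l = z / (1 - z)" using solve[of z] z z1 by auto
    have lL: "L < l" by (rule order[OF L(1) l(1) L(2) l(2) z(2) z1(2)])
    have "?w L \<le> ?w l" "?u l \<le> ?u L"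
      using log_u_strict_antimono[OF ab L(1) lL] log_w_strict_mono[OF ab L(1) lL] by (auto intro: less_imp_le)
    moreover have "?F z l < ?F z L" using z1 lL L by (intro log_mix_min[OF ab _ _ l]) auto
    ultimately obtain \<delta> c where ec: "\<delta> > 0" "c > 0"
      "\<forall>a b :: nat. (z - \<delta>) * real (a + b) \<le> real a \<longrightarrow> real a * (?u l - ?u L) + real b * (?w l - ?w L) \<le> - c * real (a + b)"
      using linear_cone_left[of "?u l - ?u L" "?w l - ?w L" z] by (auto simp: mix)
    have "(z - \<delta>) * real (a + b) \<le> real a" if "(\<zeta> + \<epsilon>) * real (a + b) \<le> real a" for a b :: nat
      using that mult_right_mono[of "z - \<delta>" "\<zeta> + \<epsilon>" "real (a + b)"] z ec(1) by simp
    then show "\<exists>LU' LV' u' w' c. stat_param \<alpha> \<beta> LU' LV' u' w' \<and> 0 < c \<and>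
        (\<forall>a b. (\<zeta> + \<epsilon>) * real (a + b) \<le> real a \<longrightarrow> real a * (u' - ?u L) + real b * (w' - ?w L) \<le> - c * real (a + b))"
      using param[OF l(1)] ec by blast
  qed (rule uw[OF lim(2)])+
  ultimately show ?thesis by blast
qed

end

section \<open>The direction of the averaged drift\<close>

lemma real_distribution_beta_borel: "a > 0 \<Longrightarrow> b > 0 \<Longrightarrow> real_distribution (beta_borel a b)"
  by (simp add: real_distribution_def real_distribution_axioms_def prob_space_beta_borel)

lemma measure_beta_borel_lessThan: "measure (beta_borel a b) {..<t} = measure (beta_borel a b) {..t}"
proof -
  have "AE x in lborel. x \<noteq> t" by (rule AE_lborel_singleton)
  then have "AE x in beta_borel a b. x \<noteq> t" unfolding beta_borel_def by (subst AE_density) auto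
  then show ?thesis by (intro measure_eq_AE) auto
qed

lemma measure_beta_borel_reflect:
  assumes "a > 0" "b > 0"
  shows "1 - measure (beta_borel b a) {..1 - t} = measure (beta_borel a b) {..t}"
proof -
  interpret A: prob_space "beta_borel a b" using assms by (intro prob_space_beta_borel)
  have "emeasure (beta_borel b a) {..1 - t} = (\<integral>\<^sup>+x. indicator {..1 - t} x \<partial>beta_borel b a)" by simp
  also have "\<dots> = (\<integral>\<^sup>+x. indicator {..1 - t} (1 - x) \<partial>beta_borel a b)"
    by (rule nn_integral_beta_borel_reflect[symmetric]) simp
  also have "\<dots> = (\<integral>\<^sup>+x. indicator (UNIV - {..<t}) x \<partial>beta_borel a b)"
    by (intro nn_integral_cong) (auto split: split_indicator)
  also have "\<dots> = emeasure (beta_borel a b) (UNIV - {..<t})" by (rule nn_integral_indicator) simp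
  finally have "measure (beta_borel b a) {..1 - t} = measure (beta_borel a b) (UNIV - {..<t})"
    by (simp add: measure_def)
  also have "\<dots> = 1 - measure (beta_borel a b) {..t}"
    using A.prob_compl[of "{..<t}"] by (simp add: measure_beta_borel_lessThan)
  finally show ?thesis by simp
qed

context
  fixes \<alpha> \<beta> :: real
  assumes ab: "\<alpha> > 0" "\<beta> > 0"
begin

abbreviation "DLaw l \<equiv> doob_law (inv_beta l \<beta>) (beta_borel (l + \<beta>) \<alpha>)"

text \<open>Measures how far 1/u is from 1 on average. It vanishes as \<open>l\<close> grows and
  controls the difference between the Doob weight and the weight of the environment.\<close>

lemma nn_integral_inv_beta_defect:
  assumes "l > 0"
  shows "(\<integral>\<^sup>+u. ennreal (1 - 1 / u) \<partial>inv_beta l \<beta>) = ennreal (\<beta> / (\<beta> + l))"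
proof -
  have m: "inverse \<in> borel_measurable (beta_borel l \<beta>)"
    unfolding measurable_cong_sets[OF sets_beta_borel refl] by (intro borel_measurable_inverse) simp
  have "(\<integral>\<^sup>+u. ennreal (1 - 1 / u) \<partial>inv_beta l \<beta>) = (\<integral>\<^sup>+q. ennreal (1 - q) \<partial>beta_borel l \<beta>)"
    unfolding inv_beta_def by (subst nn_integral_distr[OF m]) (auto simp: inverse_eq_divide)
  also have "\<dots> = (\<integral>\<^sup>+x. ennreal x \<partial>beta_borel \<beta> l)"
    by (rule nn_integral_beta_borel_reflect) simp
  also have "\<dots> = (\<integral>\<^sup>+x. ennreal (x powr 1) \<partial>beta_borel \<beta> l)"
    by (rule nn_integral_cong_AE, rule AE_mp[OF AE_beta_borel AE_I2]) auto
  also have "\<dots> = ennreal (Beta (\<beta> + 1) l / Beta \<beta> l)"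
    using assms ab by (intro nn_integral_beta_borel_powr) auto
  also have "Beta (\<beta> + 1) l / Beta \<beta> l = \<beta> / (\<beta> + l)"
  proof -
    have "\<beta> \<notin> \<int>\<^sub>\<le>\<^sub>0" using ab by (auto elim!: nonpos_Ints_cases)
    then have "(\<beta> + l) * Beta (\<beta> + 1) l = \<beta> * Beta \<beta> l" by (rule Beta_plus1_left)
    then show ?thesis using Beta_real_pos[OF ab(2) assms] assms ab by (simp add: field_simps)
  qed
  finally show ?thesis .
qed

text \<open>Since the Doob weight is the dual weight divided by u > 1, it is the smaller of the two,
  by at most \<open>1 - 1 / u\<close>. The dual weight has the beta law, and Markov's inequality for
  the defect gives the last term.\<close>

lemma measure_DLaw_bounds:
  assumes l: "l > 0" and \<delta>: "\<delta> > 0"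
  shows "measure (beta_borel \<alpha> \<beta>) {..t} \<le> measure (DLaw l) {..<t}"
    and "measure (DLaw l) {..<t} \<le> measure (DLaw l) {..t}"
    and "measure (DLaw l) {..t} \<le> measure (beta_borel \<alpha> \<beta>) {..t + \<delta>} + \<beta> / ((\<beta> + l) * \<delta>)"
proof -
  interpret stat_pair \<alpha> \<beta> "inv_beta l \<beta>" "beta_borel (l + \<beta>) \<alpha>" using l ab by (intro stat_pair_beta)
  interpret V: prob_space "beta_borel (l + \<beta>) \<alpha>" by (rule prob_LV)
  interpret W: prob_space "beta_borel \<alpha> \<beta>" using ab by (intro prob_space_beta_borel)
  interpret D: prob_space "DLaw l" by (rule prob_space_doob_law)
  let ?U = "inv_beta l \<beta>" and ?V = "beta_borel (l + \<beta>) \<alpha>"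
  have AE1: "AE u in ?U. AE v in ?V. regular_pair u v \<and> 1 < u"
  proof (rule AE_mp[OF AE_regular_pair], rule AE_I2, rule impI)
    fix u assume A: "AE v in ?V. regular_pair u v"
    show "AE v in ?V. regular_pair u v \<and> 1 < u"
      using A AE_beta_borel[of "l + \<beta>" \<alpha>] by eventually_elim (auto simp: regular_pair_def)
  qed
  have cmp: "doob_weight u v \<le> dual_weight u v" "dual_weight u v \<le> doob_weight u v + (1 - 1 / u)"
    "0 < dual_weight u v" "0 \<le> 1 - 1 / u"
    if "regular_pair u v \<and> 1 < u" for u v
  proof -
    note r = regular_pair_weights[of u v]
    have d: "0 < dual_weight u v" "dual_weight u v < 1" "doob_weight u v = dual_weight u v * (1 / u)"
      using r that by auto
    have u: "1 / u \<le> 1" "0 < 1 / u" using that by auto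
    show "doob_weight u v \<le> dual_weight u v" using d u by (simp add: mult_left_le del: times_divide_eq_right)
    have "dual_weight u v * (1 - 1 / u) \<le> 1 * (1 - 1 / u)" using d u by (intro mult_right_mono) auto
    then show "dual_weight u v \<le> doob_weight u v + (1 - 1 / u)" unfolding d(3) by (simp add: algebra_simps)
    show "0 < dual_weight u v" "0 \<le> 1 - 1 / u" using d u by auto
  qed
  show "measure (DLaw l) {..<t} \<le> measure (DLaw l) {..t}" by (intro D.finite_measure_mono) auto
  have "emeasure (beta_borel \<alpha> \<beta>) {..<t} = (\<integral>\<^sup>+x. indicator {..<t} x \<partial>beta_borel \<alpha> \<beta>)" by simp
  also have "\<dots> = (\<integral>\<^sup>+u. \<integral>\<^sup>+v. indicator {..<t} (dual_weight u v) \<partial>?V \<partial>?U)"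
    by (rule nn_integral_dual_weight[symmetric]) simp
  also have "\<dots> \<le> (\<integral>\<^sup>+u. \<integral>\<^sup>+v. indicator {..<t} (doob_weight u v) \<partial>?V \<partial>?U)"
  proof (rule nn_integral_mono_AE, rule AE_mp[OF AE1], rule AE_I2, rule impI, rule nn_integral_mono_AE)
    fix u assume "AE v in ?V. regular_pair u v \<and> 1 < u"
    then show "AE v in ?V. (indicator {..<t} (dual_weight u v) :: ennreal) \<le> indicator {..<t} (doob_weight u v)"
      by eventually_elim (use cmp in \<open>force split: split_indicator\<close>)
  qed
  also have "\<dots> = emeasure (DLaw l) {..<t}" by (subst nn_integral_doob_law[symmetric]) auto
  finally have "measure (beta_borel \<alpha> \<beta>) {..<t} \<le> measure (DLaw l) {..<t}"
    by (simp add: W.emeasure_eq_measure D.emeasure_eq_measure)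
  then show "measure (beta_borel \<alpha> \<beta>) {..t} \<le> measure (DLaw l) {..<t}" by (simp add: measure_beta_borel_lessThan)
  have "emeasure (DLaw l) {..t} = (\<integral>\<^sup>+u. \<integral>\<^sup>+v. indicator {..t} (doob_weight u v) \<partial>?V \<partial>?U)"
    by (subst nn_integral_doob_law[symmetric]) auto
  also have "\<dots> \<le> (\<integral>\<^sup>+u. \<integral>\<^sup>+v. indicator {..t + \<delta>} (dual_weight u v) + ennreal (1 / \<delta>) * ennreal (1 - 1 / u) \<partial>?V \<partial>?U)"
  proof (rule nn_integral_mono_AE, rule AE_mp[OF AE1], rule AE_I2, rule impI, rule nn_integral_mono_AE)
    fix u assume "AE v in ?V. regular_pair u v \<and> 1 < u"
    then show "AE v in ?V. (indicator {..t} (doob_weight u v) :: ennreal) \<le>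
       indicator {..t + \<delta>} (dual_weight u v) + ennreal (1 / \<delta>) * ennreal (1 - 1 / u)"
    proof eventually_elim
      case (elim v)
      show ?case
      proof (cases "doob_weight u v \<le> t \<and> \<not> dual_weight u v \<le> t + \<delta>")
        case True
        \<comment> \<open>Markov's inequality, pointwise: if the two weights are separated by more
          than \<open>\<delta>\<close>, the defect exceeds \<open>\<delta>\<close>.\<close>
        then have "1 \<le> 1 / \<delta> * (1 - 1 / u)" using cmp(2)[OF elim] \<delta> by (simp add: field_simps)
        then have "1 \<le> ennreal (1 / \<delta>) * ennreal (1 - 1 / u)"
          using cmp(4)[OF elim] \<delta> by (simp add: ennreal_mult[symmetric] del: ennreal_1 flip: ennreal_1)
        then show ?thesis using True by (simp add: indicator_def)
      qed (auto split: split_indicator)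
    qed
  qed
  also have "\<dots> = (\<integral>\<^sup>+u. (\<integral>\<^sup>+v. indicator {..t + \<delta>} (dual_weight u v) \<partial>?V) + ennreal (1 / \<delta>) * ennreal (1 - 1 / u) \<partial>?U)"
  proof -
    have "(\<lambda>v. dual_weight u v) \<in> borel_measurable ?V" for u
      unfolding measurable_cong_sets[OF sets_beta_borel refl] by (intro measurable_dual_weight) simp_all
    note [measurable] = this
    show ?thesis using V.emeasure_space_1 by (subst nn_integral_add) auto
  qed
  also have "\<dots> = (\<integral>\<^sup>+u. \<integral>\<^sup>+v. indicator {..t + \<delta>} (dual_weight u v) \<partial>?V \<partial>?U) + ennreal (1 / \<delta>) * (\<integral>\<^sup>+u. ennreal (1 - 1 / u) \<partial>?U)"
  proof -
    have m: "(\<lambda>u. ennreal (1 - 1 / u)) \<in> borel_measurable ?U"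
      unfolding measurable_cong_sets[OF sets_inv_beta refl]
      by (intro measurable_compose[OF _ measurable_ennreal] borel_measurable_diff borel_measurable_divide borel_measurable_const) simp_all
    have m': "(\<lambda>u. \<integral>\<^sup>+v. indicator {..t + \<delta>} (dual_weight u v) \<partial>?V) \<in> borel_measurable ?U"
      by measurable
    have "(\<integral>\<^sup>+u. (\<integral>\<^sup>+v. indicator {..t + \<delta>} (dual_weight u v) \<partial>?V) + ennreal (1 / \<delta>) * ennreal (1 - 1 / u) \<partial>?U) =
        (\<integral>\<^sup>+u. \<integral>\<^sup>+v. indicator {..t + \<delta>} (dual_weight u v) \<partial>?V \<partial>?U) + (\<integral>\<^sup>+u. ennreal (1 / \<delta>) * ennreal (1 - 1 / u) \<partial>?U)"
      by (rule nn_integral_add[OF m' borel_measurable_times_ennreal[OF borel_measurable_const m]])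
    then show ?thesis unfolding nn_integral_cmult[OF m] .
  qed
  also have "(\<integral>\<^sup>+u. \<integral>\<^sup>+v. indicator {..t + \<delta>} (dual_weight u v) \<partial>?V \<partial>?U) = emeasure (beta_borel \<alpha> \<beta>) {..t + \<delta>}"
    by (subst nn_integral_dual_weight) auto
  also have "emeasure (beta_borel \<alpha> \<beta>) {..t + \<delta>} + ennreal (1 / \<delta>) * (\<integral>\<^sup>+u. ennreal (1 - 1 / u) \<partial>?U) =
      ennreal (measure (beta_borel \<alpha> \<beta>) {..t + \<delta>} + \<beta> / ((\<beta> + l) * \<delta>))"
    using l ab \<delta> by (simp add: nn_integral_inv_beta_defect W.emeasure_eq_measure ennreal_mult'[symmetric] mult.commute)
  finally show "measure (DLaw l) {..t} \<le> measure (beta_borel \<alpha> \<beta>) {..t + \<delta>} + \<beta> / ((\<beta> + l) * \<delta>)"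
    using l ab \<delta> by (simp add: D.emeasure_eq_measure add_nonneg_nonneg del: ennreal_plus)
qed

lemma measure_DLaw_tendsto_beta:
  shows "(\<lambda>k. measure (DLaw (real (Suc k))) {..t}) \<longlonglongrightarrow> measure (beta_borel \<alpha> \<beta>) {..t}"
    and "(\<lambda>k. measure (DLaw (real (Suc k))) {..<t}) \<longlonglongrightarrow> measure (beta_borel \<alpha> \<beta>) {..t}"
proof -
  interpret R: real_distribution "beta_borel \<alpha> \<beta>" by (rule real_distribution_beta_borel[OF ab])
  \<comment> \<open>With \<open>l = k + 1\<close> the shift is \<open>d k\<close> and the Markov
    error is at most \<open>\<beta> / (l * d k)\<close>. The square root balances them, so that both
    vanish.\<close>
  define d where "d k = 1 / sqrt (real (Suc k))" for k
  have d: "d k > 0" for k by (simp add: d_def)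
  have "(\<lambda>k. sqrt (1 / real (Suc k))) \<longlonglongrightarrow> sqrt 0"
    using LIMSEQ_Suc[OF lim_1_over_n[where 'a = real]] by (intro tendsto_real_sqrt) simp
  then have d0: "d \<longlonglongrightarrow> 0" by (simp add: d_def[abs_def] real_sqrt_divide)
  have "filterlim (\<lambda>k. t + d k) (at_right t) sequentially"
    unfolding filterlim_at using tendsto_add[OF tendsto_const[of t] d0] d by (simp add: less_imp_neq[OF d, symmetric])
  moreover have "(cdf (beta_borel \<alpha> \<beta>) \<longlongrightarrow> cdf (beta_borel \<alpha> \<beta>) t) (at_right t)"
    using R.cdf_is_right_cont by (simp add: continuous_within)
  ultimately have "(\<lambda>k. cdf (beta_borel \<alpha> \<beta>) (t + d k)) \<longlonglongrightarrow> cdf (beta_borel \<alpha> \<beta>) t"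
    by (rule filterlim_compose[rotated])
  then have "(\<lambda>k. measure (beta_borel \<alpha> \<beta>) {..t + d k} + \<beta> * d k) \<longlonglongrightarrow> measure (beta_borel \<alpha> \<beta>) {..t} + \<beta> * 0"
    by (intro tendsto_add tendsto_mult tendsto_const d0) (simp add: cdf_def)
  then have lim: "(\<lambda>k. measure (beta_borel \<alpha> \<beta>) {..t + d k} + \<beta> * d k) \<longlonglongrightarrow> measure (beta_borel \<alpha> \<beta>) {..t}" by simp
  have up: "measure (DLaw (real (Suc k))) {..t} \<le> measure (beta_borel \<alpha> \<beta>) {..t + d k} + \<beta> * d k" for k
  proof -
    let ?l = "real (Suc k)"
    have "\<beta> / ((\<beta> + ?l) * d k) \<le> \<beta> / (?l * d k)"
      using ab d[of k] by (intro divide_left_mono mult_right_mono mult_pos_pos) auto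
    also have "\<beta> / (?l * d k) = \<beta> * d k"
    proof -
      have "sqrt ?l * sqrt ?l = ?l" by (rule real_sqrt_mult_self[THEN trans]) simp
      then have "d k = 1 / (?l * d k)" by (simp add: d_def field_simps del: of_nat_Suc real_sqrt_mult_self)
      then show ?thesis by (metis divide_inverse inverse_eq_divide)
    qed
    finally have "\<beta> / ((\<beta> + ?l) * d k) \<le> \<beta> * d k" .
    then show ?thesis using measure_DLaw_bounds(3)[of ?l "d k" t] d[of k] by simp
  qed
  show "(\<lambda>k. measure (DLaw (real (Suc k))) {..t}) \<longlonglongrightarrow> measure (beta_borel \<alpha> \<beta>) {..t}"
  proof (rule tendsto_sandwich[OF _ _ tendsto_const lim])
    show "\<forall>\<^sub>F k in sequentially. measure (beta_borel \<alpha> \<beta>) {..t} \<le> measure (DLaw (real (Suc k))) {..t}"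
      using measure_DLaw_bounds(1,2)[of "real (Suc _)" 1 t] by (intro always_eventually allI) (meson of_nat_0_less_iff order_trans zero_less_Suc zero_less_one)
  qed (intro always_eventually allI up)
  show "(\<lambda>k. measure (DLaw (real (Suc k))) {..<t}) \<longlonglongrightarrow> measure (beta_borel \<alpha> \<beta>) {..t}"
  proof (rule tendsto_sandwich[OF _ _ tendsto_const lim])
    show "\<forall>\<^sub>F k in sequentially. measure (beta_borel \<alpha> \<beta>) {..t} \<le> measure (DLaw (real (Suc k))) {..<t}"
      using measure_DLaw_bounds(1)[of "real (Suc _)" 1 t] by (intro always_eventually allI) simp
    show "\<forall>\<^sub>F k in sequentially. measure (DLaw (real (Suc k))) {..<t} \<le> measure (beta_borel \<alpha> \<beta>) {..t + d k} + \<beta> * d k"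
      using order_trans[OF measure_DLaw_bounds(2)[of "real (Suc _)" 1 t] up] by (intro always_eventually allI) simp
  qed
qed

text \<open>Along the integers every parameter is beaten by its successor, because the rate in the
  drift direction decreases strictly. The limiting rates are 0: in the limit the transform is
  trivial and the law is that of the environment.\<close>

lemma left_approx_drift:
  "left_approx (\<alpha> / (\<alpha> + \<beta>)) \<alpha> \<beta> 0 0 (\<lambda>t. measure (beta_borel \<alpha> \<beta>) {..t}) (\<lambda>t. measure (beta_borel \<alpha> \<beta>) {..t})"
proof -
  let ?u = "log_u \<beta>" and ?w = "log_w \<alpha> \<beta>" and ?F = "log_mix \<alpha> \<beta>" and ?\<rho> = "pg_ratio \<alpha> \<beta>"
  let ?\<zeta> = "\<alpha> / (\<alpha> + \<beta>)"
  have \<zeta>: "0 < ?\<zeta>" "?\<zeta> < 1" using ab by auto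
  have param: "stat_param \<alpha> \<beta> (inv_beta l \<beta>) (beta_borel (l + \<beta>) \<alpha>) (?u l) (?w l)" if "l > 0" for l
    using stat_param_beta[OF ab that] .
  have mix: "\<zeta>' * (?u l - ?u l') + (1 - \<zeta>') * (?w l - ?w l') = ?F \<zeta>' l - ?F \<zeta>' l'" for \<zeta>' l l'
    by (simp add: log_mix_def[OF ab] algebra_simps)
  have top: "filterlim (\<lambda>k. real (Suc k)) at_top sequentially"
    using filterlim_compose[OF filterlim_real_sequentially filterlim_Suc] .
  show ?thesis
    unfolding left_approx_def
  proof (rule side_approxI[where LU="\<lambda>k. inv_beta (real (Suc k)) \<beta>" and LV="\<lambda>k. beta_borel (real (Suc k) + \<beta>) \<alpha>"
      and u="\<lambda>k. ?u (real (Suc k))" and w="\<lambda>k. ?w (real (Suc k))"])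
    fix k :: nat and t
    let ?l = "real (Suc k)" and ?m = "real (Suc (Suc k))"
    have lm: "0 < ?l" "?l < ?m" "0 < ?m" by auto
    show "stat_param \<alpha> \<beta> (inv_beta ?l \<beta>) (beta_borel (?l + \<beta>) \<alpha>) (?u ?l) (?w ?l)" by (rule param[OF lm(1)])
    have "?u ?m \<le> ?u ?l" "?w ?l \<le> ?w ?m"
      using log_u_strict_antimono[OF ab lm(1,2)] log_w_strict_mono[OF ab lm(1,2)] by (auto intro: less_imp_le)
    moreover have "?F ?\<zeta> ?m < ?F ?\<zeta> ?l" by (rule log_mix_drift_decreasing[OF ab lm(1,2)])
    ultimately obtain \<epsilon> c where ec: "\<epsilon> > 0" "c > 0"
      "\<forall>a b :: nat. (?\<zeta> - \<epsilon>) * real (a + b) \<le> real a \<longrightarrow> real a * (?u ?m - ?u ?l) + real b * (?w ?m - ?w ?l) \<le> - c * real (a + b)"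
      using linear_cone_left[of "?u ?m - ?u ?l" "?w ?m - ?w ?l" ?\<zeta>] unfolding mix by auto
    then show "\<exists>LU' LV' u' w' \<epsilon> c. stat_param \<alpha> \<beta> LU' LV' u' w' \<and> 0 < \<epsilon> \<and> 0 < c \<and>
        (\<forall>a b. (?\<zeta> - \<epsilon>) * real (a + b) \<le> real a \<longrightarrow> real a * (u' - ?u ?l) + real b * (w' - ?w ?l) \<le> - c * real (a + b))"
      using param[OF lm(3)] by blast
    show "(\<lambda>k. measure (DLaw (real (Suc k))) {..t}) \<longlonglongrightarrow> measure (beta_borel \<alpha> \<beta>) {..t}"
      "(\<lambda>k. measure (DLaw (real (Suc k))) {..<t}) \<longlonglongrightarrow> measure (beta_borel \<alpha> \<beta>) {..t}"
      by (rule measure_DLaw_tendsto_beta)+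
    show "(\<lambda>k. ?u (real (Suc k))) \<longlonglongrightarrow> 0" "(\<lambda>k. ?w (real (Suc k))) \<longlonglongrightarrow> 0"
      by (rule filterlim_compose[OF log_uw_tendsto_0(1)[OF ab] top], rule filterlim_compose[OF log_uw_tendsto_0(2)[OF ab] top])
  next
    fix \<epsilon> :: real assume \<epsilon>: "\<epsilon> > 0"
    define z where "z = max (?\<zeta> - \<epsilon>) (?\<zeta> / 2)"
    have "0 < max (x - \<epsilon>) (x / 2)" "max (x - \<epsilon>) (x / 2) < x" if "0 < x" for x :: real
      using that \<epsilon> by (auto simp: less_max_iff_disj)
    from this[OF \<zeta>(1)] have z: "0 < z" "z < ?\<zeta>" "?\<zeta> - \<epsilon> \<le> z" unfolding z_def by auto
    have z1: "z < 1" using z \<zeta> by simp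
    have "z * (\<alpha> + \<beta>) < \<alpha>" using z(2) ab by (simp add: field_simps)
    then have "z / (1 - z) < \<alpha> / \<beta>" using z1 ab by (simp add: divide_simps algebra_simps)
    then obtain l where l: "l > 0" "?\<rho> l = z / (1 - z)" using pg_ratio_surj[OF ab, of "z / (1 - z)"] z z1 by auto
    have lim_neg: "?w l < 0" "?u l > 0"
    proof -
      show "?u l > 0" unfolding log_u_def[OF ab] using l ab Digamma_real_strict_mono[of l "l + \<beta>"] by simp
      show "?w l < 0" unfolding log_w_def[OF ab] using l ab Digamma_real_strict_mono[of "l + \<beta>" "l + (\<alpha> + \<beta>)"] by simp
    qed
    \<comment> \<open>For a direction z west of the drift a minimiser exists. Beyond it the rate
      increases towards its limit 0 at infinity, so the minimum is strictly negative.\<close>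
    have "?F z l < 0"
    proof -
      have "?F z l < ?F z (l + 1)" using z z1 l by (intro log_mix_min[OF ab _ _ l]) auto
      also have "?F z (l + 1) \<le> 0"
      proof (rule tendsto_lowerbound[of _ _ at_top])
        have "((\<lambda>m. z * ?u m + (1 - z) * ?w m) \<longlongrightarrow> z * 0 + (1 - z) * 0) at_top"
          by (intro tendsto_intros log_uw_tendsto_0[OF ab])
        then show "((\<lambda>m. ?F z m) \<longlongrightarrow> 0) at_top" by (simp add: log_mix_def[OF ab])
        show "\<forall>\<^sub>F m in at_top. ?F z (l + 1) \<le> ?F z m"
          using eventually_gt_at_top[of "l + 1"]
        proof eventually_elim
          case (elim m)
          show ?case
          proof (rule less_imp_le, rule DERIV_pos_imp_increasing[OF elim])
            fix x assume "l + 1 \<le> x"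
            then have x: "x > 0" "l < x" using l by auto
            have "(1 - z) * ?\<rho> l < (1 - z) * ?\<rho> x"
              using z1 by (intro mult_strict_left_mono pg_ratio_strict_mono[OF ab] l x) auto
            then have "pg_den \<beta> x * ((1 - z) * ?\<rho> x - z) > 0"
              using l z1 pg_pos(2)[OF ab x(1)] by (intro mult_pos_pos) auto
            then show "\<exists>y. (?F z has_real_derivative y) (at x) \<and> y > 0"
              using log_mix_deriv[OF ab x(1)] by blast
          qed
        qed
      qed simp
      finally show ?thesis .
    qed
    then have "z * ?u l + (1 - z) * ?w l < 0" by (simp add: log_mix_def[OF ab])
    then obtain \<delta> c where ec: "\<delta> > 0" "c > 0"
      "\<forall>a b :: nat. real a \<le> (z + \<delta>) * real (a + b) \<longrightarrow> real a * ?u l + real b * ?w l \<le> - c * real (a + b)"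
      using linear_cone_right[of "?w l" "?u l" z] lim_neg by auto
    have "real a \<le> (z + \<delta>) * real (a + b)" if "real a \<le> (?\<zeta> - \<epsilon>) * real (a + b)" for a b :: nat
      using that mult_right_mono[of "?\<zeta> - \<epsilon>" "z + \<delta>" "real (a + b)"] z ec(1) by linarith
    then have "\<forall>a b. real a \<le> (?\<zeta> - \<epsilon>) * real (a + b) \<longrightarrow> real a * (?u l - 0) + real b * (?w l - 0) \<le> - c * real (a + b)"
      using ec(3) by simp
    then show "\<exists>LU' LV' u' w' c. stat_param \<alpha> \<beta> LU' LV' u' w' \<and> 0 < c \<and>
        (\<forall>a b. real a \<le> (?\<zeta> - \<epsilon>) * real (a + b) \<longrightarrow> real a * (u' - 0) + real b * (w' - 0) \<le> - c * real (a + b))"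
      using param[OF l(1)] ec(2) by blast
  qed
qed

end

theorem two_sided_approx:
  assumes ab: "\<alpha> > 0" "\<beta> > 0" and \<zeta>: "0 < \<zeta>" "\<zeta> < 1"
  shows "\<exists>us ws G G'. left_approx \<zeta> \<alpha> \<beta> us ws G G' \<and> right_approx \<zeta> \<alpha> \<beta> us ws G G'"
proof -
  have e: "1 - \<alpha> / (\<alpha> + \<beta>) = \<beta> / (\<beta> + \<alpha>)" using ab by (simp add: field_simps)
  consider "\<zeta> < \<alpha> / (\<alpha> + \<beta>)" | "\<zeta> = \<alpha> / (\<alpha> + \<beta>)" | "1 - \<zeta> < \<beta> / (\<beta> + \<alpha>)"
    using e by linarith
  then show ?thesis
  proof cases
    case 1
    then show ?thesis using approx_interior[OF ab \<zeta>(1)] by blast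
  next
    case 2
    have "right_approx \<zeta> \<alpha> \<beta> 0 0 (\<lambda>t. 1 - measure (beta_borel \<beta> \<alpha>) {..1 - t}) (\<lambda>t. 1 - measure (beta_borel \<beta> \<alpha>) {..1 - t})"
      by (rule right_approx_swap) (use left_approx_drift[OF ab(2,1)] in \<open>simp add: 2 e\<close>)
    then have "right_approx \<zeta> \<alpha> \<beta> 0 0 (\<lambda>t. measure (beta_borel \<alpha> \<beta>) {..t}) (\<lambda>t. measure (beta_borel \<alpha> \<beta>) {..t})"
      unfolding measure_beta_borel_reflect[OF ab] .
    then show ?thesis using left_approx_drift[OF ab] 2 by blast
  next
    case 3
    \<comment> \<open>Beyond the drift, exchanging the coordinates leads back to the first case; the
      mirror image also exchanges the left and the right approximation.\<close>
    have "0 < 1 - \<zeta>" using \<zeta> by simp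
    from approx_interior[OF ab(2,1) this 3] obtain us ws G G' where
      "left_approx (1 - \<zeta>) \<beta> \<alpha> us ws G G'" "right_approx (1 - \<zeta>) \<beta> \<alpha> us ws G G'" by blast
    then show ?thesis using right_approx_swap left_approx_swap by blast
  qed
qed

section \<open>Limits of conditioned walks\<close>

text \<open>A limit superior over all sequences in the direction simultaneously. Only countably many
  sites and zones are involved, so it is measurable, and it depends on the environment alone, not on
  any field.\<close>

definition bridge_sup :: "real \<Rightarrow> (site \<Rightarrow> real) \<Rightarrow> site \<Rightarrow> ennreal" where
  "bridge_sup \<zeta> w x = (INF M. SUP z\<in>zone \<zeta> M. ennreal (bridge w x z))"

definition bridge_inf :: "real \<Rightarrow> (site \<Rightarrow> real) \<Rightarrow> site \<Rightarrow> ennreal" where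
  "bridge_inf \<zeta> w x = (SUP M. INF z\<in>zone \<zeta> M. ennreal (bridge w x z))"

lemma measurable_bridge [measurable]: "(\<lambda>w. bridge w x z) \<in> borel_measurable (env_law \<alpha> \<beta>)"
  unfolding bridge_def by (intro borel_measurable_divide borel_measurable_times measurable_env_law_coord measurable_pass)

lemma measurable_bridge_sup [measurable]: "(\<lambda>w. bridge_sup \<zeta> w x) \<in> borel_measurable (env_law \<alpha> \<beta>)"
  unfolding bridge_sup_def by (intro borel_measurable_INF borel_measurable_SUP countableI_type measurable_compose[OF measurable_bridge measurable_ennreal])

lemma measurable_bridge_inf [measurable]: "(\<lambda>w. bridge_inf \<zeta> w x) \<in> borel_measurable (env_law \<alpha> \<beta>)"
  unfolding bridge_inf_def by (intro borel_measurable_INF borel_measurable_SUP countableI_type measurable_compose[OF measurable_bridge measurable_ennreal])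

text \<open>A sequence in the given direction whose N-th term has norm exactly N. Its existence
  makes zones nonempty and limits unique, and later limits of passage quotients are taken along
  it.\<close>

definition ray :: "real \<Rightarrow> nat \<Rightarrow> site" where
  "ray \<zeta> N = (\<lfloor>\<zeta> * real N\<rfloor>, int N - \<lfloor>\<zeta> * real N\<rfloor>)"

lemma goes_in_direction_ray:
  assumes "0 < \<zeta>" "\<zeta> < 1"
  shows "goes_in_direction (ray \<zeta>) (\<zeta>, 1 - \<zeta>)"
proof -
  have f: "0 \<le> \<lfloor>\<zeta> * real N\<rfloor>" "\<lfloor>\<zeta> * real N\<rfloor> \<le> int N" for N
  proof -
    have "\<zeta> * real N \<le> real N" using assms by (simp add: mult_left_le_one_le)
    then show "\<lfloor>\<zeta> * real N\<rfloor> \<le> int N" by linarith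
    show "0 \<le> \<lfloor>\<zeta> * real N\<rfloor>" using assms by simp
  qed
  have l: "l1norm (ray \<zeta> N) = N" for N using f[of N] by (simp add: l1norm_def ray_def)
  have c: "(\<lambda>N. real_of_int \<lfloor>\<zeta> * real N\<rfloor> / real N) \<longlonglongrightarrow> \<zeta>"
  proof (rule tendsto_sandwich)
    show "\<forall>\<^sub>F N in sequentially. \<zeta> - 1 / real N \<le> real_of_int \<lfloor>\<zeta> * real N\<rfloor> / real N"
      using eventually_gt_at_top[of 0]
    proof eventually_elim
      case (elim N)
      have "(\<zeta> - 1 / real N) * real N \<le> real_of_int \<lfloor>\<zeta> * real N\<rfloor>"
        using elim by (simp add: left_diff_distrib)
      then show ?case using elim by (simp add: pos_le_divide_eq)
    qed
    show "\<forall>\<^sub>F N in sequentially. real_of_int \<lfloor>\<zeta> * real N\<rfloor> / real N \<le> \<zeta>"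
      using eventually_gt_at_top[of 0] by (rule eventually_mono) (simp add: pos_divide_le_eq)
    have "(\<lambda>N. \<zeta> - 1 / real N) \<longlonglongrightarrow> \<zeta> - 0" by (intro tendsto_diff tendsto_const lim_1_over_n)
    then show "(\<lambda>N. \<zeta> - 1 / real N) \<longlonglongrightarrow> \<zeta>" by simp
  qed simp
  have "(\<lambda>N. (real_of_int \<lfloor>\<zeta> * real N\<rfloor> / real N, 1 - real_of_int \<lfloor>\<zeta> * real N\<rfloor> / real N)) \<longlonglongrightarrow> (\<zeta>, 1 - \<zeta>)"
    by (intro tendsto_Pair tendsto_diff tendsto_const c)
  moreover have "\<forall>\<^sub>F N in sequentially. (real_of_int \<lfloor>\<zeta> * real N\<rfloor> / real N, 1 - real_of_int \<lfloor>\<zeta> * real N\<rfloor> / real N) =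
      to_plane (ray \<zeta> N) /\<^sub>R real (l1norm (ray \<zeta> N))"
    using eventually_gt_at_top[of 0]
  proof eventually_elim
    case (elim N)
    then show ?case unfolding l by (simp add: to_plane_def ray_def divide_inverse right_diff_distrib mult.commute)
  qed
  ultimately have "(\<lambda>N. to_plane (ray \<zeta> N) /\<^sub>R real (l1norm (ray \<zeta> N))) \<longlonglongrightarrow> (\<zeta>, 1 - \<zeta>)"
    by (rule Lim_transform_eventually)
  then show ?thesis unfolding goes_in_direction_def l by (simp add: filterlim_ident)
qed

lemma zone_nonempty:
  assumes "0 < \<zeta>" "\<zeta> < 1"
  shows "zone \<zeta> M \<noteq> {}"
  using goes_in_direction_ray[OF assms] unfolding goes_in_direction_zone
  by (metis empty_iff eventually_happens trivial_limit_sequentially)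

lemma bridge_inf_le_sup:
  assumes "0 < \<zeta>" "\<zeta> < 1"
  shows "bridge_inf \<zeta> w x \<le> bridge_sup \<zeta> w x"
  unfolding bridge_inf_def bridge_sup_def
proof (rule SUP_least, rule INF_greatest)
  fix M M'
  obtain z where "z \<in> zone \<zeta> (max M M')" using zone_nonempty[OF assms] by blast
  then have z: "z \<in> zone \<zeta> M" "z \<in> zone \<zeta> M'" using subsetD[OF zone_mono[of M "max M M'"]] subsetD[OF zone_mono[of M' "max M M'"]] by simp_all
  show "(INF z\<in>zone \<zeta> M. ennreal (bridge w x z)) \<le> (SUP z\<in>zone \<zeta> M'. ennreal (bridge w x z))"
    by (rule order_trans[OF INF_lower[OF z(1)] SUP_upper[OF z(2)]])
qed

context stat_pair
begin

lemma AE_bridge_sup: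
  assumes \<zeta>: "0 < \<zeta>" "\<zeta> < 1"
    and L: "log_mgf LU r3 m3 u" "log_mgf LV r4 m4 w"
    and near: "\<exists>LU' LV' u' w' \<epsilon> c. stat_param \<alpha> \<beta> LU' LV' u' w' \<and> 0 < \<epsilon> \<and> 0 < c \<and>
        (\<forall>a b. real a \<le> (\<zeta> + \<epsilon>) * real (a + b) \<longrightarrow> real a * (u' - u) + real b * (w' - w) \<le> - c * real (a + b))"
  shows "AE \<eta> in field_law. \<forall>x. c \<sqsubseteq> x \<longrightarrow> bridge_sup \<zeta> (true_env c \<eta>) x \<le> ennreal (doob_at c \<eta> x)"
proof -
  obtain LU' LV' u' w' \<epsilon> k where P: "stat_param \<alpha> \<beta> LU' LV' u' w'" and ek: "\<epsilon> > 0" "k > 0"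
    and cone: "\<And>a b. real a \<le> (\<zeta> + \<epsilon>) * real (a + b) \<Longrightarrow> real a * (u' - u) + real b * (w' - w) \<le> - k * real (a + b)"
    using near by blast
  obtain r1 m1 r2 m2 where P': "stat_pair \<alpha> \<beta> LU' LV'" "log_mgf LU' r1 m1 u'" "log_mgf LV' r2 m2 w'"
    using P unfolding stat_param_def by blast
  have "AE \<eta> in field_law. summable (\<lambda>n. \<Sum>a\<in>{a. a \<le> n \<and> (a, n - a) \<in> {(a, b). real a \<le> (\<zeta> + \<epsilon>) * real (a + b)}}.
     doob_mass c \<eta> a (n - a))"
    unfolding doob_mass_def by (rule AE_summable_doob[OF P' L ek(2)]) (use cone in blast)
  with AE_regular_field[of c] show ?thesis
  proof eventually_elim
    case (elim \<eta>)
    show ?case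
    proof (intro allI impI)
      fix x assume x: "c \<sqsubseteq> x"
      show "bridge_sup \<zeta> (true_env c \<eta>) x \<le> ennreal (doob_at c \<eta> x)"
      proof (rule ennreal_le_epsilon)
        fix e :: real assume e: "e > 0"
        obtain M where M: "\<And>z. z \<in> zone \<zeta> M \<Longrightarrow> bridge (true_env c \<eta>) x z \<le> doob_at c \<eta> x + e"
          using bridge_upper[OF elim(1) \<zeta> ek(1) elim(2) x e] by blast
        have "bridge_sup \<zeta> (true_env c \<eta>) x \<le> (SUP z\<in>zone \<zeta> M. ennreal (bridge (true_env c \<eta>) x z))"
          unfolding bridge_sup_def by (rule INF_lower) simp
        also have "\<dots> \<le> ennreal (doob_at c \<eta> x + e)"
          by (rule SUP_least) (intro ennreal_leI M)
        also have "\<dots> = ennreal (doob_at c \<eta> x) + ennreal e"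
          using doob_at_pos[OF elim(1) x] e by (intro ennreal_plus) auto
        finally show "bridge_sup \<zeta> (true_env c \<eta>) x \<le> ennreal (doob_at c \<eta> x) + ennreal e" .
      qed
    qed
  qed
qed

lemma AE_bridge_inf:
  assumes \<zeta>: "0 < \<zeta>" "\<zeta> < 1"
    and L: "log_mgf LU r3 m3 u" "log_mgf LV r4 m4 w"
    and near: "\<exists>LU' LV' u' w' \<epsilon> c. stat_param \<alpha> \<beta> LU' LV' u' w' \<and> 0 < \<epsilon> \<and> 0 < c \<and>
        (\<forall>a b. (\<zeta> - \<epsilon>) * real (a + b) \<le> real a \<longrightarrow> real a * (u' - u) + real b * (w' - w) \<le> - c * real (a + b))"
  shows "AE \<eta> in field_law. \<forall>x. c \<sqsubseteq> x \<longrightarrow> ennreal (doob_at c \<eta> x) \<le> bridge_inf \<zeta> (true_env c \<eta>) x"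
proof -
  obtain LU' LV' u' w' \<epsilon> k where P: "stat_param \<alpha> \<beta> LU' LV' u' w'" and ek: "\<epsilon> > 0" "k > 0"
    and cone: "\<And>a b. (\<zeta> - \<epsilon>) * real (a + b) \<le> real a \<Longrightarrow> real a * (u' - u) + real b * (w' - w) \<le> - k * real (a + b)"
    using near by blast
  obtain r1 m1 r2 m2 where P': "stat_pair \<alpha> \<beta> LU' LV'" "log_mgf LU' r1 m1 u'" "log_mgf LV' r2 m2 w'"
    using P unfolding stat_param_def by blast
  have "AE \<eta> in field_law. summable (\<lambda>n. \<Sum>a\<in>{a. a \<le> n \<and> (a, n - a) \<in> {(a, b). (\<zeta> - \<epsilon>) * real (a + b) \<le> real a}}.
     doob_mass c \<eta> a (n - a))"
    unfolding doob_mass_def by (rule AE_summable_doob[OF P' L ek(2)]) (use cone in blast)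
  with AE_regular_field[of c] show ?thesis
  proof eventually_elim
    case (elim \<eta>)
    show ?case
    proof (intro allI impI)
      fix x assume x: "c \<sqsubseteq> x"
      show "ennreal (doob_at c \<eta> x) \<le> bridge_inf \<zeta> (true_env c \<eta>) x"
      proof (rule ennreal_le_epsilon)
        fix e :: real assume e: "e > 0"
        obtain M where M: "\<And>z. z \<in> zone \<zeta> M \<Longrightarrow> doob_at c \<eta> x - e \<le> bridge (true_env c \<eta>) x z"
          using bridge_lower[OF elim(1) \<zeta> ek(1) elim(2) x e] by blast
        have "ennreal (doob_at c \<eta> x) \<le> (INF z\<in>zone \<zeta> M. ennreal (bridge (true_env c \<eta>) x z)) + ennreal e"
        proof -
          have "ennreal (doob_at c \<eta> x - e) \<le> (INF z\<in>zone \<zeta> M. ennreal (bridge (true_env c \<eta>) x z))"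
            by (rule INF_greatest) (intro ennreal_leI M)
          then have "ennreal (doob_at c \<eta> x - e) + ennreal e \<le> (INF z\<in>zone \<zeta> M. ennreal (bridge (true_env c \<eta>) x z)) + ennreal e"
            by (rule add_right_mono)
          moreover have "ennreal (doob_at c \<eta> x) \<le> ennreal (doob_at c \<eta> x - e) + ennreal e"
            using e by (cases "doob_at c \<eta> x \<ge> e") (auto simp: ennreal_plus[symmetric] ennreal_neg intro: ennreal_leI simp del: ennreal_plus)
          ultimately show ?thesis by (rule order_trans[rotated])
        qed
        also have "\<dots> \<le> bridge_inf \<zeta> (true_env c \<eta>) x + ennreal e"
          unfolding bridge_inf_def by (intro add_right_mono SUP_upper) simp
        finally show "ennreal (doob_at c \<eta> x) \<le> bridge_inf \<zeta> (true_env c \<eta>) x + ennreal e" .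
      qed
    qed
  qed
qed

lemma measure_antidiagonal:
  assumes A: "A \<subseteq> {..n}"
  shows "measure field_law {\<eta>. \<forall>a\<in>A. doob_at c \<eta> (site_at c a (n - a)) \<le> t a} = (\<Prod>a\<in>A. measure (doob_law LU LV) {..t a})"
proof -
  interpret F: prob_space field_law by (rule prob_space_field_law)
  interpret D: prob_space "doob_law LU LV" by (rule prob_space_doob_law)
  have fin: "finite A" using A finite_subset by blast
  have m: "(\<lambda>\<eta>. doob_weight (field_h c \<eta> a b) (field_v c \<eta> a b)) \<in> borel_measurable field_law" for a b
    by (intro measurable_doob_weight measurable_field)
  have S: "{\<eta>. \<forall>a\<in>A. doob_at c \<eta> (site_at c a (n - a)) \<le> t a} \<in> sets field_law"
  proof -
    have "{\<eta> \<in> space field_law. \<forall>a\<in>A. doob_at c \<eta> (site_at c a (n - a)) \<le> t a} \<in> sets field_law"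
      unfolding doob_at_site using m by (intro sets.sets_Collect_finite_All fin) measurable
    then show ?thesis by simp
  qed
  have "emeasure field_law {\<eta>. \<forall>a\<in>A. doob_at c \<eta> (site_at c a (n - a)) \<le> t a} =
     (\<integral>\<^sup>+\<eta>. indicator {\<eta>. \<forall>a\<in>A. doob_at c \<eta> (site_at c a (n - a)) \<le> t a} \<eta> \<partial>field_law)"
    using S by simp
  also have "\<dots> = (\<integral>\<^sup>+\<eta>. (\<Prod>a\<in>A. indicator {..t a} (doob_weight (field_h c \<eta> a (n - a)) (field_v c \<eta> a (n - a)))) \<partial>field_law)"
  proof (rule nn_integral_cong)
    fix \<eta>
    show "(indicator {\<eta>. \<forall>a\<in>A. doob_at c \<eta> (site_at c a (n - a)) \<le> t a} \<eta> :: ennreal) =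
      (\<Prod>a\<in>A. indicator {..t a} (doob_weight (field_h c \<eta> a (n - a)) (field_v c \<eta> a (n - a))))"
    proof (cases "\<forall>a\<in>A. doob_weight (field_h c \<eta> a (n - a)) (field_v c \<eta> a (n - a)) \<le> t a")
      case False
      then obtain a where "a \<in> A" "\<not> doob_weight (field_h c \<eta> a (n - a)) (field_v c \<eta> a (n - a)) \<le> t a" by blast
      then have "(\<Prod>a\<in>A. indicator {..t a} (doob_weight (field_h c \<eta> a (n - a)) (field_v c \<eta> a (n - a)))) = (0 :: ennreal)"
        using fin by (intro prod_zero bexI[of _ a]) auto
      then show ?thesis using False by (simp add: doob_at_site)
    qed (simp add: doob_at_site)
  qed
  also have "\<dots> = (\<Prod>a\<in>A. \<integral>\<^sup>+u. \<integral>\<^sup>+v. indicator {..t a} (doob_weight u v) \<partial>LV \<partial>LU)"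
  proof (rule nn_integral_antidiagonal[OF A])
    fix a
    have "(\<lambda>p. doob_weight (fst p) (snd p)) \<in> borel_measurable (borel \<Otimes>\<^sub>M borel :: (real \<times> real) measure)"
      by (intro measurable_doob_weight) auto
    then show "(\<lambda>(u, v). indicator {..t a} (doob_weight u v) :: ennreal) \<in> borel_measurable (borel \<Otimes>\<^sub>M borel)"
      by (simp add: split_beta')
  qed
  also have "\<dots> = (\<Prod>a\<in>A. emeasure (doob_law LU LV) {..t a})"
    by (intro prod.cong refl) (subst nn_integral_doob_law[symmetric], auto)
  finally show ?thesis
    by (simp add: F.emeasure_eq_measure D.emeasure_eq_measure prod_ennreal prod_nonneg)
qed

lemma measure_env_law_eq:
  assumes "Measurable.pred (env_law \<alpha> \<beta>) P"
  shows "measure (env_law \<alpha> \<beta>) {w \<in> space (env_law \<alpha> \<beta>). P w} = measure field_law {\<eta>. P (true_env c \<eta>)}"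
proof -
  note [measurable] = assms measurable_true_env
  have "measure (env_law \<alpha> \<beta>) {w \<in> space (env_law \<alpha> \<beta>). P w} =
      measure (distr field_law (env_law \<alpha> \<beta>) (true_env c)) {w \<in> space (env_law \<alpha> \<beta>). P w}"
    by (simp add: distr_true_env)
  also have "\<dots> = measure field_law (true_env c -` {w \<in> space (env_law \<alpha> \<beta>). P w} \<inter> space field_law)"
    by (rule measure_distr) auto
  also have "true_env c -` {w \<in> space (env_law \<alpha> \<beta>). P w} \<inter> space field_law = {\<eta>. P (true_env c \<eta>)}"
    using is_envD[OF is_env_true_env] by (auto simp: space_env_law)
  finally show ?thesis .
qed

lemma AE_env_lawI:
  assumes "AE \<eta> in field_law. P (true_env c \<eta>)" and "Measurable.pred (env_law \<alpha> \<beta>) P"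
  shows "AE w in env_law \<alpha> \<beta>. P w"
proof -
  have "AE w in distr field_law (env_law \<alpha> \<beta>) (true_env c). P w"
    using assms by (subst AE_distr_iff) (auto intro: measurable_true_env)
  then show ?thesis unfolding distr_true_env .
qed

end

section \<open>Equality of the upper and lower limits\<close>

locale direction =
  fixes \<alpha> \<beta> \<zeta> us ws :: real and G G' :: "real \<Rightarrow> real"
  assumes ab: "\<alpha> > 0" "\<beta> > 0" and \<zeta>: "0 < \<zeta>" "\<zeta> < 1"
    and left: "left_approx \<zeta> \<alpha> \<beta> us ws G G'" and right: "right_approx \<zeta> \<alpha> \<beta> us ws G G'"
begin

sublocale E: prob_space "env_law \<alpha> \<beta>" by (rule prob_space_env_law[OF ab])

abbreviation "Om \<equiv> env_law \<alpha> \<beta>"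

text \<open>For each approximating parameter the upper limit is below the Doob weight, almost surely
  in its own field. The right side sees only the law of the environment, so the fields disappear and
  the parameter can be sent to its limit.\<close>

lemma sup_cdf_ge:
  assumes A: "A \<subseteq> {..n}"
  shows "(\<Prod>a\<in>A. G (t a)) \<le> measure Om {w \<in> space Om. \<forall>a\<in>A. bridge_sup \<zeta> w (site_at c a (n - a)) \<le> ennreal (t a)}"
proof -
  have fin: "finite A" using A finite_subset by blast
  obtain LU LV u w where 1: "\<And>k :: nat. stat_param \<alpha> \<beta> (LU k) (LV k) (u k) (w k)"
    and 2: "\<And>k. \<exists>LU' LV' u' w' \<epsilon> c. stat_param \<alpha> \<beta> LU' LV' u' w' \<and> 0 < \<epsilon> \<and> 0 < c \<and>
        (\<forall>a b. real a \<le> (\<zeta> + \<epsilon>) * real (a + b) \<longrightarrow> real a * (u' - u k) + real b * (w' - w k) \<le> - c * real (a + b))"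
    and 3: "\<And>t. (\<lambda>k. measure (doob_law (LU k) (LV k)) {..t}) \<longlonglongrightarrow> G t"
    using right unfolding right_approx_def side_approx_def by blast
  have pm: "Measurable.pred Om (\<lambda>w. \<forall>a\<in>A. bridge_sup \<zeta> w (site_at c a (n - a)) \<le> ennreal (t a))"
    using fin by measurable
  have "(\<Prod>a\<in>A. measure (doob_law (LU k) (LV k)) {..t a}) \<le>
      measure Om {w \<in> space Om. \<forall>a\<in>A. bridge_sup \<zeta> w (site_at c a (n - a)) \<le> ennreal (t a)}" for k
  proof -
    obtain r1 m1 r2 m2 where k: "stat_pair \<alpha> \<beta> (LU k) (LV k)" "log_mgf (LU k) r1 m1 (u k)" "log_mgf (LV k) r2 m2 (w k)"
      using 1[of k] unfolding stat_param_def by blast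
    interpret stat_pair \<alpha> \<beta> "LU k" "LV k" by fact
    interpret F: prob_space field_law by (rule prob_space_field_law)
    note [measurable] = measurable_true_env pm
    have "(\<Prod>a\<in>A. measure (doob_law (LU k) (LV k)) {..t a}) = measure field_law {\<eta>. \<forall>a\<in>A. doob_at c \<eta> (site_at c a (n - a)) \<le> t a}"
      by (rule measure_antidiagonal[OF A, symmetric])
    also have "\<dots> \<le> measure field_law {\<eta>. \<forall>a\<in>A. bridge_sup \<zeta> (true_env c \<eta>) (site_at c a (n - a)) \<le> ennreal (t a)}"
    proof (rule F.finite_measure_mono_AE)
      show "AE \<eta> in field_law. \<eta> \<in> {\<eta>. \<forall>a\<in>A. doob_at c \<eta> (site_at c a (n - a)) \<le> t a} \<longrightarrow>
         \<eta> \<in> {\<eta>. \<forall>a\<in>A. bridge_sup \<zeta> (true_env c \<eta>) (site_at c a (n - a)) \<le> ennreal (t a)}"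
        using AE_bridge_sup[OF \<zeta> k(2,3) 2[of k], of c]
      proof eventually_elim
        case (elim \<eta>)
        have "bridge_sup \<zeta> (true_env c \<eta>) (site_at c a b) \<le> ennreal (doob_at c \<eta> (site_at c a b))" for a b
          using elim below_site_at by blast
        then show ?case by (auto intro: order_trans[OF _ ennreal_leI])
      qed
      have "{\<eta> \<in> space field_law. \<forall>a\<in>A. bridge_sup \<zeta> (true_env c \<eta>) (site_at c a (n - a)) \<le> ennreal (t a)} \<in> sets field_law"
        using fin by measurable
      then show "{\<eta>. \<forall>a\<in>A. bridge_sup \<zeta> (true_env c \<eta>) (site_at c a (n - a)) \<le> ennreal (t a)} \<in> sets field_law" by simp
    qed
    also have "\<dots> = measure Om {w \<in> space Om. \<forall>a\<in>A. bridge_sup \<zeta> w (site_at c a (n - a)) \<le> ennreal (t a)}"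
      by (rule measure_env_law_eq[symmetric, OF pm])
    finally show ?thesis .
  qed
  moreover have "(\<lambda>k. \<Prod>a\<in>A. measure (doob_law (LU k) (LV k)) {..t a}) \<longlonglongrightarrow> (\<Prod>a\<in>A. G (t a))"
    by (intro tendsto_prod 3)
  ultimately show ?thesis by (intro LIMSEQ_le_const2) auto
qed

text \<open>The mirror image of \<open>sup_cdf_ge\<close>. Nonnegative thresholds are required
  because \<open>ennreal\<close> sends all negative numbers to 0.\<close>

lemma inf_cdf_le:
  assumes A: "A \<subseteq> {..n}" and t: "\<And>a. a \<in> A \<Longrightarrow> 0 \<le> t a"
  shows "measure Om {w \<in> space Om. \<forall>a\<in>A. bridge_inf \<zeta> w (site_at c a (n - a)) \<le> ennreal (t a)} \<le> (\<Prod>a\<in>A. G (t a))"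
proof -
  have fin: "finite A" using A finite_subset by blast
  obtain LU LV u w where 1: "\<And>k :: nat. stat_param \<alpha> \<beta> (LU k) (LV k) (u k) (w k)"
    and 2: "\<And>k. \<exists>LU' LV' u' w' \<epsilon> c. stat_param \<alpha> \<beta> LU' LV' u' w' \<and> 0 < \<epsilon> \<and> 0 < c \<and>
        (\<forall>a b. (\<zeta> - \<epsilon>) * real (a + b) \<le> real a \<longrightarrow> real a * (u' - u k) + real b * (w' - w k) \<le> - c * real (a + b))"
    and 3: "\<And>t. (\<lambda>k. measure (doob_law (LU k) (LV k)) {..t}) \<longlonglongrightarrow> G t"
    using left unfolding left_approx_def side_approx_def by blast
  have pm: "Measurable.pred Om (\<lambda>w. \<forall>a\<in>A. bridge_inf \<zeta> w (site_at c a (n - a)) \<le> ennreal (t a))"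
    using fin by measurable
  have "measure Om {w \<in> space Om. \<forall>a\<in>A. bridge_inf \<zeta> w (site_at c a (n - a)) \<le> ennreal (t a)} \<le>
    (\<Prod>a\<in>A. measure (doob_law (LU k) (LV k)) {..t a})" for k
  proof -
    obtain r1 m1 r2 m2 where k: "stat_pair \<alpha> \<beta> (LU k) (LV k)" "log_mgf (LU k) r1 m1 (u k)" "log_mgf (LV k) r2 m2 (w k)"
      using 1[of k] unfolding stat_param_def by blast
    interpret stat_pair \<alpha> \<beta> "LU k" "LV k" by fact
    interpret F: prob_space field_law by (rule prob_space_field_law)
    have "measure Om {w \<in> space Om. \<forall>a\<in>A. bridge_inf \<zeta> w (site_at c a (n - a)) \<le> ennreal (t a)} =
        measure field_law {\<eta>. \<forall>a\<in>A. bridge_inf \<zeta> (true_env c \<eta>) (site_at c a (n - a)) \<le> ennreal (t a)}"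
      by (rule measure_env_law_eq[OF pm])
    also have "\<dots> \<le> measure field_law {\<eta>. \<forall>a\<in>A. doob_at c \<eta> (site_at c a (n - a)) \<le> t a}"
    proof (rule F.finite_measure_mono_AE)
      show "AE \<eta> in field_law. \<eta> \<in> {\<eta>. \<forall>a\<in>A. bridge_inf \<zeta> (true_env c \<eta>) (site_at c a (n - a)) \<le> ennreal (t a)} \<longrightarrow>
         \<eta> \<in> {\<eta>. \<forall>a\<in>A. doob_at c \<eta> (site_at c a (n - a)) \<le> t a}"
        using AE_bridge_inf[OF \<zeta> k(2,3) 2[of k], of c]
      proof eventually_elim
        case (elim \<eta>)
        have "ennreal (doob_at c \<eta> (site_at c a b)) \<le> bridge_inf \<zeta> (true_env c \<eta>) (site_at c a b)" for a b
          using elim below_site_at by blast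
        then show ?case using t by (auto dest!: bspec dest: order_trans simp flip: ennreal_le_iff)
      qed
      have "{\<eta> \<in> space field_law. \<forall>a\<in>A. doob_at c \<eta> (site_at c a (n - a)) \<le> t a} \<in> sets field_law"
        unfolding doob_at_site
        by (intro sets.sets_Collect_finite_All fin borel_measurable_le borel_measurable_const measurable_doob_weight measurable_field)
      then show "{\<eta>. \<forall>a\<in>A. doob_at c \<eta> (site_at c a (n - a)) \<le> t a} \<in> sets field_law" by simp
    qed
    also have "\<dots> = (\<Prod>a\<in>A. measure (doob_law (LU k) (LV k)) {..t a})"
      by (rule measure_antidiagonal[OF A])
    finally show ?thesis .
  qed
  moreover have "(\<lambda>k. \<Prod>a\<in>A. measure (doob_law (LU k) (LV k)) {..t a}) \<longlonglongrightarrow> (\<Prod>a\<in>A. G (t a))"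
    by (intro tendsto_prod 3)
  ultimately show ?thesis by (intro LIMSEQ_le_const) auto
qed

text \<open>The lower limit never exceeds the upper one, so the two preceding bounds enclose both
  distribution functions and force equality.\<close>

lemma sup_cdf:
  assumes A: "A \<subseteq> {..n}" and t: "\<And>a. a \<in> A \<Longrightarrow> 0 \<le> t a"
  shows "measure Om {w \<in> space Om. \<forall>a\<in>A. bridge_sup \<zeta> w (site_at c a (n - a)) \<le> ennreal (t a)} = (\<Prod>a\<in>A. G (t a))"
    and "measure Om {w \<in> space Om. \<forall>a\<in>A. bridge_inf \<zeta> w (site_at c a (n - a)) \<le> ennreal (t a)} = (\<Prod>a\<in>A. G (t a))"
proof -
  have fin: "finite A" using A finite_subset by blast
  have "measure Om {w \<in> space Om. \<forall>a\<in>A. bridge_sup \<zeta> w (site_at c a (n - a)) \<le> ennreal (t a)} \<le>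
      measure Om {w \<in> space Om. \<forall>a\<in>A. bridge_inf \<zeta> w (site_at c a (n - a)) \<le> ennreal (t a)}"
    using fin by (intro E.finite_measure_mono) (auto intro: order_trans[OF bridge_inf_le_sup[OF \<zeta>]])
  then show "measure Om {w \<in> space Om. \<forall>a\<in>A. bridge_sup \<zeta> w (site_at c a (n - a)) \<le> ennreal (t a)} = (\<Prod>a\<in>A. G (t a))"
    "measure Om {w \<in> space Om. \<forall>a\<in>A. bridge_inf \<zeta> w (site_at c a (n - a)) \<le> ennreal (t a)} = (\<Prod>a\<in>A. G (t a))"
    using sup_cdf_ge[OF A, where t=t and c=c] inf_cdf_le[OF A, where t=t and c=c] t by auto
qed

lemma AE_inf_eq_sup: "AE w in Om. \<forall>x. bridge_inf \<zeta> w x = bridge_sup \<zeta> w x"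
proof -
  \<comment> \<open>Two ordered variables with equal laws: if they differed, some rational level
    would separate them, but at each level the events are nested and equally likely.\<close>
  have "AE w in Om. \<forall>x. \<forall>q :: rat. \<not> (bridge_inf \<zeta> w x \<le> ennreal (of_rat q) \<and> ennreal (of_rat q) < bridge_sup \<zeta> w x \<and> q \<ge> 0)"
    unfolding AE_all_countable
  proof (intro allI)
    fix x :: site and q :: rat
    show "AE w in Om. \<not> (bridge_inf \<zeta> w x \<le> ennreal (of_rat q) \<and> ennreal (of_rat q) < bridge_sup \<zeta> w x \<and> q \<ge> 0)"
    proof (cases "q \<ge> 0")
      case True
      let ?I = "{w \<in> space Om. bridge_inf \<zeta> w x \<le> ennreal (of_rat q)}"
      let ?S = "{w \<in> space Om. bridge_sup \<zeta> w x \<le> ennreal (of_rat q)}"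
      have "measure Om ?S = measure Om ?I"
        using sup_cdf[of "{0}" 0 "\<lambda>_. of_rat q" x] True by simp
      moreover have "?S \<subseteq> ?I" by (auto intro: order_trans[OF bridge_inf_le_sup[OF \<zeta>]])
      ultimately have "measure Om (?I - ?S) = 0"
        by (subst E.finite_measure_Diff) auto
      then have "emeasure Om (?I - ?S) = 0" by (simp add: E.emeasure_eq_measure)
      then have "AE w in Om. w \<notin> ?I - ?S" by (intro AE_not_in) (auto simp: null_sets_def)
      then show ?thesis by (rule AE_mp) (auto intro!: AE_I2)
    qed simp
  qed
  then show ?thesis
  proof eventually_elim
    case (elim w)
    show ?case
    proof (rule allI, rule ccontr)
      fix x assume "bridge_inf \<zeta> w x \<noteq> bridge_sup \<zeta> w x"
      then have lt: "bridge_inf \<zeta> w x < bridge_sup \<zeta> w x" using bridge_inf_le_sup[OF \<zeta>, of w x] by simp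
      obtain y where y: "bridge_inf \<zeta> w x < y" "y < bridge_sup \<zeta> w x" using dense[OF lt] by blast
      from ennreal_rat_dense[OF y(2)] obtain r :: rat where r: "y < real_of_rat r" "ennreal (real_of_rat r) < bridge_sup \<zeta> w x" by blast
      have "0 \<le> r"
      proof (rule ccontr)
        assume "\<not> 0 \<le> r"
        then have "real_of_rat r \<le> 0" by simp
        then have "ennreal (real_of_rat r) = 0" by (rule ennreal_neg)
        then show False using r(1) by simp
      qed
      then show False using elim y(1) r by (meson less_imp_le less_trans)
    qed
  qed
qed

text \<open>A single approximating parameter on each side is enough, since its Doob weights already
  lie strictly between 0 and 1.\<close>

lemma AE_strict:
  "AE w in Om. \<forall>x. 0 < w x \<and> w x < 1 \<and> 0 < bridge_inf \<zeta> w x \<and> bridge_sup \<zeta> w x < 1"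
proof -
  note [measurable] = measurable_env_law_coord
  have "AE w in Om. 0 < w x \<and> w x < 1 \<and> 0 < bridge_inf \<zeta> w x" for x
  proof -
    obtain LU LV u w where 1: "\<And>k :: nat. stat_param \<alpha> \<beta> (LU k) (LV k) (u k) (w k)"
      and 2: "\<And>k. \<exists>LU' LV' u' w' \<epsilon> c. stat_param \<alpha> \<beta> LU' LV' u' w' \<and> 0 < \<epsilon> \<and> 0 < c \<and>
        (\<forall>a b. (\<zeta> - \<epsilon>) * real (a + b) \<le> real a \<longrightarrow> real a * (u' - u k) + real b * (w' - w k) \<le> - c * real (a + b))"
      using left unfolding left_approx_def side_approx_def by blast
    obtain r1 m1 r2 m2 where k: "stat_pair \<alpha> \<beta> (LU 0) (LV 0)" "log_mgf (LU 0) r1 m1 (u 0)" "log_mgf (LV 0) r2 m2 (w 0)"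
      using 1[of 0] unfolding stat_param_def by blast
    interpret stat_pair \<alpha> \<beta> "LU 0" "LV 0" by fact
    show ?thesis
    proof (rule AE_env_lawI[of _ x])
      show "AE \<eta> in field_law. 0 < true_env x \<eta> x \<and> true_env x \<eta> x < 1 \<and> 0 < bridge_inf \<zeta> (true_env x \<eta>) x"
        using AE_bridge_inf[OF \<zeta> k(2,3) 2[of 0], of x] AE_regular_field[of x]
      proof eventually_elim
        case (elim \<eta>)
        have "x \<sqsubseteq> x" by (simp add: below_def)
        then show ?case
          using elim(1) true_env_pos[OF elim(2), of x] doob_at_pos[OF elim(2), of x] by (metis ennreal_less_zero_iff less_le_trans)
      qed
    qed measurable
  qed
  moreover have "AE w in Om. bridge_sup \<zeta> w x < 1" for x
  proof -
    obtain LU LV u w where 1: "\<And>k :: nat. stat_param \<alpha> \<beta> (LU k) (LV k) (u k) (w k)"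
      and 2: "\<And>k. \<exists>LU' LV' u' w' \<epsilon> c. stat_param \<alpha> \<beta> LU' LV' u' w' \<and> 0 < \<epsilon> \<and> 0 < c \<and>
        (\<forall>a b. real a \<le> (\<zeta> + \<epsilon>) * real (a + b) \<longrightarrow> real a * (u' - u k) + real b * (w' - w k) \<le> - c * real (a + b))"
      using right unfolding right_approx_def side_approx_def by blast
    obtain r1 m1 r2 m2 where k: "stat_pair \<alpha> \<beta> (LU 0) (LV 0)" "log_mgf (LU 0) r1 m1 (u 0)" "log_mgf (LV 0) r2 m2 (w 0)"
      using 1[of 0] unfolding stat_param_def by blast
    interpret stat_pair \<alpha> \<beta> "LU 0" "LV 0" by fact
    show ?thesis
    proof (rule AE_env_lawI[of _ x])
      show "AE \<eta> in field_law. bridge_sup \<zeta> (true_env x \<eta>) x < 1"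
        using AE_bridge_sup[OF \<zeta> k(2,3) 2[of 0], of x] AE_regular_field[of x]
      proof eventually_elim
        case (elim \<eta>)
        have "x \<sqsubseteq> x" by (simp add: below_def)
        then show ?case
          using elim(1) doob_at_pos[OF elim(2), of x] by (metis ennreal_less_one_iff le_less_trans)
      qed
    qed measurable
  qed
  ultimately have "AE w in Om. 0 < w x \<and> w x < 1 \<and> 0 < bridge_inf \<zeta> w x \<and> bridge_sup \<zeta> w x < 1" for x
    using AE_conjI[of "\<lambda>w. 0 < w x \<and> w x < 1 \<and> 0 < bridge_inf \<zeta> w x" Om "\<lambda>w. bridge_sup \<zeta> w x < 1"]
    unfolding conj_assoc by blast
  then show ?thesis unfolding AE_all_countable by blast
qed

end

section \<open>From bridge limits to the Busemann function\<close>

lemma zone_limit: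
  fixes f :: "site \<Rightarrow> 'a :: {complete_linorder, linorder_topology}"
  assumes "(SUP M. INF z\<in>zone \<zeta> M. f z) = l" "(INF M. SUP z\<in>zone \<zeta> M. f z) = l"
    and z: "goes_in_direction z (\<zeta>, 1 - \<zeta>)"
  shows "(\<lambda>N. f (z N)) \<longlonglongrightarrow> l"
proof (rule order_tendstoI)
  note ev = z[unfolded goes_in_direction_zone, rule_format]
  fix y
  { assume "y < l"
    then obtain M where M: "y < (INF z\<in>zone \<zeta> M. f z)" using assms(1) by (auto simp: less_SUP_iff)
    show "\<forall>\<^sub>F N in sequentially. y < f (z N)"
      using ev[of M] by eventually_elim (rule less_INF_D[OF M]) }
  { assume "l < y"
    then obtain M where M: "(SUP z\<in>zone \<zeta> M. f z) < y" using assms(2) by (auto simp: INF_less_iff)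
    show "\<forall>\<^sub>F N in sequentially. f (z N) < y"
      using ev[of M] by eventually_elim (rule SUP_lessD[OF M]) }
qed

text \<open>For the converse, a violation of either bound yields in every zone a site where it
  occurs. As zones are nested, one such site per zone forms a sequence in the direction whose limit
  would be wrong.\<close>

lemma zone_limit_iff:
  fixes f :: "site \<Rightarrow> real"
  assumes \<zeta>: "0 < \<zeta>" "\<zeta> < 1"
  shows "(\<forall>z. goes_in_direction z (\<zeta>, 1 - \<zeta>) \<longrightarrow> (\<lambda>N. f (z N)) \<longlonglongrightarrow> b) \<longleftrightarrow>
    (SUP M. INF z\<in>zone \<zeta> M. ereal (f z)) = ereal b \<and> (INF M. SUP z\<in>zone \<zeta> M. ereal (f z)) = ereal b"
    (is "?L \<longleftrightarrow> ?I = _ \<and> ?S = _")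
proof
  assume "?I = ereal b \<and> ?S = ereal b"
  then show ?L using zone_limit[where f="\<lambda>z. ereal (f z)" and \<zeta>=\<zeta> and l="ereal b"] by simp
next
  assume L: ?L
  have seq: "goes_in_direction z (\<zeta>, 1 - \<zeta>)" if "\<And>M. z M \<in> zone \<zeta> M" for z
    unfolding goes_in_direction_zone
  proof
    fix M
    show "\<forall>\<^sub>F N in sequentially. z N \<in> zone \<zeta> M"
      using eventually_ge_at_top[of M] by eventually_elim (use that zone_mono in blast)
  qed
  have "?S \<le> ereal b"
  proof (rule ccontr)
    assume "\<not> ?S \<le> ereal b"
    then obtain y where y: "ereal b < ereal y" "ereal y < ?S" using ereal_dense2[of "ereal b" ?S] by (auto simp: not_le)
    have "\<exists>z\<in>zone \<zeta> M. ereal y < ereal (f z)" for M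
    proof -
      have "ereal y < (SUP z\<in>zone \<zeta> M. ereal (f z))" using y(2) by (rule less_le_trans) (rule INF_lower, simp)
      then show ?thesis by (simp add: less_SUP_iff)
    qed
    then obtain z where z: "\<And>M. z M \<in> zone \<zeta> M" "\<And>M. y < f (z M)" by (metis less_ereal.simps(1))
    have "(\<lambda>N. f (z N)) \<longlonglongrightarrow> b" using L seq[of z] z(1) by blast
    then have "y \<le> b" using z(2) by (intro LIMSEQ_le_const) (auto intro: less_imp_le)
    then show False using y(1) by simp
  qed
  moreover have "ereal b \<le> ?I"
  proof (rule ccontr)
    assume "\<not> ereal b \<le> ?I"
    then obtain y where y: "?I < ereal y" "ereal y < ereal b" using ereal_dense2[of ?I "ereal b"] by (auto simp: not_le)
    have "\<exists>z\<in>zone \<zeta> M. ereal (f z) < ereal y" for M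
    proof -
      have "(INF z\<in>zone \<zeta> M. ereal (f z)) < ereal y" by (rule le_less_trans[OF _ y(1)]) (rule SUP_upper, simp)
      then show ?thesis by (simp add: INF_less_iff)
    qed
    then obtain z where z: "\<And>M. z M \<in> zone \<zeta> M" "\<And>M. f (z M) < y" by (metis less_ereal.simps(1))
    have "(\<lambda>N. f (z N)) \<longlonglongrightarrow> b" using L seq[of z] z(1) by blast
    then have "b \<le> y" using z(2) by (intro LIMSEQ_le_const2) (auto intro: less_imp_le)
    then show False using y(2) by simp
  qed
  moreover have "?I \<le> ?S"
  proof (rule SUP_least, rule INF_greatest)
    fix M M'
    obtain z where "z \<in> zone \<zeta> (max M M')" using zone_nonempty[OF \<zeta>] by blast
    then have z: "z \<in> zone \<zeta> M" "z \<in> zone \<zeta> M'"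
      using subsetD[OF zone_mono[of M "max M M'"]] subsetD[OF zone_mono[of M' "max M M'"]] by simp_all
    show "(INF z\<in>zone \<zeta> M. ereal (f z)) \<le> (SUP z\<in>zone \<zeta> M'. ereal (f z))"
      by (rule order_trans[OF INF_lower[OF z(1)] SUP_upper[OF z(2)]])
  qed
  ultimately show "?I = ereal b \<and> ?S = ereal b"
    by (intro conjI order_antisym[OF order_trans[of _ ?S] ] order_antisym[OF _ order_trans[of _ ?I]])
qed

lemma is_env_space: "w \<in> space (env_law \<alpha> \<beta>) \<Longrightarrow> is_env w"
  by (auto simp: space_env_law is_env_def)

text \<open>Independence of random variables demands measurability on all environments, not only
  where the limit exists, so the value that the definite description takes elsewhere must be
  analysed too.\<close>

lemma measurable_busemann:
  assumes \<zeta>: "0 < \<zeta>" "\<zeta> < 1"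
  shows "(\<lambda>w. busemann (\<zeta>, 1 - \<zeta>) w x y) \<in> borel_measurable (env_law \<alpha> \<beta>)"
proof -
  define f where "f w z = ln (pass w x z) - ln (pass w y z)" for w z
  define I where "I w = (SUP M. INF z\<in>zone \<zeta> M. ereal (f w z))" for w
  define S where "S w = (INF M. SUP z\<in>zone \<zeta> M. ereal (f w z))" for w
  have [measurable]: "(\<lambda>w. f w z) \<in> borel_measurable (env_law \<alpha> \<beta>)" for z
    unfolding f_def by (intro borel_measurable_diff borel_measurable_ln measurable_pass)
  have IS: "I \<in> borel_measurable (env_law \<alpha> \<beta>)" "S \<in> borel_measurable (env_law \<alpha> \<beta>)"
    unfolding I_def S_def by (intro borel_measurable_INF borel_measurable_SUP countableI_type borel_measurable_ereal; simp)+
  have iff: "(\<forall>z. goes_in_direction z (\<zeta>, 1 - \<zeta>) \<longrightarrow> (\<lambda>N. ln (hit_prob w x (z N)) - ln (hit_prob w y (z N))) \<longlonglongrightarrow> b) \<longleftrightarrow>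
      I w = ereal b \<and> S w = ereal b" if "is_env w" for w b
    unfolding I_def S_def hit_prob_eq_pass[OF that] f_def[symmetric] by (rule zone_limit_iff[OF \<zeta>])
  \<comment> \<open>Without a common limit no number satisfies the description, which then is the
    one unspecified constant \<open>THE b. False\<close>, the same for every such
    environment.\<close>
  have eq: "busemann (\<zeta>, 1 - \<zeta>) w x y =
      (if I w \<le> S w \<and> S w \<le> I w \<and> S w < \<infinity> \<and> - \<infinity> < S w then real_of_ereal (S w) else (THE b. False))" if "is_env w" for w
  proof (cases "I w \<le> S w \<and> S w \<le> I w \<and> S w < \<infinity> \<and> - \<infinity> < S w")
    case True
    then have "I w = ereal (real_of_ereal (S w)) \<and> S w = ereal (real_of_ereal (S w))"
      by (cases "S w"; cases "I w") auto
    then show ?thesis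
      using True unfolding busemann_def iff[OF that] by (auto intro!: the_equality)
  next
    case False
    then have f: "(\<lambda>b. I w = ereal b \<and> S w = ereal b) = (\<lambda>_. False)" by (auto simp: fun_eq_iff)
    show ?thesis by (simp only: busemann_def iff[OF that] f False if_False)
  qed
  have "(\<lambda>w. if I w \<le> S w \<and> S w \<le> I w \<and> S w < \<infinity> \<and> - \<infinity> < S w then real_of_ereal (S w) else (THE b. False)) \<in> borel_measurable (env_law \<alpha> \<beta>)" (is "_ \<in> borel_measurable ?E")
  proof (rule measurable_If_set[where A="{w. I w \<le> S w \<and> S w \<le> I w \<and> S w < \<infinity> \<and> - \<infinity> < S w}", simplified mem_Collect_eq])
    have "{w \<in> space ?E. I w \<le> S w} \<inter> {w \<in> space ?E. S w \<le> I w} \<inter> {w \<in> space ?E. S w < \<infinity>} \<inter> {w \<in> space ?E. - \<infinity> < S w} \<in> sets ?E"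
      by (intro sets.Int borel_measurable_le borel_measurable_less IS) simp_all
    also have "{w \<in> space ?E. I w \<le> S w} \<inter> {w \<in> space ?E. S w \<le> I w} \<inter> {w \<in> space ?E. S w < \<infinity>} \<inter> {w \<in> space ?E. - \<infinity> < S w} =
      {w. I w \<le> S w \<and> S w \<le> I w \<and> S w < \<infinity> \<and> - \<infinity> < S w} \<inter> space ?E" by blast
    finally show "{w. I w \<le> S w \<and> S w \<le> I w \<and> S w < \<infinity> \<and> - \<infinity> < S w} \<inter> space ?E \<in> sets ?E" .
  qed (use IS in simp_all)
  then show ?thesis
    by (rule measurable_cong[THEN iffD2, rotated]) (use eq is_env_space in blast)
qed

lemma measurable_doob_kernel:
  assumes \<zeta>: "0 < \<zeta>" "\<zeta> < 1"
  shows "(\<lambda>w. doob_kernel (\<zeta>, 1 - \<zeta>) w x (x + e1)) \<in> borel_measurable (env_law \<alpha> \<beta>)"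
proof -
  have "(\<lambda>w. w x * exp (- busemann (\<zeta>, 1 - \<zeta>) w x (x + e1))) \<in> borel_measurable (env_law \<alpha> \<beta>)"
    using measurable_busemann[OF \<zeta>] by (intro borel_measurable_times measurable_env_law_coord borel_measurable_exp
      measurable_compose[OF _ borel_measurable_exp] borel_measurable_uminus) auto
  then show ?thesis by (simp add: doob_kernel_def env_def)
qed

definition good_env :: "real \<Rightarrow> (site \<Rightarrow> real) \<Rightarrow> bool" where
  "good_env \<zeta> w \<longleftrightarrow> (\<forall>x. 0 < w x \<and> w x < 1 \<and> bridge_inf \<zeta> w x = bridge_sup \<zeta> w x \<and>
     0 < bridge_inf \<zeta> w x \<and> bridge_sup \<zeta> w x < 1)"

definition bridge_lim :: "real \<Rightarrow> (site \<Rightarrow> real) \<Rightarrow> site \<Rightarrow> real" where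
  "bridge_lim \<zeta> w x = enn2real (bridge_sup \<zeta> w x)"

context
  fixes \<zeta> :: real and w :: "site \<Rightarrow> real"
  assumes \<zeta>: "0 < \<zeta>" "\<zeta> < 1" and good: "good_env \<zeta> w"
begin

lemma good_env_pos: "0 < w x" "w x < 1"
  using good unfolding good_env_def by blast+

lemma good_inf_sup: "bridge_inf \<zeta> w x = bridge_sup \<zeta> w x"
  using good unfolding good_env_def by blast

lemma good_is_env: "is_env w"
  unfolding is_env_def using good_env_pos less_imp_le by blast

lemma bridge_lim_pos: "0 < bridge_lim \<zeta> w x" "bridge_lim \<zeta> w x < 1"
  and ennreal_bridge_lim: "ennreal (bridge_lim \<zeta> w x) = bridge_sup \<zeta> w x"
proof -
  have s: "0 < bridge_sup \<zeta> w x" "bridge_sup \<zeta> w x < 1"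
    using good unfolding good_env_def by metis+
  then have fin: "bridge_sup \<zeta> w x < \<top>" by (meson ennreal_one_less_top less_trans)
  then show e: "ennreal (bridge_lim \<zeta> w x) = bridge_sup \<zeta> w x" by (simp add: bridge_lim_def)
  show "0 < bridge_lim \<zeta> w x" using s(1) unfolding e[symmetric] by simp
  show "bridge_lim \<zeta> w x < 1" using s(2) unfolding e[symmetric] by simp
qed

lemma is_env_bridge_lim: "is_env (bridge_lim \<zeta> w)"
  unfolding is_env_def using bridge_lim_pos less_imp_le by blast

lemma bridge_tendsto:
  assumes "goes_in_direction z (\<zeta>, 1 - \<zeta>)"
  shows "(\<lambda>N. bridge w x (z N)) \<longlonglongrightarrow> bridge_lim \<zeta> w x"
proof -
  have "(\<lambda>N. ennreal (bridge w x (z N))) \<longlonglongrightarrow> ennreal (bridge_lim \<zeta> w x)"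
    unfolding ennreal_bridge_lim
    by (rule zone_limit[OF good_inf_sup[unfolded bridge_inf_def] bridge_sup_def[symmetric] assms])
  then show ?thesis
    by (rule tendsto_ennrealD) (simp_all add: bridge_bounds(1)[OF good_is_env] less_imp_le[OF bridge_lim_pos(1)])
qed

lemma eventually_reachable:
  assumes "goes_in_direction z (\<zeta>, 1 - \<zeta>)"
  shows "\<forall>\<^sub>F N in sequentially. x + e1 \<sqsubseteq> z N \<and> x + e2 \<sqsubseteq> z N"
proof -
  obtain M where M: "\<And>z. z \<in> zone \<zeta> M \<Longrightarrow> \<exists>p q. z = site_at x p q \<and> 1 \<le> p \<and> 1 \<le> q \<and>
    real p \<le> (\<zeta> + 1) * real (p + q) \<and> (\<zeta> - 1) * real (p + q) \<le> real p"
    using zone_quadrant[OF \<zeta>, of 1 x 1] by (metis zero_less_one)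
  have "\<forall>\<^sub>F N in sequentially. z N \<in> zone \<zeta> M" using assms by (simp add: goes_in_direction_zone)
  then show ?thesis
  proof eventually_elim
    case (elim N)
    then obtain p q where "z N = site_at x p q" "1 \<le> p" "1 \<le> q" using M by blast
    then show ?case by (simp add: site_at_def below_def)
  qed
qed

lemma pass_ratio_tendsto:
  assumes z: "goes_in_direction z (\<zeta>, 1 - \<zeta>)"
  shows "(\<lambda>N. pass w (x + e1) (z N) / pass w x (z N)) \<longlonglongrightarrow> bridge_lim \<zeta> w x / w x"
    and "(\<lambda>N. pass w (x + e2) (z N) / pass w x (z N)) \<longlonglongrightarrow> (1 - bridge_lim \<zeta> w x) / (1 - w x)"
proof -
  note wx = good_env_pos[of x]
  have "(\<lambda>N. bridge w x (z N) / w x) \<longlonglongrightarrow> bridge_lim \<zeta> w x / w x"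
    by (intro tendsto_divide bridge_tendsto[OF z] tendsto_const) (use wx in auto)
  then show "(\<lambda>N. pass w (x + e1) (z N) / pass w x (z N)) \<longlonglongrightarrow> bridge_lim \<zeta> w x / w x"
    using wx by (simp add: bridge_def)
  have lim: "(\<lambda>N. (1 - bridge w x (z N)) / (1 - w x)) \<longlonglongrightarrow> (1 - bridge_lim \<zeta> w x) / (1 - w x)"
    by (intro tendsto_divide tendsto_diff bridge_tendsto[OF z] tendsto_const) (use wx in auto)
  show "(\<lambda>N. pass w (x + e2) (z N) / pass w x (z N)) \<longlonglongrightarrow> (1 - bridge_lim \<zeta> w x) / (1 - w x)"
  proof (rule Lim_transform_eventually[OF lim])
    show "\<forall>\<^sub>F N in sequentially. (1 - bridge w x (z N)) / (1 - w x) = pass w (x + e2) (z N) / pass w x (z N)"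
      using eventually_reachable[OF z, of x]
    proof eventually_elim
      case (elim N)
      then have xz: "x \<sqsubseteq> z N" "x \<noteq> z N" by (auto simp: below_def)
      have "pass w x (z N) > 0" by (rule pass_pos[OF xz(1) good_is_env]) (use good_env_pos in blast)
      then have "1 - bridge w x (z N) = (1 - w x) * pass w (x + e2) (z N) / pass w x (z N)"
        using pass_harmonic[OF xz(2), of w] by (simp add: bridge_def field_simps)
      then show ?case using wx by simp
    qed
  qed
qed

lemma busemann_eq:
  assumes y: "y = x + e1 \<or> y = x + e2"
    and lim: "\<And>z. goes_in_direction z (\<zeta>, 1 - \<zeta>) \<Longrightarrow> (\<lambda>N. pass w y (z N) / pass w x (z N)) \<longlonglongrightarrow> r" and "r > 0"
  shows "busemann (\<zeta>, 1 - \<zeta>) w x y = - ln r"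
  unfolding busemann_def hit_prob_eq_pass[OF good_is_env]
proof (rule the_equality)
  have B: "(\<lambda>N. ln (pass w x (z N)) - ln (pass w y (z N))) \<longlonglongrightarrow> - ln r" if z: "goes_in_direction z (\<zeta>, 1 - \<zeta>)" for z
  proof (rule Lim_transform_eventually)
    show "(\<lambda>N. - ln (pass w y (z N) / pass w x (z N))) \<longlonglongrightarrow> - ln r"
      by (intro tendsto_minus tendsto_ln lim z) (use \<open>r > 0\<close> in simp)
    show "\<forall>\<^sub>F N in sequentially. - ln (pass w y (z N) / pass w x (z N)) = ln (pass w x (z N)) - ln (pass w y (z N))"
      using eventually_reachable[OF z, of x]
    proof eventually_elim
      case (elim N)
      then have "x \<sqsubseteq> z N" "y \<sqsubseteq> z N" using y by (auto simp: below_def)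
      then have "pass w x (z N) > 0" "pass w y (z N) > 0"
        by (auto intro!: pass_pos[OF _ good_is_env] good_env_pos)
      then show ?case by (simp add: ln_div)
    qed
  qed
  then show "\<forall>z. goes_in_direction z (\<zeta>, 1 - \<zeta>) \<longrightarrow> (\<lambda>N. ln (pass w x (z N)) - ln (pass w y (z N))) \<longlonglongrightarrow> - ln r" by blast
  fix b assume "\<forall>z. goes_in_direction z (\<zeta>, 1 - \<zeta>) \<longrightarrow> (\<lambda>N. ln (pass w x (z N)) - ln (pass w y (z N))) \<longlonglongrightarrow> b"
  then show "b = - ln r"
    using LIMSEQ_unique[OF _ B[OF goes_in_direction_ray[OF \<zeta>]]] goes_in_direction_ray[OF \<zeta>] by blast
qed

text \<open>The exponential of minus the Busemann increment is the limit of quotients of passage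
  probabilities, and multiplying it by the weight gives the limit of the bridge. Equality holds as
  functions on all pairs of sites, so the laws of the walks coincide.\<close>

lemma doob_kernel_eq: "doob_kernel (\<zeta>, 1 - \<zeta>) w = env (bridge_lim \<zeta> w)"
proof (intro ext)
  fix x y
  note p = good_env_pos[of x] bridge_lim_pos[of x]
  show "doob_kernel (\<zeta>, 1 - \<zeta>) w x y = env (bridge_lim \<zeta> w) x y"
  proof (cases "y = x + e1 \<or> y = x + e2")
    case True
    then show ?thesis
    proof
      assume y: "y = x + e1"
      have "busemann (\<zeta>, 1 - \<zeta>) w x y = - ln (bridge_lim \<zeta> w x / w x)"
        by (rule busemann_eq) (use y p pass_ratio_tendsto(1) in auto)
      then show ?thesis using p y by (simp add: doob_kernel_def env_def)
    next
      assume y: "y = x + e2"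
      have "busemann (\<zeta>, 1 - \<zeta>) w x y = - ln ((1 - bridge_lim \<zeta> w x) / (1 - w x))"
        by (rule busemann_eq) (use y p pass_ratio_tendsto(2) in auto)
      then show ?thesis using p y by (simp add: doob_kernel_def env_def)
    qed
  qed (simp add: doob_kernel_def env_def)
qed

end

section \<open>The joint law of the kernel along an antidiagonal\<close>

context direction
begin

lemma AE_good_env: "AE w in Om. good_env \<zeta> w"
  using AE_inf_eq_sup AE_strict by eventually_elim (simp add: good_env_def)

abbreviation "kap x w \<equiv> doob_kernel (\<zeta>, 1 - \<zeta>) w x (x + e1)"

lemma kap_measurable [measurable]: "kap x \<in> borel_measurable Om"
  by (rule measurable_doob_kernel[OF \<zeta>])

lemma AE_kap: "AE w in Om. \<forall>x. kap x w = bridge_lim \<zeta> w x \<and> 0 < kap x w"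
  using AE_good_env
proof eventually_elim
  case (elim w)
  show ?case using bridge_lim_pos(1)[OF \<zeta> elim] by (simp add: doob_kernel_eq[OF \<zeta> elim] env_def)
qed

text \<open>Thresholds pass through \<open>ennreal\<close>, so \<open>G\<close> is used only for
  nonnegative ones; below 0 the distribution function of a positive variable is 0.\<close>

definition kap_cdf :: "real \<Rightarrow> real" where "kap_cdf t = (if t < 0 then 0 else G t)"

lemma kap_joint_cdf:
  assumes J: "finite J" "J \<subseteq> {x. fst x + snd x = n}"
  shows "measure Om {w \<in> space Om. \<forall>x\<in>J. kap x w \<le> t x} = (\<Prod>x\<in>J. kap_cdf (t x))"
proof (cases "\<exists>x\<in>J. t x < 0")
  case True
  then obtain x where x: "x \<in> J" "t x < 0" by blast
  have "measure Om {w \<in> space Om. \<forall>x\<in>J. kap x w \<le> t x} = measure Om {}"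
  proof (rule measure_eq_AE)
    show "AE w in Om. w \<in> {w \<in> space Om. \<forall>x\<in>J. kap x w \<le> t x} \<longleftrightarrow> w \<in> {}"
      using AE_kap
    proof eventually_elim
      case (elim w)
      have "\<not> kap x w \<le> t x" using elim x by (meson less_le_trans less_trans not_less)
      then show ?case using x by blast
    qed
  qed (use J in measurable)
  moreover have "(\<Prod>x\<in>J. kap_cdf (t x)) = 0" using J x by (intro prod_zero bexI[of _ x]) (auto simp: kap_cdf_def)
  ultimately show ?thesis by simp
next
  case False
  then have t: "0 \<le> t x" if "x \<in> J" for x using that by (meson not_less)
  \<comment> \<open>Any corner weakly south-west of all sites of \<open>J\<close> will do. Inserting
    0 keeps the minimum meaningful when \<open>J\<close> is empty.\<close>
  define l where "l = Min (insert 0 (fst ` J))"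
  define r where "r = Min (insert 0 (snd ` J))"
  have lr: "l \<le> fst x" "r \<le> snd x" if "x \<in> J" for x
    using that J unfolding l_def r_def by (auto intro!: Min_le)
  define c :: site where "c = (l, r)"
  define m where "m = nat (n - l - r)"
  define A where "A = (\<lambda>x. nat (fst x - l)) ` J"
  have x_eq: "nat (fst x - l) \<le> m \<and> x = site_at c (nat (fst x - l)) (m - nat (fst x - l))" if "x \<in> J" for x
  proof -
    have "fst x + snd x = n" using J that by auto
    then show ?thesis using lr[OF that] by (auto simp: m_def c_def site_at_def prod_eq_iff)
  qed
  have A: "A \<subseteq> {..m}" using x_eq by (auto simp: A_def)
  have J_eq: "J = (\<lambda>a. site_at c a (m - a)) ` A" unfolding A_def image_image using x_eq by (auto simp: image_iff)
  have inj: "inj_on (\<lambda>a. site_at c a (m - a)) A" by (auto simp: inj_on_def)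
  have "measure Om {w \<in> space Om. \<forall>x\<in>J. kap x w \<le> t x} =
      measure Om {w \<in> space Om. \<forall>a\<in>A. bridge_sup \<zeta> w (site_at c a (m - a)) \<le> ennreal (t (site_at c a (m - a)))}"
  proof (rule measure_eq_AE)
    show "AE w in Om. w \<in> {w \<in> space Om. \<forall>x\<in>J. kap x w \<le> t x} \<longleftrightarrow>
      w \<in> {w \<in> space Om. \<forall>a\<in>A. bridge_sup \<zeta> w (site_at c a (m - a)) \<le> ennreal (t (site_at c a (m - a)))}"
      using AE_kap AE_good_env
    proof eventually_elim
      case (elim w)
      have "kap x w \<le> t x \<longleftrightarrow> bridge_sup \<zeta> w x \<le> ennreal (t x)" if "x \<in> J" for x
      proof -
        have "kap x w = bridge_lim \<zeta> w x" using elim(1) by blast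
        then show ?thesis
          using t[OF that] by (simp only: ennreal_bridge_lim[OF \<zeta> elim(2), symmetric] ennreal_le_iff)
      qed
      then show ?case unfolding J_eq by auto
    qed
    have "finite A" using A finite_subset by blast
    then show "{w \<in> space Om. \<forall>a\<in>A. bridge_sup \<zeta> w (site_at c a (m - a)) \<le> ennreal (t (site_at c a (m - a)))} \<in> E.events"
      by measurable
  qed (use J in measurable)
  also have "\<dots> = (\<Prod>a\<in>A. G (t (site_at c a (m - a))))"
    by (rule sup_cdf(1)[OF A]) (use t J_eq in auto)
  also have "\<dots> = (\<Prod>x\<in>J. G (t x))"
    unfolding J_eq by (subst prod.reindex[OF inj]) simp
  also have "\<dots> = (\<Prod>x\<in>J. kap_cdf (t x))"
    using t by (intro prod.cong refl) (simp add: kap_cdf_def not_less[symmetric] del: not_less)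
  finally show ?thesis .
qed

lemma kap_cdf_eq: "measure Om {w \<in> space Om. kap x w \<le> t} = kap_cdf t"
  using kap_joint_cdf[of "{x}" "fst x + snd x" "\<lambda>_. t"] by simp

lemma kap_indep: "E.indep_vars (\<lambda>_. borel) kap {x. fst x + snd x = n}"
proof -
  have fin: "E.indep_vars (\<lambda>_. borel) kap J" if J: "J \<subseteq> {x. fst x + snd x = n}" "J \<noteq> {}" "finite J" for J
  proof -
    \<comment> \<open>Half-lines form an intersection-stable generator. The whole line is added
      because the criterion for finite families requires it; coordinates where it is chosen drop out
      on both sides, leaving the index set \<open>K\<close>.\<close>
    define Ev :: "site \<Rightarrow> real set set" where "Ev = (\<lambda>_. insert UNIV (range atMost))"
    have gen: "sets borel = sigma_sets UNIV (insert UNIV (range (atMost :: real \<Rightarrow> real set)))"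
    proof -
      have "sets (borel :: real measure) = sigma_sets UNIV (range atMost)"
        by (simp add: borel_eq_atMost)
      moreover have "sigma_sets UNIV (insert UNIV (range (atMost :: real \<Rightarrow> real set))) = sigma_sets UNIV (range atMost)"
        by (intro sigma_sets_eqI) (auto intro: sigma_sets_top)
      ultimately show ?thesis by simp
    qed
    have "E.indep_vars (\<lambda>_. borel) kap J \<longleftrightarrow>
      (\<forall>A\<in>(\<Pi> i\<in>J. Ev i). E.prob (\<Inter>j\<in>J. kap j -` A j \<inter> space Om) = (\<Prod>j\<in>J. E.prob (kap j -` A j \<inter> space Om)))"
    proof (rule E.indep_vars_finite[OF J(2,3)])
      show "Int_stable (Ev i)" for i
        by (auto simp: Int_stable_def Ev_def)
    qed (use gen in \<open>auto simp: Ev_def\<close>)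
    moreover have "E.prob (\<Inter>j\<in>J. kap j -` A j \<inter> space Om) = (\<Prod>j\<in>J. E.prob (kap j -` A j \<inter> space Om))"
      if "A \<in> (\<Pi> i\<in>J. Ev i)" for A
    proof -
      define K where "K = {j \<in> J. A j \<noteq> UNIV}"
      have K: "finite K" "K \<subseteq> J" using J by (auto simp: K_def)
      have "\<forall>j\<in>K. \<exists>s. A j = {..s}" using that by (auto simp: K_def Ev_def Pi_iff)
      then obtain t where t: "\<And>j. j \<in> K \<Longrightarrow> A j = {..t j}" by metis
      have "(\<Inter>j\<in>J. kap j -` A j \<inter> space Om) = {w \<in> space Om. \<forall>x\<in>K. kap x w \<le> t x}"
      proof -
        have mem: "kap j w \<in> A j \<longleftrightarrow> (j \<in> K \<longrightarrow> kap j w \<le> t j)" if "j \<in> J" for j w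
        proof (cases "j \<in> K")
          case True
          then show ?thesis by (simp add: t)
        next
          case False
          then have "A j = UNIV" using that unfolding K_def by blast
          then show ?thesis using False by simp
        qed
        have "(\<Inter>j\<in>J. kap j -` A j \<inter> space Om) = {w \<in> space Om. \<forall>j\<in>J. kap j w \<in> A j}"
          using J(2) by blast
        also have "\<dots> = {w \<in> space Om. \<forall>x\<in>K. kap x w \<le> t x}"
          using mem K(2) by blast
        finally show ?thesis .
      qed
      then have "E.prob (\<Inter>j\<in>J. kap j -` A j \<inter> space Om) = (\<Prod>x\<in>K. kap_cdf (t x))"
        using kap_joint_cdf[of K n t] K J by auto
      also have "\<dots> = (\<Prod>j\<in>K. E.prob (kap j -` A j \<inter> space Om))"
      proof (intro prod.cong refl)
        fix j assume "j \<in> K"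
        then have "kap j -` A j \<inter> space Om = {w \<in> space Om. kap j w \<le> t j}" using t by auto
        then show "kap_cdf (t j) = E.prob (kap j -` A j \<inter> space Om)" by (simp only: kap_cdf_eq)
      qed
      also have "\<dots> = (\<Prod>j\<in>J. E.prob (kap j -` A j \<inter> space Om))"
        using J K by (intro prod.mono_neutral_left) (auto simp: K_def E.prob_space)
      finally show ?thesis .
    qed
    ultimately show ?thesis by blast
  qed
  show ?thesis
    unfolding E.indep_vars_def2
  proof
    show "\<forall>i\<in>{x. fst x + snd x = n}. E.random_variable borel (kap i)" by simp
    show "E.indep_sets (\<lambda>i. {kap i -` A \<inter> space Om |A. A \<in> sets borel}) {x. fst x + snd x = n}"
    proof (rule E.indep_sets_finite_index_sets[THEN iffD2], intro allI impI)
      fix J assume "J \<subseteq> {x. fst x + snd x = n}" "J \<noteq> {}" "finite J"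
      then have "E.indep_vars (\<lambda>_. borel) kap J" by (rule fin)
      then show "E.indep_sets (\<lambda>i. {kap i -` A \<inter> space Om |A. A \<in> sets borel}) J"
        by (simp only: E.indep_vars_def2)
    qed
  qed
qed

lemma kap_identical: "distr Om borel (kap x) = distr Om borel (kap y)"
proof (rule cdf_unique)
  show "real_distribution (distr Om borel (kap x))" "real_distribution (distr Om borel (kap y))"
    by (simp_all add: E.real_distribution_distr)
  have "cdf (distr Om borel (kap x)) t = kap_cdf t" for x t
  proof -
    have "kap x -` {..t} \<inter> space Om = {w \<in> space Om. kap x w \<le> t}" by auto
    then show ?thesis unfolding cdf_def by (subst measure_distr) (simp_all only: kap_measurable kap_cdf_eq atMost_borel)
  qed
  then show "cdf (distr Om borel (kap x)) = cdf (distr Om borel (kap y))" by (auto simp: fun_eq_iff)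
qed

end

section \<open>The law of large numbers\<close>

definition lim_row :: "real \<Rightarrow> (site \<Rightarrow> real) \<Rightarrow> nat \<Rightarrow> real" where
  "lim_row \<zeta> w a = (\<Prod>i<a. bridge_lim \<zeta> w (site_at 0 i 0) / w (site_at 0 i 0))"

definition lim_col :: "real \<Rightarrow> (site \<Rightarrow> real) \<Rightarrow> nat \<Rightarrow> nat \<Rightarrow> real" where
  "lim_col \<zeta> w a b = (\<Prod>j<b. (1 - bridge_lim \<zeta> w (site_at 0 a j)) / (1 - w (site_at 0 a j)))"

lemma measurable_bridge_lim: "(\<lambda>w. bridge_lim \<zeta> w x) \<in> borel_measurable (env_law \<alpha> \<beta>)"
  unfolding bridge_lim_def by (intro borel_measurable_enn2real measurable_bridge_sup)

lemma measurable_powr_const: "(\<lambda>x :: real. ennreal (x powr t)) \<in> borel_measurable borel"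
  by measurable

lemma measurable_lim_row: "(\<lambda>w. lim_row \<zeta> w a) \<in> borel_measurable (env_law \<alpha> \<beta>)"
  and measurable_lim_col: "(\<lambda>w. lim_col \<zeta> w a b) \<in> borel_measurable (env_law \<alpha> \<beta>)"
  unfolding lim_row_def lim_col_def
  using measurable_bridge_lim measurable_env_law_coord
  by (intro borel_measurable_prod borel_measurable_divide borel_measurable_diff borel_measurable_const; blast)+

context
  fixes \<zeta> :: real and w :: "site \<Rightarrow> real"
  assumes \<zeta>: "0 < \<zeta>" "\<zeta> < 1" and good: "good_env \<zeta> w"
begin

lemma lim_row_pos: "0 < lim_row \<zeta> w a"
  unfolding lim_row_def by (intro prod_pos divide_pos_pos good_env_pos[OF \<zeta> good] bridge_lim_pos[OF \<zeta> good] ballI)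

lemma lim_col_pos: "0 < lim_col \<zeta> w a b"
  unfolding lim_col_def by (intro prod_pos divide_pos_pos ballI) (simp_all add: good_env_pos[OF \<zeta> good] bridge_lim_pos[OF \<zeta> good])

lemma pass_ratio_extend:
  assumes z: "goes_in_direction z (\<zeta>, 1 - \<zeta>)"
    and y: "(\<lambda>N. pass w y (z N) / pass w x (z N)) \<longlonglongrightarrow> l"
  shows "(\<lambda>N. pass w (y + e1) (z N) / pass w x (z N)) \<longlonglongrightarrow> bridge_lim \<zeta> w y / w y * l"
    and "(\<lambda>N. pass w (y + e2) (z N) / pass w x (z N)) \<longlonglongrightarrow> (1 - bridge_lim \<zeta> w y) / (1 - w y) * l"
proof -
  have pos: "\<forall>\<^sub>F N in sequentially. pass w y (z N) > 0"
    using eventually_reachable[OF \<zeta> good z, of y]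
  proof eventually_elim
    case (elim N)
    then have "y \<sqsubseteq> z N" by (auto simp: below_def)
    then show ?case by (rule pass_pos[OF _ good_is_env[OF \<zeta> good]]) (simp add: good_env_pos[OF \<zeta> good])
  qed
  show "(\<lambda>N. pass w (y + e1) (z N) / pass w x (z N)) \<longlonglongrightarrow> bridge_lim \<zeta> w y / w y * l"
    by (rule Lim_transform_eventually[OF tendsto_mult[OF pass_ratio_tendsto(1)[OF \<zeta> good z] y]])
       (use pos in eventually_elim, simp)
  show "(\<lambda>N. pass w (y + e2) (z N) / pass w x (z N)) \<longlonglongrightarrow> (1 - bridge_lim \<zeta> w y) / (1 - w y) * l"
    by (rule Lim_transform_eventually[OF tendsto_mult[OF pass_ratio_tendsto(2)[OF \<zeta> good z] y]])
       (use pos in eventually_elim, simp)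
qed

text \<open>The path goes along the bottom row and then up a column, so the one-step limits
  telescope into the two products.\<close>

lemma pass_ratio_site:
  "(\<lambda>N. pass w (site_at 0 a b) (ray \<zeta> N) / pass w 0 (ray \<zeta> N)) \<longlonglongrightarrow> lim_row \<zeta> w a * lim_col \<zeta> w a b"
proof (induction b)
  case 0
  show ?case
  proof (induction a)
    case 0
    have "\<forall>\<^sub>F N in sequentially. 1 = pass w (site_at 0 0 0) (ray \<zeta> N) / pass w 0 (ray \<zeta> N)"
      using eventually_reachable[OF \<zeta> good goes_in_direction_ray[OF \<zeta>], of 0]
    proof eventually_elim
      case (elim N)
      then have "0 \<sqsubseteq> ray \<zeta> N" by (auto simp: below_def)
      then have "pass w 0 (ray \<zeta> N) > 0" by (rule pass_pos[OF _ good_is_env[OF \<zeta> good]]) (simp add: good_env_pos[OF \<zeta> good])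
      then show ?case by simp
    qed
    from Lim_transform_eventually[OF tendsto_const this] show ?case by (simp add: lim_row_def lim_col_def)
  next
    case (Suc a)
    from pass_ratio_extend(1)[OF goes_in_direction_ray[OF \<zeta>] this] show ?case
      by (simp add: site_at_Suc lim_row_def lim_col_def mult.commute)
  qed
next
  case (Suc b)
  from pass_ratio_extend(2)[OF goes_in_direction_ray[OF \<zeta>] this] show ?case
    by (simp add: site_at_Suc lim_col_def mult_ac)
qed

text \<open>The limits of passage quotients along \<open>ray\<close> form a positive function with
  value 1 at the origin. The limiting kernel is the Doob transform by it, so the quotients of its
  values telescope.\<close>

lemma step_prob_bridge_lim:
  "step_prob (bridge_lim \<zeta> w) (a + b) 0 (site_at 0 a b) = pass w 0 (site_at 0 a b) * lim_row \<zeta> w a * lim_col \<zeta> w a b"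
proof -
  define h where "h y = lim (\<lambda>N. pass w y (ray \<zeta> N) / pass w 0 (ray \<zeta> N))" for y
  have h_site: "h (site_at 0 a b) = lim_row \<zeta> w a * lim_col \<zeta> w a b" for a b
    unfolding h_def by (rule limI[OF pass_ratio_site])
  have h_lim: "(\<lambda>N. pass w y (ray \<zeta> N) / pass w 0 (ray \<zeta> N)) \<longlonglongrightarrow> h y" and h_pos: "h y > 0" if "0 \<sqsubseteq> y" for y
  proof -
    obtain a b where y: "y = site_at 0 a b" using \<open>0 \<sqsubseteq> y\<close> below_site_at by blast
    show "(\<lambda>N. pass w y (ray \<zeta> N) / pass w 0 (ray \<zeta> N)) \<longlonglongrightarrow> h y"
      unfolding y h_site by (rule pass_ratio_site)
    show "h y > 0" unfolding y h_site by (intro mult_pos_pos lim_row_pos lim_col_pos)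
  qed
  have h1: "h (y + e1) = bridge_lim \<zeta> w y / w y * h y" "h (y + e2) = (1 - bridge_lim \<zeta> w y) / (1 - w y) * h y"
    if "0 \<sqsubseteq> y" for y
    unfolding h_def[of "y + e1"] h_def[of "y + e2"]
    by (intro limI pass_ratio_extend goes_in_direction_ray \<zeta> h_lim that)+
  have "step_prob (bridge_lim \<zeta> w) (a + b) 0 (site_at 0 a b) * h 0 = step_prob w (a + b) 0 (site_at 0 a b) * h (site_at 0 a b)"
  proof (rule step_prob_doob[of 0, OF _ h_pos])
    fix y :: site assume y: "0 \<sqsubseteq> y"
    show "bridge_lim \<zeta> w y = w y * h (y + e1) / h y \<and> 1 - bridge_lim \<zeta> w y = (1 - w y) * h (y + e2) / h y"
      using h_pos[OF y] good_env_pos[OF \<zeta> good, of y] by (simp add: h1[OF y])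
  qed (simp_all add: below_def)
  moreover have "h 0 = 1" using h_site[of 0 0] by (simp add: lim_row_def lim_col_def)
  moreover have "pass w 0 (site_at 0 a b) = step_prob w (a + b) 0 (site_at 0 a b)"
    by (simp add: pass_def site_at_def nat_add_distrib)
  ultimately show ?thesis by (simp add: h_site mult.assoc)
qed

end

context stat_pair
begin

lemma nn_integral_env_law:
  assumes "f \<in> borel_measurable (env_law \<alpha> \<beta>)"
  shows "(\<integral>\<^sup>+w. f w \<partial>env_law \<alpha> \<beta>) = (\<integral>\<^sup>+\<eta>. f (true_env c \<eta>) \<partial>field_law)"
  using nn_integral_distr[OF measurable_true_env[of c], of f] assms by (simp add: distr_true_env)

lemma AE_true_env: "AE w in env_law \<alpha> \<beta>. P w \<Longrightarrow> AE \<eta> in field_law. P (true_env c \<eta>)"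
  using AE_distrD[OF measurable_true_env[of c], of P] unfolding distr_true_env .

lemma inverse_powr_eq: "x > 0 \<Longrightarrow> inverse x powr t = (x :: real) powr (- t)"
  by (simp add: powr_minus powr_def ln_inverse exp_minus[symmetric])

text \<open>The limit of the bridge is at most the Doob weight, which is the weight of the
  environment divided by u. Each factor of the row product is therefore at most 1/u.\<close>

lemma lim_row_moment:
  assumes \<zeta>: "0 < \<zeta>" "\<zeta> < 1" and L: "log_mgf LU r m u" and t: "0 < t" "t < r"
    and good: "AE w in env_law \<alpha> \<beta>. good_env \<zeta> w"
    and le: "AE \<eta> in field_law. \<forall>x. 0 \<sqsubseteq> x \<longrightarrow> bridge_sup \<zeta> (true_env 0 \<eta>) x \<le> ennreal (doob_at 0 \<eta> x)"
  shows "(\<integral>\<^sup>+w. ennreal (lim_row \<zeta> w a powr t) \<partial>env_law \<alpha> \<beta>) \<le> ennreal (exp (real a * m (- t)))"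
proof -
  have "(\<integral>\<^sup>+w. ennreal (lim_row \<zeta> w a powr t) \<partial>env_law \<alpha> \<beta>) = (\<integral>\<^sup>+\<eta>. ennreal (lim_row \<zeta> (true_env 0 \<eta>) a powr t) \<partial>field_law)"
    by (intro nn_integral_env_law measurable_compose[OF measurable_lim_row measurable_powr_const])
  also have "\<dots> \<le> (\<integral>\<^sup>+\<eta>. ennreal (row_prod 0 \<eta> a powr (- t)) \<partial>field_law)"
  proof (rule nn_integral_mono_AE, use AE_true_env[OF good, of 0] le AE_regular_field[of 0] in eventually_elim)
    case (elim \<eta>)
    have "lim_row \<zeta> (true_env 0 \<eta>) a \<le> (\<Prod>i<a. inverse (field_h 0 \<eta> i 0))"
      unfolding lim_row_def
    proof (rule prod_mono)
      fix i
      note p = regular_pair_weights[OF reg_pair[OF elim(3)], of i 0]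
      have "0 \<sqsubseteq> site_at 0 i 0" unfolding below_site_at by blast
      then have "ennreal (bridge_lim \<zeta> (true_env 0 \<eta>) (site_at 0 i 0)) \<le> ennreal (doob_at 0 \<eta> (site_at 0 i 0))"
        unfolding ennreal_bridge_lim[OF \<zeta> elim(1)] using elim(2) by blast
      then have "bridge_lim \<zeta> (true_env 0 \<eta>) (site_at 0 i 0) \<le> doob_weight (field_h 0 \<eta> i 0) (field_v 0 \<eta> i 0)"
        unfolding doob_at_site using p(7) by (simp add: ennreal_le_iff del: field_h.simps)
      then show "0 \<le> bridge_lim \<zeta> (true_env 0 \<eta>) (site_at 0 i 0) / true_env 0 \<eta> (site_at 0 i 0) \<and>
          bridge_lim \<zeta> (true_env 0 \<eta>) (site_at 0 i 0) / true_env 0 \<eta> (site_at 0 i 0) \<le> inverse (field_h 0 \<eta> i 0)"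
        using p bridge_lim_pos(1)[OF \<zeta> elim(1), of "site_at 0 i 0"] unfolding true_env_at
        by (simp add: field_simps del: field_h.simps)
    qed
    then have "lim_row \<zeta> (true_env 0 \<eta>) a \<le> inverse (row_prod 0 \<eta> a)"
      by (simp add: row_prod_def prod_inversef[symmetric] del: field_h.simps)
    then have "lim_row \<zeta> (true_env 0 \<eta>) a powr t \<le> inverse (row_prod 0 \<eta> a) powr t"
      using t lim_row_pos[OF \<zeta> elim(1), of a] by (intro powr_mono2) auto
    then show ?case using row_prod_pos[OF elim(3), of a] by (intro ennreal_leI) (simp add: inverse_powr_eq)
  qed
  also have "\<dots> = ennreal (exp (real a * m (- t)))"
    using t by (intro row_moment[OF L]) simp
  finally show ?thesis .
qed

text \<open>Here the limit of the bridge is at least the Doob weight, so the complementary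
  probabilities are ordered the other way and each factor of the column product is at most
  1/v.\<close>

lemma lim_col_moment:
  assumes \<zeta>: "0 < \<zeta>" "\<zeta> < 1" and L: "log_mgf LV r m u" and t: "0 < t" "t < r"
    and good: "AE w in env_law \<alpha> \<beta>. good_env \<zeta> w"
    and le: "AE \<eta> in field_law. \<forall>x. 0 \<sqsubseteq> x \<longrightarrow> ennreal (doob_at 0 \<eta> x) \<le> bridge_inf \<zeta> (true_env 0 \<eta>) x"
  shows "(\<integral>\<^sup>+w. ennreal (lim_col \<zeta> w a b powr t) \<partial>env_law \<alpha> \<beta>) \<le> ennreal (exp (real b * m (- t)))"
proof -
  have "(\<integral>\<^sup>+w. ennreal (lim_col \<zeta> w a b powr t) \<partial>env_law \<alpha> \<beta>) = (\<integral>\<^sup>+\<eta>. ennreal (lim_col \<zeta> (true_env 0 \<eta>) a b powr t) \<partial>field_law)"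
    by (intro nn_integral_env_law measurable_compose[OF measurable_lim_col measurable_powr_const])
  also have "\<dots> \<le> (\<integral>\<^sup>+\<eta>. ennreal (col_prod 0 \<eta> a b powr (- t)) \<partial>field_law)"
  proof (rule nn_integral_mono_AE, use AE_true_env[OF good, of 0] le AE_regular_field[of 0] in eventually_elim)
    case (elim \<eta>)
    have "lim_col \<zeta> (true_env 0 \<eta>) a b \<le> (\<Prod>j<b. inverse (field_v 0 \<eta> a j))"
      unfolding lim_col_def
    proof (rule prod_mono)
      fix j
      note p = regular_pair_weights[OF reg_pair[OF elim(3)], of a j]
      have "0 \<sqsubseteq> site_at 0 a j" unfolding below_site_at by blast
      then have "ennreal (doob_at 0 \<eta> (site_at 0 a j)) \<le> ennreal (bridge_lim \<zeta> (true_env 0 \<eta>) (site_at 0 a j))"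
        unfolding ennreal_bridge_lim[OF \<zeta> elim(1)] good_inf_sup[OF \<zeta> elim(1), symmetric] using elim(2) by blast
      then have "1 - bridge_lim \<zeta> (true_env 0 \<eta>) (site_at 0 a j) \<le> 1 - doob_weight (field_h 0 \<eta> a j) (field_v 0 \<eta> a j)"
        unfolding doob_at_site using bridge_lim_pos(1)[OF \<zeta> elim(1), of "site_at 0 a j"] by (simp add: ennreal_le_iff)
      then show "0 \<le> (1 - bridge_lim \<zeta> (true_env 0 \<eta>) (site_at 0 a j)) / (1 - true_env 0 \<eta> (site_at 0 a j)) \<and>
          (1 - bridge_lim \<zeta> (true_env 0 \<eta>) (site_at 0 a j)) / (1 - true_env 0 \<eta> (site_at 0 a j)) \<le> inverse (field_v 0 \<eta> a j)"
        using p(2-4) bridge_lim_pos(2)[OF \<zeta> elim(1), of "site_at 0 a j"] unfolding true_env_at p(6)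
        by (simp add: field_simps)
    qed
    then have "lim_col \<zeta> (true_env 0 \<eta>) a b \<le> inverse (col_prod 0 \<eta> a b)"
      by (simp add: col_prod_def prod_inversef[symmetric])
    then have "lim_col \<zeta> (true_env 0 \<eta>) a b powr t \<le> inverse (col_prod 0 \<eta> a b) powr t"
      using t lim_col_pos[OF \<zeta> elim(1), of a b] by (intro powr_mono2) auto
    then show ?case using col_prod_pos[OF elim(3), of a b] by (intro ennreal_leI) (simp add: inverse_powr_eq)
  qed
  also have "\<dots> = ennreal (exp (real b * m (- t)))"
    using t by (intro col_moment[OF L]) simp
  finally show ?thesis .
qed

end

context direction
begin

text \<open>The limiting product need not have a stationary law of its own. It is enough that it is
  dominated by one whose rate is arbitrarily close to \<open>us\<close>, since the cone conditions
  leave a margin.\<close>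

lemma row_moment_near:
  assumes "\<delta> > 0"
  shows "\<exists>r m u. 0 < r \<and> m 0 = 0 \<and> (m has_real_derivative u) (at 0) \<and> \<bar>u - us\<bar> < \<delta> \<and>
    (\<forall>a t. 0 < t \<longrightarrow> t < r \<longrightarrow> (\<integral>\<^sup>+w. ennreal (lim_row \<zeta> w a powr t) \<partial>Om) \<le> ennreal (exp (real a * m (- t))))"
proof -
  obtain LU LV u w where 1: "\<And>k :: nat. stat_param \<alpha> \<beta> (LU k) (LV k) (u k) (w k)"
    and 2: "\<And>k. \<exists>LU' LV' u' w' \<epsilon> c. stat_param \<alpha> \<beta> LU' LV' u' w' \<and> 0 < \<epsilon> \<and> 0 < c \<and>
        (\<forall>a b. real a \<le> (\<zeta> + \<epsilon>) * real (a + b) \<longrightarrow> real a * (u' - u k) + real b * (w' - w k) \<le> - c * real (a + b))"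
    and 3: "u \<longlonglongrightarrow> us"
    using right unfolding right_approx_def side_approx_def by blast
  obtain k where k: "\<bar>u k - us\<bar> < \<delta>"
    using LIMSEQ_D[OF 3 \<open>\<delta> > 0\<close>] by (auto simp: dist_real_def)
  obtain r1 m1 r2 m2 where L: "stat_pair \<alpha> \<beta> (LU k) (LV k)" "log_mgf (LU k) r1 m1 (u k)" "log_mgf (LV k) r2 m2 (w k)"
    using 1[of k] unfolding stat_param_def by blast
  interpret S: stat_pair \<alpha> \<beta> "LU k" "LV k" by fact
  show ?thesis
    using S.lim_row_moment[OF \<zeta> L(2) _ _ AE_good_env S.AE_bridge_sup[OF \<zeta> L(2,3) 2[of k], of 0]] L(2) k
    by (intro exI[of _ r1] exI[of _ m1] exI[of _ "u k"]) (simp add: log_mgf_def)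
qed

lemma col_moment_near:
  assumes "\<delta> > 0"
  shows "\<exists>r m v. 0 < r \<and> m 0 = 0 \<and> (m has_real_derivative v) (at 0) \<and> \<bar>v - ws\<bar> < \<delta> \<and>
    (\<forall>a b t. 0 < t \<longrightarrow> t < r \<longrightarrow> (\<integral>\<^sup>+w. ennreal (lim_col \<zeta> w a b powr t) \<partial>Om) \<le> ennreal (exp (real b * m (- t))))"
proof -
  obtain LU LV u w where 1: "\<And>k :: nat. stat_param \<alpha> \<beta> (LU k) (LV k) (u k) (w k)"
    and 2: "\<And>k. \<exists>LU' LV' u' w' \<epsilon> c. stat_param \<alpha> \<beta> LU' LV' u' w' \<and> 0 < \<epsilon> \<and> 0 < c \<and>
        (\<forall>a b. (\<zeta> - \<epsilon>) * real (a + b) \<le> real a \<longrightarrow> real a * (u' - u k) + real b * (w' - w k) \<le> - c * real (a + b))"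
    and 3: "w \<longlonglongrightarrow> ws"
    using left unfolding left_approx_def side_approx_def by blast
  obtain k where k: "\<bar>w k - ws\<bar> < \<delta>"
    using LIMSEQ_D[OF 3 \<open>\<delta> > 0\<close>] by (auto simp: dist_real_def)
  obtain r1 m1 r2 m2 where L: "stat_pair \<alpha> \<beta> (LU k) (LV k)" "log_mgf (LU k) r1 m1 (u k)" "log_mgf (LV k) r2 m2 (w k)"
    using 1[of k] unfolding stat_param_def by blast
  interpret S: stat_pair \<alpha> \<beta> "LU k" "LV k" by fact
  show ?thesis
    using S.lim_col_moment[OF \<zeta> L(3) _ _ AE_good_env S.AE_bridge_inf[OF \<zeta> L(2,3) 2[of k], of 0]] L(3) k
    by (intro exI[of _ r2] exI[of _ m2] exI[of _ "w k"]) (simp add: log_mgf_def)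
qed

lemma AE_summable_kernel:
  assumes "\<exists>LU' LV' u' w' c. stat_param \<alpha> \<beta> LU' LV' u' w' \<and> 0 < c \<and>
      (\<forall>a b. Q a b \<longrightarrow> real a * (u' - us) + real b * (w' - ws) \<le> - c * real (a + b))"
  shows "AE w in Om. summable (\<lambda>n. \<Sum>a\<in>{a. a \<le> n \<and> Q a (n - a)}. step_prob (bridge_lim \<zeta> w) n 0 (site_at 0 a (n - a)))"
proof -
  obtain LU' LV' u' w' c where P: "stat_param \<alpha> \<beta> LU' LV' u' w'" and c: "0 < c"
    and cone: "\<And>a b. Q a b \<Longrightarrow> real a * (u' - us) + real b * (w' - ws) \<le> - c * real (a + b)"
    using assms by blast
  obtain r1 m1 r2 m2 where L: "stat_pair \<alpha> \<beta> LU' LV'" "log_mgf LU' r1 m1 u'" "log_mgf LV' r2 m2 w'"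
    using P unfolding stat_param_def by blast
  interpret \<mu>: stat_pair \<alpha> \<beta> LU' LV' by fact
  obtain r3 m3 u where m3: "0 < r3" "m3 0 = 0" "(m3 has_real_derivative u) (at 0)" "\<bar>u - us\<bar> < c / 2"
    "\<And>a t. 0 < t \<Longrightarrow> t < r3 \<Longrightarrow> (\<integral>\<^sup>+w. ennreal (lim_row \<zeta> w a powr t) \<partial>Om) \<le> ennreal (exp (real a * m3 (- t)))"
    using row_moment_near[of "c / 2"] c by auto
  obtain r4 m4 v where m4: "0 < r4" "m4 0 = 0" "(m4 has_real_derivative v) (at 0)" "\<bar>v - ws\<bar> < c / 2"
    "\<And>a b t. 0 < t \<Longrightarrow> t < r4 \<Longrightarrow> (\<integral>\<^sup>+w. ennreal (lim_col \<zeta> w a b powr t) \<partial>Om) \<le> ennreal (exp (real b * m4 (- t)))"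
    using col_moment_near[of "c / 2"] c by auto
  have "AE w in Om. summable (\<lambda>n. \<Sum>a\<in>{a. a \<le> n \<and> (a, n - a) \<in> {(a, b). Q a b}}.
     pass w 0 (site_at 0 a (n - a)) * lim_row \<zeta> w a * lim_col \<zeta> w a (n - a))"
  \<comment> \<open>The measure is now the environment law itself, with the identity in place of
    \<open>true_env\<close>. Replacing \<open>us\<close> and \<open>ws\<close> by nearby rates costs
    at most \<open>c / 2\<close> per step, so half of the margin remains.\<close>
  proof (rule \<mu>.AE_summable_pass[OF L(2,3), where r="min r3 r4" and ?m3.0=m3 and ?m4.0=m4 and u=u and w=v and \<epsilon>="c / 2"])
    show "distr Om Om (\<lambda>w. w) = Om" by (rule distr_id)
    show "AE w in Om. \<forall>a b. 0 \<le> lim_row \<zeta> w a \<and> 0 \<le> lim_col \<zeta> w a b \<and>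
       pass w 0 (site_at 0 a b) * lim_row \<zeta> w a * lim_col \<zeta> w a b \<le> 1"
      using AE_good_env
    proof eventually_elim
      case (elim w)
      show ?case
        using lim_row_pos[OF \<zeta> elim] lim_col_pos[OF \<zeta> elim] step_prob_le_1[OF is_env_bridge_lim[OF \<zeta> elim]]
        unfolding step_prob_bridge_lim[OF \<zeta> elim, symmetric] by (simp add: less_imp_le)
    qed
    fix a b :: nat
    assume "(a, b) \<in> {(a, b). Q a b}"
    then have "real a * (u' - us) + real b * (w' - ws) \<le> - c * real (a + b)" using cone by blast
    moreover have "real a * (us - u) \<le> real a * (c / 2)" "real b * (ws - v) \<le> real b * (c / 2)"
      using m3(4) m4(4) by (intro mult_left_mono; linarith)+
    ultimately show "real a * (u' - u) + real b * (w' - v) \<le> - (c / 2) * real (a + b)"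
      by (simp add: field_simps)
  qed (use m3 m4 c in \<open>auto intro: measurable_lim_row measurable_lim_col is_env_space\<close>)
  with AE_good_env show ?thesis
  proof eventually_elim
    case (elim w)
    have eq: "pass w 0 (site_at 0 a (n - a)) * lim_row \<zeta> w a * lim_col \<zeta> w a (n - a) =
        step_prob (bridge_lim \<zeta> w) n 0 (site_at 0 a (n - a))" if "a \<le> n" for a n
      using step_prob_bridge_lim[OF \<zeta> elim(1), of a "n - a"] that by simp
    have "(\<Sum>a\<in>{a. a \<le> n \<and> (a, n - a) \<in> {(a, b). Q a b}}.
        pass w 0 (site_at 0 a (n - a)) * lim_row \<zeta> w a * lim_col \<zeta> w a (n - a)) =
      (\<Sum>a\<in>{a. a \<le> n \<and> Q a (n - a)}. step_prob (bridge_lim \<zeta> w) n 0 (site_at 0 a (n - a)))" for n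
      by (intro sum.cong) (auto simp: eq)
    then show ?case using elim(2) by simp
  qed
qed

lemma AE_summable_cones:
  assumes "\<epsilon> > 0"
  shows "AE w in Om. summable (\<lambda>n. \<Sum>a\<in>{a. a \<le> n \<and> real a \<le> (\<zeta> - \<epsilon>) * real (a + (n - a))}.
      step_prob (bridge_lim \<zeta> w) n 0 (site_at 0 a (n - a)))"
    and "AE w in Om. summable (\<lambda>n. \<Sum>a\<in>{a. a \<le> n \<and> (\<zeta> + \<epsilon>) * real (a + (n - a)) \<le> real a}.
      step_prob (bridge_lim \<zeta> w) n 0 (site_at 0 a (n - a)))"
proof -
  show "AE w in Om. summable (\<lambda>n. \<Sum>a\<in>{a. a \<le> n \<and> real a \<le> (\<zeta> - \<epsilon>) * real (a + (n - a))}.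
      step_prob (bridge_lim \<zeta> w) n 0 (site_at 0 a (n - a)))"
    by (rule AE_summable_kernel) (use left assms in \<open>unfold left_approx_def side_approx_def, blast\<close>)
  show "AE w in Om. summable (\<lambda>n. \<Sum>a\<in>{a. a \<le> n \<and> (\<zeta> + \<epsilon>) * real (a + (n - a)) \<le> real a}.
      step_prob (bridge_lim \<zeta> w) n 0 (site_at 0 a (n - a)))"
    by (rule AE_summable_kernel) (use right assms in \<open>unfold right_approx_def side_approx_def, blast\<close>)
qed

end

section \<open>From site probabilities to trajectories\<close>

lemma sets_walk_at: "{X. X n = z} \<in> sets (walk_law p x)"
  using measurable_sets[OF measurable_walk_component[of n p x], of "{z}"] by (simp add: vimage_def space_walk_law)

lemma AE_walk_support:
  assumes "is_env k"
  shows "AE X in walk_law (env k) 0. \<forall>n. \<exists>a\<le>n. X n = site_at 0 a (n - a)"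
proof -
  have "AE X in walk_law (env k) 0. \<forall>n z. X n = z \<longrightarrow> (\<exists>a\<le>n. z = site_at 0 a (n - a))"
    unfolding AE_all_countable
  proof (intro allI)
    fix n z
    show "AE X in walk_law (env k) 0. X n = z \<longrightarrow> (\<exists>a\<le>n. z = site_at 0 a (n - a))"
    proof (cases "step_prob k n 0 z = 0")
      case True
      have "AE X in walk_law (env k) 0. X \<notin> {X. X n = z}"
        by (rule AE_not_in) (simp add: null_sets_def sets_walk_at emeasure_walk_law_at[OF assms] True)
      then show ?thesis by eventually_elim simp
    next
      case False
      then have "z = site_at 0 (nat (fst z)) (n - nat (fst z)) \<and> nat (fst z) \<le> n"
        using step_prob_support[OF False] by (auto simp: site_at_def prod_eq_iff)
      then show ?thesis by blast
    qed
  qed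
  then show ?thesis by eventually_elim blast
qed

text \<open>The Borel-Cantelli lemma, with a union bound over the forbidden sites of each
  level.\<close>

lemma AE_walk_avoids:
  assumes "is_env k" and "summable (\<lambda>n. \<Sum>a\<in>{a. a \<le> n \<and> Q a (n - a)}. step_prob k n 0 (site_at 0 a (n - a)))"
  shows "AE X in walk_law (env k) 0. \<forall>\<^sub>F n in sequentially. \<forall>a\<le>n. Q a (n - a) \<longrightarrow> X n \<noteq> site_at 0 a (n - a)"
proof -
  interpret W: prob_space "walk_law (env k) 0" by (rule prob_space_walk_law)
  define A where "A n = (\<Union>a\<in>{a. a \<le> n \<and> Q a (n - a)}. {X. X n = site_at 0 a (n - a)})" for n
  have A: "A n \<in> sets (walk_law (env k) 0)" for n unfolding A_def by (intro sets.finite_UN sets_walk_at) auto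
  have "W.prob (A n) \<le> (\<Sum>a\<in>{a. a \<le> n \<and> Q a (n - a)}. step_prob k n 0 (site_at 0 a (n - a)))" for n
    unfolding A_def measure_walk_law_at[OF assms(1), symmetric]
    by (rule W.finite_measure_subadditive_finite) (auto simp: sets_walk_at)
  then have "summable (\<lambda>n. W.prob (A n))"
    by (intro summable_comparison_test'[OF assms(2), of 0]) simp
  from borel_cantelli_AE1[OF A _ this]
  have "AE X in walk_law (env k) 0. \<forall>\<^sub>F n in sequentially. X \<in> space (walk_law (env k) 0) - A n"
    by (simp add: W.emeasure_eq_measure)
  then show ?thesis
  proof eventually_elim
    case (elim X)
    then show ?case by eventually_elim (auto simp: A_def)
  qed
qed

text \<open>Avoiding the cones outside each of countably many shrinking neighbourhoods of \<zeta>
  confines the proportion of \<open>e1\<close> steps. The expression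
  \<open>real (a + (n - a))\<close> is just n; it appears because the cones are predicates of both
  offsets.\<close>

lemma AE_walk_direction:
  assumes k: "is_env k"
    and l: "\<And>j :: nat. summable (\<lambda>n. \<Sum>a\<in>{a. a \<le> n \<and> real a \<le> (\<zeta> - 1 / real (Suc j)) * real (a + (n - a))}.
      step_prob k n 0 (site_at 0 a (n - a)))"
    and r: "\<And>j :: nat. summable (\<lambda>n. \<Sum>a\<in>{a. a \<le> n \<and> (\<zeta> + 1 / real (Suc j)) * real (a + (n - a)) \<le> real a}.
      step_prob k n 0 (site_at 0 a (n - a)))"
  shows "AE X in walk_law (env k) 0. (\<lambda>n. to_plane (X n) /\<^sub>R real n) \<longlonglongrightarrow> (\<zeta>, 1 - \<zeta>)"
proof -
  have "AE X in walk_law (env k) 0. \<forall>j. \<forall>\<^sub>F n in sequentially. \<forall>a\<le>n. real a \<le> (\<zeta> - 1 / real (Suc j)) * real (a + (n - a)) \<longrightarrow> X n \<noteq> site_at 0 a (n - a)"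
    unfolding AE_all_countable using AE_walk_avoids[OF k l] by blast
  moreover have "AE X in walk_law (env k) 0. \<forall>j. \<forall>\<^sub>F n in sequentially. \<forall>a\<le>n. (\<zeta> + 1 / real (Suc j)) * real (a + (n - a)) \<le> real a \<longrightarrow> X n \<noteq> site_at 0 a (n - a)"
    unfolding AE_all_countable using AE_walk_avoids[OF k r] by blast
  ultimately show ?thesis using AE_walk_support[OF k]
  proof eventually_elim
    case (elim X)
    then obtain a where a: "\<And>n. a n \<le> n" "\<And>n. X n = site_at 0 (a n) (n - a n)" by metis
    have "(\<lambda>n. real (a n) / real n) \<longlonglongrightarrow> \<zeta>"
    proof (rule LIMSEQ_I)
      fix e :: real assume "e > 0"
      then obtain j where j: "1 / real (Suc j) < e" using nat_approx_posE by metis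
      have "\<forall>\<^sub>F n in sequentially. norm (real (a n) / real n - \<zeta>) < e"
        using elim(1)[rule_format, of j] elim(2)[rule_format, of j] eventually_gt_at_top[of 0]
      proof eventually_elim
        case (elim n)
        have "(\<zeta> - 1 / real (Suc j)) * real n < real (a n)" "real (a n) < (\<zeta> + 1 / real (Suc j)) * real n"
          unfolding not_le[symmetric] using elim(1,2) a(1)[of n] a(2)[of n] le_add_diff_inverse[OF a(1)[of n]] by metis+
        then have "\<zeta> - 1 / real (Suc j) < real (a n) / real n" "real (a n) / real n < \<zeta> + 1 / real (Suc j)"
          using elim(3) by (simp_all only: pos_less_divide_eq pos_divide_less_eq of_nat_0_less_iff)
        then show ?case using j unfolding real_norm_def abs_less_iff by linarith
      qed
      then show "\<exists>no. \<forall>n\<ge>no. norm (real (a n) / real n - \<zeta>) < e" by (simp add: eventually_sequentially)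
    qed
    then have "(\<lambda>n. (real (a n) / real n, 1 - real (a n) / real n)) \<longlonglongrightarrow> (\<zeta>, 1 - \<zeta>)"
      by (intro tendsto_Pair tendsto_diff tendsto_const)
    then show ?case
    proof (rule Lim_transform_eventually)
      show "\<forall>\<^sub>F n in sequentially. (real (a n) / real n, 1 - real (a n) / real n) = to_plane (X n) /\<^sub>R real n"
        using eventually_gt_at_top[of 0]
      proof eventually_elim
        case (elim n)
        then show ?case using a(1)[of n] by (simp add: a(2) to_plane_def site_at_def of_nat_diff field_simps)
      qed
    qed
  qed
qed

lemma measurable_to_plane_walk:
  "(\<lambda>X. to_plane (X n) /\<^sub>R real n) \<in> borel_measurable (walk_law p x)"
  by (rule measurable_compose[OF measurable_walk_component]) simp

lemma walk_direction_prob: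
  assumes "AE X in walk_law p x. (\<lambda>n. to_plane (X n) /\<^sub>R real n) \<longlonglongrightarrow> \<xi>"
  shows "measure (walk_law p x) {X \<in> space (walk_law p x). (\<lambda>n. to_plane (X n) /\<^sub>R real n) \<longlonglongrightarrow> \<xi>} = 1"
proof -
  interpret W: prob_space "walk_law p x" by (rule prob_space_walk_law)
  have "{X \<in> space (walk_law p x). (\<lambda>n. to_plane (X n) /\<^sub>R real n) \<longlonglongrightarrow> \<xi>} \<in> sets (walk_law p x)"
    using measurable_limit[OF measurable_to_plane_walk[of _ p x]] by (simp add: pred_def)
  then show ?thesis using assms by (simp only: W.prob_Collect_eq_1)
qed

theorem theorem2p2:
  fixes \<alpha> \<beta> :: real and \<xi> :: "real \<times> real"
  assumes "\<alpha> > 0" and "\<beta> > 0" and "\<xi> \<in> ri_U"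
  shows "(\<forall>n::int.
            prob_space.indep_vars (env_law \<alpha> \<beta>) (\<lambda>_. borel)
              (\<lambda>x \<omega>. doob_kernel \<xi> \<omega> x (x + e1)) {x. fst x + snd x = n} \<and>
            (\<forall>x \<in> {x. fst x + snd x = n}. \<forall>y \<in> {x. fst x + snd x = n}.
              distr (env_law \<alpha> \<beta>) borel (\<lambda>\<omega>. doob_kernel \<xi> \<omega> x (x + e1)) =
              distr (env_law \<alpha> \<beta>) borel (\<lambda>\<omega>. doob_kernel \<xi> \<omega> y (y + e1)))) \<and>
         (AE \<omega> in env_law \<alpha> \<beta>.
            measure (walk_law (doob_kernel \<xi> \<omega>) 0)
              {X \<in> space (walk_law (doob_kernel \<xi> \<omega>) 0).
                 (\<lambda>N. to_plane (X N) /\<^sub>R real N) \<longlonglongrightarrow> \<xi>} = 1)"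
proof -
  obtain \<zeta> where \<zeta>: "0 < \<zeta>" "\<zeta> < 1" and \<xi>: "\<xi> = (\<zeta>, 1 - \<zeta>)"
    using assms(3) by (auto simp: ri_U_def to_plane_def)
  obtain us ws G G' where "left_approx \<zeta> \<alpha> \<beta> us ws G G'" "right_approx \<zeta> \<alpha> \<beta> us ws G G'"
    using two_sided_approx[OF assms(1,2) \<zeta>] by blast
  then interpret direction \<alpha> \<beta> \<zeta> us ws G G' using assms \<zeta> by unfold_locales
  have "AE \<omega> in env_law \<alpha> \<beta>. measure (walk_law (doob_kernel \<xi> \<omega>) 0)
      {X \<in> space (walk_law (doob_kernel \<xi> \<omega>) 0). (\<lambda>N. to_plane (X N) /\<^sub>R real N) \<longlonglongrightarrow> \<xi>} = 1"
  proof -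
    have "AE w in Om. \<forall>j :: nat. summable (\<lambda>n. \<Sum>a\<in>{a. a \<le> n \<and> real a \<le> (\<zeta> - 1 / real (Suc j)) * real (a + (n - a))}.
        step_prob (bridge_lim \<zeta> w) n 0 (site_at 0 a (n - a)))"
      unfolding AE_all_countable by (intro allI AE_summable_cones(1)) simp
    moreover have "AE w in Om. \<forall>j :: nat. summable (\<lambda>n. \<Sum>a\<in>{a. a \<le> n \<and> (\<zeta> + 1 / real (Suc j)) * real (a + (n - a)) \<le> real a}.
        step_prob (bridge_lim \<zeta> w) n 0 (site_at 0 a (n - a)))"
      unfolding AE_all_countable by (intro allI AE_summable_cones(2)) simp
    ultimately show ?thesis using AE_good_env
    proof eventually_elim
      case (elim w)
      show ?case
        unfolding \<xi> doob_kernel_eq[OF \<zeta> elim(3)]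
        by (rule walk_direction_prob[OF AE_walk_direction[OF is_env_bridge_lim[OF \<zeta> elim(3)]]]) (use elim(1,2) in blast)+
    qed
  qed
  then show ?thesis using kap_indep kap_identical unfolding \<xi> by blast
qed

end
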